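(* Let $A$ be a $\sigma$-unital C*-algebra and let $\rho\colon A\to\mathcal{M}(A)$ be a faithful non-degenerate $*$-homomorphism. Let $(\mathfrak{B},\sigma)$ be the associated C*-algebra with automorphism, and identify $A$ with the C*-subalgebra $B_0=\iota_0(A)\subset\mathfrak{B}\subset\mathfrak{B}\rtimes_{\sigma,\mathrm{r}}\mathbb{Z}$ (all defined in the context). Let $H$ be the hereditary C*-subalgebra of the reduced crossed product $\mathfrak{B}\rtimes_{\sigma,\mathrm{r}}\mathbb{Z}$ generated by $A$. Then $H$ is full in $\mathfrak{B}\rtimes_{\sigma,\mathrm{r}}\mathbb{Z}$, and the Cuntz--Pimsner algebra $\mathcal{O}_\rho$ of the C*-correspondence ${}_\rho A$ is isomorphic to $H$.
   Context: $\mathcal{M}(A)$ is the multiplier algebra; non-degenerate means $\rho(A)A$ is dense in $A$; $\rho$ also denotes its strictly continuous extension $\mathcal{M}(A)\to\mathcal{M}(A)$, which is injective. ${}_\rho A$ is the C*-correspondence over $A$ which is $A$ as a standard right Hilbert $A$-module, with left action $a\cdot x=\rho(a)x$. $\mathcal{O}_\rho$ is its Cuntz--Pimsner algebra: the universal C*-algebra generated by a copy of $A$ and elements $S_x$ ($x\in {}_\rho A$, linear in $x$) with $S_x^*S_y=x^*y$, $aS_xb=S_{\rho(a)xb}$, and $a=\psi(\rho(a))$ for every $a\in A$ with $\rho(a)\in A=\mathbb{K}({}_\rho A)$, where $\psi$ is the $*$-homomorphism on $A$ with $\psi(xy^* )=S_xS_y^*$. Construction of $(\mathfrak{B},\sigma)$: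 let $\mathfrak{A}$ be the C*-inductive limit of the inductive system indexed by $\mathbb{Z}$ with all algebras equal to $\mathcal{M}(A)$ and all connecting maps (from $n$ to $n+1$) equal to $\rho$. Let $\iota_n\colon\mathcal{M}(A)\to\mathfrak{A}$ be the $n$-th canonical map, so $\iota_{n+1}\circ\rho=\iota_n$. Put $B_n:=\iota_n(A)$ for $n\in\mathbb{Z}$ and $\mathfrak{B}:=\overline{\mathrm{span}}\,\bigcup_{n\in\mathbb{Z}}B_n\subset\mathfrak{A}$, which is a C*-subalgebra. There is an automorphism $\sigma$ of $\mathfrak{A}$ with $\sigma\circ\iota_n=\iota_{n+1}$ for all $n$; it restricts to an automorphism of $\mathfrak{B}$, also denoted $\sigma$. *)

theory Defs
  imports "HOL-Analysis.Analysis" "HOL-Algebra.Module"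
begin

section \<open>C*-algebras\<close>

text \<open>
  The structures below are carrier-based, extending the module records of HOL-Algebra.
  The inherited field \<open>one\<close> is never used: algebras need not be unital, and no notion
  (in particular no homomorphism) refers to it.
\<close>

record 'a cstar_struct = "(complex, 'a) module" +
  cadj :: "'a \<Rightarrow> 'a" (\<open>_\<^sup>\<star>\<index>\<close> [1000] 999)
  cnorm :: "'a \<Rightarrow> real" (\<open>\<parallel>_\<parallel>\<index>\<close>)

definition complex_ring :: "complex ring" where
  "complex_ring = \<lparr>carrier = UNIV, mult = (*), one = 1, zero = 0, add = (+)\<rparr>"

text \<open>The metric of the norm; it is set to 0 outside the carrier because the locale
  \<^locale>\<open>Metric_space\<close> wants a symmetric nonnegative function on the whole type.\<close>

definition cdist :: "('a, 'm) cstar_struct_scheme \<Rightarrow> 'a \<Rightarrow> 'a \<Rightarrow> real" where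
  "cdist A x y = (if x \<in> carrier A \<and> y \<in> carrier A then \<parallel>x \<ominus>\<^bsub>A\<^esub> y\<parallel>\<^bsub>A\<^esub> else 0)"

definition norm_topology :: "('a, 'm) cstar_struct_scheme \<Rightarrow> 'a topology" where
  "norm_topology A = Metric_space.mtopology (carrier A) (cdist A)"

locale star_algebra = module complex_ring A for A :: "('a, 'm) cstar_struct_scheme" (structure) +
  assumes mult_closed: "\<lbrakk>x \<in> carrier A; y \<in> carrier A\<rbrakk> \<Longrightarrow> x \<otimes> y \<in> carrier A"
    and mult_assoc: "\<lbrakk>x \<in> carrier A; y \<in> carrier A; z \<in> carrier A\<rbrakk> \<Longrightarrow> (x \<otimes> y) \<otimes> z = x \<otimes> (y \<otimes> z)"
    and distrib_right: "\<lbrakk>x \<in> carrier A; y \<in> carrier A; z \<in> carrier A\<rbrakk> \<Longrightarrow> (x \<oplus> y) \<otimes> z = x \<otimes> z \<oplus> y \<otimes> z"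
    and distrib_left: "\<lbrakk>x \<in> carrier A; y \<in> carrier A; z \<in> carrier A\<rbrakk> \<Longrightarrow> z \<otimes> (x \<oplus> y) = z \<otimes> x \<oplus> z \<otimes> y"
    and smult_mult_left: "\<lbrakk>x \<in> carrier A; y \<in> carrier A\<rbrakk> \<Longrightarrow> (c \<odot> x) \<otimes> y = c \<odot> (x \<otimes> y)"
    and smult_mult_right: "\<lbrakk>x \<in> carrier A; y \<in> carrier A\<rbrakk> \<Longrightarrow> x \<otimes> (c \<odot> y) = c \<odot> (x \<otimes> y)"
    and adj_closed: "x \<in> carrier A \<Longrightarrow> x\<^sup>\<star> \<in> carrier A"
    and adj_adj: "x \<in> carrier A \<Longrightarrow> (x\<^sup>\<star>)\<^sup>\<star> = x"
    and adj_add: "\<lbrakk>x \<in> carrier A; y \<in> carrier A\<rbrakk> \<Longrightarrow> (x \<oplus> y)\<^sup>\<star> = x\<^sup>\<star> \<oplus> y\<^sup>\<star>"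
    and adj_smult: "x \<in> carrier A \<Longrightarrow> (c \<odot> x)\<^sup>\<star> = cnj c \<odot> x\<^sup>\<star>"
    and adj_mult: "\<lbrakk>x \<in> carrier A; y \<in> carrier A\<rbrakk> \<Longrightarrow> (x \<otimes> y)\<^sup>\<star> = y\<^sup>\<star> \<otimes> x\<^sup>\<star>"

definition cstar_seminorm :: "('a, 'm) cstar_struct_scheme \<Rightarrow> ('a \<Rightarrow> real) \<Rightarrow> bool" where
  "cstar_seminorm A p \<longleftrightarrow>
     (\<forall>x\<in>carrier A. 0 \<le> p x) \<and>
     (\<forall>x\<in>carrier A. \<forall>y\<in>carrier A. p (x \<oplus>\<^bsub>A\<^esub> y) \<le> p x + p y) \<and>
     (\<forall>c. \<forall>x\<in>carrier A. p (c \<odot>\<^bsub>A\<^esub> x) = cmod c * p x) \<and>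
     (\<forall>x\<in>carrier A. \<forall>y\<in>carrier A. p (x \<otimes>\<^bsub>A\<^esub> y) \<le> p x * p y) \<and>
     (\<forall>x\<in>carrier A. p (x\<^sup>\<star>\<^bsub>A\<^esub> \<otimes>\<^bsub>A\<^esub> x) = (p x)\<^sup>2)"

locale cstar_algebra = star_algebra A for A :: "('a, 'm) cstar_struct_scheme" (structure) +
  assumes cstar_norm: "cstar_seminorm A (cnorm A)"
    and norm_definite: "\<lbrakk>x \<in> carrier A; \<parallel>x\<parallel> = 0\<rbrakk> \<Longrightarrow> x = \<zero>"
    and complete: "Metric_space.mcomplete (carrier A) (cdist A)"

definition star_hom :: "('a, 'm) cstar_struct_scheme \<Rightarrow> ('b, 'n) cstar_struct_scheme \<Rightarrow> ('a \<Rightarrow> 'b) \<Rightarrow> bool" where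
  "star_hom A B \<phi> \<longleftrightarrow>
     \<phi> \<in> carrier A \<rightarrow> carrier B \<and>
     (\<forall>x\<in>carrier A. \<forall>y\<in>carrier A. \<phi> (x \<oplus>\<^bsub>A\<^esub> y) = \<phi> x \<oplus>\<^bsub>B\<^esub> \<phi> y) \<and>
     (\<forall>c. \<forall>x\<in>carrier A. \<phi> (c \<odot>\<^bsub>A\<^esub> x) = c \<odot>\<^bsub>B\<^esub> \<phi> x) \<and>
     (\<forall>x\<in>carrier A. \<forall>y\<in>carrier A. \<phi> (x \<otimes>\<^bsub>A\<^esub> y) = \<phi> x \<otimes>\<^bsub>B\<^esub> \<phi> y) \<and>
     (\<forall>x\<in>carrier A. \<phi> (x\<^sup>\<star>\<^bsub>A\<^esub>) = (\<phi> x)\<^sup>\<star>\<^bsub>B\<^esub>)"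

definition star_iso :: "('a, 'm) cstar_struct_scheme \<Rightarrow> ('b, 'n) cstar_struct_scheme \<Rightarrow> ('a \<Rightarrow> 'b) \<Rightarrow> bool" where
  "star_iso A B \<phi> \<longleftrightarrow> star_hom A B \<phi> \<and> bij_betw \<phi> (carrier A) (carrier B)"

definition star_isomorphic :: "('a, 'm) cstar_struct_scheme \<Rightarrow> ('b, 'n) cstar_struct_scheme \<Rightarrow> bool" where
  "star_isomorphic A B \<longleftrightarrow> (\<exists>\<phi>. star_iso A B \<phi>)"

definition closed_span :: "('a, 'm) cstar_struct_scheme \<Rightarrow> 'a set \<Rightarrow> 'a set" where
  "closed_span A S = norm_topology A closure_of ((\<lambda>V. submodule V complex_ring A) hull S)"

definition cstar_subalgebra :: "('a, 'm) cstar_struct_scheme \<Rightarrow> 'a set \<Rightarrow> bool" where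
  "cstar_subalgebra A S \<longleftrightarrow>
     submodule S complex_ring A \<and> closedin (norm_topology A) S \<and>
     (\<forall>x\<in>S. \<forall>y\<in>S. x \<otimes>\<^bsub>A\<^esub> y \<in> S) \<and> (\<forall>x\<in>S. x\<^sup>\<star>\<^bsub>A\<^esub> \<in> S)"

definition closed_ideal :: "('a, 'm) cstar_struct_scheme \<Rightarrow> 'a set \<Rightarrow> bool" where
  "closed_ideal A I \<longleftrightarrow>
     submodule I complex_ring A \<and> closedin (norm_topology A) I \<and>
     (\<forall>x\<in>I. \<forall>y\<in>carrier A. x \<otimes>\<^bsub>A\<^esub> y \<in> I \<and> y \<otimes>\<^bsub>A\<^esub> x \<in> I)"

definition cpos :: "('a, 'm) cstar_struct_scheme \<Rightarrow> 'a \<Rightarrow> bool" where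
  "cpos A x \<longleftrightarrow> (\<exists>y\<in>carrier A. x = y\<^sup>\<star>\<^bsub>A\<^esub> \<otimes>\<^bsub>A\<^esub> y)"

definition hereditary :: "('a, 'm) cstar_struct_scheme \<Rightarrow> 'a set \<Rightarrow> bool" where
  "hereditary A H \<longleftrightarrow>
     cstar_subalgebra A H \<and>
     (\<forall>h\<in>H. \<forall>a\<in>carrier A. cpos A h \<and> cpos A a \<and> cpos A (h \<ominus>\<^bsub>A\<^esub> a) \<longrightarrow> a \<in> H)"

definition full_in :: "('a, 'm) cstar_struct_scheme \<Rightarrow> 'a set \<Rightarrow> bool" where
  "full_in A H \<longleftrightarrow> closed_ideal A hull H = carrier A"

text \<open>Sigma-unital: there is a countable approximate unit (an increasing sequence of
  positive contractions).\<close>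

definition sigma_unital :: "('a, 'm) cstar_struct_scheme \<Rightarrow> bool" where
  "sigma_unital A \<longleftrightarrow>
     (\<exists>e :: nat \<Rightarrow> 'a. (\<forall>n. e n \<in> carrier A \<and> cpos A (e n) \<and> \<parallel>e n\<parallel>\<^bsub>A\<^esub> \<le> 1 \<and> cpos A (e (Suc n) \<ominus>\<^bsub>A\<^esub> e n)) \<and>
        (\<forall>x\<in>carrier A. (\<lambda>n. \<parallel>e n \<otimes>\<^bsub>A\<^esub> x \<ominus>\<^bsub>A\<^esub> x\<parallel>\<^bsub>A\<^esub>) \<longlonglongrightarrow> 0 \<and> (\<lambda>n. \<parallel>x \<otimes>\<^bsub>A\<^esub> e n \<ominus>\<^bsub>A\<^esub> x\<parallel>\<^bsub>A\<^esub>) \<longlonglongrightarrow> 0))"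


section \<open>Separation and completion of a seminormed *-algebra\<close>

definition cauchy_seqs :: "('a, 'm) cstar_struct_scheme \<Rightarrow> (nat \<Rightarrow> 'a) set" where
  "cauchy_seqs P = {s. (\<forall>n. s n \<in> carrier P) \<and>
     (\<forall>\<epsilon>>0. \<exists>N. \<forall>m\<ge>N. \<forall>n\<ge>N. \<parallel>s m \<ominus>\<^bsub>P\<^esub> s n\<parallel>\<^bsub>P\<^esub> < \<epsilon>)}"

definition null_rel :: "('a, 'm) cstar_struct_scheme \<Rightarrow> (nat \<Rightarrow> 'a) rel" where
  "null_rel P = {(s, t). s \<in> cauchy_seqs P \<and> t \<in> cauchy_seqs P \<and> (\<lambda>n. \<parallel>s n \<ominus>\<^bsub>P\<^esub> t n\<parallel>\<^bsub>P\<^esub>) \<longlonglongrightarrow> 0}"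

definition completion :: "('a, 'm) cstar_struct_scheme \<Rightarrow> (nat \<Rightarrow> 'a) set cstar_struct" where
  "completion P = \<lparr>
     carrier = cauchy_seqs P // null_rel P,
     mult = (\<lambda>X Y. \<Union>s\<in>X. \<Union>t\<in>Y. null_rel P `` {\<lambda>n. s n \<otimes>\<^bsub>P\<^esub> t n}),
     one = undefined,
     zero = null_rel P `` {\<lambda>n. \<zero>\<^bsub>P\<^esub>},
     add = (\<lambda>X Y. \<Union>s\<in>X. \<Union>t\<in>Y. null_rel P `` {\<lambda>n. s n \<oplus>\<^bsub>P\<^esub> t n}),
     smult = (\<lambda>c X. \<Union>s\<in>X. null_rel P `` {\<lambda>n. c \<odot>\<^bsub>P\<^esub> s n}),
     cadj = (\<lambda>X. \<Union>s\<in>X. null_rel P `` {\<lambda>n. (s n)\<^sup>\<star>\<^bsub>P\<^esub>}),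
     cnorm = (\<lambda>X. the_elem ((\<lambda>s. lim (\<lambda>n. \<parallel>s n\<parallel>\<^bsub>P\<^esub>)) ` X))\<rparr>"

definition to_completion :: "('a, 'm) cstar_struct_scheme \<Rightarrow> 'a \<Rightarrow> (nat \<Rightarrow> 'a) set" where
  "to_completion P x = null_rel P `` {\<lambda>n. x}"


section \<open>Multiplier algebras\<close>

text \<open>Multipliers are double centralizers \<open>(L, R)\<close>, where \<open>L x\<close> stands for \<open>m x\<close> and
  \<open>R x\<close> for \<open>x m\<close>.\<close>

type_synonym 'a multiplier = "('a \<Rightarrow> 'a) \<times> ('a \<Rightarrow> 'a)"

definition bounded_linear_map :: "('a, 'm) cstar_struct_scheme \<Rightarrow> ('a \<Rightarrow> 'a) \<Rightarrow> bool" where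
  "bounded_linear_map A T \<longleftrightarrow>
     T \<in> carrier A \<rightarrow>\<^sub>E carrier A \<and>
     (\<forall>x\<in>carrier A. \<forall>y\<in>carrier A. T (x \<oplus>\<^bsub>A\<^esub> y) = T x \<oplus>\<^bsub>A\<^esub> T y) \<and>
     (\<forall>c. \<forall>x\<in>carrier A. T (c \<odot>\<^bsub>A\<^esub> x) = c \<odot>\<^bsub>A\<^esub> T x) \<and>
     (\<exists>C. \<forall>x\<in>carrier A. \<parallel>T x\<parallel>\<^bsub>A\<^esub> \<le> C * \<parallel>x\<parallel>\<^bsub>A\<^esub>)"

definition multiplier_algebra :: "('a, 'm) cstar_struct_scheme \<Rightarrow> 'a multiplier cstar_struct" where
  "multiplier_algebra A = \<lparr>
     carrier = {(L, R). bounded_linear_map A L \<and> bounded_linear_map A R \<and>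
       (\<forall>x\<in>carrier A. \<forall>y\<in>carrier A.
          L (x \<otimes>\<^bsub>A\<^esub> y) = L x \<otimes>\<^bsub>A\<^esub> y \<and> R (x \<otimes>\<^bsub>A\<^esub> y) = x \<otimes>\<^bsub>A\<^esub> R y \<and> R x \<otimes>\<^bsub>A\<^esub> y = x \<otimes>\<^bsub>A\<^esub> L y)},
     mult = (\<lambda>(L, R) (L', R'). (\<lambda>x\<in>carrier A. L (L' x), \<lambda>x\<in>carrier A. R' (R x))),
     one = (\<lambda>x\<in>carrier A. x, \<lambda>x\<in>carrier A. x),
     zero = (\<lambda>x\<in>carrier A. \<zero>\<^bsub>A\<^esub>, \<lambda>x\<in>carrier A. \<zero>\<^bsub>A\<^esub>),
     add = (\<lambda>(L, R) (L', R'). (\<lambda>x\<in>carrier A. L x \<oplus>\<^bsub>A\<^esub> L' x, \<lambda>x\<in>carrier A. R x \<oplus>\<^bsub>A\<^esub> R' x)),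
     smult = (\<lambda>c (L, R). (\<lambda>x\<in>carrier A. c \<odot>\<^bsub>A\<^esub> L x, \<lambda>x\<in>carrier A. c \<odot>\<^bsub>A\<^esub> R x)),
     cadj = (\<lambda>(L, R). (\<lambda>x\<in>carrier A. (R (x\<^sup>\<star>\<^bsub>A\<^esub>))\<^sup>\<star>\<^bsub>A\<^esub>, \<lambda>x\<in>carrier A. (L (x\<^sup>\<star>\<^bsub>A\<^esub>))\<^sup>\<star>\<^bsub>A\<^esub>)),
     cnorm = (\<lambda>(L, R). Sup {\<parallel>L x\<parallel>\<^bsub>A\<^esub> | x. x \<in> carrier A \<and> \<parallel>x\<parallel>\<^bsub>A\<^esub> \<le> 1})\<rparr>"

abbreviation lact :: "'a multiplier \<Rightarrow> 'a \<Rightarrow> 'a" where "lact \<equiv> fst"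
abbreviation ract :: "'a multiplier \<Rightarrow> 'a \<Rightarrow> 'a" where "ract \<equiv> snd"

definition to_multiplier :: "('a, 'm) cstar_struct_scheme \<Rightarrow> 'a \<Rightarrow> 'a multiplier" where
  "to_multiplier A a = (\<lambda>x\<in>carrier A. a \<otimes>\<^bsub>A\<^esub> x, \<lambda>x\<in>carrier A. x \<otimes>\<^bsub>A\<^esub> a)"

text \<open>The strict topology is the initial topology for the maps \<open>m \<mapsto> m a\<close> and \<open>m \<mapsto> a m\<close>.\<close>

definition strict_topology :: "('a, 'm) cstar_struct_scheme \<Rightarrow> 'a multiplier topology" where
  "strict_topology A = topology_generated_by
     ({{m \<in> carrier (multiplier_algebra A). \<parallel>lact m a \<ominus>\<^bsub>A\<^esub> lact m0 a\<parallel>\<^bsub>A\<^esub> < \<epsilon>} | m0 a \<epsilon>.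
         m0 \<in> carrier (multiplier_algebra A) \<and> a \<in> carrier A \<and> \<epsilon> > 0} \<union>
      {{m \<in> carrier (multiplier_algebra A). \<parallel>ract m a \<ominus>\<^bsub>A\<^esub> ract m0 a\<parallel>\<^bsub>A\<^esub> < \<epsilon>} | m0 a \<epsilon>.
         m0 \<in> carrier (multiplier_algebra A) \<and> a \<in> carrier A \<and> \<epsilon> > 0})"

definition nondegenerate :: "('a, 'm) cstar_struct_scheme \<Rightarrow> ('a \<Rightarrow> 'a multiplier) \<Rightarrow> bool" where
  "nondegenerate A \<rho> \<longleftrightarrow>
     closed_span A {lact (\<rho> a) x | a x. a \<in> carrier A \<and> x \<in> carrier A} = carrier A"

definition strict_extension ::
  "('a, 'm) cstar_struct_scheme \<Rightarrow> ('a \<Rightarrow> 'a multiplier) \<Rightarrow> 'a multiplier \<Rightarrow> 'a multiplier" where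
  "strict_extension A \<rho> = (THE \<phi>.
     \<phi> \<in> extensional (carrier (multiplier_algebra A)) \<and>
     star_hom (multiplier_algebra A) (multiplier_algebra A) \<phi> \<and>
     continuous_map (strict_topology A) (strict_topology A) \<phi> \<and>
     (\<forall>a\<in>carrier A. \<phi> (to_multiplier A a) = \<rho> a))"


section \<open>C*-inductive limits over the integers\<close>

text \<open>
  The algebraic inductive limit of \<open>D n \<rightarrow> D (n + 1)\<close> is modelled by families that are
  eventually compatible with the connecting maps, modulo eventual equality. The C*-inductive
  limit is its separated completion for the seminorm \<open>lim \<parallel>f k\<parallel>\<close> as \<open>k \<rightarrow> +\<infinity>\<close>. Passing to the
  separated completion already identifies eventually equal families.
\<close>

definition algebraic_limit ::
  "(int \<Rightarrow> 'a cstar_struct) \<Rightarrow> (int \<Rightarrow> 'a \<Rightarrow> 'a) \<Rightarrow> (int \<Rightarrow> 'a) cstar_struct" where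
  "algebraic_limit D \<phi> = \<lparr>
     carrier = {f. (\<forall>k. f k \<in> carrier (D k)) \<and> (\<exists>N. \<forall>k\<ge>N. f (k + 1) = \<phi> k (f k))},
     mult = (\<lambda>f g k. f k \<otimes>\<^bsub>D k\<^esub> g k),
     one = undefined,
     zero = (\<lambda>k. \<zero>\<^bsub>D k\<^esub>),
     add = (\<lambda>f g k. f k \<oplus>\<^bsub>D k\<^esub> g k),
     smult = (\<lambda>c f k. c \<odot>\<^bsub>D k\<^esub> f k),
     cadj = (\<lambda>f k. (f k)\<^sup>\<star>\<^bsub>D k\<^esub>),
     cnorm = (\<lambda>f. Lim at_top (\<lambda>k. \<parallel>f k\<parallel>\<^bsub>D k\<^esub>))\<rparr>"

definition inductive_limit ::
  "(int \<Rightarrow> 'a cstar_struct) \<Rightarrow> (int \<Rightarrow> 'a \<Rightarrow> 'a) \<Rightarrow> (nat \<Rightarrow> int \<Rightarrow> 'a) set cstar_struct" where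
  "inductive_limit D \<phi> = completion (algebraic_limit D \<phi>)"

primrec transition :: "(int \<Rightarrow> 'a \<Rightarrow> 'a) \<Rightarrow> int \<Rightarrow> nat \<Rightarrow> 'a \<Rightarrow> 'a" where
  "transition \<phi> n 0 x = x"
| "transition \<phi> n (Suc j) x = \<phi> (n + int j) (transition \<phi> n j x)"

definition limit_map ::
  "(int \<Rightarrow> 'a cstar_struct) \<Rightarrow> (int \<Rightarrow> 'a \<Rightarrow> 'a) \<Rightarrow> int \<Rightarrow> 'a \<Rightarrow> (nat \<Rightarrow> int \<Rightarrow> 'a) set" where
  "limit_map D \<phi> n x = to_completion (algebraic_limit D \<phi>)
     (\<lambda>k. if k < n then \<zero>\<^bsub>D k\<^esub> else transition \<phi> n (nat (k - n)) x)"


section \<open>The algebra with automorphism associated with an endomorphism\<close>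

type_synonym 'a dilated = "(nat \<Rightarrow> int \<Rightarrow> 'a multiplier) set"

definition frakA :: "('a, 'm) cstar_struct_scheme \<Rightarrow> ('a \<Rightarrow> 'a multiplier) \<Rightarrow> 'a dilated cstar_struct" where
  "frakA A \<rho> = inductive_limit (\<lambda>_. multiplier_algebra A) (\<lambda>_. strict_extension A \<rho>)"

definition iota :: "('a, 'm) cstar_struct_scheme \<Rightarrow> ('a \<Rightarrow> 'a multiplier) \<Rightarrow> int \<Rightarrow> 'a multiplier \<Rightarrow> 'a dilated" where
  "iota A \<rho> n = limit_map (\<lambda>_. multiplier_algebra A) (\<lambda>_. strict_extension A \<rho>) n"

definition limit_shift :: "('a, 'm) cstar_struct_scheme \<Rightarrow> ('a \<Rightarrow> 'a multiplier) \<Rightarrow> 'a dilated \<Rightarrow> 'a dilated" where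
  "limit_shift A \<rho> = (THE \<sigma>.
     \<sigma> \<in> extensional (carrier (frakA A \<rho>)) \<and>
     star_iso (frakA A \<rho>) (frakA A \<rho>) \<sigma> \<and>
     (\<forall>n. \<forall>x\<in>carrier (multiplier_algebra A). \<sigma> (iota A \<rho> n x) = iota A \<rho> (n + 1) x))"

definition B_level :: "('a, 'm) cstar_struct_scheme \<Rightarrow> ('a \<Rightarrow> 'a multiplier) \<Rightarrow> int \<Rightarrow> 'a dilated set" where
  "B_level A \<rho> n = iota A \<rho> n ` to_multiplier A ` carrier A"

definition frakB :: "('a, 'm) cstar_struct_scheme \<Rightarrow> ('a \<Rightarrow> 'a multiplier) \<Rightarrow> 'a dilated cstar_struct" where
  "frakB A \<rho> = (frakA A \<rho>)\<lparr>carrier := closed_span (frakA A \<rho>) (\<Union>n. B_level A \<rho> n)\<rparr>"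


section \<open>Reduced crossed products by the integers\<close>

definition aut_power :: "('b, 'm) cstar_struct_scheme \<Rightarrow> ('b \<Rightarrow> 'b) \<Rightarrow> int \<Rightarrow> 'b \<Rightarrow> 'b" where
  "aut_power B \<alpha> n = (if 0 \<le> n then \<alpha> ^^ nat n else inv_into (carrier B) \<alpha> ^^ nat (- n))"

definition fin_support :: "('b, 'm) cstar_struct_scheme \<Rightarrow> (int \<Rightarrow> 'b) set" where
  "fin_support B = {f. (\<forall>n. f n \<in> carrier B) \<and> finite {n. f n \<noteq> \<zero>\<^bsub>B\<^esub>}}"

text \<open>The norm of the Hilbert module \<open>\<ell>\<^sup>2(\<int>, B)\<close>, on finitely supported families.\<close>

definition l2_norm :: "('b, 'm) cstar_struct_scheme \<Rightarrow> (int \<Rightarrow> 'b) \<Rightarrow> real" where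
  "l2_norm B \<xi> = sqrt \<parallel>\<Oplus>\<^bsub>B\<^esub>n\<in>{n. \<xi> n \<noteq> \<zero>\<^bsub>B\<^esub>}. (\<xi> n)\<^sup>\<star>\<^bsub>B\<^esub> \<otimes>\<^bsub>B\<^esub> \<xi> n\<parallel>\<^bsub>B\<^esub>"

text \<open>The regular representation of \<open>\<Sum>m. f m u\<^sup>m\<close>: it is determined by
  \<open>(b \<xi>)(n) = \<alpha>\<^bsup>-n\<^esup>(b) \<xi>(n)\<close> and \<open>(u \<xi>)(n) = \<xi>(n - 1)\<close>.\<close>

definition regular_rep ::
  "('b, 'm) cstar_struct_scheme \<Rightarrow> ('b \<Rightarrow> 'b) \<Rightarrow> (int \<Rightarrow> 'b) \<Rightarrow> (int \<Rightarrow> 'b) \<Rightarrow> int \<Rightarrow> 'b" where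
  "regular_rep B \<alpha> f \<xi> n =
     (\<Oplus>\<^bsub>B\<^esub>m\<in>{m. f m \<noteq> \<zero>\<^bsub>B\<^esub>}. aut_power B \<alpha> (- n) (f m) \<otimes>\<^bsub>B\<^esub> \<xi> (n - m))"

text \<open>The *-algebra \<open>C\<^sub>c(\<int>, B)\<close> with the reduced norm. Its finitely supported families are
  dense in \<open>\<ell>\<^sup>2(\<int>, B)\<close>, so that the operator norm may be computed on them.\<close>

definition crossed_prealgebra :: "('b, 'm) cstar_struct_scheme \<Rightarrow> ('b \<Rightarrow> 'b) \<Rightarrow> (int \<Rightarrow> 'b) cstar_struct" where
  "crossed_prealgebra B \<alpha> = \<lparr>
     carrier = fin_support B,
     mult = (\<lambda>f g n. \<Oplus>\<^bsub>B\<^esub>m\<in>{m. f m \<noteq> \<zero>\<^bsub>B\<^esub>}. f m \<otimes>\<^bsub>B\<^esub> aut_power B \<alpha> m (g (n - m))),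
     one = undefined,
     zero = (\<lambda>n. \<zero>\<^bsub>B\<^esub>),
     add = (\<lambda>f g n. f n \<oplus>\<^bsub>B\<^esub> g n),
     smult = (\<lambda>c f n. c \<odot>\<^bsub>B\<^esub> f n),
     cadj = (\<lambda>f n. aut_power B \<alpha> n ((f (- n))\<^sup>\<star>\<^bsub>B\<^esub>)),
     cnorm = (\<lambda>f. Sup {l2_norm B (regular_rep B \<alpha> f \<xi>) | \<xi>. \<xi> \<in> fin_support B \<and> l2_norm B \<xi> \<le> 1})\<rparr>"

definition reduced_crossed_product ::
  "('b, 'm) cstar_struct_scheme \<Rightarrow> ('b \<Rightarrow> 'b) \<Rightarrow> (nat \<Rightarrow> int \<Rightarrow> 'b) set cstar_struct" where
  "reduced_crossed_product B \<alpha> = completion (crossed_prealgebra B \<alpha>)"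

definition to_crossed_product ::
  "('b, 'm) cstar_struct_scheme \<Rightarrow> ('b \<Rightarrow> 'b) \<Rightarrow> 'b \<Rightarrow> (nat \<Rightarrow> int \<Rightarrow> 'b) set" where
  "to_crossed_product B \<alpha> b =
     to_completion (crossed_prealgebra B \<alpha>) (\<lambda>n. if n = 0 then b else \<zero>\<^bsub>B\<^esub>)"


section \<open>Universal C*-algebras\<close>

text \<open>
  The free *-algebra (without unit) on a set \<open>G\<close> of generators: finitely supported functions on
  nonempty words in letters \<open>(g, False)\<close>, standing for \<open>g\<close>, and \<open>(g, True)\<close>, standing for \<open>g\<^sup>*\<close>.
  It carries a seminorm \<open>p\<close> given as a parameter.
\<close>

type_synonym 'g star_word = "('g \<times> bool) list"

definition free_star_algebra :: "'g set \<Rightarrow> (('g star_word \<Rightarrow> complex) \<Rightarrow> real) \<Rightarrow> ('g star_word \<Rightarrow> complex) cstar_struct" where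
  "free_star_algebra G p = \<lparr>
     carrier = {f. finite {w. f w \<noteq> 0} \<and> (\<forall>w. f w \<noteq> 0 \<longrightarrow> w \<noteq> [] \<and> fst ` set w \<subseteq> G)},
     mult = (\<lambda>f g w. \<Sum>k\<le>length w. f (take k w) * g (drop k w)),
     one = undefined,
     zero = (\<lambda>w. 0),
     add = (\<lambda>f g w. f w + g w),
     smult = (\<lambda>c f w. c * f w),
     cadj = (\<lambda>f w. cnj (f (rev (map (map_prod id Not) w)))),
     cnorm = p\<rparr>"

definition free_gen :: "'g \<Rightarrow> 'g star_word \<Rightarrow> complex" where
  "free_gen g w = (if w = [(g, False)] then 1 else 0)"

text \<open>
  \<open>Rel D \<gamma>\<close> expresses that the family \<open>\<gamma>\<close> of elements of the C*-algebra \<open>D\<close> satisfies the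
  relations. A C*-seminorm on the free *-algebra is admissible if the generators satisfy the
  relations in its separated completion; every representation of the relations in a C*-algebra
  yields an admissible seminorm, whatever the type of that algebra. The universal C*-algebra is
  the separated completion for the largest admissible seminorm.
\<close>

type_synonym 'g universal = "(nat \<Rightarrow> 'g star_word \<Rightarrow> complex) set"

definition admissible ::
  "'g set \<Rightarrow> ('g universal cstar_struct \<Rightarrow> ('g \<Rightarrow> 'g universal) \<Rightarrow> bool) \<Rightarrow>
   (('g star_word \<Rightarrow> complex) \<Rightarrow> real) \<Rightarrow> bool" where
  "admissible G Rel p \<longleftrightarrow>
     cstar_seminorm (free_star_algebra G p) p \<and>
     Rel (completion (free_star_algebra G p)) (\<lambda>g. to_completion (free_star_algebra G p) (free_gen g))"

definition universal_cstar_algebra ::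
  "'g set \<Rightarrow> ('g universal cstar_struct \<Rightarrow> ('g \<Rightarrow> 'g universal) \<Rightarrow> bool) \<Rightarrow> 'g universal cstar_struct" where
  "universal_cstar_algebra G Rel =
     completion (free_star_algebra G (\<lambda>f. Sup {p f | p. admissible G Rel p}))"


section \<open>The Cuntz--Pimsner algebra\<close>

text \<open>A covariant representation of the correspondence \<open>A\<close>, with inner product \<open>x\<^sup>*y\<close> and left
  action \<open>a \<cdot> x = \<rho>(a) x\<close>: \<open>\<pi>\<close> represents \<open>A\<close> and \<open>S\<close> the module.\<close>

definition covariant_rep ::
  "('a, 'm) cstar_struct_scheme \<Rightarrow> ('a \<Rightarrow> 'a multiplier) \<Rightarrow> ('d, 'n) cstar_struct_scheme \<Rightarrow>
   ('a \<Rightarrow> 'd) \<Rightarrow> ('a \<Rightarrow> 'd) \<Rightarrow> bool" where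
  "covariant_rep A \<rho> D \<pi> S \<longleftrightarrow>
     star_hom A D \<pi> \<and>
     S \<in> carrier A \<rightarrow> carrier D \<and>
     (\<forall>x\<in>carrier A. \<forall>y\<in>carrier A. S (x \<oplus>\<^bsub>A\<^esub> y) = S x \<oplus>\<^bsub>D\<^esub> S y) \<and>
     (\<forall>c. \<forall>x\<in>carrier A. S (c \<odot>\<^bsub>A\<^esub> x) = c \<odot>\<^bsub>D\<^esub> S x) \<and>
     (\<forall>x\<in>carrier A. \<forall>y\<in>carrier A. (S x)\<^sup>\<star>\<^bsub>D\<^esub> \<otimes>\<^bsub>D\<^esub> S y = \<pi> (x\<^sup>\<star>\<^bsub>A\<^esub> \<otimes>\<^bsub>A\<^esub> y)) \<and>
     (\<forall>a\<in>carrier A. \<forall>x\<in>carrier A. \<forall>b\<in>carrier A.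
        \<pi> a \<otimes>\<^bsub>D\<^esub> S x \<otimes>\<^bsub>D\<^esub> \<pi> b = S (lact (\<rho> a) (x \<otimes>\<^bsub>A\<^esub> b))) \<and>
     (\<exists>\<psi>. star_hom A D \<psi> \<and>
        (\<forall>x\<in>carrier A. \<forall>y\<in>carrier A. \<psi> (x \<otimes>\<^bsub>A\<^esub> y\<^sup>\<star>\<^bsub>A\<^esub>) = S x \<otimes>\<^bsub>D\<^esub> (S y)\<^sup>\<star>\<^bsub>D\<^esub>) \<and>
        (\<forall>a\<in>carrier A. \<forall>c\<in>carrier A. \<rho> a = to_multiplier A c \<longrightarrow> \<pi> a = \<psi> c))"

datatype 'a cp_generator = Coeff 'a | Creation 'a

definition cuntz_pimsner ::
  "('a, 'm) cstar_struct_scheme \<Rightarrow> ('a \<Rightarrow> 'a multiplier) \<Rightarrow> 'a cp_generator universal cstar_struct" where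
  "cuntz_pimsner A \<rho> = universal_cstar_algebra (Coeff ` carrier A \<union> Creation ` carrier A)
     (\<lambda>D \<gamma>. covariant_rep A \<rho> D (\<lambda>a. \<gamma> (Coeff a)) (\<lambda>x. \<gamma> (Creation x)))"

end

theory Submission
 imports Defs
begin

notation cnorm (\<open>||_||\<index>\<close>) and cadj (\<open>_\<star>\<index>\<close> [1000] 999) and mult (infixl \<open>\<cdot>\<index>\<close> 70) and carrier (\<open>|_|\<close>)
syntax "_index" :: "logic => index" (\<open>\<^sub>_\<close> [1000] 1000)

text \<open>Write \<open>R\<close> for the strictly continuous extension of \<open>\<rho>\<close>. A covariant representation \<open>(\<pi>, S)\<close> yields maps
  \<open>S\<^sup>k\<close>, determined by \<open>S\<^sup>0 = \<pi>\<close> and \<open>S\<^sup>k\<^sup>+\<^sup>1(\<rho>(b)c) = S\<^sup>k(b)S(c)\<close>; Cohen factorization makes every element of \<open>A\<close> of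
  the form \<open>\<rho>(b)c\<close>. Every word in the generators is \<open>S\<^sup>k(x)S\<^sup>l(y)\<star>\<close>, and in the crossed product this is
  \<open>\<iota>\<^sub>k(xy\<star>)\<close> in degree \<open>k - l\<close>. The universal algebra therefore embeds as soon as every representation is
  dominated by the one in the crossed product. In degree 0 one compares \<open>a\<^sub>m + R(a\<^sub>m\<^sub>-\<^sub>1 + R(\<dots>))\<close> in the multiplier
  algebra with \<open>\<psi>\<^sub>m(a\<^sub>m) + \<psi>\<^sub>m\<^sub>-\<^sub>1(a\<^sub>m\<^sub>-\<^sub>1) + \<dots>\<close>: truncating the positive part of \<open>T\<star>T\<close> below the top level
  changes it only by elements \<open>j\<close> with \<open>\<rho>(j)\<in>A\<close>, which covariance moves up one level, so induction on the level
  bounds the norm up to a constant, and the C*-identity removes constants by passing to powers. The same trick reduces arbitrary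
  elements to homogeneous ones, since the number of degrees grows linearly in the powers. The image is hereditary
  because \<open>\<pi>(e\<^sub>n)z\<pi>(e\<^sub>n)\<close> lies in it for every \<open>z\<close> and \<open>\<pi>(e\<^sub>n)\<close> is an approximate unit.\<close>

section \<open>Algebra in *-algebras\<close>

text \<open>The obstacle in degree 0 is that the levels overlap: if \<rho>(a) lies in A, one
  multiplier has several expressions as a sum over levels, and it is not clear that the
  corresponding sum in a representation depends on the multiplier alone. Covariance removes exactly
  this ambiguity, but it is a statement about single elements and not about norms. Truncation turns
  it into a norm bound: it is functional calculus modulo the ideal A, where T\<star>T agrees with
  its lower part. Neither the quotient M(A)/A nor a spectrum appears. Square roots are limits of a
  polynomial iteration, which visibly respects closed ideals and contractive homomorphisms, and
  positivity is built on these roots. The passage from homogeneous to arbitrary elements takes the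
  place of averaging over the circle in a gauge-invariant uniqueness argument; from the crossed
  product it uses only that coefficients are bounded by the norm. Finally, the crossed product
  itself carries a covariant representation, so the supremum that defines the universal norm is a
  maximum, attained there.\<close>

lemma complex_ring_simps [simp]:
 "carrier complex_ring = UNIV" "a\<cdot>\<^bsub>complex_ring\<^esub> b = a * b" "\<one>\<^bsub>complex_ring\<^esub> = 1"
 "\<zero>\<^bsub>complex_ring\<^esub> = 0" "a\<oplus>\<^bsub>complex_ring\<^esub> b = a + b"
 by (simp_all add: complex_ring_def)

lemma complex_ring_cring: "cring complex_ring"
proof (rule cringI)
 show "abelian_group complex_ring"
 proof (rule abelian_groupI)
  show "\<exists>y\<in>carrier complex_ring. y\<oplus>\<^bsub>complex_ring\<^esub> x = \<zero>\<^bsub>complex_ring\<^esub>" for x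
   by (rule bexI[of _ "-x"]) simp_all
 qed simp_all
 show "comm_monoid complex_ring"
  by (rule comm_monoidI) simp_all
 show "(x\<oplus>\<^bsub>complex_ring\<^esub> y)\<cdot>\<^bsub>complex_ring\<^esub> z
   = x\<cdot>\<^bsub>complex_ring\<^esub> z\<oplus>\<^bsub>complex_ring\<^esub> y\<cdot>\<^bsub>complex_ring\<^esub> z" for x y z
  by (simp add: distrib_right)
qed

text \<open>Negatives are multiples by -1, so the existence of inverses becomes one more equation.
  All hypotheses are closure statements or identities, which a concrete algebra can verify uniformly
  by rewriting.\<close>

lemma star_algebraI:
 fixes A :: "('a, 'm) cstar_struct_scheme" (structure)
 assumes "\<zero>\<in>|A|"
  "\<And>x y. x\<in>|A| ==> y\<in>|A| ==> x\<oplus>y\<in>|A|"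
  "\<And>c x. x\<in>|A| ==> c\<odot>x\<in>|A|"
  "\<And>x y. x\<in>|A| ==> y\<in>|A| ==> x\<cdot>y\<in>|A|"
  "\<And>x. x\<in>|A| ==> x\<star>\<in>|A|"
  "\<And>x y z. x\<in>|A| ==> y\<in>|A| ==> z\<in>|A| ==> x\<oplus>y\<oplus>z = x\<oplus>(y\<oplus>z)"
  "\<And>x y. x\<in>|A| ==> y\<in>|A| ==> x\<oplus>y = y\<oplus>x"
  "\<And>x. x\<in>|A| ==> \<zero>\<oplus>x = x"
  "\<And>x. x\<in>|A| ==> (-1)\<odot>x\<oplus>x = \<zero>"
  "\<And>c d x. x\<in>|A| ==> (c + d)\<odot>x = c\<odot>x\<oplus>d\<odot>x"
  "\<And>c x y. x\<in>|A| ==> y\<in>|A| ==> c\<odot>(x\<oplus>y) = c\<odot>x\<oplus>c\<odot>y"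
  "\<And>c d x. x\<in>|A| ==> (c * d)\<odot>x = c\<odot>(d\<odot>x)"
  "\<And>x. x\<in>|A| ==> 1\<odot>x = x"
  "\<And>x y z. x\<in>|A| ==> y\<in>|A| ==> z\<in>|A| ==> x\<cdot>y\<cdot>z = x\<cdot>(y\<cdot>z)"
  "\<And>x y z. x\<in>|A| ==> y\<in>|A| ==> z\<in>|A| ==> (x\<oplus>y)\<cdot>z = x\<cdot>z\<oplus>y\<cdot>z"
  "\<And>x y z. x\<in>|A| ==> y\<in>|A| ==> z\<in>|A| ==> z\<cdot>(x\<oplus>y) = z\<cdot>x\<oplus>z\<cdot>y"
  "\<And>c x y. x\<in>|A| ==> y\<in>|A| ==> (c\<odot>x)\<cdot>y = c\<odot>(x\<cdot>y)"
  "\<And>c x y. x\<in>|A| ==> y\<in>|A| ==> x\<cdot>(c\<odot>y) = c\<odot>(x\<cdot>y)"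
  "\<And>x. x\<in>|A| ==> (x\<star>)\<star> = x"
  "\<And>x y. x\<in>|A| ==> y\<in>|A| ==> (x\<oplus>y)\<star> = x\<star>\<oplus>y\<star>"
  "\<And>c x. x\<in>|A| ==> (c\<odot>x)\<star> = cnj c\<odot>x\<star>"
  "\<And>x y. x\<in>|A| ==> y\<in>|A| ==> (x\<cdot>y)\<star> = y\<star>\<cdot>x\<star>"
 shows "star_algebra A"
proof -
 have "abelian_group A"
 proof (rule abelian_groupI)
  show "\<exists>y\<in>|A|. y\<oplus>x = \<zero>" if "x\<in>|A|" for x
   using assms(3)[OF that, of "-1"] assms(9)[OF that] by blast
 qed (fact assms)+
 then have "module complex_ring A"
  by (rule moduleI[OF complex_ring_cring]) (simp_all only: complex_ring_simps assms)
 then show ?thesis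
  by (rule star_algebra.intro) (rule star_algebra_axioms.intro; fact assms)
qed

context star_algebra
begin

lemmas closed [simp] = M.zero_closed M.add.m_closed mult_closed adj_closed M.a_inv_closed M.minus_closed

lemma smult_in [simp]: "x\<in>|A| ==> c\<odot>x\<in>|A|"
 by (rule smult_closed) simp_all

lemma smult_add_left: "x\<in>|A| ==> (c + d)\<odot>x = c\<odot>x\<oplus>d\<odot>x"
 using smult_l_distr[of c d x] by simp

lemma smult_add_right: "x\<in>|A| ==> y\<in>|A| ==> c\<odot>(x\<oplus>y) = c\<odot>x\<oplus>c\<odot>y"
 using smult_r_distr[of c x y] by simp

lemma smult_smult [simp]: "x\<in>|A| ==> c\<odot>(d\<odot>x) = (c * d)\<odot>x"
 using smult_assoc1[of c d x] by simp

lemma smult_1 [simp]: "x\<in>|A| ==> 1\<odot>x = x"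
 using smult_one[of x] by simp

lemma smult_0 [simp]: "x\<in>|A| ==> 0\<odot>x = \<zero>"
 using smult_l_null[of x] by simp

lemma smult_zero [simp]: "c\<odot>\<zero> = \<zero>"
 using smult_r_null[of c] by simp

lemma uminus_eq: assumes "x\<in>|A|" shows "\<ominus>x = (-1)\<odot>x"
proof (rule M.minus_equality)
 show "(-1)\<odot>x\<oplus>x = \<zero>"
  using smult_add_left[of x "-1" 1] assms by simp
qed (use assms in auto)

lemma diff_eq: "x\<in>|A| ==> y\<in>|A| ==> x\<ominus>y = x\<oplus>(-1)\<odot>y"
 by (simp add: a_minus_def uminus_eq)

text \<open>The formal combination with coefficients \<open>f\<close> sums to \<open>x\<close>. This
  is a relation because one \<open>x\<close> has many coefficient functions; conversely
  \<open>f\<close> determines \<open>x\<close>, and that direction proves identities.\<close>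

definition rep :: "'a=>('a=>complex)=>bool" where
 "rep x f\<longleftrightarrow>(\<exists>F. finite F\<and>F\<subseteq>|A|\<and>(\<forall>z. z\<notin>F\<longrightarrow>f z = 0)\<and>x = (\<Oplus>z\<in>F. f z\<odot>z))"

lemma rep_unique: assumes "rep x f" "rep y f" shows "x = y"
proof -
 obtain F where F: "finite F" "F\<subseteq>|A|" "\<And>z. z\<notin>F ==> f z = 0" "x = (\<Oplus>z\<in>F. f z\<odot>z)"
  using assms(1) unfolding rep_def by blast
 obtain G where G: "finite G" "G\<subseteq>|A|" "\<And>z. z\<notin>G ==> f z = 0" "y = (\<Oplus>z\<in>G. f z\<odot>z)"
  using assms(2) unfolding rep_def by blast
 have "x = (\<Oplus>z\<in>F\<union>G. f z\<odot>z)"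
  unfolding F(4) by (rule M.add.finprod_mono_neutral_cong_left) (use F G in auto)
 moreover have "y = (\<Oplus>z\<in>F\<union>G. f z\<odot>z)"
  unfolding G(4) by (rule M.add.finprod_mono_neutral_cong_left) (use F G in auto)
 ultimately show ?thesis by simp
qed

lemma rep_add: assumes "rep x f" "rep y g" shows "rep (x\<oplus>y) (\<lambda>z. f z + g z)"
proof -
 obtain F where F: "finite F" "F\<subseteq>|A|" "\<And>z. z\<notin>F ==> f z = 0" "x = (\<Oplus>z\<in>F. f z\<odot>z)"
  using assms(1) unfolding rep_def by blast
 obtain G where G: "finite G" "G\<subseteq>|A|" "\<And>z. z\<notin>G ==> g z = 0" "y = (\<Oplus>z\<in>G. g z\<odot>z)"
  using assms(2) unfolding rep_def by blast
 have "x = (\<Oplus>z\<in>F\<union>G. f z\<odot>z)"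
  unfolding F(4) by (rule M.add.finprod_mono_neutral_cong_left) (use F G in auto)
 moreover have "y = (\<Oplus>z\<in>F\<union>G. g z\<odot>z)"
  unfolding G(4) by (rule M.add.finprod_mono_neutral_cong_left) (use F G in auto)
 moreover have "(\<Oplus>z\<in>F\<union>G. f z\<odot>z)\<oplus>(\<Oplus>z\<in>F\<union>G. g z\<odot>z) = (\<Oplus>z\<in>F\<union>G. f z\<odot>z\<oplus>g z\<odot>z)"
  by (rule M.finsum_addf[symmetric]) (use F G in auto)
 moreover have "\<dots> = (\<Oplus>z\<in>F\<union>G. (f z + g z)\<odot>z)"
  by (rule M.finsum_cong') (use F G in \<open>auto simp: smult_add_left\<close>)
 ultimately show ?thesis
  unfolding rep_def using F G by (intro exI[of _ "F\<union>G"]) auto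
qed

lemma rep_smult: assumes "rep x f" shows "rep (c\<odot>x) (\<lambda>z. c * f z)"
proof -
 obtain F where F: "finite F" "F\<subseteq>|A|" "\<And>z. z\<notin>F ==> f z = 0" "x = (\<Oplus>z\<in>F. f z\<odot>z)"
  using assms(1) unfolding rep_def by blast
 have "c\<odot>x = (\<Oplus>z\<in>F. c\<odot>(f z\<odot>z))"
  unfolding F(4) by (rule finsum_smult_ldistr) (use F in auto)
 also have "\<dots> = (\<Oplus>z\<in>F. (c * f z)\<odot>z)"
  by (rule M.finsum_cong') (use F in auto)
 finally show ?thesis
  unfolding rep_def using F by (intro exI[of _ F]) auto
qed

lemma rep_in: "rep x f ==> x\<in>|A|"
 unfolding rep_def by (auto intro!: M.finsum_closed)

lemma rep_uminus: assumes "rep x f" shows "rep (\<ominus>x) (\<lambda>z. - f z)"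
 using rep_smult[OF assms, of "-1"] rep_in[OF assms] by (simp add: uminus_eq)

lemma rep_diff: assumes "rep x f" "rep y g" shows "rep (x\<ominus>y) (\<lambda>z. f z - g z)"
 using rep_add[OF assms(1) rep_uminus[OF assms(2)]] by (simp add: a_minus_def)

lemma rep_zero: "rep \<zero> (\<lambda>z. 0)"
 unfolding rep_def by (intro exI[of _ "{}"]) auto

lemma rep_atom: "x\<in>|A| ==> rep x (\<lambda>z. of_bool (z = x))"
 unfolding rep_def by (intro exI[of _ "{x}"]) auto

text \<open>The order matters: \<open>rep_atom\<close> comes last, so it catches only terms that are
  not visibly sums, multiples, differences, negatives or zero. Expanded products thus become the
  monomials.\<close>

lemmas lins = rep_add rep_smult rep_diff rep_uminus rep_zero rep_atom

text \<open>To prove an identity between linear combinations, compare the coefficients of the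
 monomials, as formal functions of the monomial.\<close>

lemma linI: "rep x f ==> rep y g ==> (\<And>z. f z = g z) ==> x = y"
 using rep_unique[of x f y] by (metis ext)

lemma mult_zero [simp]: "x\<in>|A| ==> x\<cdot>\<zero> = \<zero>" "x\<in>|A| ==> \<zero>\<cdot>x = \<zero>"
 using smult_mult_left[of \<zero> x 0] smult_mult_right[of x \<zero> 0] by auto

lemma adj_zero [simp]: "\<zero>\<star> = \<zero>"
 using adj_smult[of \<zero> 0] by auto

lemma distrib_left_diff: "x\<in>|A| ==> y\<in>|A| ==> z\<in>|A| ==> z\<cdot>(x\<ominus>y) = z\<cdot>x\<ominus>z\<cdot>y"
 by (simp add: diff_eq distrib_left smult_mult_right)

lemma distrib_right_diff: "x\<in>|A| ==> y\<in>|A| ==> z\<in>|A| ==> (x\<ominus>y)\<cdot>z = x\<cdot>z\<ominus>y\<cdot>z"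
 by (simp add: diff_eq distrib_right smult_mult_left)

lemma smult_diff: "x\<in>|A| ==> y\<in>|A| ==> c\<odot>(x\<ominus>y) = c\<odot>x\<ominus>c\<odot>y"
 by (simp add: diff_eq smult_add_right mult.commute)

lemma adj_diff: "x\<in>|A| ==> y\<in>|A| ==> (x\<ominus>y)\<star> = x\<star>\<ominus>y\<star>"
 by (simp add: diff_eq adj_add adj_smult)

lemmas expand = distrib_left distrib_right distrib_left_diff distrib_right_diff smult_mult_left
 smult_mult_right smult_add_right smult_diff adj_add adj_diff adj_smult adj_mult adj_adj mult_assoc

lemma diff_self [simp]: "x\<in>|A| ==> x\<ominus>x = \<zero>"
 by (simp add: a_minus_def M.r_neg)

lemma diff_eq_zeroD: assumes "x\<in>|A|" "y\<in>|A|" "x\<ominus>y = \<zero>" shows "x = y"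
proof -
 have "x = (x\<ominus>y)\<oplus>y"
  by (rule linI, (rule lins | (simp add: algebra_simps assms; fail))+)
 then show ?thesis using assms by simp
qed

end

section \<open>Norms and limits\<close>

text \<open>The free algebra, the algebraic inductive limit and the finitely supported families of
  the crossed product are of this kind before separation and completion.\<close>

locale pre_cstar = star_algebra A for A :: "('a, 'm) cstar_struct_scheme" (structure) +
 assumes cstar_seminorm: "cstar_seminorm A (cnorm A)"

sublocale cstar_algebra\<subseteq>pre_cstar
 by unfold_locales (rule cstar_norm)

context pre_cstar
begin

lemma norm_nonneg [simp]: "x\<in>|A| ==> 0\<le>||x||"
 and norm_triangle: "x\<in>|A| ==> y\<in>|A| ==> ||x\<oplus>y||\<le>||x|| + ||y||"
 and norm_smult: "x\<in>|A| ==> ||c\<odot>x|| = cmod c * ||x||"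
 and norm_mult: "x\<in>|A| ==> y\<in>|A| ==> ||x\<cdot>y||\<le>||x|| * ||y||"
 and norm_cstar: "x\<in>|A| ==> ||x\<star>\<cdot>x|| = ||x||\<^sup>2"
 using cstar_seminorm unfolding cstar_seminorm_def by auto

lemma norm_zero [simp]: "||\<zero>|| = 0"
 using norm_smult[of \<zero> 0] by simp

lemma norm_uminus [simp]: "x\<in>|A| ==> ||\<ominus>x|| = ||x||"
 by (simp add: uminus_eq norm_smult)

lemma norm_diff_triangle: "x\<in>|A| ==> y\<in>|A| ==> ||x\<ominus>y||\<le>||x|| + ||y||"
 using norm_triangle[of x "\<ominus>y"] by (simp add: a_minus_def)

lemma norm_diff_commute: assumes "x\<in>|A|" "y\<in>|A|" shows "||x\<ominus>y|| = ||y\<ominus>x||"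
proof -
 have "x\<ominus>y =\<ominus>(y\<ominus>x)"
  by (rule linI, (rule lins | (simp add: algebra_simps assms; fail))+)
 then show ?thesis using assms by simp
qed

lemma norm_dist_triangle:
 assumes "x\<in>|A|" "y\<in>|A|" "z\<in>|A|"
 shows "||x\<ominus>z||\<le>||x\<ominus>y|| + ||y\<ominus>z||"
proof -
 have "x\<ominus>z = (x\<ominus>y)\<oplus>(y\<ominus>z)"
  by (rule linI, (rule lins | (simp add: algebra_simps assms; fail))+)
 then show ?thesis using assms norm_triangle[of "x\<ominus>y" "y\<ominus>z"] by simp
qed

lemma norm_adj_le: assumes "x\<in>|A|" shows "||x||\<le>||x\<star>||"
proof (cases "||x|| = 0")
 case False
 have "||x|| * ||x||\<le>||x\<star>|| * ||x||"
  using norm_mult[of "x\<star>" x] norm_cstar[of x] assms by (simp add: power2_eq_square)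
 then show ?thesis
  using False norm_nonneg[OF assms] by (auto simp: mult_le_cancel_right)
qed (use assms in simp)

lemma norm_adj [simp]: "x\<in>|A| ==> ||x\<star>|| = ||x||"
 using norm_adj_le[of x] norm_adj_le[of "x\<star>"] by (simp add: adj_adj)

lemma norm_cstar': "x\<in>|A| ==> ||x\<cdot>x\<star>|| = ||x||\<^sup>2"
 using norm_cstar[of "x\<star>"] by (simp add: adj_adj)

lemma norm_le_plus_diff: assumes "x\<in>|A|" "y\<in>|A|" shows "||x||\<le>||y|| + ||x\<ominus>y||"
proof -
 have "x = y\<oplus>(x\<ominus>y)"
  by (rule linI, (rule lins | (simp add: algebra_simps assms; fail))+)
 then show ?thesis
  using norm_triangle[of y "x\<ominus>y"] assms by simp
qed

lemma norm_diff_ineq: "x\<in>|A| ==> y\<in>|A| ==> \<bar>||x|| - ||y||\<bar>\<le>||x\<ominus>y||"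
 using norm_le_plus_diff[of x y] norm_le_plus_diff[of y x] norm_diff_commute[of x y] by auto

end

text \<open>Membership of all terms and of the limit is part of the notion, which saves side
  conditions throughout. For a mere seminorm the limit is not unique.\<close>

definition tends :: "('a, 'm) cstar_struct_scheme=>(nat=>'a)=>'a=>bool" where
 "tends A s x\<longleftrightarrow>(\<forall>n. s n\<in>|A| )\<and>x\<in>|A|\<and>(\<lambda>n. ||s n\<ominus>\<^sub>A x||\<^sub>A)\<longlonglongrightarrow>0"

context pre_cstar
begin

lemma tendsI:
 assumes "\<And>n. s n\<in>|A|" "x\<in>|A|" "\<And>n. ||s n\<ominus>x||\<le>r n" "r\<longlonglongrightarrow>0"
 shows "tends A s x"
 unfolding tends_def using assms
 by (auto intro!: tendsto_sandwich[of "\<lambda>_. 0" "\<lambda>n. ||s n\<ominus>x||" sequentially r 0])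

lemma tends_in: "tends A s x ==> s n\<in>|A|" "tends A s x ==> x\<in>|A|"
 unfolding tends_def by auto

lemma tends_const: "x\<in>|A| ==> tends A (\<lambda>n. x) x"
 by (simp add: tends_def)

lemma tends_add: assumes "tends A s x" "tends A t y" shows "tends A (\<lambda>n. s n\<oplus>t n) (x\<oplus>y)"
proof (rule tendsI)
 note [simp] = tends_in[OF assms(1)] tends_in[OF assms(2)]
 show "||s n\<oplus>t n\<ominus>(x\<oplus>y)||\<le>||s n\<ominus>x|| + ||t n\<ominus>y||" for n
 proof -
  have "s n\<oplus>t n\<ominus>(x\<oplus>y) = (s n\<ominus>x)\<oplus>(t n\<ominus>y)"
   by (rule linI, (rule lins | (simp add: algebra_simps ; fail))+)
  then show ?thesis by (simp add: norm_triangle)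
 qed
 show "(\<lambda>n. ||s n\<ominus>x|| + ||t n\<ominus>y||)\<longlonglongrightarrow>0"
  using assms unfolding tends_def by (auto intro: tendsto_add_zero)
qed (use assms in \<open>auto simp: tends_in\<close>)

lemma tends_smult: assumes "tends A s x" shows "tends A (\<lambda>n. c\<odot>s n) (c\<odot>x)"
proof (rule tendsI)
 note [simp] = tends_in[OF assms(1)]
 show "||c\<odot>s n\<ominus>c\<odot>x||\<le>cmod c * ||s n\<ominus>x||" for n
  by (simp add: smult_diff[symmetric] norm_smult)
 show "(\<lambda>n. cmod c * ||s n\<ominus>x||)\<longlonglongrightarrow>0"
  using assms unfolding tends_def by (auto intro: tendsto_mult_right_zero)
qed (use assms in \<open>auto simp: tends_in\<close>)

lemma tends_diff: assumes "tends A s x" "tends A t y" shows "tends A (\<lambda>n. s n\<ominus>t n) (x\<ominus>y)"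
 using tends_add[OF assms(1) tends_smult[OF assms(2), of "-1"]] tends_in[OF assms(1)] tends_in[OF assms(2)]
 by (simp add: diff_eq)

lemma tends_adj: assumes "tends A s x" shows "tends A (\<lambda>n. (s n)\<star>) (x\<star>)"
proof (rule tendsI)
 note [simp] = tends_in[OF assms(1)]
 show "||(s n)\<star>\<ominus>x\<star>||\<le>||s n\<ominus>x||" for n
  by (simp add: adj_diff[symmetric])
qed (use assms in \<open>auto simp: tends_def\<close>)

lemma tends_norm: assumes "tends A s x" shows "(\<lambda>n. ||s n||)\<longlonglongrightarrow>||x||"
proof (rule LIM_zero_cancel, rule Lim_null_comparison)
 note [simp] = tends_in[OF assms(1)]
 show "(\<lambda>n. ||s n\<ominus>x||)\<longlonglongrightarrow>0" using assms unfolding tends_def by blast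
 show "\<forall>\<^sub>F n in sequentially. norm ( ||s n|| - ||x||)\<le>||s n\<ominus>x||"
  by (auto intro!: always_eventually norm_diff_ineq)
qed

lemma tends_mult: assumes "tends A s x" "tends A t y" shows "tends A (\<lambda>n. s n\<cdot>t n) (x\<cdot>y)"
proof (rule tendsI)
 note [simp] = tends_in[OF assms(1)] tends_in[OF assms(2)]
 show "||s n\<cdot>t n\<ominus>x\<cdot>y||\<le>||s n\<ominus>x|| * ||t n|| + ||x|| * ||t n\<ominus>y||" for n
 proof -
  have "s n\<cdot>t n\<ominus>x\<cdot>y = (s n\<ominus>x)\<cdot>t n\<oplus>x\<cdot>(t n\<ominus>y)"
   by (simp add: expand, rule linI, (rule lins | (simp add: algebra_simps ; fail))+)
  then have "||s n\<cdot>t n\<ominus>x\<cdot>y||\<le>||(s n\<ominus>x)\<cdot>t n|| + ||x\<cdot>(t n\<ominus>y)||"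
   by (simp add: norm_triangle)
  then show ?thesis using norm_mult[of "s n\<ominus>x" "t n"] norm_mult[of x "t n\<ominus>y"] by simp
 qed
 have "(\<lambda>n. ||s n\<ominus>x|| * ||t n|| + ||x|| * ||t n\<ominus>y||)\<longlonglongrightarrow>0 * ||y|| + ||x|| * 0"
  by (intro tendsto_intros tends_norm[OF assms(2)]) (use assms in \<open>auto simp: tends_def\<close>)
 then show "(\<lambda>n. ||s n\<ominus>x|| * ||t n|| + ||x|| * ||t n\<ominus>y||)\<longlonglongrightarrow>0" by simp
qed (use assms in \<open>auto simp: tends_in\<close>)

lemmas tends_intros = tends_const tends_add tends_smult tends_diff tends_adj tends_mult

lemma tends_norm_le: assumes "tends A s x" "\<And>n. ||s n||\<le>C" shows "||x||\<le>C"
 using LIMSEQ_le_const2[OF tends_norm[OF assms(1)]] assms(2) by blast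

lemma tends_Suc: "tends A s x ==> tends A (\<lambda>n. s (Suc n)) x"
 unfolding tends_def using LIMSEQ_Suc[of "\<lambda>n. ||s n\<ominus>x||"] by auto

lemma tends_epsE:
 assumes "tends A s x" "\<epsilon> > 0" obtains n where "||x\<ominus>s n|| < \<epsilon>"
proof -
 have "\<forall>\<^sub>F n in sequentially. ||s n\<ominus>x|| < \<epsilon>"
  using assms unfolding tends_def by (auto simp: order_tendsto_iff)
 then obtain n where "||s n\<ominus>x|| < \<epsilon>"
  using eventually_happens'[OF sequentially_bot] by blast
 then show ?thesis using that[of n] norm_diff_commute tends_in[OF assms(1)] by metis
qed

end

context cstar_algebra
begin

lemma norm_eq_zero [simp]: "x\<in>|A| ==> ||x|| = 0\<longleftrightarrow>x = \<zero>"
 using norm_definite by auto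

lemma norm_diff_eq_zero: "x\<in>|A| ==> y\<in>|A| ==> ||x\<ominus>y|| = 0\<longleftrightarrow>x = y"
 using diff_eq_zeroD by auto

lemma tends_unique: assumes "tends A s x" "tends A s y" shows "x = y"
proof -
 note [simp] = tends_in[OF assms(1)] tends_in[OF assms(2)]
 have "(\<lambda>n. s n\<ominus>s n) = (\<lambda>n. \<zero>)" by simp
 then have "tends A (\<lambda>n. \<zero>) (x\<ominus>y)"
  using tends_diff[OF assms] by simp
 from tends_norm[OF this] have "||x\<ominus>y|| = 0"
  by (simp add: LIMSEQ_const_iff)
 then show ?thesis using diff_eq_zeroD[of x y] by simp
qed

lemma adj_eq_mult_zero: "x\<in>|A| ==> x\<star>\<cdot>x = \<zero> ==> x = \<zero>"
 using norm_cstar[of x] by simp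

end

subsection \<open>Metric notions in terms of norm limits\<close>

lemma (in pre_cstar) Metric_space_cdist:
 assumes "\<And>x. x\<in>|A| ==> ||x|| = 0 ==> x = \<zero>"
 shows "Metric_space ( |A| ) (cdist A)"
proof
 show "0\<le>cdist A x y" for x y by (simp add: cdist_def)
 show "cdist A x y = cdist A y x" for x y by (auto simp: cdist_def norm_diff_commute)
 show "cdist A x y = 0\<longleftrightarrow>x = y" if "x\<in>|A|" "y\<in>|A|" for x y
  using that assms[of "x\<ominus>y"] diff_eq_zeroD[of x y] by (auto simp: cdist_def)
 show "cdist A x z\<le>cdist A x y + cdist A y z"
  if "x\<in>|A|" "y\<in>|A|" "z\<in>|A|" for x y z
  using that by (simp add: cdist_def norm_dist_triangle)
qed

context cstar_algebra
begin

lemma Metric_space: "Metric_space ( |A| ) (cdist A)"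
 by (rule Metric_space_cdist) (rule norm_definite)

sublocale met: Metric_space "|A|" "cdist A"
 by (rule Metric_space)

lemma limitin_iff_tends:
 assumes "range s\<subseteq>|A|"
 shows "limitin met.mtopology s x sequentially\<longleftrightarrow>tends A s x"
proof -
 have "s n\<in>|A|" for n using assms by auto
 then show ?thesis
  unfolding met.limit_metric_sequentially tends_def lim_sequentially
  by (auto simp: cdist_def)
qed

lemma Cauchy_tends:
 assumes "\<And>n. s n\<in>|A|" "\<And>\<epsilon>. \<epsilon> > 0 ==> \<exists>N. \<forall>m\<ge>N. \<forall>n\<ge>N. ||s m\<ominus>s n|| < \<epsilon>"
 obtains x where "tends A s x"
proof -
 have "met.MCauchy s"
  unfolding met.MCauchy_def using assms by (auto simp: cdist_def)
 then obtain x where "limitin met.mtopology s x sequentially"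
  using complete unfolding met.mcomplete_def by blast
 then show ?thesis using that limitin_iff_tends assms(1) by (auto simp: image_subset_iff)
qed

lemma closure_iff:
 assumes "S\<subseteq>|A|"
 shows "x\<in>norm_topology A closure_of S\<longleftrightarrow>(\<exists>s. (\<forall>n. s n\<in>S)\<and>tends A s x)" (is "_ = ?R")
proof
 assume x: "x\<in>norm_topology A closure_of S"
 then have x': "x\<in>|A|" "\<And>r. r > 0 ==> \<exists>y\<in>S. cdist A x y < r"
  unfolding norm_topology_def met.metric_closure_of by (auto simp: met.mball_def)
 have "\<forall>n. \<exists>y\<in>S. cdist A x y < 1 / real (Suc n)"
  using x'(2) by auto
 then obtain s where s: "\<And>n. s n\<in>S" "\<And>n. cdist A x (s n) < 1 / real (Suc n)"
  by metis
 have "tends A s x"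
 proof (rule tendsI)
  show "||s n\<ominus>x||\<le>1 / real (Suc n)" for n
   using s[of n] assms x' norm_diff_commute[of x "s n"] by (auto simp: cdist_def subset_iff)
  show "(\<lambda>n. 1 / real (Suc n))\<longlonglongrightarrow>0" by (rule LIMSEQ_Suc[OF lim_1_over_n])
 qed (use s x' assms in auto)
 then show ?R using s by blast
next
 assume ?R
 then obtain s where s: "\<And>n. s n\<in>S" "tends A s x" by blast
 have "\<exists>y\<in>S. y\<in>met.mball x r" if "r > 0" for r
 proof -
  obtain n where "||x\<ominus>s n|| < r" using tends_epsE[OF s(2) \<open>r > 0\<close>] by blast
  then show ?thesis using s tends_in[OF s(2)] by (auto simp: met.mball_def cdist_def intro!: bexI[of _ "s n"])
 qed
 then show "x\<in>norm_topology A closure_of S"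
  unfolding norm_topology_def met.metric_closure_of using tends_in[OF s(2)] by auto
qed

lemma closedin_iff:
 "closedin (norm_topology A) S\<longleftrightarrow>S\<subseteq>|A|\<and>(\<forall>s x. (\<forall>n. s n\<in>S)\<and>tends A s x\<longrightarrow>x\<in>S)"
 unfolding norm_topology_def met.metric_closedin_iff_sequentially_closed
proof (rule conj_cong[OF refl], rule iffI, goal_cases)
 case 1
 then show ?case using limitin_iff_tends by (metis image_subset_iff subset_trans)
next
 case 2
 then show ?case using limitin_iff_tends
  by (metis image_subset_iff range_subsetD subset_trans)
qed

lemma closedin_tends: "closedin (norm_topology A) S ==> (\<And>n. s n\<in>S) ==> tends A s x ==> x\<in>S"
 unfolding closedin_iff by blast

end

lemma (in pre_cstar) cstar_algebraI:
 assumes "\<And>x. x\<in>|A| ==> ||x|| = 0 ==> x = \<zero>"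
  "\<And>s. (\<And>n. s n\<in>|A| ) ==> (\<And>\<epsilon>. \<epsilon> > 0 ==> \<exists>N. \<forall>m\<ge>N. \<forall>n\<ge>N. ||s m\<ominus>s n|| < \<epsilon>) ==> \<exists>x. tends A s x"
 shows "cstar_algebra A"
proof -
 interpret met: Metric_space "|A|" "cdist A"
  by (rule Metric_space_cdist) (rule assms(1))
 have "met.mcomplete"
  unfolding met.mcomplete_def
 proof (intro allI impI)
  fix s assume s: "met.MCauchy s"
  then have sA: "s n\<in>|A|" for n by (auto simp: met.MCauchy_def)
  obtain x where "tends A s x"
   using assms(2)[of s] s sA unfolding met.MCauchy_def by (auto simp: cdist_def)
  then have "limitin met.mtopology s x sequentially"
   unfolding met.limit_metric_sequentially tends_def lim_sequentially by (auto simp: cdist_def)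
  then show "\<exists>x. limitin met.mtopology s x sequentially" by blast
 qed
 then show ?thesis
  by (intro cstar_algebra.intro star_algebra_axioms cstar_algebra_axioms.intro cstar_seminorm assms(1))
qed

text \<open>Majorant principle: the increments of \<open>r\<close> telescope, so convergence of the
  scalar sequence makes \<open>s\<close> Cauchy. It serves the square root iteration, the Neumann
  series and Cohen's construction alike.\<close>

lemma (in cstar_algebra) summable_tends:
 assumes "\<And>n. s n\<in>|A|" "\<And>n. ||s (Suc n)\<ominus>s n||\<le>r (Suc n) - r n" "convergent r"
 obtains x where "tends A s x"
proof -
 have le: "||s (n + k)\<ominus>s n||\<le>r (n + k) - r n" for n k
 proof (induction k)
  case 0 then show ?case using assms(1) by simp
 next
  case (Suc k)
  then show ?case
   using norm_dist_triangle[of "s (Suc (n + k))" "s (n + k)" "s n"] assms(1) assms(2)[of "n + k"] by simp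
 qed
 show ?thesis
 proof (rule Cauchy_tends[of s])
  fix \<epsilon> :: real assume "\<epsilon> > 0"
  then obtain N where N: "\<And>m n. m\<ge>N ==> n\<ge>N ==> \<bar>r m - r n\<bar> < \<epsilon>"
   using convergent_Cauchy[OF assms(3)] unfolding Cauchy_def dist_real_def by blast
  have *: "||s m\<ominus>s n|| < \<epsilon>" if "m\<ge>n" "n\<ge>N" for m n
   using le[of n "m - n"] N[of m n] that by auto
  have "||s m\<ominus>s n|| < \<epsilon>" if "m\<ge>N" "n\<ge>N" for m n
   using *[of n m] *[of m n] that norm_diff_commute[of "s m" "s n"] assms(1) by (cases "m\<le>n") auto
  then show "\<exists>N. \<forall>m\<ge>N. \<forall>n\<ge>N. ||s m\<ominus>s n|| < \<epsilon>" by blast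
 qed (use assms(1) that in auto)
qed

text \<open>\<open>q n\<close> is the power of x\<star>x with exponent 2^n. It is self-adjoint, so
  its norm is exactly the corresponding power, and estimates for all \<open>q n\<close> with a
  moderate factor become an estimate for \<open>x\<close> without it.\<close>

lemma (in pre_cstar) power_trick_aux:
 assumes "x\<in>|A|"
 defines "q\<equiv>rec_nat (x\<star>\<cdot>x) (\<lambda>n y. y\<cdot>y)"
 shows "q n\<in>|A|\<and>(q n)\<star> = q n\<and>||q n|| = ||x|| ^ (2 ^ Suc n)"
proof (induction n)
 case 0
 then show ?case unfolding q_def using assms(1) by (simp add: norm_cstar adj_mult adj_adj)
next
 case (Suc n)
 have "q (Suc n) = (q n)\<star>\<cdot>q n" using Suc by (simp add: q_def)
 then have "||q (Suc n)|| = ||q n||\<^sup>2" using Suc norm_cstar[of "q n"] by simp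
 then show ?case using Suc by (simp add: q_def adj_mult power_mult[symmetric] mult.commute)
qed

text \<open>If a > b > 0, then r = a/b exceeds 1, and Bernoulli's inequality at exponent 2^n,
  squared, makes r^(2^(n+1)) grow at least quadratically in 2^n. This beats the factor, which may
  grow linearly because \<open>norm_swap\<close> and \<open>estimate\<close> both produce such a
  factor.\<close>

lemma power_le_poly:
 fixes a b C D :: real
 assumes "0\<le>a" "0\<le>b" "\<And>n. a ^ (2 ^ n)\<le>(C + D * 2 ^ n) * b ^ (2 ^ n)"
 shows "a\<le>b"
proof (rule ccontr)
 assume "\<not> a\<le>b"
 then have ab: "b < a" by simp
 show False
 proof (cases "b = 0")
  case True
  then show False using assms(3)[of 0] ab by simp
 next
  case False
  define r where "r = a / b"
  have r: "r > 1" using ab False assms by (simp add: r_def)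
  have "r ^ (2 ^ n)\<le>C + D * 2 ^ n" for n
   using assms(3)[of n] False assms(2) by (simp add: r_def power_divide field_simps)
  moreover have "\<exists>n. r ^ (2 ^ n) > C + D * 2 ^ n"
  proof -
   define \<delta> where "\<delta> = r - 1"
   have d: "\<delta> > 0" using r by (simp add: \<delta>_def)
   have "r ^ (2 ^ Suc n)\<ge>(1 + real (2 ^ n) * \<delta>)\<^sup>2" for n
   proof -
    have "1 + real (2 ^ n) * \<delta>\<le>(1 + \<delta>) ^ (2 ^ n)"
     by (rule Bernoulli_inequality) (use d in simp)
    then have "(1 + real (2 ^ n) * \<delta>)\<^sup>2\<le>((1 + \<delta>) ^ (2 ^ n))\<^sup>2"
     using d by (intro power_mono) auto
    also have "\<dots> = r ^ (2 ^ Suc n)"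
     by (simp add: \<delta>_def power_mult[symmetric] mult.commute)
    finally show ?thesis .
   qed
   \<comment> \<open>The factor 2 in front of |D| accounts for evaluating the linear factor at
     2^(n+1) and not at 2^n.\<close>
   moreover obtain n where n: "real (2 ^ n) * \<delta>\<^sup>2 > \<bar>C\<bar> + 2 * \<bar>D\<bar>"
   proof -
    obtain n where "real n > (\<bar>C\<bar> + 2 * \<bar>D\<bar>) / \<delta>\<^sup>2" using reals_Archimedean2 by blast
    moreover have "real (2 ^ n)\<ge>real n"
     using less_exp[of n] by (metis less_imp_le of_nat_le_iff)
    ultimately have "real (2 ^ n) > (\<bar>C\<bar> + 2 * \<bar>D\<bar>) / \<delta>\<^sup>2" by linarith
    then show ?thesis using that[of n] d by (simp add: field_simps)
   qed
   moreover have "(1 + real (2 ^ n) * \<delta>)\<^sup>2 = 1 + 2 * (real (2 ^ n) * \<delta>) + (real (2 ^ n))\<^sup>2 * \<delta>\<^sup>2"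
    by (simp add: power2_eq_square algebra_simps)
   moreover have "real (2 ^ n) * \<delta>\<ge>0" using d by simp
   ultimately have "r ^ (2 ^ Suc n)\<ge>1 + (real (2 ^ n))\<^sup>2 * \<delta>\<^sup>2"
    by (metis add_increasing2 add_mono_thms_linordered_semiring(3) add_right_mono le_add_same_cancel1 mult_nonneg_nonneg order_trans zero_le_numeral)
   moreover have "(real (2 ^ n))\<^sup>2 * \<delta>\<^sup>2 = real (2 ^ n) * (real (2 ^ n) * \<delta>\<^sup>2)" by (simp add: power2_eq_square)
   moreover have "real (2 ^ n) * (real (2 ^ n) * \<delta>\<^sup>2)\<ge>real (2 ^ n) * (\<bar>C\<bar> + 2 * \<bar>D\<bar>)"
    using n by (intro mult_left_mono) auto
   moreover have "real (2 ^ n) * (\<bar>C\<bar> + 2 * \<bar>D\<bar>)\<ge>C + D * 2 ^ Suc n"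
   proof -
    have "real (2 ^ n) * \<bar>C\<bar>\<ge>1 * \<bar>C\<bar>" by (intro mult_right_mono) auto
    moreover have "D * (2 * 2 ^ n)\<le>\<bar>D\<bar> * (2 * 2 ^ n)" by (intro mult_right_mono) auto
    moreover have "real (2 ^ n) * (\<bar>C\<bar> + 2 * \<bar>D\<bar>) = real (2 ^ n) * \<bar>C\<bar> + \<bar>D\<bar> * (2 * 2 ^ n)"
     by (simp add: algebra_simps)
    moreover have "D * 2 ^ Suc n = D * (2 * 2 ^ n)" by simp
    ultimately show ?thesis using abs_ge_self[of C] by linarith
   qed
   ultimately have "r ^ (2 ^ Suc n) > C + D * 2 ^ Suc n" by linarith
   then show ?thesis by blast
  qed
  ultimately show False by (meson not_le)
 qed
qed

section \<open>Homomorphisms, ideals and square roots\<close>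

lemma (in pre_cstar) norm_scale_le:
 assumes "x\<in>|A|" "0 < K" "||x||\<le>K"
 shows "||of_real (inverse K)\<odot>x||\<le>1"
 using assms by (simp add: norm_smult norm_inverse del: of_real_inverse) (simp add: field_simps)

lemma star_hom_in: "star_hom A B \<phi> ==> x\<in>|A| ==> \<phi> x\<in>|B|"
 and star_hom_add: "star_hom A B \<phi> ==> x\<in>|A| ==> y\<in>|A| ==> \<phi> (x\<oplus>\<^sub>A y) = \<phi> x\<oplus>\<^sub>B \<phi> y"
 and star_hom_smult: "star_hom A B \<phi> ==> x\<in>|A| ==> \<phi> (c\<odot>\<^sub>A x) = c\<odot>\<^sub>B \<phi> x"
 and star_hom_mult: "star_hom A B \<phi> ==> x\<in>|A| ==> y\<in>|A| ==> \<phi> (x\<cdot>\<^sub>A y) = \<phi> x\<cdot>\<^sub>B \<phi> y"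
 and star_hom_adj: "star_hom A B \<phi> ==> x\<in>|A| ==> \<phi> (x\<star>\<^sub>A) = (\<phi> x)\<star>\<^sub>B"
 unfolding star_hom_def by auto

lemma star_hom_diff:
 assumes "star_algebra A" "star_algebra B" "star_hom A B \<phi>" "x\<in>|A|" "y\<in>|A|"
 shows "\<phi> (x\<ominus>\<^sub>A y) = \<phi> x\<ominus>\<^sub>B \<phi> y"
proof -
 interpret A: star_algebra A by fact
 interpret B: star_algebra B by fact
 note h = assms(3)
 show ?thesis using assms(4,5)
  by (simp add: A.diff_eq B.diff_eq star_hom_in[OF h] star_hom_add[OF h] star_hom_smult[OF h])
qed

lemma star_hom_zero:
 assumes "star_algebra A" "star_algebra B" "star_hom A B \<phi>"
 shows "\<phi> \<zero>\<^sub>A = \<zero>\<^sub>B"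
proof -
 interpret A: star_algebra A by fact
 interpret B: star_algebra B by fact
 show ?thesis
  using star_hom_smult[OF assms(3), of "\<zero>\<^sub>A" 0] star_hom_in[OF assms(3), of "\<zero>\<^sub>A"] by simp
qed

lemmas star_hom_simps = star_hom_in star_hom_add star_hom_smult star_hom_mult star_hom_adj

lemma star_hom_comp: "star_hom A B \<phi> ==> star_hom B C \<psi> ==> star_hom A C (\<psi> \<circ> \<phi>)"
 unfolding star_hom_def by (auto simp: Pi_def)

context star_algebra
begin

lemma submodule_in: "submodule H complex_ring A ==> x\<in>H ==> x\<in>|A|"
 and submodule_add: "submodule H complex_ring A ==> x\<in>H ==> y\<in>H ==> x\<oplus>y\<in>H"
 and submodule_smult: "submodule H complex_ring A ==> x\<in>H ==> c\<odot>x\<in>H"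
 using submoduleE[of H] by auto

lemma submodule_zero: "submodule H complex_ring A ==> \<zero>\<in>H"
 using submoduleE(2)[of H] submodule_smult[of H _ 0] submodule_in[of H] by fastforce

lemma submodule_diff: "submodule H complex_ring A ==> x\<in>H ==> y\<in>H ==> x\<ominus>y\<in>H"
 using submodule_add[of H x "(-1)\<odot>y"] submodule_smult[of H y "-1"] submodule_in[of H x] submodule_in[of H y]
 by (simp add: diff_eq)

lemma submoduleI':
 assumes "H\<subseteq>|A|" "\<zero>\<in>H" "\<And>x y. x\<in>H ==> y\<in>H ==> x\<oplus>y\<in>H" "\<And>c x. x\<in>H ==> c\<odot>x\<in>H"
 shows "submodule H complex_ring A"
proof (rule submoduleI)
 show "\<ominus>a\<in>H" if "a\<in>H" for a
  using assms(4)[OF that, of "-1"] that assms(1) by (auto simp: uminus_eq)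
qed (use assms in auto)

definition sa :: "'a=>bool" where "sa x\<longleftrightarrow>x\<in>|A|\<and>x\<star> = x"

lemma sa_in: "sa x ==> x\<in>|A|"
 and sa_adj: "sa x ==> x\<star> = x"
 by (auto simp: sa_def)

lemma sa_add: "sa x ==> sa y ==> sa (x\<oplus>y)"
 and sa_diff: "sa x ==> sa y ==> sa (x\<ominus>y)"
 and sa_smult: "sa x ==> sa (of_real r\<odot>x)"
 and sa_square: "sa x ==> sa (x\<cdot>x)"
 and sa_mult: "sa x ==> sa y ==> x\<cdot>y = y\<cdot>x ==> sa (x\<cdot>y)"
 and sa_cstar: "z\<in>|A| ==> sa (z\<star>\<cdot>z)"
 by (auto simp: sa_def expand)

declare sa_in [simp] sa_adj [simp]

end

lemma (in cstar_algebra) closed_idealD: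
 assumes "closed_ideal A I"
 shows "submodule I complex_ring A" "\<And>x y. x\<in>I ==> y\<in>|A| ==> x\<cdot>y\<in>I"
  "\<And>x y. x\<in>I ==> y\<in>|A| ==> y\<cdot>x\<in>I" "\<And>s x. (\<And>n. s n\<in>I) ==> tends A s x ==> x\<in>I"
 using assms unfolding closed_ideal_def closedin_iff by blast+

section \<open>Square roots by iteration, without a unit\<close>

primrec sqrt_iter :: "('a, 'm) cstar_struct_scheme=>'a=>nat=>'a" where
 "sqrt_iter A t 0 = \<zero>\<^sub>A"
| "sqrt_iter A t (Suc n) = (1/2)\<odot>\<^sub>A (t\<oplus>\<^sub>A sqrt_iter A t n\<cdot>\<^sub>A sqrt_iter A t n)"

text \<open>The limit \<open>y\<close> of the iteration satisfies \<open>(1 - y)\<^sup>2 = 1 - t\<close>. It is formed inside \<open>A\<close>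
 even when \<open>A\<close> has no unit, and exists as soon as \<open>||t||\<le>1\<close>, by comparison with the scalar
 iteration for \<open>t = 1\<close>.\<close>

definition sqrt_defect :: "('a, 'm) cstar_struct_scheme=>'a=>'a" where
 "sqrt_defect A t = (THE y. tends A (sqrt_iter A t) y)"

primrec scalar_iter :: "nat=>real" where
 "scalar_iter 0 = 0"
| "scalar_iter (Suc n) = (1 + (scalar_iter n)\<^sup>2) / 2"

lemma scalar_iter_bounds: "0\<le>scalar_iter n\<and>scalar_iter n\<le>1"
proof (induction n)
 case (Suc n)
 then have "(scalar_iter n)\<^sup>2\<le>1" by (simp add: power_le_one)
 then show ?case by simp
qed simp

lemma scalar_iter_mono: "scalar_iter n\<le>scalar_iter (Suc n)"
proof -
 have "0\<le>(1 - scalar_iter n)\<^sup>2" by simp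
 then show ?thesis by (simp add: power2_diff)
qed

lemma convergent_scalar_iter: "convergent scalar_iter"
proof (rule Bseq_mono_convergent)
 show "Bseq scalar_iter"
  by (rule BseqI'[of _ 1]) (use scalar_iter_bounds in auto)
 show "\<forall>m n. m\<le>n\<longrightarrow>scalar_iter m\<le>scalar_iter n"
  using lift_Suc_mono_le[of scalar_iter] scalar_iter_mono by blast
qed

context cstar_algebra
begin

lemma sqrt_iter_in [simp]: "t\<in>|A| ==> sqrt_iter A t n\<in>|A|"
 by (induction n) auto

lemma sqrt_iter_norm:
 assumes "t\<in>|A|" "||t||\<le>1" shows "||sqrt_iter A t n||\<le>scalar_iter n"
proof (induction n)
 case (Suc n)
 let ?y = "sqrt_iter A t n"
 have [simp]: "?y\<in>|A|" using assms by simp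
 have "||?y\<cdot>?y||\<le>(scalar_iter n)\<^sup>2"
  using norm_mult[of ?y ?y] mult_mono[OF Suc Suc] scalar_iter_bounds[of n]
  by (simp add: power2_eq_square)
 then have "||t\<oplus>?y\<cdot>?y||\<le>1 + (scalar_iter n)\<^sup>2"
  using norm_triangle[of t "?y\<cdot>?y"] assms by simp
 then show ?case using assms by (simp add: norm_smult)
qed simp

text \<open>y^2 - x^2 = (y - x)y + x(y - x) holds without commutativity, and the same identity for
  the scalar iteration turns the resulting bound into its own next increment. So the scalar sequence
  majorizes the increments and not only the norms.\<close>

lemma sqrt_iter_step:
 assumes "t\<in>|A|" "||t||\<le>1"
 shows "||sqrt_iter A t (Suc n)\<ominus>sqrt_iter A t n||\<le>scalar_iter (Suc n) - scalar_iter n"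
proof (induction n)
 case 0
 have "(1/2)\<odot>t\<oplus>(1/2)\<odot>\<zero>\<ominus>\<zero> = (1/2)\<odot>t" supply assms(1) [simp] by ((simp add: expand)?; (rule linI, (rule lins | (simp add: algebra_simps; fail))+))
 then show ?case using assms by (simp add: norm_smult smult_add_right)
next
 case (Suc n)
 let ?y = "sqrt_iter A t (Suc n)" and ?x = "sqrt_iter A t n"
 have in': "?y\<in>|A|" "?x\<in>|A|" using assms by (simp_all del: sqrt_iter.simps)
 note [simp] = in' assms(1)
 have "sqrt_iter A t (Suc (Suc n))\<ominus>?y = (1/2)\<odot>(t\<oplus>?y\<cdot>?y)\<ominus>(1/2)\<odot>(t\<oplus>?x\<cdot>?x)"
  by simp
 also have "\<dots> = (1/2)\<odot>((?y\<ominus>?x)\<cdot>?y\<oplus>?x\<cdot>(?y\<ominus>?x))"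
  supply sqrt_iter.simps [simp del] by ((simp add: expand)?; (rule linI, (rule lins | (simp add: algebra_simps; fail))+))
 finally have eq: "sqrt_iter A t (Suc (Suc n))\<ominus>?y = (1/2)\<odot>((?y\<ominus>?x)\<cdot>?y\<oplus>?x\<cdot>(?y\<ominus>?x))" .
 let ?d = "scalar_iter (Suc n) - scalar_iter n"
 have "||(?y\<ominus>?x)\<cdot>?y||\<le>?d * scalar_iter (Suc n)"
  using norm_mult[of "?y\<ominus>?x" ?y] mult_mono[OF Suc sqrt_iter_norm[OF assms, of "Suc n"]]
   in' scalar_iter_mono[of n] by (simp del: sqrt_iter.simps scalar_iter.simps)
 moreover have "||?x\<cdot>(?y\<ominus>?x)||\<le>scalar_iter n * ?d"
  using norm_mult[of ?x "?y\<ominus>?x"] mult_mono[OF sqrt_iter_norm[OF assms, of n] Suc]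
   in' scalar_iter_bounds[of n] by (simp del: sqrt_iter.simps scalar_iter.simps)
 ultimately have "||(?y\<ominus>?x)\<cdot>?y\<oplus>?x\<cdot>(?y\<ominus>?x)||\<le>?d * scalar_iter (Suc n) + scalar_iter n * ?d"
  using norm_triangle[of "(?y\<ominus>?x)\<cdot>?y" "?x\<cdot>(?y\<ominus>?x)"] in' by (simp del: sqrt_iter.simps scalar_iter.simps)
 moreover have "?d * scalar_iter (Suc n) + scalar_iter n * ?d = 2 * (scalar_iter (Suc (Suc n)) - scalar_iter (Suc n))"
  unfolding scalar_iter.simps(2)[of "Suc n"] by (subst (3) scalar_iter.simps) (simp add: power2_eq_square algebra_simps del: scalar_iter.simps)
 ultimately show ?case
  unfolding eq using in' by (simp add: norm_smult del: sqrt_iter.simps scalar_iter.simps)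
qed

lemma sqrt_defect_tends:
 assumes "t\<in>|A|" "||t||\<le>1" shows "tends A (sqrt_iter A t) (sqrt_defect A t)"
proof -
 obtain y where y: "tends A (sqrt_iter A t) y"
  by (rule summable_tends[of "sqrt_iter A t" scalar_iter])
   (use assms sqrt_iter_step convergent_scalar_iter in \<open>simp_all del: sqrt_iter.simps scalar_iter.simps\<close>)
 then show ?thesis
  unfolding sqrt_defect_def by (rule theI2) (use y tends_unique in blast)+
qed

context
 fixes t assumes t: "t\<in>|A|" "||t||\<le>1"
begin

lemma sqrt_defect_in: "sqrt_defect A t\<in>|A|"
 using tends_in(2)[OF sqrt_defect_tends[OF t]] .

lemma sqrt_defect_norm: "||sqrt_defect A t||\<le>1"
 by (rule tends_norm_le[OF sqrt_defect_tends[OF t]])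
  (use sqrt_iter_norm[OF t] scalar_iter_bounds order_trans in blast)

lemma sqrt_defect_eq: "sqrt_defect A t\<cdot>sqrt_defect A t = 2\<odot>sqrt_defect A t\<ominus>t"
proof -
 let ?y = "sqrt_defect A t"
 note [simp] = sqrt_defect_in t(1)
 have "tends A (\<lambda>n. sqrt_iter A t (Suc n)) ((1/2)\<odot>(t\<oplus>?y\<cdot>?y))"
  using sqrt_defect_tends[OF t] by (auto intro!: tends_intros t)
 from tends_unique[OF this tends_Suc[OF sqrt_defect_tends[OF t]]]
 have e: "(1/2)\<odot>(t\<oplus>?y\<cdot>?y) = ?y" .
 have "?y\<cdot>?y = 2\<odot>((1/2)\<odot>(t\<oplus>?y\<cdot>?y))\<ominus>t" by ((simp add: expand)?; (rule linI, (rule lins | (simp add: algebra_simps; fail))+))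
 then show ?thesis unfolding e .
qed

lemma sqrt_defect_sa: assumes "sa t" shows "sa (sqrt_defect A t)"
proof -
 have "(sqrt_iter A t n)\<star> = sqrt_iter A t n" for n
  by (induction n) (use assms t in \<open>auto simp: expand\<close>)
 then have "tends A (sqrt_iter A t) ((sqrt_defect A t)\<star>)"
  using tends_adj[OF sqrt_defect_tends[OF t]] by simp
 from tends_unique[OF this sqrt_defect_tends[OF t]] show ?thesis
  using sqrt_defect_in by (simp only: sa_def simp_thms)
qed

lemma sqrt_defect_commute:
 assumes z: "z\<in>|A|" "z\<cdot>t = t\<cdot>z" shows "z\<cdot>sqrt_defect A t = sqrt_defect A t\<cdot>z"
proof -
 have "z\<cdot>sqrt_iter A t n = sqrt_iter A t n\<cdot>z" for n
 proof (induction n)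
  case (Suc n)
  let ?y = "sqrt_iter A t n"
  have "z\<cdot>(?y\<cdot>?y) = (?y\<cdot>?y)\<cdot>z"
   using Suc z t by (metis mult_assoc sqrt_iter_in)
  then show ?case using z t by (simp add: expand)
 qed (use z in simp)
 then have "tends A (\<lambda>n. z\<cdot>sqrt_iter A t n) (sqrt_defect A t\<cdot>z)"
  using tends_mult[OF sqrt_defect_tends[OF t] tends_const[OF z(1)]] by simp
 from tends_unique[OF tends_mult[OF tends_const[OF z(1)] sqrt_defect_tends[OF t]] this] show ?thesis .
qed

text \<open>The iteration only adds, scales and squares, so every iterate respects congruence modulo
  \<open>I\<close>, and \<open>I\<close> is closed. This stands in for functional calculus in the
  quotient by \<open>I\<close>.\<close>

lemma sqrt_defect_cong:
 assumes I: "closed_ideal A I" and t': "t'\<in>|A|" "||t'||\<le>1" and "t\<ominus>t'\<in>I"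
 shows "sqrt_defect A t\<ominus>sqrt_defect A t'\<in>I"
proof (rule closed_idealD(4)[OF I _ tends_diff[OF sqrt_defect_tends[OF t] sqrt_defect_tends[OF t']]])
 note I' = closed_idealD[OF I]
 show "sqrt_iter A t n\<ominus>sqrt_iter A t' n\<in>I" for n
 proof (induction n)
  case 0
  show ?case using submodule_zero[OF I'(1)] by simp
 next
  case (Suc n)
  let ?y = "sqrt_iter A t n" and ?x = "sqrt_iter A t' n"
  note [simp] = t(1) t'(1)
  have "sqrt_iter A t (Suc n)\<ominus>sqrt_iter A t' (Suc n)
    = (1/2)\<odot>((t\<ominus>t')\<oplus>((?y\<ominus>?x)\<cdot>?y\<oplus>?x\<cdot>(?y\<ominus>?x)))"
   by ((simp add: expand)?; (rule linI, (rule lins | (simp add: algebra_simps; fail))+))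
  also have "\<dots>\<in>I"
   using Suc assms(4) by (intro submodule_smult[OF I'(1)] submodule_add[OF I'(1)] I'(2,3)) auto
  finally show ?case .
 qed
qed

end

end

lemma sqrt_defect_hom:
 assumes A: "cstar_algebra A" and B: "cstar_algebra B" and h: "star_hom A B \<phi>"
  and le: "\<And>x. x\<in>|A| ==> ||\<phi> x||\<^sub>B\<le>||x||\<^sub>A"
  and t: "t\<in>|A|" "||t||\<^sub>A\<le>1"
 shows "\<phi> (sqrt_defect A t) = sqrt_defect B (\<phi> t)"
proof -
 interpret A: cstar_algebra A by fact
 interpret B: cstar_algebra B by fact
 have "\<phi> (sqrt_iter A t n) = sqrt_iter B (\<phi> t) n" for n
 proof (induction n)
  case 0
  show ?case using star_hom_zero[OF A.star_algebra_axioms B.star_algebra_axioms h] by simp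
 next
  case (Suc n)
  then show ?case using t by (simp add: star_hom_simps[OF h])
 qed
 then have eq: "(\<lambda>n. \<phi> (sqrt_iter A t n)) = sqrt_iter B (\<phi> t)" by auto
 have "tends B (\<lambda>n. \<phi> (sqrt_iter A t n)) (\<phi> (sqrt_defect A t))"
 proof (rule B.tendsI)
  note T = A.sqrt_defect_tends[OF t]
  note [simp] = A.tends_in[OF T]
  show "||\<phi> (sqrt_iter A t n)\<ominus>\<^sub>B \<phi> (sqrt_defect A t)||\<^sub>B\<le>||sqrt_iter A t n\<ominus>\<^sub>A sqrt_defect A t||\<^sub>A" for n
   by (subst star_hom_diff[OF A.star_algebra_axioms B.star_algebra_axioms h, symmetric]) (auto intro!: le)
  show "(\<lambda>n. ||sqrt_iter A t n\<ominus>\<^sub>A sqrt_defect A t||\<^sub>A)\<longlonglongrightarrow>0"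
   using T unfolding tends_def by blast
 qed (use A.tends_in[OF A.sqrt_defect_tends[OF t]] star_hom_in[OF h] in auto)
 moreover have "tends B (sqrt_iter B (\<phi> t)) (sqrt_defect B (\<phi> t))"
  using B.sqrt_defect_tends star_hom_in[OF h t(1)] le[OF t(1)] t(2) by simp
 ultimately show ?thesis unfolding eq by (rule B.tends_unique)
qed

section \<open>Positivity in unital C*-algebras\<close>

locale unital_cstar = cstar_algebra A for A :: "('a, 'm) cstar_struct_scheme" (structure) +
 assumes unit_in [simp]: "\<one>\<in>|A|"
  and unit_left [simp]: "x\<in>|A| ==> \<one>\<cdot>x = x"
  and unit_right [simp]: "x\<in>|A| ==> x\<cdot>\<one> = x"
begin

lemma unit_adj [simp]: "\<one>\<star> = \<one>"
proof -
 show ?thesis using adj_mult[of "\<one>\<star>" \<one>] by (simp add: adj_adj)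
qed

lemma sa_one [simp]: "sa \<one>" by (simp only: sa_def unit_in unit_adj)

text \<open>The norm of the unit is 0 in the zero algebra and 1 otherwise.\<close>

lemma norm_one_le: "||\<one>||\<le>1"
 using norm_cstar[of \<one>] by (simp add: power2_eq_square) (elim disjE; simp)

lemma norm_mult_le_one: "x\<in>|A| ==> y\<in>|A| ==> ||x||\<le>1 ==> ||y||\<le>1 ==> ||x\<cdot>y||\<le>1"
 using norm_mult[of x y] mult_le_one[of "||x||" "||y||"] by simp

text \<open>\<open>b + ic\<close> is unitary and \<open>b\<close> is its real part.\<close>

lemma unitary_bound:
 assumes "sa b" "sa c" "b\<cdot>c = c\<cdot>b" "b\<cdot>b\<oplus>c\<cdot>c = \<one>"
 shows "||b||\<le>1"
proof -
 note [simp] = assms(1,2)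
 define u where "u = b\<oplus>\<i>\<odot>c"
 have [simp]: "u\<in>|A|" by (simp add: u_def)
 have "u\<star>\<cdot>u = b\<cdot>b\<oplus>c\<cdot>c"
  unfolding u_def supply assms(3) [simp] by ((simp add: expand)?; (rule linI, (rule lins | (simp add: algebra_simps; fail))+))
 then have "||u||\<^sup>2\<le>1" using norm_cstar[of u] norm_one_le assms(4) by simp
 then have u: "||u||\<le>1" by (simp add: power_le_one_iff)
 have "b = (1/2)\<odot>(u\<oplus>u\<star>)" unfolding u_def by ((simp add: expand)?; (rule linI, (rule lins | (simp add: algebra_simps; fail))+))
 then have "||b|| = ||(1/2)\<odot>(u\<oplus>u\<star>)||" by (rule arg_cong)
 also have "\<dots>\<le>1/2 * ( ||u|| + ||u\<star>||)"
  using norm_triangle[of u "u\<star>"] by (simp add: norm_smult)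
 finally show ?thesis using u by simp
qed

text \<open>Squares of self-adjoint elements, a notion of positivity that does not mention the
  spectrum. That every z\<star>z is of this form is the theorem \<open>cstar_pos\<close>.\<close>

definition pos :: "'a=>bool" where "pos x\<longleftrightarrow>(\<exists>b. sa b\<and>x = b\<cdot>b)"

lemma pos_sa: "pos x ==> sa x"
 unfolding pos_def using sa_square by blast

lemma pos_square: "sa b ==> pos (b\<cdot>b)"
 unfolding pos_def by blast

text \<open>One minus the defect of 1 - x is a square root of x. Together with
  \<open>pos_near_one\<close> this makes positivity, for self-adjoint elements of the unit ball,
  equivalent to lying within distance 1 of the unit. The commutation clause is kept because later
  arguments combine several roots.\<close>

lemma sqrt_near_one:
 assumes "sa x" "||\<one>\<ominus>x||\<le>1"
 obtains b where "sa b" "b\<cdot>b = x" "\<And>z. z\<in>|A| ==> z\<cdot>x = x\<cdot>z ==> z\<cdot>b = b\<cdot>z"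
proof
 note [simp] = sa_in[OF assms(1)]
 let ?t = "\<one>\<ominus>x" let ?s = "sqrt_defect A ?t"
 have t: "?t\<in>|A|" "||?t||\<le>1" "sa ?t" using assms by (auto intro: sa_diff)
 note [simp] = sqrt_defect_in[OF t(1,2)]
 show "sa (\<one>\<ominus>?s)" using sqrt_defect_sa[OF t] by (auto intro: sa_diff)
 have "(\<one>\<ominus>?s)\<cdot>(\<one>\<ominus>?s) = \<one>\<ominus>?s\<ominus>?s\<oplus>?s\<cdot>?s" by ((simp add: expand)?; (rule linI, (rule lins | (simp add: algebra_simps; fail))+))
 also have "\<dots> = x" unfolding sqrt_defect_eq[OF t(1,2)] by ((simp add: expand)?; (rule linI, (rule lins | (simp add: algebra_simps; fail))+))
 finally show "(\<one>\<ominus>?s)\<cdot>(\<one>\<ominus>?s) = x" .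
 show "z\<cdot>(\<one>\<ominus>?s) = (\<one>\<ominus>?s)\<cdot>z" if z: "z\<in>|A|" "z\<cdot>x = x\<cdot>z" for z
  using sqrt_defect_commute[OF t(1,2) z(1)] z by (simp add: expand)
qed

text \<open>For x = b^2 in the unit ball, 1 - x is within distance 1 of the unit and so has a root
  c, which commutes with b. Since b^2 + c^2 = 1, c is the real part of a unitary; hence its norm,
  and that of c^2 = 1 - x, is at most 1.\<close>

lemma pos_near_one:
 assumes "pos x" "||x||\<le>1" shows "||\<one>\<ominus>x||\<le>1"
proof -
 obtain b where b: "sa b" "x = b\<cdot>b" using assms pos_def by blast
 have [simp]: "sa x" "x\<in>|A|" "b\<in>|A|" using b sa_square by auto
 have eq: "\<one>\<ominus>(\<one>\<ominus>x) = x" by ((simp add: expand)?; (rule linI, (rule lins | (simp add: algebra_simps; fail))+))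
 obtain c where c: "sa c" "c\<cdot>c = \<one>\<ominus>x" and cc: "\<And>z. z\<in>|A| ==> z\<cdot>(\<one>\<ominus>x) = (\<one>\<ominus>x)\<cdot>z ==> z\<cdot>c = c\<cdot>z"
  using sqrt_near_one[of "\<one>\<ominus>x"] assms(2) unfolding eq by (metis sa_diff sa_one \<open>sa x\<close>)
 have "b\<cdot>c = c\<cdot>b" by (rule cc) (use b in \<open>auto simp: expand\<close>)
 moreover have "c\<cdot>c\<oplus>b\<cdot>b = \<one>" unfolding c(2) b(2)[symmetric] by ((simp add: expand)?; (rule linI, (rule lins | (simp add: algebra_simps; fail))+))
 ultimately have "||c||\<le>1" using unitary_bound[of c b] b c by simp
 then show ?thesis using norm_mult_le_one[of c c] c by simp
qed

lemma pos_smult: assumes "pos x" "0\<le>r" shows "pos (of_real r\<odot>x)"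
proof -
 obtain b where b: "sa b" "x = b\<cdot>b" using assms pos_def by blast
 have "of_real r\<odot>x = (of_real (sqrt r)\<odot>b)\<cdot>(of_real (sqrt r)\<odot>b)"
  using b assms(2) by (simp add: smult_mult_left smult_mult_right flip: of_real_mult)
 then show ?thesis using b sa_smult pos_def by blast
qed

lemma pos_smult_cancel: assumes "x\<in>|A|" "pos (of_real r\<odot>x)" "0 < r" shows "pos x"
 using pos_smult[OF assms(2), of "inverse r"] assms by (simp flip: of_real_mult)

lemma pos_sqrt:
 assumes "pos x"
 obtains b where "sa b" "b\<cdot>b = x" "\<And>z. z\<in>|A| ==> z\<cdot>x = x\<cdot>z ==> z\<cdot>b = b\<cdot>z"
proof -
 note [simp] = sa_in[OF pos_sa[OF assms]]
 define K where "K = ||x|| + 1"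
 have K: "K > 0" by (simp add: K_def add_nonneg_pos)
 define x' where "x' = of_real (inverse K)\<odot>x"
 have [simp]: "x'\<in>|A|" by (simp add: x'_def)
 have x': "pos x'" using pos_smult[OF assms, of "inverse K"] K by (simp add: x'_def)
 have "||x'||\<le>1" unfolding x'_def by (rule norm_scale_le) (use K in \<open>auto simp: K_def\<close>)
 then obtain b where b: "sa b" "b\<cdot>b = x'" and bc: "\<And>z. z\<in>|A| ==> z\<cdot>x' = x'\<cdot>z ==> z\<cdot>b = b\<cdot>z"
  using sqrt_near_one[OF pos_sa[OF x'] pos_near_one[OF x']] by blast
 show ?thesis
 proof
  show "sa (of_real (sqrt K)\<odot>b)" using b by (simp add: sa_smult)
  show "(of_real (sqrt K)\<odot>b)\<cdot>(of_real (sqrt K)\<odot>b) = x"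
   using b(1) K by (simp add: smult_mult_left smult_mult_right b(2) flip: of_real_mult)
    (simp add: x'_def flip: of_real_mult)
  show "z\<cdot>(of_real (sqrt K)\<odot>b) = (of_real (sqrt K)\<odot>b)\<cdot>z" if "z\<in>|A|" "z\<cdot>x = x\<cdot>z" for z
   using bc[of z] that b(1) by (simp add: smult_mult_left smult_mult_right x'_def)
 qed
qed

text \<open>After a common rescaling, positivity is the condition of distance at most 1 from the
  unit, which is convex. The summand 1 in \<open>K\<close> only keeps the scale nonzero.\<close>

lemma pos_add: assumes "pos x" "pos y" shows "pos (x\<oplus>y)"
proof -
 note [simp] = sa_in[OF pos_sa[OF assms(1)]] sa_in[OF pos_sa[OF assms(2)]]
 define K where "K = ||x|| + ||y|| + 1"
 have K: "K > 0" by (simp add: K_def add_nonneg_pos)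
 define x' where "x' = of_real (inverse K)\<odot>x"
 define y' where "y' = of_real (inverse K)\<odot>y"
 have [simp]: "x'\<in>|A|" "y'\<in>|A|" by (simp_all add: x'_def y'_def)
 have p: "pos x'" "pos y'" using pos_smult[OF assms(1), of "inverse K"] pos_smult[OF assms(2), of "inverse K"] K
  by (simp_all add: x'_def y'_def)
 have "||x'||\<le>1" "||y'||\<le>1"
  unfolding x'_def y'_def by (rule norm_scale_le; use K in \<open>simp add: K_def\<close>)+
 then have n: "||\<one>\<ominus>x'||\<le>1" "||\<one>\<ominus>y'||\<le>1" using pos_near_one p by auto
 let ?z = "of_real (1/2)\<odot>(x'\<oplus>y')"
 have "\<one>\<ominus>?z = of_real (1/2)\<odot>((\<one>\<ominus>x')\<oplus>(\<one>\<ominus>y'))" by ((simp add: expand)?; (rule linI, (rule lins | (simp add: algebra_simps; fail))+))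
 then have "||\<one>\<ominus>?z||\<le>1/2 * ( ||\<one>\<ominus>x'|| + ||\<one>\<ominus>y'||)"
  using norm_triangle[of "\<one>\<ominus>x'" "\<one>\<ominus>y'"] by (simp add: norm_smult)
 then have "||\<one>\<ominus>?z||\<le>1" using n by simp
 moreover have "sa ?z" using p pos_sa by (intro sa_smult sa_add) auto
 ultimately have "pos ?z" using sqrt_near_one pos_def by metis
 then have "pos (of_real (2 * K)\<odot>?z)" by (rule pos_smult) (use K in simp)
 moreover have "of_real (2 * K)\<odot>?z = x\<oplus>y"
  using K by (simp add: x'_def y'_def smult_add_right)
 ultimately show ?thesis by simp
qed

text \<open>The roots b of x and c of -x commute, so u = b + ic satisfies u\<star>u = b^2 + c^2 = 0,
  and b is the real part of u.\<close>

lemma pos_antisym: assumes "pos x" "pos (\<ominus>x)" shows "x = \<zero>"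
proof -
 note [simp] = sa_in[OF pos_sa[OF assms(1)]]
 obtain b where b: "sa b" "b\<cdot>b = x" and bc: "\<And>z. z\<in>|A| ==> z\<cdot>x = x\<cdot>z ==> z\<cdot>b = b\<cdot>z"
  using pos_sqrt[OF assms(1)] by blast
 obtain c where c: "sa c" "c\<cdot>c =\<ominus>x" and cc: "\<And>z. z\<in>|A| ==> z\<cdot>\<ominus>x =\<ominus>x\<cdot>z ==> z\<cdot>c = c\<cdot>z"
  using pos_sqrt[OF assms(2)] by blast
 note [simp] = b(1) c(1)
 have "b\<cdot>x = x\<cdot>b" using b(2)[symmetric] by (simp add: mult_assoc)
 then have comm: "b\<cdot>c = c\<cdot>b" by (intro cc) (simp_all add: uminus_eq smult_mult_left smult_mult_right)
 define u where "u = b\<oplus>\<i>\<odot>c"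
 have [simp]: "u\<in>|A|" by (simp add: u_def)
 have "u\<star>\<cdot>u = b\<cdot>b\<oplus>c\<cdot>c" unfolding u_def supply comm [simp] by ((simp add: expand)?; (rule linI, (rule lins | (simp add: algebra_simps; fail))+))
 also have "\<dots> = \<zero>" unfolding b(2) c(2) by (simp add: M.r_neg)
 finally have u0: "u = \<zero>" using adj_eq_mult_zero[of u] by simp
 have "b = (1/2)\<odot>(u\<oplus>u\<star>)" unfolding u_def by ((simp add: expand)?; (rule linI, (rule lins | (simp add: algebra_simps; fail))+))
 then show ?thesis using b(2) by (simp add: u0)
qed

end

section \<open>Positivity of z\<star>z, and negative parts\<close>

context unital_cstar
begin

primrec pw :: "'a=>nat=>'a" where
 "pw x 0 = \<one>"
| "pw x (Suc n) = pw x n\<cdot>x"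

primrec pw_sum :: "'a=>nat=>'a" where
 "pw_sum x 0 = \<zero>"
| "pw_sum x (Suc n) = pw_sum x n\<oplus>pw x n"

lemma pw_in [simp]: "x\<in>|A| ==> pw x n\<in>|A|"
 by (induction n) auto

lemma pw_sum_in [simp]: "x\<in>|A| ==> pw_sum x n\<in>|A|"
 by (induction n) auto

lemma pw_add: "x\<in>|A| ==> pw x (m + n) = pw x m\<cdot>pw x n"
 by (induction n) (auto simp: mult_assoc)

lemma pw_norm: assumes "x\<in>|A|" "||x||\<le>1" shows "||pw x n||\<le>1"
 by (induction n) (use assms norm_one_le norm_mult_le_one in auto)

lemma pw_sum_norm: assumes "x\<in>|A|" "||x||\<le>1" shows "||pw_sum x n||\<le>real n"
proof (induction n)
 case (Suc n)
 then show ?case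
  using norm_triangle[of "pw_sum x n" "pw x n"] pw_norm[OF assms, of n] assms by simp
qed simp

lemma pw_sa: assumes "sa x" shows "sa (pw x n)" "pw x n\<cdot>x = x\<cdot>pw x n"
proof -
 have *: "pw x n\<cdot>x = x\<cdot>pw x n" for n
  by (induction n) (use assms in \<open>auto simp: mult_assoc\<close>)
 show "pw x n\<cdot>x = x\<cdot>pw x n" by (rule *)
 show "sa (pw x n)"
  by (induction n) (use assms * in \<open>auto intro: sa_mult\<close>)
qed

lemma pw_norm_eq: assumes "sa x" shows "||pw x (2 ^ n)|| = ||x|| ^ (2 ^ n)"
proof (induction n)
 case 0 then show ?case using assms by simp
next
 case (Suc n)
 have "pw x (2 ^ Suc n) = (pw x (2 ^ n))\<star>\<cdot>pw x (2 ^ n)"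
  using pw_add[of x "2 ^ n" "2 ^ n"] pw_sa(1)[OF assms] assms by (simp add: mult_2)
 then have "||pw x (2 ^ Suc n)|| = ||pw x (2 ^ n)||\<^sup>2"
  using norm_cstar[of "pw x (2 ^ n)"] assms by simp
 then show ?case using Suc by (simp add: power_mult[symmetric] mult.commute)
qed

text \<open>The spectra of \<open>z\<^sup>*z\<close> and \<open>zz\<^sup>*\<close> agree up to zero; here only the consequence for one-sided
 norm bounds is needed, and it follows from \<open>(1 + zz\<^sup>*)\<^sup>n = 1 + z (\<Sum>i<n. (1 + z\<^sup>*z)\<^sup>i) z\<^sup>*\<close>.\<close>

lemma norm_swap:
 assumes "z\<in>|A|" "||z||\<le>1" "||\<one>\<oplus>z\<star>\<cdot>z||\<le>1"
 shows "||\<one>\<oplus>z\<cdot>z\<star>||\<le>1"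
proof -
 note [simp] = assms(1)
 define q where "q = \<one>\<oplus>z\<star>\<cdot>z"
 define v where "v = \<one>\<oplus>z\<cdot>z\<star>"
 have [simp]: "q\<in>|A|" "v\<in>|A|" by (simp_all add: q_def v_def)
 have vz: "v\<cdot>z = z\<cdot>q" by (simp add: q_def v_def expand)
 have pz: "pw v n\<cdot>z = z\<cdot>pw q n" for n
 proof (induction n)
  case (Suc n)
  have "pw v n\<cdot>v\<cdot>z = (pw v n\<cdot>z)\<cdot>q" using vz by (simp add: mult_assoc)
  then show ?case using Suc by (simp add: mult_assoc)
 qed simp
 have eq: "pw v n = \<one>\<oplus>z\<cdot>(pw_sum q n\<cdot>z\<star>)" for n
 proof (induction n)
  case (Suc n)
  have "pw v (Suc n) = pw v n\<oplus>(pw v n\<cdot>z)\<cdot>z\<star>"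
   by (simp add: v_def[THEN arg_cong[where f="\<lambda>x. pw v n\<cdot>x"]] expand)
  also have "\<dots> = \<one>\<oplus>z\<cdot>(pw_sum q n\<cdot>z\<star>)\<oplus>z\<cdot>(pw q n\<cdot>z\<star>)"
   unfolding pz by (subst Suc) (simp add: mult_assoc)
  also have "\<dots> = \<one>\<oplus>z\<cdot>(pw_sum q (Suc n)\<cdot>z\<star>)" by ((simp add: expand)?; (rule linI, (rule lins | (simp add: algebra_simps; fail))+))
  finally show ?case .
 qed simp
 \<comment> \<open>Since q has norm at most 1, its first n powers sum to norm at most n. The growth
   of the powers of v is therefore linear in the exponent, and \<open>power_le_poly\<close> removes
   it because v is self-adjoint.\<close>
 have vn: "||pw v n||\<le>1 + real n" for n
 proof -
  have "||z\<cdot>(pw_sum q n\<cdot>z\<star>)||\<le>||z|| * ( ||pw_sum q n|| * ||z||)"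
   using order_trans[OF norm_mult[of z "pw_sum q n\<cdot>z\<star>"] mult_left_mono[OF norm_mult[of "pw_sum q n" "z\<star>"]]]
   by simp
  also have "\<dots>\<le>1 * (real n * 1)"
   using pw_sum_norm[of q n] assms by (intro mult_mono) (auto simp: q_def)
  finally show ?thesis
   unfolding eq using norm_triangle[of \<one> "z\<cdot>(pw_sum q n\<cdot>z\<star>)"] norm_one_le by simp
 qed
 have sv: "sa v" unfolding v_def using sa_add[OF sa_one sa_cstar[of "z\<star>"]] by (simp add: adj_adj)
 have "||v||\<le>1"
 proof (rule power_le_poly[where C = 1 and D = 1])
  show "||v|| ^ 2 ^ n\<le>(1 + 1 * 2 ^ n) * 1 ^ 2 ^ n" for n
   using vn[of "2 ^ n"] pw_norm_eq[OF sv, of n] by simp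
 qed auto
 then show ?thesis by (simp add: v_def)
qed

text \<open>Kaplansky's argument. If -w\<star>w is positive, then \<open>norm_swap\<close> makes
  -ww\<star> positive as well. On the other hand P^2 + Q^2 = 2(w\<star>w + ww\<star>) for P = w +
  w\<star> and Q = i(w - w\<star>), so ww\<star> is itself positive. Hence it is both positive and
  negative, and vanishes.\<close>

lemma neg_cstar_pos_zero:
 assumes "z\<in>|A|" "pos (\<ominus>(z\<star>\<cdot>z))" shows "z = \<zero>"
proof -
 note [simp] = assms(1)
 define K where "K = ||z|| + 1"
 have K: "K > 0" by (simp add: K_def add_nonneg_pos)
 define w where "w = of_real (inverse K)\<odot>z"
 have [simp]: "w\<in>|A|" by (simp add: w_def)
 have nw: "||w||\<le>1" unfolding w_def by (rule norm_scale_le) (use K in \<open>auto simp: K_def\<close>)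
 have "\<ominus>(w\<star>\<cdot>w) = of_real (inverse K * inverse K)\<odot>\<ominus>(z\<star>\<cdot>z)"
  unfolding w_def by (simp add: expand uminus_eq)
 then have pw: "pos (\<ominus>(w\<star>\<cdot>w))" using pos_smult[OF assms(2), of "inverse K * inverse K"] by simp
 have "||\<ominus>(w\<star>\<cdot>w)||\<le>1" using nw by (simp add: norm_cstar power_le_one)
 from pos_near_one[OF pw this] have "||\<one>\<oplus>w\<star>\<cdot>w||\<le>1" by (simp add: a_minus_def)
 from norm_swap[OF _ nw this] have nn: "||\<one>\<oplus>w\<cdot>w\<star>||\<le>1" by simp
 have sw: "sa (w\<cdot>w\<star>)" using sa_cstar[of "w\<star>"] by (simp add: adj_adj)
 have "sa (\<ominus>(w\<cdot>w\<star>))" using sa_smult[OF sw, of "-1"] by (simp add: uminus_eq)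
 moreover have "||\<one>\<ominus>\<ominus>(w\<cdot>w\<star>)||\<le>1" using nn by (simp add: a_minus_def)
 ultimately have neg: "pos (\<ominus>(w\<cdot>w\<star>))"
  using sqrt_near_one pos_def by metis
 define P where "P = w\<oplus>w\<star>"
 define Q where "Q = \<i>\<odot>(w\<ominus>w\<star>)"
 have "(w\<oplus>w\<star>)\<star> = w\<oplus>w\<star>" by ((simp add: expand)?; (rule linI, (rule lins | (simp add: algebra_simps; fail))+))
 moreover have "(\<i>\<odot>(w\<ominus>w\<star>))\<star> = \<i>\<odot>(w\<ominus>w\<star>)" by ((simp add: expand)?; (rule linI, (rule lins | (simp add: algebra_simps; fail))+))
 ultimately have s: "sa P" "sa Q" unfolding P_def Q_def by (auto simp: sa_def simp del: sa_in sa_adj)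
 have "of_real 2\<odot>(w\<cdot>w\<star>) = P\<cdot>P\<oplus>Q\<cdot>Q\<oplus>of_real 2\<odot>(\<ominus>(w\<star>\<cdot>w))"
  unfolding P_def Q_def by ((simp add: expand)?; (rule linI, (rule lins | (simp add: algebra_simps; fail))+))
 then have "pos (of_real 2\<odot>(w\<cdot>w\<star>))"
  using pos_add[OF pos_add[OF pos_square[OF s(1)] pos_square[OF s(2)]] pos_smult[OF pw, of 2]] by simp
 then have "pos (w\<cdot>w\<star>)" by (rule pos_smult_cancel[rotated]) auto
 from pos_antisym[OF this neg] have "(w\<star>)\<star>\<cdot>w\<star> = \<zero>" by (simp add: adj_adj)
 then have "w\<star> = \<zero>" using adj_eq_mult_zero[of "w\<star>"] by simp
 then have "w = \<zero>" using adj_adj[of w] by simp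
 then have "of_real K\<odot>w = \<zero>" by simp
 then show ?thesis using K by (simp add: w_def)
qed

text \<open>The absolute value of a self-adjoint \<open>k\<close> of norm at most \<open>K\<close>:
  K times the root of k^2/K^2, which lies in the range where \<open>sqrt_near_one\<close>
  applies.\<close>

definition absv :: "real=>'a=>'a" where
 "absv K k = of_real K\<odot>(\<one>\<ominus>sqrt_defect A (\<one>\<ominus>of_real (inverse (K * K))\<odot>(k\<cdot>k)))"

text \<open>Twice the negative part of \<open>k\<close>; the parameter \<open>K\<ge>||k||\<close> is only a scale.\<close>

definition npart :: "real=>'a=>'a" where
 "npart K k = absv K k\<ominus>k"

context
 fixes K k
 assumes k: "sa k" "||k||\<le>K" and K: "0 < K"
begin

private abbreviation "x\<equiv>of_real (inverse (K * K))\<odot>(k\<cdot>k)"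
private abbreviation "d\<equiv>sqrt_defect A (\<one>\<ominus>x)"

lemma absv_arg: "\<one>\<ominus>x\<in>|A|" "||\<one>\<ominus>x||\<le>1" "sa (\<one>\<ominus>x)"
proof -
 show "\<one>\<ominus>x\<in>|A|" using k by simp
 have p: "pos x" using pos_smult[OF pos_square[OF k(1)], of "inverse (K * K)"] K by simp
 have "||x||\<le>1"
 proof (rule norm_scale_le)
  show "||k\<cdot>k||\<le>K * K" using norm_mult[of k k] mult_mono[OF k(2) k(2)] k K by simp
 qed (use k K in auto)
 from pos_near_one[OF p this] show "||\<one>\<ominus>x||\<le>1" .
 show "sa (\<one>\<ominus>x)" using pos_sa[OF p] by (auto intro: sa_diff)
qed

lemma absv_props:
 shows "pos (absv K k)" "absv K k\<cdot>absv K k = k\<cdot>k"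
  "\<And>z. z\<in>|A| ==> z\<cdot>k = k\<cdot>z ==> z\<cdot>absv K k = absv K k\<cdot>z"
proof -
 define e where "e = d"
 have e: "sa e" "||e||\<le>1" "e\<cdot>e = 2\<odot>e\<ominus>(\<one>\<ominus>x)"
  unfolding e_def using sqrt_defect_sa[OF absv_arg] sqrt_defect_norm[OF absv_arg(1,2)]
   sqrt_defect_eq[OF absv_arg(1,2)] by blast+
 have absv: "absv K k = of_real K\<odot>(\<one>\<ominus>e)" by (simp only: absv_def e_def)
 note [simp] = k(1) e(1)
 let ?b = "\<one>\<ominus>e"
 have sd: "sa ?b" by (intro sa_diff) auto
 have "\<one>\<ominus>?b = e" by ((simp add: expand)?; (rule linI, (rule lins | (simp add: algebra_simps; fail))+))
 then have "pos ?b" using sqrt_near_one[OF sd] e(2) pos_def by metis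
 then show "pos (absv K k)" unfolding absv using pos_smult K by simp
 have "?b\<cdot>?b = \<one>\<ominus>e\<ominus>e\<oplus>e\<cdot>e" by ((simp add: expand)?; (rule linI, (rule lins | (simp add: algebra_simps; fail))+))
 also have "\<dots> = x" unfolding e(3) by ((simp add: expand)?; (rule linI, (rule lins | (simp add: algebra_simps; fail))+))
 finally have "?b\<cdot>?b = x" .
 moreover have "of_real K * (of_real K * (inverse (of_real K) * inverse (of_real K))) = (1 :: complex)"
  using K by (simp add: field_simps)
 ultimately show "absv K k\<cdot>absv K k = k\<cdot>k"
  unfolding absv by (simp add: smult_mult_left smult_mult_right)
 show "z\<cdot>absv K k = absv K k\<cdot>z" if z: "z\<in>|A|" "z\<cdot>k = k\<cdot>z" for z
 proof -
  have "z\<cdot>(k\<cdot>k) = (k\<cdot>k)\<cdot>z" using z by (metis mult_assoc k(1) sa_in)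
  then have "z\<cdot>(\<one>\<ominus>x) = (\<one>\<ominus>x)\<cdot>z"
   using z by (simp add: distrib_left_diff distrib_right_diff smult_mult_left smult_mult_right)
  from sqrt_defect_commute[OF absv_arg(1,2) z(1) this]
  have "z\<cdot>e = e\<cdot>z" unfolding e_def .
  then have "z\<cdot>?b = ?b\<cdot>z" using z by (simp add: distrib_left_diff distrib_right_diff)
  then show ?thesis unfolding absv using z by (simp add: smult_mult_left smult_mult_right)
 qed
qed

lemma npart_sa: "sa (npart K k)"
 unfolding npart_def using absv_props(1) pos_sa k by (auto intro: sa_diff)

text \<open>With r = |k| and n = r - k one has nk = -rn, so nkn = -rn^2, and w is the root of r
  times n. Moreover n^2 = 2rn, so w^2 = 0 forces n^3 = 0 and then n = 0.\<close>

lemma npart_sandwich: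
 obtains w where "sa w" "npart K k\<cdot>k\<cdot>npart K k =\<ominus>(w\<cdot>w)" "w\<cdot>w = \<zero> ==> npart K k = \<zero>"
proof -
 define r where "r = absv K k"
 define n where "n = npart K k"
 have r: "pos r" "r\<cdot>r = k\<cdot>k" and rc: "\<And>z. z\<in>|A| ==> z\<cdot>k = k\<cdot>z ==> z\<cdot>r = r\<cdot>z"
  using absv_props unfolding r_def by blast+
 have n: "n = r\<ominus>k" by (simp add: n_def r_def npart_def)
 have [simp]: "sa k" "sa r" "sa n" using k r pos_sa npart_sa by (auto simp: n_def)
 have kr: "k\<cdot>r = r\<cdot>k" by (rule rc) auto
 obtain s where s: "sa s" "s\<cdot>s = r" and sc: "\<And>z. z\<in>|A| ==> z\<cdot>r = r\<cdot>z ==> z\<cdot>s = s\<cdot>z"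
  using pos_sqrt[OF r(1)] by blast
 note [simp] = s(1)
 have nr: "n\<cdot>r = r\<cdot>n" unfolding n using kr by (simp add: expand)
 have ns: "n\<cdot>s = s\<cdot>n" by (rule sc[OF _ nr]) simp
 have "n\<cdot>k = r\<cdot>k\<ominus>r\<cdot>r" unfolding n r(2) by (simp add: expand)
 also have "\<dots> =\<ominus>(r\<cdot>n)" unfolding n by ((simp add: expand)?; (rule linI, (rule lins | (simp add: algebra_simps; fail))+))
 finally have nk: "n\<cdot>k =\<ominus>(r\<cdot>n)" .
 have "n\<cdot>n = r\<cdot>r\<ominus>r\<cdot>k\<ominus>k\<cdot>r\<oplus>k\<cdot>k" unfolding n by ((simp add: expand)?; (rule linI, (rule lins | (simp add: algebra_simps; fail))+))
 also have "\<dots> = 2\<odot>(r\<cdot>n)" unfolding kr r(2)[symmetric] n by ((simp add: expand)?; (rule linI, (rule lins | (simp add: algebra_simps; fail))+))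
 finally have nn: "n\<cdot>n = 2\<odot>(r\<cdot>n)" .
 define w where "w = s\<cdot>n"
 have sw: "sa w" unfolding w_def using ns by (auto intro: sa_mult)
 have "w\<cdot>w = s\<cdot>((n\<cdot>s)\<cdot>n)" unfolding w_def by (simp add: mult_assoc)
 also have "\<dots> = (s\<cdot>s)\<cdot>(n\<cdot>n)" unfolding ns by (simp add: mult_assoc)
 finally have ww: "w\<cdot>w = r\<cdot>(n\<cdot>n)" using s by simp
 show ?thesis
 proof (rule that[OF sw])
  show "npart K k\<cdot>k\<cdot>npart K k =\<ominus>(w\<cdot>w)"
   unfolding n_def[symmetric] nk ww by (simp add: uminus_eq expand)
  assume "w\<cdot>w = \<zero>"
  then have "2\<odot>(r\<cdot>(n\<cdot>n)) = \<zero>" unfolding ww by simp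
  then have "(n\<cdot>n)\<cdot>n = \<zero>"
   by (subst nn) (simp add: mult_assoc smult_mult_left)
  then have "(n\<cdot>n)\<star>\<cdot>(n\<cdot>n) = \<zero>" by (simp add: adj_mult mult_assoc[symmetric])
  then have "n\<star>\<cdot>n = \<zero>" using adj_eq_mult_zero[of "n\<cdot>n"] by simp
  then have "n = \<zero>" using adj_eq_mult_zero[of n] by simp
  then show "npart K k = \<zero>" by (simp only: n_def)
 qed
qed

text \<open>Compression by the negative part exposes the negative of a square; if the compression is
  also positive, antisymmetry makes it vanish.\<close>

lemma npart_zero: assumes "pos (npart K k\<cdot>k\<cdot>npart K k)" shows "npart K k = \<zero>"
proof -
 obtain w where w: "sa w" "npart K k\<cdot>k\<cdot>npart K k =\<ominus>(w\<cdot>w)" "w\<cdot>w = \<zero> ==> npart K k = \<zero>"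
  using npart_sandwich by blast
 show ?thesis using assms pos_antisym[OF pos_square[OF w(1)]] w by metis
qed

lemma npart_zero_pos: assumes "npart K k = \<zero>" shows "pos k"
proof -
 have "absv K k = k"
  using assms diff_eq_zeroD[of "absv K k" k] pos_sa[OF absv_props(1)] k by (simp add: npart_def)
 then show ?thesis using absv_props(1) by simp
qed

end

text \<open>Let n be the negative part of k = z\<star>z, up to the factor 2. Then (zn)\<star>(zn) =
  nkn is the negative of a square, which \<open>neg_cstar_pos_zero\<close> allows only if zn = 0;
  hence n = 0 and k = |k|.\<close>

lemma cstar_pos: assumes "z\<in>|A|" shows "pos (z\<star>\<cdot>z)"
proof -
 note [simp] = assms
 define k where "k = z\<star>\<cdot>z"
 define K where "K = ||k|| + 1"
 have sk: "sa k" by (simp add: k_def sa_cstar)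
 have K: "||k||\<le>K" "K > 0" using sk by (auto simp: K_def add_nonneg_pos)
 define n where "n = npart K k"
 have sn: "sa n" unfolding n_def by (rule npart_sa[OF sk K])
 note [simp] = sk sn
 obtain w where w: "sa w" "n\<cdot>k\<cdot>n =\<ominus>(w\<cdot>w)" "w\<cdot>w = \<zero> ==> n = \<zero>"
  using npart_sandwich[OF sk K] unfolding n_def by blast
 have e: "(z\<cdot>n)\<star>\<cdot>(z\<cdot>n) = n\<cdot>k\<cdot>n" by (simp add: k_def expand)
 have "\<ominus>((z\<cdot>n)\<star>\<cdot>(z\<cdot>n)) = w\<cdot>w" unfolding e w(2) using w(1) by simp
 then have "z\<cdot>n = \<zero>" using neg_cstar_pos_zero[of "z\<cdot>n"] pos_square[OF w(1)] by simp
 then have "n\<cdot>k\<cdot>n = \<zero>" unfolding e[symmetric] by simp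
 then have "(-1)\<odot>(\<ominus>(w\<cdot>w)) = \<zero>" using w(2) by simp
 then have "w\<cdot>w = \<zero>" using w(1) by (simp add: uminus_eq)
 then have "n = \<zero>" by (rule w(3))
 then show ?thesis using npart_zero_pos[OF sk K] by (simp add: n_def k_def)
qed

lemma pos_sandwich: assumes "pos x" "y\<in>|A|" shows "pos (y\<star>\<cdot>x\<cdot>y)"
proof -
 obtain b where b: "sa b" "x = b\<cdot>b" using assms pos_def by blast
 have "y\<star>\<cdot>x\<cdot>y = (b\<cdot>y)\<star>\<cdot>(b\<cdot>y)" using b assms(2) by (simp add: expand)
 then show ?thesis using cstar_pos[of "b\<cdot>y"] b assms(2) by simp
qed

lemma pos_of_norm_le: assumes "sa x" "||x||\<le>t" "0 < t" shows "pos (of_real t\<odot>\<one>\<ominus>x)"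
proof -
 note [simp] = assms(1)
 let ?y = "\<one>\<ominus>of_real (inverse t)\<odot>x"
 have "\<one>\<ominus>?y = of_real (inverse t)\<odot>x" by ((simp add: expand)?; (rule linI, (rule lins | (simp add: algebra_simps; fail))+))
 then have "||\<one>\<ominus>?y||\<le>1" using norm_scale_le[OF _ assms(3,2)] by simp
 moreover have "sa ?y" by (intro sa_diff sa_smult) auto
 ultimately have "pos ?y" using sqrt_near_one pos_def by metis
 then have "pos (of_real t\<odot>?y)" using assms(3) by (simp add: pos_smult)
 then show ?thesis using assms(3) by (simp add: smult_diff)
qed

text \<open>p/t and 1 - p/t are squares of commuting self-adjoint elements with sum 1, so
  \<open>unitary_bound\<close> applies to the root of p/t.\<close>

lemma norm_le_of_pos: assumes "pos p" "pos (of_real t\<odot>\<one>\<ominus>p)" "0 < t" shows "||p||\<le>t"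
proof -
 let ?p = "of_real (inverse t)\<odot>p"
 note [simp] = sa_in[OF pos_sa[OF assms(1)]]
 have p: "pos ?p" using pos_smult[OF assms(1), of "inverse t"] assms(3) by simp
 have "of_real (inverse t)\<odot>(of_real t\<odot>\<one>\<ominus>p) = \<one>\<ominus>?p" using assms(3) by (simp add: smult_diff)
 then have q: "pos (\<one>\<ominus>?p)" using pos_smult[OF assms(2), of "inverse t"] assms(3) by simp
 obtain b where b: "sa b" "b\<cdot>b = ?p" using p pos_def by metis
 obtain c where c: "sa c" "c\<cdot>c = \<one>\<ominus>?p"
   and cc: "\<And>z. z\<in>|A| ==> z\<cdot>(\<one>\<ominus>?p) = (\<one>\<ominus>?p)\<cdot>z ==> z\<cdot>c = c\<cdot>z"
  using pos_sqrt[OF q] by blast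
 note [simp] = b(1) c(1)
 have "b\<cdot>?p = ?p\<cdot>b" unfolding b(2)[symmetric] by (simp add: mult_assoc)
 then have "b\<cdot>c = c\<cdot>b"
  by (intro cc) (simp_all add: distrib_left_diff distrib_right_diff)
 moreover have "b\<cdot>b\<oplus>c\<cdot>c = \<one>" unfolding b(2) c(2) by ((simp add: expand)?; (rule linI, (rule lins | (simp add: algebra_simps; fail))+))
 ultimately have "||b||\<le>1" by (intro unitary_bound) auto
 then have "||b\<cdot>b||\<le>1" by (intro norm_mult_le_one) auto
 moreover have "||?p|| = inverse t * ||p||" using assms(3) by (simp add: norm_smult norm_inverse)
 ultimately have "inverse t * ||p||\<le>1" unfolding b(2) by simp
 then show ?thesis using assms(3) by (simp add: field_simps)
qed

lemma pos_norm_mono: assumes "pos p" "pos q" shows "||p||\<le>||p\<oplus>q||"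
proof (rule field_le_epsilon)
 fix \<epsilon> :: real assume e: "0 < \<epsilon>"
 note [simp] = sa_in[OF pos_sa[OF assms(1)]] sa_in[OF pos_sa[OF assms(2)]]
 \<comment> \<open>The slack keeps t strictly positive, as the rescaling by 1/t requires, even when
   p + q = 0.\<close>
 define t where "t = ||p\<oplus>q|| + \<epsilon>"
 have t: "t > 0" using e by (simp add: t_def add_nonneg_pos)
 have "pos (of_real t\<odot>\<one>\<ominus>(p\<oplus>q))"
  by (rule pos_of_norm_le) (use t e assms pos_add pos_sa in \<open>auto simp: t_def\<close>)
 then have "pos (of_real t\<odot>\<one>\<ominus>(p\<oplus>q)\<oplus>q)" using assms(2) pos_add by blast
 moreover have "of_real t\<odot>\<one>\<ominus>(p\<oplus>q)\<oplus>q = of_real t\<odot>\<one>\<ominus>p" by ((simp add: expand)?; (rule linI, (rule lins | (simp add: algebra_simps; fail))+))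
 ultimately show "||p||\<le>t" using norm_le_of_pos[OF assms(1) _ t] by simp
qed

text \<open>With \<open>k = t - y\<close> and \<open>p = 2 k\<^sub>+\<close> one has \<open>p\<^sup>2 = 2kp\<close>, hence \<open>p\<^sup>3\<le>2tp\<^sup>2\<close>.\<close>

lemma clamp_bound:
 assumes "pos y" "0 < t" "||of_real t\<odot>\<one>\<ominus>y||\<le>K" "0 < K"
 shows "||absv K (of_real t\<odot>\<one>\<ominus>y)\<oplus>(of_real t\<odot>\<one>\<ominus>y)||\<le>2 * t"
proof -
 define k where "k = of_real t\<odot>\<one>\<ominus>y"
 define r where "r = absv K k"
 define p where "p = r\<oplus>k"
 note [simp] = pos_sa[OF assms(1)]
 have sk [simp]: "sa k" unfolding k_def by (intro sa_diff sa_smult) auto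
 have kK: "||k||\<le>K" using assms by (simp add: k_def)
 have r: "pos r" "r\<cdot>r = k\<cdot>k" and rc: "\<And>z. z\<in>|A| ==> z\<cdot>k = k\<cdot>z ==> z\<cdot>r = r\<cdot>z"
  using absv_props[OF sk kK assms(4)] unfolding r_def by blast+
 have [simp]: "sa r" "sa p" using pos_sa r(1) by (auto simp: p_def intro: sa_add)
 have kr: "k\<cdot>r = r\<cdot>k" by (rule rc) auto
 have y: "y = of_real t\<odot>\<one>\<ominus>k" unfolding k_def by ((simp add: expand)?; (rule linI, (rule lins | (simp add: algebra_simps; fail))+))
 have yr: "y\<cdot>r = r\<cdot>y" by (rule rc) (simp_all add: k_def expand)
 obtain s where s: "sa s" "s\<cdot>s = r" and sc: "\<And>z. z\<in>|A| ==> z\<cdot>r = r\<cdot>z ==> z\<cdot>s = s\<cdot>z"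
  using pos_sqrt[OF r(1)] by blast
 note [simp] = s(1)
 have pr: "p\<cdot>r = r\<cdot>p" unfolding p_def using kr by (simp add: expand)
 have ps: "p\<cdot>s = s\<cdot>p" by (rule sc[OF _ pr]) simp
 have py: "p\<cdot>y = y\<cdot>p" unfolding p_def using yr by (simp add: k_def expand)
 have "p\<cdot>p = r\<cdot>r\<oplus>r\<cdot>k\<oplus>k\<cdot>r\<oplus>k\<cdot>k" unfolding p_def by ((simp add: expand)?; (rule linI, (rule lins | (simp add: algebra_simps; fail))+))
 moreover have "\<dots> = 2\<odot>(r\<cdot>p)" unfolding p_def supply kr [simp] r(2)[symmetric, simp] by ((simp add: expand)?; (rule linI, (rule lins | (simp add: algebra_simps; fail))+))
 moreover have "r\<cdot>r\<oplus>r\<cdot>k\<oplus>k\<cdot>r\<oplus>k\<cdot>k = 2\<odot>(k\<cdot>p)" unfolding p_def supply kr [simp] r(2) [simp] by ((simp add: expand)?; (rule linI, (rule lins | (simp add: algebra_simps; fail))+))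
 ultimately have pp: "p\<cdot>p = 2\<odot>(r\<cdot>p)" "p\<cdot>p = 2\<odot>(k\<cdot>p)" by auto
 have sp: "sa (s\<cdot>p)" using ps by (auto intro: sa_mult)
 have "(s\<cdot>p)\<cdot>(s\<cdot>p) = s\<cdot>((p\<cdot>s)\<cdot>p)" by (simp add: mult_assoc)
 also have "\<dots> = r\<cdot>(p\<cdot>p)" unfolding ps using s(2)[symmetric] by (simp add: mult_assoc)
 finally have "2\<odot>((s\<cdot>p)\<cdot>(s\<cdot>p)) = p\<cdot>p\<cdot>p"
  using pp(1) by (simp add: smult_mult_left mult_assoc)
 then have pos3: "pos (p\<cdot>p\<cdot>p)"
  using pos_smult[OF pos_square[OF sp], of 2] by simp
 have "of_real (2 * t)\<odot>(p\<cdot>p)\<ominus>p\<cdot>p\<cdot>p = 2\<odot>(y\<cdot>(p\<cdot>p))"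
 proof -
  have p3: "p\<cdot>p\<cdot>p = 2\<odot>(k\<cdot>(p\<cdot>p))" using pp(2) by (simp add: smult_mult_left mult_assoc)
  show ?thesis unfolding p3 y by ((simp add: expand)?; (rule linI, (rule lins | (simp add: algebra_simps; fail))+))
 qed
 also have "y\<cdot>(p\<cdot>p) = p\<star>\<cdot>y\<cdot>p" using py by (simp add: mult_assoc[symmetric])
 finally have "of_real (2 * t)\<odot>(p\<cdot>p)\<ominus>p\<cdot>p\<cdot>p = of_real 2\<odot>(p\<star>\<cdot>y\<cdot>p)" by simp
 then have posd: "pos (of_real (2 * t)\<odot>(p\<cdot>p)\<ominus>p\<cdot>p\<cdot>p)"
  using pos_smult[OF pos_sandwich[OF assms(1), of p], of 2] by simp
 have "p\<cdot>p\<cdot>p\<oplus>(of_real (2 * t)\<odot>(p\<cdot>p)\<ominus>p\<cdot>p\<cdot>p) = of_real (2 * t)\<odot>(p\<cdot>p)" by ((simp add: expand)?; (rule linI, (rule lins | (simp add: algebra_simps; fail))+))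
 then have n1: "||p\<cdot>p\<cdot>p||\<le>||of_real (2 * t)\<odot>(p\<cdot>p)||"
  using pos_norm_mono[OF pos3 posd] by simp
 \<comment> \<open>For self-adjoint p, the fourth power of its norm is the norm of p^4, which is at
   most that of p^3 times that of p. The bound on p^3 then leaves 2t after cancelling the
   cube.\<close>
 have n2: "||p\<cdot>p|| = ||p||\<^sup>2" using norm_cstar[of p] by simp
 have "||p\<cdot>p\<cdot>(p\<cdot>p)|| = ( ||p||\<^sup>2)\<^sup>2" using norm_cstar[of "p\<cdot>p"] n2 by (simp add: adj_mult)
 moreover have "||p\<cdot>p\<cdot>p\<cdot>p||\<le>||p\<cdot>p\<cdot>p|| * ||p||" by (intro norm_mult) auto
 ultimately have n3: "( ||p||\<^sup>2)\<^sup>2\<le>||p\<cdot>p\<cdot>p|| * ||p||" by (simp add: mult_assoc)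
 have "||p||\<le>2 * t"
 proof (cases "||p|| = 0")
  case True then show ?thesis using assms(2) by linarith
 next
  case False
  then have pp0: "||p|| > 0" using norm_nonneg[of p] by (simp del: norm_eq_zero norm_nonneg)
  have "( ||p||\<^sup>2)\<^sup>2\<le>(2 * t * ||p||\<^sup>2) * ||p||"
  proof (rule order_trans[OF n3 mult_right_mono])
   show "||p\<cdot>p\<cdot>p||\<le>2 * t * ||p||\<^sup>2" using n1 n2 assms(2) by (simp add: norm_smult)
  qed simp
  then have "||p|| * ||p|| ^ 3\<le>(2 * t) * ||p|| ^ 3" by (simp add: power2_eq_square power3_eq_cube mult_ac)
  then show ?thesis using pp0 by (simp only: mult_le_cancel_right) auto
 qed
 then show ?thesis by (simp add: p_def r_def k_def)
qed

text \<open>Negative parts can be computed modulo a closed ideal. The scale \<open>K\<close> has to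
  be the same on both sides, since it enters the formula for the root.\<close>

lemma npart_cong:
 assumes "closed_ideal A I" "sa k" "||k||\<le>K" "sa k'" "||k'||\<le>K" "0 < K" "k\<ominus>k'\<in>I"
 shows "npart K k\<ominus>npart K k'\<in>I"
proof -
 note I = closed_idealD[OF assms(1)]
 note [simp] = assms(2,4)
 let ?x = "\<lambda>k. \<one>\<ominus>of_real (inverse (K * K))\<odot>(k\<cdot>k)"
 note a = absv_arg[OF assms(2,3,6)] absv_arg[OF assms(4,5,6)]
 note [simp] = sqrt_defect_in[OF a(1,2)] sqrt_defect_in[OF a(4,5)]
 have "?x k\<ominus>?x k' = of_real (- inverse (K * K))\<odot>((k\<ominus>k')\<cdot>k\<oplus>k'\<cdot>(k\<ominus>k'))" by ((simp add: expand)?; (rule linI, (rule lins | (simp add: algebra_simps; fail))+))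
 also have "\<dots>\<in>I" using assms(7) by (intro submodule_smult[OF I(1)] submodule_add[OF I(1)] I(2,3)) auto
 finally have "sqrt_defect A (?x k)\<ominus>sqrt_defect A (?x k')\<in>I"
  by (intro sqrt_defect_cong assms(1) a)
 then have "of_real (- K)\<odot>(sqrt_defect A (?x k)\<ominus>sqrt_defect A (?x k'))\<ominus>(k\<ominus>k')\<in>I"
  by (rule submodule_diff[OF I(1) submodule_smult[OF I(1)] assms(7)])
 moreover have "of_real (- K)\<odot>(sqrt_defect A (?x k)\<ominus>sqrt_defect A (?x k'))\<ominus>(k\<ominus>k')
   = npart K k\<ominus>npart K k'"
 proof -
  define d d' where "d = sqrt_defect A (?x k)" and "d' = sqrt_defect A (?x k')"
  have [simp]: "d\<in>|A|" "d'\<in>|A|"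
   unfolding d_def d'_def using sqrt_defect_in[OF a(1,2)] sqrt_defect_in[OF a(4,5)] by blast+
  show ?thesis unfolding npart_def absv_def d_def[symmetric] d'_def[symmetric] by ((simp add: expand)?; (rule linI, (rule lins | (simp add: algebra_simps; fail))+))
 qed
 ultimately show ?thesis by simp
qed

lemma npart_pos: assumes "pos k" "||k||\<le>K" "0 < K" shows "npart K k = \<zero>"
proof (rule npart_zero[OF pos_sa[OF assms(1)] assms(2,3)])
 show "pos (npart K k\<cdot>k\<cdot>npart K k)"
  using pos_sandwich[OF assms(1), of "npart K k"] npart_sa[OF pos_sa[OF assms(1)] assms(2,3)] by simp
qed

end

section \<open>The multiplier algebra\<close>

context cstar_algebra
begin

abbreviation "MA\<equiv>multiplier_algebra A"
abbreviation "J\<equiv>to_multiplier A"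

lemma cancel_left:
 assumes "u\<in>|A|" "v\<in>|A|" "\<And>y. y\<in>|A| ==> y\<cdot>u = y\<cdot>v" shows "u = v"
proof (rule diff_eq_zeroD[OF assms(1,2)], rule adj_eq_mult_zero)
 show "(u\<ominus>v)\<star>\<cdot>(u\<ominus>v) = \<zero>"
  using assms(3)[of "(u\<ominus>v)\<star>"] assms by (simp add: distrib_left_diff)
qed (use assms in simp)

lemma cancel_right:
 assumes "u\<in>|A|" "v\<in>|A|" "\<And>y. y\<in>|A| ==> u\<cdot>y = v\<cdot>y" shows "u = v"
proof -
 have "u\<star> = v\<star>"
 proof (rule cancel_left)
  show "y\<cdot>u\<star> = y\<cdot>v\<star>" if "y\<in>|A|" for y
  proof -
   have "(u\<cdot>y\<star>)\<star> = (v\<cdot>y\<star>)\<star>" using assms(3)[of "y\<star>"] that by simp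
   then show ?thesis using that assms(1,2) by (simp add: adj_mult adj_adj)
  qed
 qed (use assms in auto)
 then show ?thesis using assms adj_adj by metis
qed

text \<open>L and R behave like an operator and its adjoint on a Hilbert module: the square of the
  norm of R x is the norm of x L((R x)\<star>). Hence a bound for one map is a bound for the
  other.\<close>

lemma bound_of_adjoint:
 assumes L: "L\<in>|A| \<rightarrow> |A|" and R: "R\<in>|A| \<rightarrow> |A|"
  and LR: "\<And>x y. x\<in>|A| ==> y\<in>|A| ==> R x\<cdot>y = x\<cdot>L y"
  and C: "\<And>x. x\<in>|A| ==> ||L x||\<le>C * ||x||" and x: "x\<in>|A|"
 shows "||R x||\<le>C * ||x||"
proof (cases "||R x|| = 0")
 case True
 have "0\<le>C * ||x||" using order_trans[OF norm_nonneg C[OF x]] L x by auto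
 then show ?thesis using True by linarith
next
 case False
 have [simp]: "R x\<in>|A|" using R x by auto
 have [simp]: "L ((R x)\<star>)\<in>|A|" using L by (rule funcset_mem) simp
 have "||R x||\<^sup>2 = ||x\<cdot>L ((R x)\<star>)||"
  using norm_cstar'[of "R x"] LR[of x "(R x)\<star>"] x by simp
 also have "\<dots>\<le>||x|| * (C * ||R x||)"
  using order_trans[OF norm_mult[of x "L ((R x)\<star>)"] mult_left_mono[OF C[of "(R x)\<star>"]]] x by simp
 finally have "||R x|| * ||R x||\<le>(C * ||x||) * ||R x||" by (simp add: power2_eq_square mult_ac)
 moreover have "||R x|| > 0" using False norm_nonneg[of "R x"] by (simp del: norm_eq_zero norm_nonneg)
 ultimately show ?thesis using mult_le_cancel_right_pos by blast
qed

text \<open>Linearity and the module properties of a double centralizer are automatic.\<close>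

lemma multiplierI:
 assumes L: "L\<in>|A| \<rightarrow> |A|" and R: "R\<in>|A| \<rightarrow> |A|"
  and LR: "\<And>x y. x\<in>|A| ==> y\<in>|A| ==> R x\<cdot>y = x\<cdot>L y"
  and C: "\<And>x. x\<in>|A| ==> ||L x||\<le>C * ||x||"
 shows "(\<lambda>x\<in>|A|. L x, \<lambda>x\<in>|A|. R x)\<in>|MA|"
proof -
 have [simp]: "L x\<in>|A|" "R x\<in>|A|" if "x\<in>|A|" for x using L R that by auto
 have "L (x\<oplus>y) = L x\<oplus>L y" if "x\<in>|A|" "y\<in>|A|" for x y
  by (rule cancel_left) (use that in \<open>simp_all add: distrib_left flip: LR\<close>)
 moreover have "L (c\<odot>x) = c\<odot>L x" if "x\<in>|A|" for x c
  by (rule cancel_left) (use that in \<open>simp_all add: smult_mult_right flip: LR\<close>)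
 moreover have "L (x\<cdot>y) = L x\<cdot>y" if "x\<in>|A|" "y\<in>|A|" for x y
  by (rule cancel_left) (use that in \<open>simp_all add: mult_assoc[symmetric] flip: LR\<close>)
 moreover have "R (x\<oplus>y) = R x\<oplus>R y" if "x\<in>|A|" "y\<in>|A|" for x y
  by (rule cancel_right) (use that in \<open>simp_all add: distrib_right LR\<close>)
 moreover have "R (c\<odot>x) = c\<odot>R x" if "x\<in>|A|" for x c
  by (rule cancel_right) (use that in \<open>simp_all add: smult_mult_left LR\<close>)
 moreover have "R (x\<cdot>y) = x\<cdot>R y" if "x\<in>|A|" "y\<in>|A|" for x y
  by (rule cancel_right) (use that in \<open>simp_all add: mult_assoc LR\<close>)
 moreover have "\<exists>C. \<forall>x\<in>|A|. ||L x||\<le>C * ||x||" using C by blast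
 moreover have "\<exists>C. \<forall>x\<in>|A|. ||R x||\<le>C * ||x||" using bound_of_adjoint[OF L R LR C] by blast
 ultimately show ?thesis
  unfolding multiplier_algebra_def bounded_linear_map_def using LR by auto
qed

context
 fixes m assumes m: "m\<in>|MA|"
begin

lemma lact_in [simp]: "x\<in>|A| ==> lact m x\<in>|A|"
 and ract_in [simp]: "x\<in>|A| ==> ract m x\<in>|A|"
 and lact_add: "x\<in>|A| ==> y\<in>|A| ==> lact m (x\<oplus>y) = lact m x\<oplus>lact m y"
 and lact_smult: "x\<in>|A| ==> lact m (c\<odot>x) = c\<odot>lact m x"
 and ract_add: "x\<in>|A| ==> y\<in>|A| ==> ract m (x\<oplus>y) = ract m x\<oplus>ract m y"
 and ract_smult: "x\<in>|A| ==> ract m (c\<odot>x) = c\<odot>ract m x"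
 and lact_mult: "x\<in>|A| ==> y\<in>|A| ==> lact m (x\<cdot>y) = lact m x\<cdot>y"
 and ract_mult: "x\<in>|A| ==> y\<in>|A| ==> ract m (x\<cdot>y) = x\<cdot>ract m y"
 and ract_lact: "x\<in>|A| ==> y\<in>|A| ==> ract m x\<cdot>y = x\<cdot>lact m y"
 and lact_ext: "lact m\<in>extensional ( |A| )" "ract m\<in>extensional ( |A| )"
 using m unfolding multiplier_algebra_def bounded_linear_map_def by (auto simp: PiE_def)

lemma lact_bdd: "\<exists>C. \<forall>x\<in>|A|. ||lact m x||\<le>C * ||x||"
 using m unfolding multiplier_algebra_def bounded_linear_map_def by auto blast

lemma mnorm_def: "||m||\<^sub>MA = Sup { ||lact m x|| | x. x\<in>|A|\<and>||x||\<le>1}"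
 by (simp add: multiplier_algebra_def case_prod_unfold)

lemma lact_le1: assumes "x\<in>|A|" "||x||\<le>1" shows "||lact m x||\<le>||m||\<^sub>MA"
proof -
 obtain C where C: "\<And>x. x\<in>|A| ==> ||lact m x||\<le>C * ||x||" using lact_bdd by blast
 have "||lact m x||\<le>\<bar>C\<bar>" if "x\<in>|A|" "||x||\<le>1" for x
 proof -
  have "C * ||x||\<le>\<bar>C\<bar> * 1" using that by (intro mult_mono) auto
  then show ?thesis using C[OF that(1)] by simp
 qed
 then have "bdd_above { ||lact m x|| | x. x\<in>|A|\<and>||x||\<le>1}" by (intro bdd_aboveI) auto
 then show ?thesis unfolding mnorm_def using assms by (intro cSup_upper) auto
qed

lemma mnorm_nonneg: "0\<le>||m||\<^sub>MA"
 using order_trans[OF norm_nonneg lact_le1[of \<zero>]] by simp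

lemma lact_le: assumes "x\<in>|A|" shows "||lact m x||\<le>||m||\<^sub>MA * ||x||"
proof (cases "||x|| = 0")
 case True
 then have "x = \<zero>" using assms by simp
 then show ?thesis using lact_smult[of \<zero> 0] by simp
next
 case False
 then have p: "||x|| > 0" using assms norm_nonneg[of x] by (simp del: norm_eq_zero norm_nonneg)
 define y where "y = of_real (inverse ||x||)\<odot>x"
 have "||lact m y||\<le>||m||\<^sub>MA" unfolding y_def by (rule lact_le1) (use assms p norm_scale_le[of x "||x||"] in auto)
 moreover have "||lact m y|| = inverse ||x|| * ||lact m x||"
  unfolding y_def using assms p by (simp add: lact_smult norm_smult norm_inverse)
 ultimately show ?thesis using p by (simp add: field_simps)
qed

lemma mnorm_le: assumes "0\<le>C" "\<And>x. x\<in>|A| ==> ||lact m x||\<le>C * ||x||" shows "||m||\<^sub>MA\<le>C"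
 unfolding mnorm_def
proof (rule cSup_least)
 show "{ ||lact m x|| | x. x\<in>|A|\<and>||x||\<le>1}\<noteq>{}" by (auto intro: exI[of _ \<zero>])
 fix r assume "r\<in>{ ||lact m x|| | x. x\<in>|A|\<and>||x||\<le>1}"
 then obtain x where x: "r = ||lact m x||" "x\<in>|A|" "||x||\<le>1" by blast
 have "C * ||x||\<le>C * 1" using x assms by (intro mult_left_mono) auto
 then show "r\<le>C" using assms(2)[OF x(2)] x(1) by simp
qed

lemma ract_le: assumes "x\<in>|A|" shows "||ract m x||\<le>||m||\<^sub>MA * ||x||"
 by (rule bound_of_adjoint[of "lact m"]) (use assms lact_le ract_lact in auto)

end

lemma multiplier_eqI:
 assumes "m\<in>|MA|" "n\<in>|MA|" "\<And>x. x\<in>|A| ==> lact m x = lact n x" shows "m = n"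
proof (rule prod_eqI)
 show "lact m = lact n"
  by (rule extensionalityI[OF lact_ext(1)[OF assms(1)] lact_ext(1)[OF assms(2)] assms(3)])
 show "ract m = ract n"
 proof (rule extensionalityI[OF lact_ext(2)[OF assms(1)] lact_ext(2)[OF assms(2)]])
  show "ract m x = ract n x" if "x\<in>|A|" for x
   by (rule cancel_right) (use that assms in \<open>simp_all add: ract_lact\<close>)
 qed
qed

lemma mult_ops [simp]:
 "x\<in>|A| ==> lact (m\<oplus>\<^sub>MA n) x = lact m x\<oplus>lact n x"
 "x\<in>|A| ==> ract (m\<oplus>\<^sub>MA n) x = ract m x\<oplus>ract n x"
 "x\<in>|A| ==> lact (m\<cdot>\<^sub>MA n) x = lact m (lact n x)"
 "x\<in>|A| ==> ract (m\<cdot>\<^sub>MA n) x = ract n (ract m x)"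
 "x\<in>|A| ==> lact (c\<odot>\<^sub>MA m) x = c\<odot>lact m x"
 "x\<in>|A| ==> ract (c\<odot>\<^sub>MA m) x = c\<odot>ract m x"
 "x\<in>|A| ==> lact (m\<star>\<^sub>MA) x = (ract m (x\<star>))\<star>"
 "x\<in>|A| ==> ract (m\<star>\<^sub>MA) x = (lact m (x\<star>))\<star>"
 "x\<in>|A| ==> lact \<zero>\<^sub>MA x = \<zero>"
 "x\<in>|A| ==> ract \<zero>\<^sub>MA x = \<zero>"
 "x\<in>|A| ==> lact \<one>\<^sub>MA x = x"
 "x\<in>|A| ==> ract \<one>\<^sub>MA x = x"
 by (simp_all add: multiplier_algebra_def case_prod_unfold)

lemma mult_add_in: assumes "m\<in>|MA|" "n\<in>|MA|" shows "m\<oplus>\<^sub>MA n\<in>|MA|"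
proof -
 have "(\<lambda>x\<in>|A|. lact m x\<oplus>lact n x, \<lambda>x\<in>|A|. ract m x\<oplus>ract n x)\<in>|MA|"
 proof (rule multiplierI)
  show "||lact m x\<oplus>lact n x||\<le>( ||m||\<^sub>MA + ||n||\<^sub>MA) * ||x||" if "x\<in>|A|" for x
   using norm_triangle[of "lact m x" "lact n x"] lact_le[OF assms(1) that] lact_le[OF assms(2) that] assms that
   by (simp add: ring_distribs)
 qed (use assms in \<open>auto simp: distrib_left distrib_right ract_lact\<close>)
 then show ?thesis by (simp add: multiplier_algebra_def case_prod_unfold)
qed

lemma mult_mult_in: assumes "m\<in>|MA|" "n\<in>|MA|" shows "m\<cdot>\<^sub>MA n\<in>|MA|"
proof -
 have "(\<lambda>x\<in>|A|. lact m (lact n x), \<lambda>x\<in>|A|. ract n (ract m x))\<in>|MA|"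
 proof (rule multiplierI)
  show "||lact m (lact n x)||\<le>( ||m||\<^sub>MA * ||n||\<^sub>MA) * ||x||" if "x\<in>|A|" for x
   using order_trans[OF lact_le[OF assms(1), of "lact n x"] mult_left_mono[OF lact_le[OF assms(2) that]]] assms that
   by (simp add: mnorm_nonneg mult.assoc)
 qed (use assms in \<open>auto simp: ract_lact\<close>)
 then show ?thesis by (simp add: multiplier_algebra_def case_prod_unfold)
qed

lemma mult_smult_in: assumes "m\<in>|MA|" shows "c\<odot>\<^sub>MA m\<in>|MA|"
proof -
 have "(\<lambda>x\<in>|A|. c\<odot>lact m x, \<lambda>x\<in>|A|. c\<odot>ract m x)\<in>|MA|"
 proof (rule multiplierI)
  show "||c\<odot>lact m x||\<le>(cmod c * ||m||\<^sub>MA) * ||x||" if "x\<in>|A|" for x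
   using mult_left_mono[OF lact_le[OF assms that], of "cmod c"] assms that by (simp add: norm_smult mult.assoc)
 qed (use assms in \<open>auto simp: smult_mult_left smult_mult_right ract_lact\<close>)
 then show ?thesis by (simp add: multiplier_algebra_def case_prod_unfold)
qed

lemma mult_adj_in: assumes "m\<in>|MA|" shows "m\<star>\<^sub>MA\<in>|MA|"
proof -
 have "(\<lambda>x\<in>|A|. (ract m (x\<star>))\<star>, \<lambda>x\<in>|A|. (lact m (x\<star>))\<star>)\<in>|MA|"
 proof (rule multiplierI)
  show "||(ract m (x\<star>))\<star>||\<le>||m||\<^sub>MA * ||x||" if "x\<in>|A|" for x
   using ract_le[OF assms, of "x\<star>"] assms that by simp
  show "(lact m (x\<star>))\<star>\<cdot>y = x\<cdot>(ract m (y\<star>))\<star>" if "x\<in>|A|" "y\<in>|A|" for x y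
   using arg_cong[OF ract_lact[OF assms, of "y\<star>" "x\<star>"], of "cadj A"] assms that by (simp add: adj_mult adj_adj)
 qed (use assms in auto)
 then show ?thesis by (simp add: multiplier_algebra_def case_prod_unfold)
qed

lemma mult_zero_in: "\<zero>\<^sub>MA\<in>|MA|"
proof -
 have "(\<lambda>x\<in>|A|. \<zero>, \<lambda>x\<in>|A|. \<zero>)\<in>|MA|"
  by (rule multiplierI[where C = 0]) auto
 then show ?thesis by (simp add: multiplier_algebra_def)
qed

lemma mult_one_in: "\<one>\<^sub>MA\<in>|MA|"
proof -
 have "(\<lambda>x\<in>|A|. x, \<lambda>x\<in>|A|. x)\<in>|MA|"
  by (rule multiplierI[where C = 1]) auto
 then show ?thesis by (simp add: multiplier_algebra_def)
qed

lemmas mult_in = mult_add_in mult_mult_in mult_smult_in mult_adj_in mult_zero_in mult_one_in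

lemma star_algebra_multiplier: "star_algebra MA"
 by (rule star_algebraI; (rule multiplier_eqI)?;
  simp add: mult_in M.a_assoc M.a_comm smult_add_left smult_add_right adj_adj adj_add
    adj_smult lact_add lact_smult ract_add ract_smult uminus_eq[symmetric] M.l_neg M.r_neg M.a_lcomm)

lemma pre_cstar_multiplier: "pre_cstar MA"
proof -
 interpret M: star_algebra MA by (rule star_algebra_multiplier)
 have adj_le: "||m\<star>\<^sub>MA||\<^sub>MA\<le>||m||\<^sub>MA" if m: "m\<in>|MA|" for m
  by (rule mnorm_le) (use m ract_le[OF m] in \<open>auto simp: mnorm_nonneg\<close>, metis adj_closed norm_adj)
 have mult_le: "||m\<cdot>\<^sub>MA n||\<^sub>MA\<le>||m||\<^sub>MA * ||n||\<^sub>MA" if "m\<in>|MA|" "n\<in>|MA|" for m n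
 proof (rule mnorm_le)
  show "||lact (m\<cdot>\<^sub>MA n) x||\<le>||m||\<^sub>MA * ||n||\<^sub>MA * ||x||" if "x\<in>|A|" for x
   using order_trans[OF lact_le[of m "lact n x"] mult_left_mono[OF lact_le[of n x]]] \<open>m\<in>_\<close> \<open>n\<in>_\<close> that
   by (simp add: mnorm_nonneg mult.assoc)
 qed (use that mult_in mnorm_nonneg in auto)
 show ?thesis
 proof
  show "cstar_seminorm MA (cnorm MA)"
   unfolding cstar_seminorm_def
  proof (intro conjI ballI allI)
   fix m n c assume m: "m\<in>|MA|" and n: "n\<in>|MA|"
   show "0\<le>||m||\<^sub>MA" by (rule mnorm_nonneg[OF m])
   show "||m\<oplus>\<^sub>MA n||\<^sub>MA\<le>||m||\<^sub>MA + ||n||\<^sub>MA"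
   proof (rule mnorm_le)
    show "||lact (m\<oplus>\<^sub>MA n) x||\<le>( ||m||\<^sub>MA + ||n||\<^sub>MA) * ||x||" if "x\<in>|A|" for x
     using norm_triangle[of "lact m x" "lact n x"] lact_le[OF m that] lact_le[OF n that] m n that
     by (simp add: ring_distribs)
   qed (use m n mult_in mnorm_nonneg in auto)
   show "||m\<cdot>\<^sub>MA n||\<^sub>MA\<le>||m||\<^sub>MA * ||n||\<^sub>MA" by (rule mult_le[OF m n])
   have sm: "||c\<odot>\<^sub>MA m||\<^sub>MA\<le>cmod c * ||m||\<^sub>MA" if m: "m\<in>|MA|" for m and c
   proof (rule mnorm_le)
    show "||lact (c\<odot>\<^sub>MA m) x||\<le>cmod c * ||m||\<^sub>MA * ||x||" if "x\<in>|A|" for x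
     using mult_left_mono[OF lact_le[OF m that], of "cmod c"] m that by (simp add: norm_smult mult.assoc)
   qed (use m mult_in mnorm_nonneg in auto)
   show "||c\<odot>\<^sub>MA m||\<^sub>MA = cmod c * ||m||\<^sub>MA"
   proof (cases "c = 0")
    case True
    then show ?thesis using sm[OF m, of 0] mnorm_nonneg[OF mult_smult_in[OF m, of 0]] by simp
   next
    case False
    then have "||m||\<^sub>MA\<le>inverse (cmod c) * ||c\<odot>\<^sub>MA m||\<^sub>MA"
     using sm[OF mult_smult_in[OF m, of c], of "inverse c"] m by (simp add: norm_inverse)
    then show ?thesis using sm[OF m, of c] False by (simp add: field_simps)
   qed
   show "||m\<star>\<^sub>MA\<cdot>\<^sub>MA m||\<^sub>MA = ( ||m||\<^sub>MA)\<^sup>2"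
   proof (rule antisym)
    have "||m\<star>\<^sub>MA\<cdot>\<^sub>MA m||\<^sub>MA\<le>||m\<star>\<^sub>MA||\<^sub>MA * ||m||\<^sub>MA"
     by (rule mult_le) (use m mult_in in auto)
    also have "\<dots>\<le>||m||\<^sub>MA * ||m||\<^sub>MA"
     by (rule mult_right_mono[OF adj_le[OF m] mnorm_nonneg[OF m]])
    finally show "||m\<star>\<^sub>MA\<cdot>\<^sub>MA m||\<^sub>MA\<le>( ||m||\<^sub>MA)\<^sup>2" by (simp add: power2_eq_square)
    let ?N = "||m\<star>\<^sub>MA\<cdot>\<^sub>MA m||\<^sub>MA"
    have mm: "m\<star>\<^sub>MA\<cdot>\<^sub>MA m\<in>|MA|" using m mult_in by auto
    have "||m||\<^sub>MA\<le>sqrt ?N"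
    proof (rule mnorm_le[OF m])
     show "0\<le>sqrt ?N" using mnorm_nonneg[OF mm] by simp
     fix x assume x: "x\<in>|A|"
     note [simp] = x lact_in[OF m] ract_in[OF m]
     \<comment> \<open>The C*-identity for operators: (mx)\<star>(mx) = x\<star>(m\<star>m)x, so the
       norm of m\<star>m controls m on every vector.\<close>
     have "(lact m x)\<star>\<cdot>lact m x = x\<star>\<cdot>lact (m\<star>\<^sub>MA\<cdot>\<^sub>MA m) x"
      using arg_cong[OF ract_lact[OF m, of "(lact m x)\<star>" x], of "cadj A"] m by (simp add: adj_mult adj_adj)
     then have "||lact m x||\<^sup>2 = ||x\<star>\<cdot>lact (m\<star>\<^sub>MA\<cdot>\<^sub>MA m) x||"
      using norm_cstar[of "lact m x"] by simp
     also have "\<dots>\<le>||x|| * (?N * ||x||)"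
      using order_trans[OF norm_mult mult_left_mono[OF lact_le[OF mm x]], of "x\<star>"] lact_in[OF mm x] by simp
     finally have "||lact m x||\<^sup>2\<le>(sqrt ?N * ||x||)\<^sup>2"
      using mnorm_nonneg[OF mm] by (simp add: power_mult_distrib power2_eq_square mult_ac)
     then show "||lact m x||\<le>sqrt ?N * ||x||"
      by (rule power2_le_imp_le) (use mnorm_nonneg[OF mm] in simp)
    qed
    then have "( ||m||\<^sub>MA)\<^sup>2\<le>(sqrt ?N)\<^sup>2" using mnorm_nonneg[OF m] by (rule power_mono)
    then show "( ||m||\<^sub>MA)\<^sup>2\<le>?N" using mnorm_nonneg[OF mm] by simp
   qed
  qed
 qed
qed

lemma lact_diff: "m\<in>|MA| ==> n\<in>|MA| ==> x\<in>|A| ==> lact (m\<ominus>\<^sub>MA n) x = lact m x\<ominus>lact n x"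
 and ract_diff: "m\<in>|MA| ==> n\<in>|MA| ==> x\<in>|A| ==> ract (m\<ominus>\<^sub>MA n) x = ract m x\<ominus>ract n x"
 using star_algebra.diff_eq[OF star_algebra_multiplier] by (simp_all add: diff_eq)

text \<open>Left and right actions of a Cauchy sequence converge pointwise. The limits again form a
  double centralizer, because the centralizer identity passes to limits and the uniform estimate
  gives boundedness.\<close>

lemma cstar_multiplier: "cstar_algebra MA"
proof -
 interpret M: pre_cstar MA by (rule pre_cstar_multiplier)
 show ?thesis
 proof (rule M.cstar_algebraI)
  fix m assume m: "m\<in>|MA|" "||m||\<^sub>MA = 0"
  show "m = \<zero>\<^sub>MA"
  proof (rule multiplier_eqI)
   show "lact m x = lact \<zero>\<^sub>MA x" if "x\<in>|A|" for x
   proof -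
    have "||lact m x||\<le>0" using lact_le[OF m(1) that] m(2) by simp
    then have "||lact m x|| = 0" using norm_nonneg[OF lact_in[OF m(1) that]] by linarith
    then show ?thesis using m that by simp
   qed
  qed (use m in auto)
 next
  fix s :: "nat=>_" assume s [simp]: "\<And>n. s n\<in>|MA|"
   and Cau: "\<And>\<epsilon>. \<epsilon> > 0 ==> \<exists>N. \<forall>m\<ge>N. \<forall>n\<ge>N. ||s m\<ominus>\<^sub>MA s n||\<^sub>MA < \<epsilon>"
  have Cau': "\<exists>N. \<forall>m\<ge>N. \<forall>n\<ge>N. ||f (s m)\<ominus>f (s n)|| < \<epsilon>"
   if f: "\<And>m. m\<in>|MA| ==> f m\<in>|A|"
    "\<And>m n. m\<in>|MA| ==> n\<in>|MA| ==> ||f m\<ominus>f n||\<le>||m\<ominus>\<^sub>MA n||\<^sub>MA * K"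
    "K\<ge>0" "\<epsilon> > 0" for f K and \<epsilon> :: real
  proof -
   have "\<epsilon> / (K + 1) > 0" using that by (simp add: add_nonneg_pos)
   from Cau[OF this] obtain N where
    N: "\<And>m n. m\<ge>N ==> n\<ge>N ==> ||s m\<ominus>\<^sub>MA s n||\<^sub>MA < \<epsilon> / (K + 1)" by blast
   have "||f (s m)\<ominus>f (s n)|| < \<epsilon>" if "m\<ge>N" "n\<ge>N" for m n
   proof -
    have "||s m\<ominus>\<^sub>MA s n||\<^sub>MA * K\<le>||s m\<ominus>\<^sub>MA s n||\<^sub>MA * (K + 1)"
     using f by (intro mult_left_mono) auto
    also have "\<dots> < \<epsilon>" using N[OF that] f(3) by (simp add: pos_less_divide_eq add_nonneg_pos)
    finally show ?thesis using f(2)[of "s m" "s n"] by simp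
   qed
   then show ?thesis by blast
  qed
  have "\<forall>x\<in>|A|. \<exists>y. tends A (\<lambda>n. lact (s n) x) y"
  proof
   fix x assume x: "x\<in>|A|"
   show "\<exists>y. tends A (\<lambda>n. lact (s n) x) y"
    by (rule Cauchy_tends[of "\<lambda>n. lact (s n) x"])
     (use Cau'[of "\<lambda>m. lact m x" "||x||"] lact_le x in \<open>auto simp: lact_diff[symmetric]\<close>)
  qed
  then obtain L where L: "\<And>x. x\<in>|A| ==> tends A (\<lambda>n. lact (s n) x) (L x)" by metis
  have "\<forall>x\<in>|A|. \<exists>y. tends A (\<lambda>n. ract (s n) x) y"
  proof
   fix x assume x: "x\<in>|A|"
   show "\<exists>y. tends A (\<lambda>n. ract (s n) x) y"
    by (rule Cauchy_tends[of "\<lambda>n. ract (s n) x"])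
     (use Cau'[of "\<lambda>m. ract m x" "||x||"] ract_le x in \<open>auto simp: ract_diff[symmetric]\<close>)
  qed
  then obtain R where R: "\<And>x. x\<in>|A| ==> tends A (\<lambda>n. ract (s n) x) (R x)" by metis
  have LR: "R x\<cdot>y = x\<cdot>L y" if "x\<in>|A|" "y\<in>|A|" for x y
  proof -
   have "tends A (\<lambda>n. ract (s n) x\<cdot>y) (R x\<cdot>y)" using R[OF that(1)] tends_const[OF that(2)] by (rule tends_mult)
   moreover have "tends A (\<lambda>n. x\<cdot>lact (s n) y) (x\<cdot>L y)" using tends_const[OF that(1)] L[OF that(2)] by (rule tends_mult)
   ultimately show ?thesis using tends_unique that by (simp add: ract_lact)
  qed
  \<comment> \<open>Letting the second index tend to infinity in the Cauchy condition keeps the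
    bound uniform over the unit ball. This upgrades pointwise limits to norm limits.\<close>
  have est: "\<exists>N. \<forall>n\<ge>N. \<forall>x\<in>|A|. ||lact (s n) x\<ominus>L x||\<le>\<epsilon> * ||x||" if e: "\<epsilon> > 0" for \<epsilon>
  proof -
   obtain N where N: "\<And>m n. m\<ge>N ==> n\<ge>N ==> ||s m\<ominus>\<^sub>MA s n||\<^sub>MA < \<epsilon>" using Cau[OF e] by blast
   have "||lact (s n) x\<ominus>L x||\<le>\<epsilon> * ||x||" if "n\<ge>N" "x\<in>|A|" for n x
   proof (rule LIMSEQ_le_const2)
    show "(\<lambda>m. ||lact (s n) x\<ominus>lact (s m) x||)\<longlonglongrightarrow>||lact (s n) x\<ominus>L x||"
     using that L by (intro tends_norm tends_diff tends_const) auto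
    have "||lact (s n) x\<ominus>lact (s m) x||\<le>\<epsilon> * ||x||" if m: "m\<ge>N" for m
    proof -
     have "||lact (s n) x\<ominus>lact (s m) x||\<le>||s n\<ominus>\<^sub>MA s m||\<^sub>MA * ||x||"
      using lact_le[of "s n\<ominus>\<^sub>MA s m" x] \<open>x\<in>|A|\<close> by (simp add: lact_diff)
     also have "\<dots>\<le>\<epsilon> * ||x||" using N[OF \<open>n\<ge>N\<close> m] \<open>x\<in>|A|\<close> by (intro mult_right_mono) auto
     finally show ?thesis .
    qed
    then show "\<exists>k. \<forall>m\<ge>k. ||lact (s n) x\<ominus>lact (s m) x||\<le>\<epsilon> * ||x||" by blast
   qed
   then show ?thesis by blast
  qed
  define l where "l = (\<lambda>x\<in>|A|. L x, \<lambda>x\<in>|A|. R x)"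
  have Lin: "L x\<in>|A|" "R x\<in>|A|" if "x\<in>|A|" for x using tends_in(2) L R that by blast+
  obtain N where N: "\<And>x. x\<in>|A| ==> ||lact (s N) x\<ominus>L x||\<le>1 * ||x||" using est[of 1] by auto
  have l: "l\<in>|MA|"
   unfolding l_def
  proof (rule multiplierI)
   show "||L x||\<le>( ||s N||\<^sub>MA + 1) * ||x||" if x: "x\<in>|A|" for x
    using norm_le_plus_diff[of "L x" "lact (s N) x"] N[OF x] lact_le[OF s x, of N] Lin[OF x] x
    by (simp add: ring_distribs norm_diff_commute)
  qed (use LR Lin in auto)
  have "tends MA s l"
   unfolding tends_def
  proof (intro conjI allI s l)
   show "(\<lambda>n. ||s n\<ominus>\<^sub>MA l||\<^sub>MA)\<longlonglongrightarrow>0"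
    unfolding lim_sequentially
   proof (intro allI impI)
    fix r :: real assume r: "r > 0"
    obtain N where N: "\<And>n x. n\<ge>N ==> x\<in>|A| ==> ||lact (s n) x\<ominus>L x||\<le>r / 2 * ||x||"
     using est[of "r / 2"] r by auto
    have "||s n\<ominus>\<^sub>MA l||\<^sub>MA\<le>r / 2" if "n\<ge>N" for n
    proof (rule mnorm_le)
     show "||lact (s n\<ominus>\<^sub>MA l) x||\<le>r / 2 * ||x||" if "x\<in>|A|" for x
      using N[OF \<open>n\<ge>N\<close> that] that l by (simp add: lact_diff l_def)
    qed (use r l in auto)
    then show "\<exists>N. \<forall>n\<ge>N. dist ( ||s n\<ominus>\<^sub>MA l||\<^sub>MA) 0 < r"
     using r l by (intro exI[of _ N] allI impI) (force simp: dist_real_def)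
   qed
  qed
  then show "\<exists>x. tends MA s x" by blast
 qed
qed

lemma unital_multiplier: "unital_cstar MA"
proof -
 interpret M: cstar_algebra MA by (rule cstar_multiplier)
 show ?thesis
  by unfold_locales ((rule multiplier_eqI)?; simp add: mult_in)+
qed

lemma lact_J [simp]: "x\<in>|A| ==> lact (J a) x = a\<cdot>x"
 and ract_J [simp]: "x\<in>|A| ==> ract (J a) x = x\<cdot>a"
 by (simp_all add: to_multiplier_def)

lemma J_in [simp]: assumes "a\<in>|A|" shows "J a\<in>|MA|"
 unfolding to_multiplier_def
 by (rule multiplierI[of _ _ "||a||"]) (use assms norm_mult in \<open>auto simp: mult_assoc\<close>)

lemma J_hom: "star_hom A MA J"
 unfolding star_hom_def
 by (intro conjI allI ballI funcsetI; (rule multiplier_eqI)?;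
  simp add: mult_in distrib_right smult_mult_left mult_assoc adj_mult adj_adj)

lemma J_norm: assumes a: "a\<in>|A|" shows "||J a||\<^sub>MA = ||a||"
proof (rule antisym)
 show "||J a||\<^sub>MA\<le>||a||" by (rule mnorm_le) (use a norm_mult in auto)
 show "||a||\<le>||J a||\<^sub>MA"
 proof (cases "||a|| = 0")
  case True
  then show ?thesis using mnorm_nonneg[OF J_in[OF a]] by linarith
 next
  case False
  then have p: "||a|| > 0" using norm_nonneg[OF a] by (simp del: norm_eq_zero norm_nonneg)
  have "||a|| * ||a||\<le>||J a||\<^sub>MA * ||a||"
   using lact_le[OF J_in[OF a], of "a\<star>"] a norm_cstar'[OF a] by (simp add: power2_eq_square)
  then show ?thesis using p mult_le_cancel_right_pos by blast
 qed
qed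

lemma mult_J: "m\<in>|MA| ==> a\<in>|A| ==> m\<cdot>\<^sub>MA J a = J (lact m a)"
 by (rule multiplier_eqI) (simp_all add: mult_in lact_mult)

lemma J_mult: "m\<in>|MA| ==> a\<in>|A| ==> J a\<cdot>\<^sub>MA m = J (ract m a)"
 by (rule multiplier_eqI) (simp_all add: mult_in ract_lact)

lemma J_diff: "a\<in>|A| ==> b\<in>|A| ==> J (a\<ominus>b) = J a\<ominus>\<^sub>MA J b"
 by (rule star_hom_diff[OF star_algebra_axioms star_algebra_multiplier J_hom])

lemma J_zero: "J \<zero> = \<zero>\<^sub>MA"
 by (rule star_hom_zero[OF star_algebra_axioms star_algebra_multiplier J_hom])

lemmas J_simps = star_hom_simps[OF J_hom]

text \<open>\<open>J\<close> is isometric, so convergence of the images forces the sequence in A to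
  be Cauchy. In other words, A is closed in M(A).\<close>

lemma J_tends: assumes "\<And>n. s n\<in>|A|" "tends MA (\<lambda>n. J (s n)) m"
 obtains a where "a\<in>|A|" "m = J a" "tends A s a"
proof -
 interpret M: cstar_algebra MA by (rule cstar_multiplier)
 note [simp] = assms(1)
 obtain a where a: "tends A s a"
 proof (rule Cauchy_tends[of s])
  fix \<epsilon> :: real assume e: "\<epsilon> > 0"
  have "(\<lambda>n. ||J (s n)\<ominus>\<^sub>MA m||\<^sub>MA)\<longlonglongrightarrow>0" using assms(2) by (simp add: tends_def)
  from LIMSEQ_D[OF this, of "\<epsilon> / 2"] e
  obtain N where "\<And>n. n\<ge>N ==> norm ( ||J (s n)\<ominus>\<^sub>MA m||\<^sub>MA - 0) < \<epsilon> / 2" by auto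
  then have N: "||J (s n)\<ominus>\<^sub>MA m||\<^sub>MA < \<epsilon> / 2" if "n\<ge>N" for n
   using that abs_le_D1[of "||J (s n)\<ominus>\<^sub>MA m||\<^sub>MA"] by fastforce
  have "||s i\<ominus>s j|| < \<epsilon>" if "i\<ge>N" "j\<ge>N" for i j
  proof -
   have "||s i\<ominus>s j|| = ||J (s i)\<ominus>\<^sub>MA J (s j)||\<^sub>MA" by (simp add: J_norm flip: J_diff)
   then show ?thesis
    using M.norm_dist_triangle[of "J (s i)" m "J (s j)"] N[OF that(1)] N[OF that(2)] M.tends_in(2)[OF assms(2)]
    by (simp add: M.norm_diff_commute)
  qed
  then show "\<exists>N. \<forall>i\<ge>N. \<forall>j\<ge>N. ||s i\<ominus>s j|| < \<epsilon>" by blast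
 qed auto
 note [simp] = tends_in(2)[OF a]
 have "tends MA (\<lambda>n. J (s n)) (J a)"
  by (rule M.tendsI[where r = "\<lambda>n. ||s n\<ominus>a||"]) (use a in \<open>auto simp: tends_def J_norm simp flip: J_diff\<close>)
 then show ?thesis using that[of a] M.tends_unique[OF assms(2)] a by simp
qed

lemma J_ideal: "closed_ideal MA (J ` |A| )"
proof -
 interpret M: cstar_algebra MA by (rule cstar_multiplier)
 show ?thesis
  unfolding closed_ideal_def
 proof (intro conjI)
  show "submodule (J ` |A| ) complex_ring MA"
   by (rule M.submoduleI') (auto simp: J_zero[symmetric] simp flip: J_simps(2,3))
  show "closedin (norm_topology MA) (J ` |A| )"
   unfolding M.closedin_iff
  proof (intro conjI allI impI)
   fix s m assume "(\<forall>n. s n\<in>J ` |A| )\<and>tends MA s m"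
   then have s: "\<And>n. s n\<in>J ` |A|" "tends MA s m" by auto
   have "\<forall>n. \<exists>a. a\<in>|A|\<and>s n = J a" using s(1) by blast
   from choice[OF this] obtain t where t: "\<And>n. t n\<in>|A|" "\<And>n. s n = J (t n)" by blast
   then have "s = (\<lambda>n. J (t n))" by auto
   then have "tends MA (\<lambda>n. J (t n)) m" using s(2) by simp
   then show "m\<in>J ` |A|" using J_tends[of t m] t(1) by blast
  qed auto
  show "\<forall>x\<in>J ` |A|. \<forall>y\<in>|MA|. x\<cdot>\<^sub>MA y\<in>J ` |A|\<and>y\<cdot>\<^sub>MA x\<in>J ` |A|"
   by (auto simp: J_mult mult_J)
 qed
qed

end

section \<open>Positivity and homomorphisms of C*-algebras\<close>

context cstar_algebra
begin

text \<open>A need not have a unit, so its order is borrowed from the multiplier algebra.\<close>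

definition Pos :: "'a=>bool" where
 "Pos x\<longleftrightarrow>x\<in>|A|\<and>unital_cstar.pos MA (J x)"

lemma Pos_in [simp]: "Pos x ==> x\<in>|A|"
 by (simp add: Pos_def)

lemma Pos_cstar: "x\<in>|A| ==> Pos (x\<star>\<cdot>x)"
 unfolding Pos_def using unital_cstar.cstar_pos[OF unital_multiplier, of "J x"] by (simp add: J_simps)

lemma Pos_cpos: "cpos A x ==> Pos x"
 unfolding cpos_def using Pos_cstar by blast

lemma Pos_add: "Pos x ==> Pos y ==> Pos (x\<oplus>y)"
 unfolding Pos_def using unital_cstar.pos_add[OF unital_multiplier, of "J x" "J y"] by (simp add: J_simps)

lemma Pos_zero: "Pos \<zero>"
 using Pos_cstar[of \<zero>] by simp

lemma Pos_finsum: "finite F ==> (\<And>i. i\<in>F ==> Pos (f i)) ==> Pos (\<Oplus>i\<in>F. f i)"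
proof (induction F rule: finite_induct)
 case (insert i F)
 then show ?case by (subst M.finsum_insert) (auto intro: Pos_add)
qed (simp add: Pos_zero)

lemma Pos_norm_mono: assumes "Pos p" "Pos q" shows "||p||\<le>||p\<oplus>q||"
 using unital_cstar.pos_norm_mono[OF unital_multiplier, of "J p" "J q"] assms
 by (simp add: Pos_def J_norm flip: J_simps(2))

text \<open>With e the defect of x, formally (1 - e)^2 = 1 - x, so y = (1 - e)h. Written as h - eh
  it lies in A, whether or not A has a unit.\<close>

lemma sandwich_square:
 assumes "sa x" "||x||\<le>1" "h\<in>|A|"
 obtains y where "y\<in>|A|" "h\<star>\<cdot>h\<ominus>h\<star>\<cdot>x\<cdot>h = y\<star>\<cdot>y"
proof -
 have x: "x\<in>|A|" using assms(1) by simp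
 define e where "e = sqrt_defect A x"
 have e: "sa e" "e\<cdot>e = 2\<odot>e\<ominus>x"
  unfolding e_def using sqrt_defect_sa[OF x assms(2,1)] sqrt_defect_eq[OF x assms(2)] by blast+
 note [simp] = x assms(3) e(1)
 have "(h\<ominus>e\<cdot>h)\<star>\<cdot>(h\<ominus>e\<cdot>h) = h\<star>\<cdot>h\<ominus>2\<odot>(h\<star>\<cdot>e\<cdot>h)\<oplus>h\<star>\<cdot>(e\<cdot>e)\<cdot>h" by ((simp add: expand)?; (rule linI, (rule lins | (simp add: algebra_simps; fail))+))
 also have "\<dots> = h\<star>\<cdot>h\<ominus>h\<star>\<cdot>x\<cdot>h" unfolding e(2) by ((simp add: expand)?; (rule linI, (rule lins | (simp add: algebra_simps; fail))+))
 finally show ?thesis using that[of "h\<ominus>e\<cdot>h"] by simp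
qed

text \<open>This is (zh)\<star>(zh) \<le> t h\<star>h with an explicit witness in A. The form
  \<open>cpos\<close> is the one in which hereditary subalgebras are tested.\<close>

lemma cpos_sandwich:
 assumes "z\<in>|A|" "h\<in>|A|" "||z||\<^sup>2\<le>t" "0 < t"
 shows "cpos A (of_real t\<odot>(h\<star>\<cdot>h)\<ominus>(z\<cdot>h)\<star>\<cdot>(z\<cdot>h))"
proof -
 note [simp] = assms(1,2)
 let ?x = "of_real (inverse t)\<odot>(z\<star>\<cdot>z)"
 have "||?x||\<le>1" by (rule norm_scale_le) (use assms in \<open>auto simp: norm_cstar\<close>)
 moreover have "sa ?x" by (intro sa_smult sa_cstar) simp
 ultimately obtain y where y: "y\<in>|A|" "h\<star>\<cdot>h\<ominus>h\<star>\<cdot>?x\<cdot>h = y\<star>\<cdot>y"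
  using sandwich_square[of ?x h] by auto
 have s: "of_real (sqrt t) * (of_real (sqrt t) * c) = of_real t * (c :: complex)" for c
  using assms(4) by (simp add: mult.assoc[symmetric] flip: of_real_mult)
 have "(of_real (sqrt t)\<odot>y)\<star>\<cdot>(of_real (sqrt t)\<odot>y) = of_real t\<odot>(y\<star>\<cdot>y)"
  using y(1) s[of 1] by (simp add: adj_smult smult_mult_left smult_mult_right)
 also have "\<dots> = of_real t\<odot>(h\<star>\<cdot>h)\<ominus>(z\<cdot>h)\<star>\<cdot>(z\<cdot>h)"
  unfolding y(2)[symmetric] using assms(4) by (simp add: expand)
 finally show ?thesis unfolding cpos_def using y(1) by (metis smult_in)
qed

end

text \<open>For a self-adjoint contraction a, the defect e of a^2 satisfies a^2 + (1 - e)^2 = 1.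
  Written without the unit this is an identity in A, so it survives under \<phi>; in M(B) the unit
  is restored and \<open>unitary_bound\<close> applies. The C*-identity reduces the general case to
  self-adjoint elements.\<close>

theorem star_hom_contractive:
 assumes A: "cstar_algebra A" and B: "cstar_algebra B" and h: "star_hom A B \<phi>" and x: "x\<in>|A|"
 shows "||\<phi> x||\<^sub>B\<le>||x||\<^sub>A"
proof -
 interpret A: cstar_algebra A by fact
 interpret B: cstar_algebra B by fact
 interpret MB: unital_cstar "multiplier_algebra B" by (rule B.unital_multiplier)
 note hs = star_hom_simps[OF h] star_hom_diff[OF A.star_algebra_axioms B.star_algebra_axioms h]
 have one: "||\<phi> a||\<^sub>B\<le>1" if a: "A.sa a" "||a||\<^sub>A\<le>1" for a
 proof -
  have aA [simp]: "a\<in>|A|" using a by simp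
  let ?t = "a\<cdot>\<^sub>A a"
  have t: "?t\<in>|A|" "||?t||\<^sub>A\<le>1" "A.sa ?t"
   using a A.norm_mult[of a a] mult_le_one[OF a(2) _ a(2)] A.sa_square by (auto intro: order_trans)
  define e where "e = sqrt_defect A ?t"
  have e: "A.sa e" "e\<cdot>\<^sub>A e = 2\<odot>\<^sub>A e\<ominus>\<^sub>A ?t" "a\<cdot>\<^sub>A e = e\<cdot>\<^sub>A a"
   unfolding e_def using A.sqrt_defect_sa[OF t] A.sqrt_defect_eq[OF t(1,2)]
    A.sqrt_defect_commute[OF t(1,2) aA] by (auto simp: A.mult_assoc)
  have eA [simp]: "e\<in>|A|" using e by simp
  define b where "b = to_multiplier B (\<phi> a)"
  define d where "d = to_multiplier B (\<phi> e)"
  have [simp]: "\<phi> a\<in>|B|" "\<phi> e\<in>|B|" using hs by auto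
  have bd: "MB.sa b" "MB.sa d"
   using A.sa_adj[OF a(1)] A.sa_adj[OF e(1)] hs(5)[of a] hs(5)[of e]
   by (simp_all add: b_def d_def MB.sa_def B.J_simps(5)[symmetric] del: MB.sa_in MB.sa_adj)
  note [simp] = bd
  have com: "b\<cdot>\<^bsub>multiplier_algebra B\<^esub> d = d\<cdot>\<^bsub>multiplier_algebra B\<^esub> b"
   using arg_cong[OF e(3), of \<phi>] by (simp add: b_def d_def hs flip: B.J_simps(4))
  have "\<phi> e\<cdot>\<^sub>B \<phi> e = 2\<odot>\<^sub>B \<phi> e\<ominus>\<^sub>B \<phi> a\<cdot>\<^sub>B \<phi> a"
   using arg_cong[OF e(2), of \<phi>] by (simp add: hs)
  from arg_cong[OF this, of "to_multiplier B"]
  have dd: "d\<cdot>\<^bsub>multiplier_algebra B\<^esub> d = 2\<odot>\<^bsub>multiplier_algebra B\<^esub> d\<ominus>\<^bsub>multiplier_algebra B\<^esub> b\<cdot>\<^bsub>multiplier_algebra B\<^esub> b"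
   by (simp add: b_def d_def B.J_simps B.J_diff)
  let ?c = "\<one>\<^bsub>multiplier_algebra B\<^esub>\<ominus>\<^bsub>multiplier_algebra B\<^esub> d"
  have "?c\<cdot>\<^bsub>multiplier_algebra B\<^esub> ?c = \<one>\<^bsub>multiplier_algebra B\<^esub>\<ominus>\<^bsub>multiplier_algebra B\<^esub> 2\<odot>\<^bsub>multiplier_algebra B\<^esub> d
    \<oplus>\<^bsub>multiplier_algebra B\<^esub> d\<cdot>\<^bsub>multiplier_algebra B\<^esub> d"
   by ((simp add: MB.expand)?; (rule MB.linI, (rule MB.lins | (simp add: algebra_simps; fail))+))
  then have cc: "b\<cdot>\<^bsub>multiplier_algebra B\<^esub> b\<oplus>\<^bsub>multiplier_algebra B\<^esub> ?c\<cdot>\<^bsub>multiplier_algebra B\<^esub> ?c = \<one>\<^bsub>multiplier_algebra B\<^esub>"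
   unfolding dd by (simp only:) ((simp add: MB.expand)?; (rule MB.linI, (rule MB.lins | (simp add: algebra_simps; fail))+))
  have "||b||\<^bsub>multiplier_algebra B\<^esub>\<le>1"
   by (rule MB.unitary_bound[of b ?c]) (use com cc in \<open>auto simp: MB.distrib_left_diff MB.distrib_right_diff intro: MB.sa_diff\<close>)
  then show ?thesis by (simp add: b_def B.J_norm)
 qed
 have sa_le: "||\<phi> a||\<^sub>B\<le>||a||\<^sub>A" if a: "A.sa a" for a
 proof (rule field_le_epsilon)
  fix \<epsilon> :: real assume "0 < \<epsilon>"
  let ?K = "||a||\<^sub>A + \<epsilon>"
  have aA: "a\<in>|A|" using a by simp
  have K: "?K > 0" using \<open>0 < \<epsilon>\<close> aA by (simp add: add_nonneg_pos)
  have *: "||\<phi> (of_real (inverse ?K)\<odot>\<^sub>A a)||\<^sub>B\<le>1"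
   by (rule one) (use a K \<open>0 < \<epsilon>\<close> in \<open>auto intro!: A.sa_smult A.norm_scale_le simp del: of_real_inverse\<close>)
  have e: "||\<phi> (of_real (inverse ?K)\<odot>\<^sub>A a)||\<^sub>B = inverse ?K * ||\<phi> a||\<^sub>B"
   using aA K hs(1)[OF aA] by (simp add: hs(3) B.norm_smult norm_inverse del: of_real_inverse of_real_add)
  from * have "inverse ?K * ||\<phi> a||\<^sub>B\<le>1" unfolding e .
  then show "||\<phi> a||\<^sub>B\<le>?K" using K by (simp add: field_simps)
 qed
 have "( ||\<phi> x||\<^sub>B)\<^sup>2 = ||\<phi> (x\<star>\<^sub>A\<cdot>\<^sub>A x)||\<^sub>B"
  using x hs(1)[OF x] by (simp add: hs B.norm_cstar)
 also have "\<dots>\<le>( ||x||\<^sub>A)\<^sup>2"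
  using sa_le[OF A.sa_cstar[OF x]] A.norm_cstar[OF x] by simp
 finally show ?thesis by (rule power2_le_imp_le) (use x in simp)
qed

section \<open>Completions\<close>

lemma (in star_algebra) neg_add:
 assumes "x\<in>|A|" shows "(-1)\<odot>x\<oplus>x = \<zero>" "x\<oplus>(-1)\<odot>x = \<zero>"
 using assms M.l_neg[of x] M.r_neg[of x] by (simp_all add: uminus_eq)

context pre_cstar
begin

abbreviation "CA\<equiv>completion A"
definition cls :: "(nat=>'a)=>(nat=>'a) set" where "cls s = null_rel A `` {s}"

lemma cauchy_in: "s\<in>cauchy_seqs A ==> s n\<in>|A|"
 by (simp add: cauchy_seqs_def)

lemma cauchyI:
 assumes "\<And>n. s n\<in>|A|" "\<And>\<epsilon>. \<epsilon> > 0 ==> \<exists>N. \<forall>m\<ge>N. \<forall>n\<ge>N. ||s m\<ominus>s n|| < \<epsilon>"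
 shows "s\<in>cauchy_seqs A"
 using assms by (simp add: cauchy_seqs_def)

lemma cauchyD:
 assumes "s\<in>cauchy_seqs A" "\<epsilon> > 0" obtains N where "\<And>m n. m\<ge>N ==> n\<ge>N ==> ||s m\<ominus>s n|| < \<epsilon>"
 using assms unfolding cauchy_seqs_def by blast

lemma cauchy_const: "x\<in>|A| ==> (\<lambda>n. x)\<in>cauchy_seqs A"
 by (simp add: cauchy_seqs_def)

lemma cauchy_norm: assumes "s\<in>cauchy_seqs A" shows "Cauchy (\<lambda>n. ||s n||)"
proof (rule CauchyI)
 fix e :: real assume e: "0 < e"
 obtain N where N: "\<And>m n. m\<ge>N ==> n\<ge>N ==> ||s m\<ominus>s n|| < e" using cauchyD[OF assms e] by blast
 have "norm ( ||s m|| - ||s n||) < e" if "m\<ge>N" "n\<ge>N" for m n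
  using N[OF that] norm_diff_ineq[OF cauchy_in[OF assms, of m] cauchy_in[OF assms, of n]] by simp
 then show "\<exists>M. \<forall>m\<ge>M. \<forall>n\<ge>M. norm ( ||s m|| - ||s n||) < e" by blast
qed

lemma cauchy_norm_lim: "s\<in>cauchy_seqs A ==> (\<lambda>n. ||s n||)\<longlonglongrightarrow>lim (\<lambda>n. ||s n||)"
 using cauchy_norm Cauchy_convergent convergent_LIMSEQ_iff by blast

lemma cauchy_bdd: assumes "s\<in>cauchy_seqs A" obtains C where "C > 0" "\<And>n. ||s n||\<le>C"
proof -
 obtain C where "C > 0" "\<And>n. norm ( ||s n||)\<le>C"
  using Cauchy_Bseq[OF cauchy_norm[OF assms]] unfolding Bseq_def by blast
 then show ?thesis using that[of C] by (metis abs_le_D1 real_norm_def)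
qed

lemma cauchy_dominated:
 assumes "s\<in>cauchy_seqs A" "t\<in>cauchy_seqs A" "\<And>n. u n\<in>|A|" "C > 0"
  "\<And>m n. ||u m\<ominus>u n||\<le>C * ( ||s m\<ominus>s n|| + ||t m\<ominus>t n||)"
 shows "u\<in>cauchy_seqs A"
proof (rule cauchyI[OF assms(3)])
 fix \<epsilon> :: real assume e: "\<epsilon> > 0"
 then have e': "\<epsilon> / (2 * C) > 0" using assms(4) by simp
 obtain N where N: "\<And>m n. m\<ge>N ==> n\<ge>N ==> ||s m\<ominus>s n|| < \<epsilon> / (2 * C)" using cauchyD[OF assms(1) e'] by blast
 obtain N' where N': "\<And>m n. m\<ge>N' ==> n\<ge>N' ==> ||t m\<ominus>t n|| < \<epsilon> / (2 * C)" using cauchyD[OF assms(2) e'] by blast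
 have "||u m\<ominus>u n|| < \<epsilon>" if "m\<ge>max N N'" "n\<ge>max N N'" for m n
 proof -
  have "||s m\<ominus>s n|| + ||t m\<ominus>t n|| < \<epsilon> / (2 * C) + \<epsilon> / (2 * C)" using N[of m n] N'[of m n] that by simp
  then have "C * ( ||s m\<ominus>s n|| + ||t m\<ominus>t n||) < C * (\<epsilon> / (2 * C) + \<epsilon> / (2 * C))"
   using assms(4) by (rule mult_strict_left_mono)
  also have "\<dots> = \<epsilon>" using assms(4) by (simp add: field_simps)
  finally show ?thesis using assms(5)[of m n] by linarith
 qed
 then show "\<exists>N. \<forall>m\<ge>N. \<forall>n\<ge>N. ||u m\<ominus>u n|| < \<epsilon>" by blast
qed

lemma add_diff_le:
 assumes "x\<in>|A|" "y\<in>|A|" "x'\<in>|A|" "y'\<in>|A|"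
 shows "||(x\<oplus>y)\<ominus>(x'\<oplus>y')||\<le>||x\<ominus>x'|| + ||y\<ominus>y'||"
proof -
 note [simp] = assms
 have "(x\<oplus>y)\<ominus>(x'\<oplus>y') = (x\<ominus>x')\<oplus>(y\<ominus>y')" by ((simp add: expand)?; (rule linI, (rule lins | (simp add: algebra_simps; fail))+))
 then show ?thesis using norm_triangle[of "x\<ominus>x'" "y\<ominus>y'"] by simp
qed

lemma mult_diff_le:
 assumes "x\<in>|A|" "y\<in>|A|" "x'\<in>|A|" "y'\<in>|A|" "||x'||\<le>C" "||y||\<le>C"
 shows "||x\<cdot>y\<ominus>x'\<cdot>y'||\<le>C * ( ||x\<ominus>x'|| + ||y\<ominus>y'||)"
proof -
 note [simp] = assms(1-4)
 have "x\<cdot>y\<ominus>x'\<cdot>y' = (x\<ominus>x')\<cdot>y\<oplus>x'\<cdot>(y\<ominus>y')" by ((simp add: expand)?; (rule linI, (rule lins | (simp add: algebra_simps; fail))+))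
 then have "||x\<cdot>y\<ominus>x'\<cdot>y'||\<le>||x\<ominus>x'|| * ||y|| + ||x'|| * ||y\<ominus>y'||"
  using norm_triangle[of "(x\<ominus>x')\<cdot>y" "x'\<cdot>(y\<ominus>y')"] norm_mult[of "x\<ominus>x'" y] norm_mult[of x' "y\<ominus>y'"] by simp
 also have "\<dots>\<le>||x\<ominus>x'|| * C + C * ||y\<ominus>y'||"
  using assms order_trans[OF norm_nonneg[OF assms(3)] assms(5)] by (intro add_mono mult_mono) auto
 finally show ?thesis by (simp add: algebra_simps)
qed

lemma cauchy_add: assumes "s\<in>cauchy_seqs A" "t\<in>cauchy_seqs A" shows "(\<lambda>n. s n\<oplus>t n)\<in>cauchy_seqs A"
 by (rule cauchy_dominated[OF assms, of _ 1]) (use assms cauchy_in add_diff_le in auto)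

lemma cauchy_smult: assumes "s\<in>cauchy_seqs A" shows "(\<lambda>n. c\<odot>s n)\<in>cauchy_seqs A"
proof (rule cauchy_dominated[OF assms assms, of _ "cmod c + 1"])
 fix m n
 note [simp] = cauchy_in[OF assms]
 have "cmod c * ||s m\<ominus>s n||\<le>(cmod c + 1) * ( ||s m\<ominus>s n|| + ||s m\<ominus>s n||)"
  by (rule mult_mono) auto
 then show "||c\<odot>s m\<ominus>c\<odot>s n||\<le>(cmod c + 1) * ( ||s m\<ominus>s n|| + ||s m\<ominus>s n||)"
  by (simp add: norm_smult flip: smult_diff)
qed (use cauchy_in[OF assms] in \<open>auto simp: add_nonneg_pos\<close>)

lemma cauchy_adj: assumes "s\<in>cauchy_seqs A" shows "(\<lambda>n. (s n)\<star>)\<in>cauchy_seqs A"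
 by (rule cauchy_dominated[OF assms assms, of _ 1]) (use cauchy_in[OF assms] in \<open>auto simp flip: adj_diff\<close>)

lemma cauchy_mult: assumes "s\<in>cauchy_seqs A" "t\<in>cauchy_seqs A" shows "(\<lambda>n. s n\<cdot>t n)\<in>cauchy_seqs A"
proof -
 obtain C where C: "C > 0" "\<And>n. ||s n||\<le>C" using cauchy_bdd[OF assms(1)] by blast
 obtain C' where C': "C' > 0" "\<And>n. ||t n||\<le>C'" using cauchy_bdd[OF assms(2)] by blast
 show ?thesis
  by (rule cauchy_dominated[OF assms, of _ "max C C'"])
   (use assms cauchy_in C C' in \<open>auto intro!: mult_diff_le simp: le_max_iff_disj\<close>)
qed

lemmas cauchy_ops = cauchy_const cauchy_add cauchy_smult cauchy_adj cauchy_mult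

lemma null_relI: "s\<in>cauchy_seqs A ==> t\<in>cauchy_seqs A ==> (\<lambda>n. ||s n\<ominus>t n||)\<longlonglongrightarrow>0 ==> (s, t)\<in>null_rel A"
 by (simp add: null_rel_def)

lemma null_relD: "(s, t)\<in>null_rel A ==> s\<in>cauchy_seqs A\<and>t\<in>cauchy_seqs A\<and>(\<lambda>n. ||s n\<ominus>t n||)\<longlonglongrightarrow>0"
 by (simp add: null_rel_def)

lemma lim0_dominated: "(f :: nat=>real)\<longlonglongrightarrow>0 ==> (\<And>n. 0\<le>g n) ==> (\<And>n. g n\<le>f n) ==> g\<longlonglongrightarrow>0"
 by (rule tendsto_sandwich[of "\<lambda>_. 0" g sequentially f 0]) auto

lemma equiv_null_rel: "equiv (cauchy_seqs A) (null_rel A)"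
proof (rule equivI)
 show "null_rel A\<subseteq>cauchy_seqs A\<times>cauchy_seqs A" by (auto simp: null_rel_def)
 show "refl_on (cauchy_seqs A) (null_rel A)" by (auto simp: refl_on_def null_rel_def cauchy_in)
 show "sym (null_rel A)"
 proof (rule symI)
  fix s t assume "(s, t)\<in>null_rel A"
  then show "(t, s)\<in>null_rel A"
   using norm_diff_commute cauchy_in by (auto simp: null_rel_def)
 qed
 show "trans (null_rel A)"
 proof (rule transI)
  fix s t u assume "(s, t)\<in>null_rel A" "(t, u)\<in>null_rel A"
  note h = null_relD[OF this(1)] null_relD[OF this(2)]
  show "(s, u)\<in>null_rel A"
  proof (rule null_relI)
   show "(\<lambda>n. ||s n\<ominus>u n||)\<longlonglongrightarrow>0"
    by (rule lim0_dominated[OF tendsto_add_zero[of "\<lambda>n. ||s n\<ominus>t n||" _ "\<lambda>n. ||t n\<ominus>u n||"]])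
     (use h cauchy_in norm_dist_triangle in auto)
  qed (use h in auto)
 qed
qed

lemma cls_eq_iff: "s\<in>cauchy_seqs A ==> t\<in>cauchy_seqs A ==> cls s = cls t\<longleftrightarrow>(\<lambda>n. ||s n\<ominus>t n||)\<longlonglongrightarrow>0"
 using eq_equiv_class_iff[OF equiv_null_rel, of s t] by (simp only: cls_def null_rel_def) simp

lemma cls_eqI: "(s, t)\<in>null_rel A ==> cls s = cls t"
 unfolding cls_def by (rule equiv_class_eq[OF equiv_null_rel])

lemma cls_in: "s\<in>cauchy_seqs A ==> cls s\<in>|CA|"
 by (simp add: completion_def cls_def quotientI del: Image_singleton_iff)

lemma cls_cases: assumes "X\<in>|CA|" obtains s where "s\<in>cauchy_seqs A" "X = cls s"
 using assms by (auto simp: completion_def cls_def elim: quotientE)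

lemma cls_add: assumes "s\<in>cauchy_seqs A" "t\<in>cauchy_seqs A" shows "cls s\<oplus>\<^sub>CA cls t = cls (\<lambda>n. s n\<oplus>t n)"
proof -
 have "congruent2 (null_rel A) (null_rel A) (\<lambda>s t. cls (\<lambda>n. s n\<oplus>t n))"
 proof (rule congruent2I')
  fix s t s' t' assume "(s, s')\<in>null_rel A" "(t, t')\<in>null_rel A"
  note h = null_relD[OF this(1)] null_relD[OF this(2)]
  show "cls (\<lambda>n. s n\<oplus>t n) = cls (\<lambda>n. s' n\<oplus>t' n)"
  proof (rule cls_eqI, rule null_relI)
   show "(\<lambda>n. ||s n\<oplus>t n\<ominus>(s' n\<oplus>t' n)||)\<longlonglongrightarrow>0"
   proof (rule lim0_dominated)
    show "(\<lambda>n. ||s n\<ominus>s' n|| + ||t n\<ominus>t' n||)\<longlonglongrightarrow>0"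
     using h by (intro tendsto_add_zero) simp_all
   qed (use h cauchy_in add_diff_le in simp_all)
  qed (use h in \<open>simp_all add: cauchy_add\<close>)
 qed
 from UN_equiv_class2[OF equiv_null_rel equiv_null_rel this assms] show ?thesis by (simp add: completion_def cls_def)
qed

lemma cls_mult: assumes "s\<in>cauchy_seqs A" "t\<in>cauchy_seqs A" shows "cls s\<cdot>\<^sub>CA cls t = cls (\<lambda>n. s n\<cdot>t n)"
proof -
 have "congruent2 (null_rel A) (null_rel A) (\<lambda>s t. cls (\<lambda>n. s n\<cdot>t n))"
 proof (rule congruent2I')
  fix s t s' t' assume "(s, s')\<in>null_rel A" "(t, t')\<in>null_rel A"
  note h = null_relD[OF this(1)] null_relD[OF this(2)]
  obtain C where C: "C > 0" "\<And>n. ||s' n||\<le>C" using cauchy_bdd[of s'] h by blast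
  obtain C' where C': "C' > 0" "\<And>n. ||t n||\<le>C'" using cauchy_bdd[of t] h by blast
  show "cls (\<lambda>n. s n\<cdot>t n) = cls (\<lambda>n. s' n\<cdot>t' n)"
  proof (rule cls_eqI, rule null_relI)
   show "(\<lambda>n. ||s n\<cdot>t n\<ominus>s' n\<cdot>t' n||)\<longlonglongrightarrow>0"
   proof (rule lim0_dominated)
    show "(\<lambda>n. max C C' * ( ||s n\<ominus>s' n|| + ||t n\<ominus>t' n||))\<longlonglongrightarrow>0"
     using h by (intro tendsto_mult_right_zero tendsto_add_zero) simp_all
   qed (use h cauchy_in C C' in \<open>auto intro!: mult_diff_le simp: le_max_iff_disj\<close>)
  qed (use h in \<open>simp_all add: cauchy_mult\<close>)
 qed
 from UN_equiv_class2[OF equiv_null_rel equiv_null_rel this assms] show ?thesis by (simp add: completion_def cls_def)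
qed

lemma cls_smult: assumes "s\<in>cauchy_seqs A" shows "c\<odot>\<^sub>CA cls s = cls (\<lambda>n. c\<odot>s n)"
proof -
 have "congruent (null_rel A) (\<lambda>s. cls (\<lambda>n. c\<odot>s n))"
 proof (rule congruentI)
  fix s s' assume "(s, s')\<in>null_rel A"
  note h = null_relD[OF this]
  have [simp]: "s n\<in>|A|" "s' n\<in>|A|" for n using h cauchy_in by auto
  show "cls (\<lambda>n. c\<odot>s n) = cls (\<lambda>n. c\<odot>s' n)"
   by (rule cls_eqI, rule null_relI)
    (use h in \<open>simp_all add: cauchy_smult norm_smult tendsto_mult_right_zero flip: smult_diff\<close>)
 qed
 from UN_equiv_class[OF equiv_null_rel this assms] show ?thesis by (simp add: completion_def cls_def)
qed

lemma cls_adj: assumes "s\<in>cauchy_seqs A" shows "(cls s)\<star>\<^sub>CA = cls (\<lambda>n. (s n)\<star>)"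
proof -
 have "congruent (null_rel A) (\<lambda>s. cls (\<lambda>n. (s n)\<star>))"
 proof (rule congruentI)
  fix s s' assume "(s, s')\<in>null_rel A"
  note h = null_relD[OF this]
  have [simp]: "s n\<in>|A|" "s' n\<in>|A|" for n using h cauchy_in by auto
  show "cls (\<lambda>n. (s n)\<star>) = cls (\<lambda>n. (s' n)\<star>)"
   by (rule cls_eqI, rule null_relI)
    (use h in \<open>simp_all add: cauchy_adj flip: adj_diff\<close>)
 qed
 from UN_equiv_class[OF equiv_null_rel this assms] show ?thesis by (simp add: completion_def cls_def)
qed

lemma cls_zero: "\<zero>\<^sub>CA = cls (\<lambda>n. \<zero>)"
 by (simp add: completion_def cls_def)

lemma cls_norm: assumes "s\<in>cauchy_seqs A" shows "(\<lambda>n. ||s n||)\<longlonglongrightarrow>||cls s||\<^sub>CA"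
proof -
 have eq: "lim (\<lambda>n. ||t n||) = lim (\<lambda>n. ||s n||)" if "t\<in>cls s" for t
 proof -
  have h: "s\<in>cauchy_seqs A" "t\<in>cauchy_seqs A" "(\<lambda>n. ||s n\<ominus>t n||)\<longlonglongrightarrow>0"
   using that null_relD[of s t] by (auto simp: cls_def)
  have "(\<lambda>n. ||s n|| - ||t n||)\<longlonglongrightarrow>0"
   by (rule Lim_null_comparison[OF _ h(3)])
    (use h cauchy_in norm_diff_ineq in \<open>auto intro!: always_eventually\<close>)
  then have "(\<lambda>n. ||t n||)\<longlonglongrightarrow>lim (\<lambda>n. ||s n||)"
   using tendsto_diff[OF cauchy_norm_lim[OF h(1)] \<open>(\<lambda>n. ||s n|| - ||t n||)\<longlonglongrightarrow>0\<close>] by simp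
  then show ?thesis by (rule limI)
 qed
 have "s\<in>cls s" unfolding cls_def using equiv_class_self[OF equiv_null_rel assms] .
 then have "the_elem ((\<lambda>s. lim (\<lambda>n. ||s n||)) ` cls s) = lim (\<lambda>n. ||s n||)"
  by (intro the_elem_image_unique eq) auto
 then have "||cls s||\<^sub>CA = lim (\<lambda>n. ||s n||)" by (simp add: completion_def)
 then show ?thesis using cauchy_norm_lim[OF assms] by simp
qed

lemmas cls_ops = cls_add cls_mult cls_smult cls_adj cls_zero

lemma cls_cases':
 assumes "X\<in>|CA|" obtains s where "s\<in>cauchy_seqs A" "X = cls s" "\<And>n. s n\<in>|A|"
 using cls_cases[OF assms] cauchy_in by metis

lemma star_algebra_completion: "star_algebra CA"
 by (rule star_algebraI; (elim cls_cases')?;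
  simp add: cls_ops cls_in cauchy_ops M.a_assoc M.a_comm M.a_lcomm smult_add_left smult_add_right
   distrib_left distrib_right mult_assoc smult_mult_left smult_mult_right adj_adj adj_add adj_smult adj_mult neg_add)

lemma pre_cstar_completion: "pre_cstar CA"
proof -
 interpret C: star_algebra CA by (rule star_algebra_completion)
 show ?thesis
 proof
  show "cstar_seminorm CA (cnorm CA)"
   unfolding cstar_seminorm_def
  proof (intro conjI ballI allI; elim cls_cases)
   fix X s c assume s: "s\<in>cauchy_seqs A" and X: "X = cls s"
   note [simp] = cauchy_in[OF s]
   show "0\<le>||X||\<^sub>CA" unfolding X by (rule LIMSEQ_le_const[OF cls_norm[OF s]]) auto
   show "||c\<odot>\<^sub>CA X||\<^sub>CA = cmod c * ||X||\<^sub>CA"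
    unfolding X cls_smult[OF s]
    by (rule LIMSEQ_unique[OF cls_norm[OF cauchy_smult[OF s]]]) (use tendsto_mult_left[OF cls_norm[OF s]] in \<open>simp add: norm_smult\<close>)
   show "||X\<star>\<^sub>CA\<cdot>\<^sub>CA X||\<^sub>CA = ( ||X||\<^sub>CA)\<^sup>2"
    unfolding X cls_adj[OF s] cls_mult[OF cauchy_adj[OF s] s]
    by (rule LIMSEQ_unique[OF cls_norm[OF cauchy_mult[OF cauchy_adj[OF s] s]]])
     (use tendsto_power[OF cls_norm[OF s], of 2] in \<open>simp add: norm_cstar\<close>)
   fix Y t assume t: "t\<in>cauchy_seqs A" and Y: "Y = cls t"
   note [simp] = cauchy_in[OF t]
   show "||X\<oplus>\<^sub>CA Y||\<^sub>CA\<le>||X||\<^sub>CA + ||Y||\<^sub>CA"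
    unfolding X Y cls_add[OF s t]
    by (rule LIMSEQ_le[OF cls_norm[OF cauchy_add[OF s t]] tendsto_add[OF cls_norm[OF s] cls_norm[OF t]]])
     (auto intro!: exI[of _ 0] norm_triangle)
   show "||X\<cdot>\<^sub>CA Y||\<^sub>CA\<le>||X||\<^sub>CA * ||Y||\<^sub>CA"
    unfolding X Y cls_mult[OF s t]
    by (rule LIMSEQ_le[OF cls_norm[OF cauchy_mult[OF s t]] tendsto_mult[OF cls_norm[OF s] cls_norm[OF t]]])
     (auto intro!: exI[of _ 0] norm_mult)
  qed
 qed
qed

lemma cls_diff: assumes "s\<in>cauchy_seqs A" "t\<in>cauchy_seqs A" shows "cls s\<ominus>\<^sub>CA cls t = cls (\<lambda>n. s n\<ominus>t n)"
 using assms star_algebra.diff_eq[OF star_algebra_completion cls_in cls_in]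
 by (simp add: cls_ops cauchy_ops diff_eq[OF cauchy_in[OF assms(1)] cauchy_in[OF assms(2)]])

lemma to_completion_cls: "to_completion A x = cls (\<lambda>n. x)"
 by (simp add: to_completion_def cls_def)

lemma to_completion_in: "x\<in>|A| ==> to_completion A x\<in>|CA|"
 by (simp add: to_completion_cls cls_in cauchy_const)

lemma to_completion_hom: "star_hom A CA (to_completion A)"
 unfolding star_hom_def to_completion_cls by (auto simp: cls_ops cauchy_ops cls_in)

lemma to_completion_norm: "x\<in>|A| ==> ||to_completion A x||\<^sub>CA = ||x||"
 using LIMSEQ_unique[OF cls_norm[OF cauchy_const] tendsto_const] by (simp add: to_completion_cls)

lemma to_completion_eq_iff: "x\<in>|A| ==> y\<in>|A| ==> to_completion A x = to_completion A y\<longleftrightarrow>||x\<ominus>y|| = 0"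
 unfolding to_completion_cls by (subst cls_eq_iff) (auto intro: cauchy_const simp: LIMSEQ_const_iff)

lemma cls_tends: assumes s: "s\<in>cauchy_seqs A" shows "tends CA (\<lambda>n. to_completion A (s n)) (cls s)"
proof -
 note [simp] = cauchy_in[OF s]
 show ?thesis
  unfolding tends_def lim_sequentially
 proof (intro conjI allI impI to_completion_in cls_in s)
  fix r :: real assume r: "r > 0"
  obtain N where N: "\<And>m n. m\<ge>N ==> n\<ge>N ==> ||s m\<ominus>s n|| < r / 2" using cauchyD[OF s, of "r / 2"] r by auto
  have "||to_completion A (s n)\<ominus>\<^sub>CA cls s||\<^sub>CA\<le>r / 2" if "n\<ge>N" for n
  proof -
   have c: "(\<lambda>m. s n\<ominus>s m)\<in>cauchy_seqs A"
    using cauchy_add[OF cauchy_const[of "s n"] cauchy_smult[OF s, of "-1"]] by (simp add: diff_eq)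
   have "to_completion A (s n)\<ominus>\<^sub>CA cls s = cls (\<lambda>m. s n\<ominus>s m)"
    unfolding to_completion_cls by (rule cls_diff[OF cauchy_const s]) simp
   moreover have "||cls (\<lambda>m. s n\<ominus>s m)||\<^sub>CA\<le>r / 2"
    by (rule LIMSEQ_le_const2[OF cls_norm[OF c]]) (use N[OF that] less_imp_le in blast)
   ultimately show ?thesis by simp
  qed
  moreover have "0\<le>||to_completion A (s n)\<ominus>\<^sub>CA cls s||\<^sub>CA" for n
   using pre_cstar.norm_nonneg[OF pre_cstar_completion] star_algebra.closed(6)[OF star_algebra_completion] to_completion_in cls_in[OF s] by simp
  ultimately show "\<exists>N. \<forall>n\<ge>N. dist ||to_completion A (s n)\<ominus>\<^sub>CA cls s||\<^sub>CA 0 < r"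
   using r by (intro exI[of _ N] allI impI) (force simp: dist_real_def)
 qed auto
qed

lemma completion_approx:
 assumes "X\<in>|CA|" "\<epsilon> > 0" obtains x where "x\<in>|A|" "||X\<ominus>\<^sub>CA to_completion A x||\<^sub>CA < \<epsilon>"
proof -
 obtain s where s: "s\<in>cauchy_seqs A" "X = cls s" using cls_cases[OF assms(1)] by blast
 show ?thesis
  using pre_cstar.tends_epsE[OF pre_cstar_completion cls_tends[OF s(1)] assms(2)] that cauchy_in[OF s(1)] s(2) by metis
qed

theorem cstar_completion: "cstar_algebra CA"
proof -
 interpret C: pre_cstar CA by (rule pre_cstar_completion)
 show ?thesis
 proof (rule C.cstar_algebraI)
  fix X assume "X\<in>|CA|" "||X||\<^sub>CA = 0"
  then obtain s where s: "s\<in>cauchy_seqs A" "X = cls s" "||cls s||\<^sub>CA = 0" using cls_cases by metis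
  have "(\<lambda>n. s n\<ominus>\<zero>) = s" using cauchy_in[OF s(1)] by (auto simp: diff_eq)
  then show "X = \<zero>\<^sub>CA"
   unfolding s(2) cls_zero using cls_eq_iff[OF s(1) cauchy_const[of \<zero>]] cls_norm[OF s(1)] s(3) by (simp add: fun_eq_iff)
 next
  fix X :: "nat=>_" assume X [simp]: "\<And>k. X k\<in>|CA|"
   and Cau: "\<And>\<epsilon>. \<epsilon> > 0 ==> \<exists>N. \<forall>m\<ge>N. \<forall>n\<ge>N. ||X m\<ominus>\<^sub>CA X n||\<^sub>CA < \<epsilon>"
  \<comment> \<open>The k-th class is approximated up to 1/(k+1) by one element of A. The sequence
    of these elements is Cauchy in A, and its class is the limit.\<close>
  have "\<forall>k. \<exists>x. x\<in>|A|\<and>||X k\<ominus>\<^sub>CA to_completion A x||\<^sub>CA < 1 / real (Suc k)"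
   using completion_approx[OF X] by (metis of_nat_0_less_iff zero_less_Suc zero_less_divide_1_iff)
  from choice[OF this] obtain x where x: "\<And>k. x k\<in>|A|" "\<And>k. ||X k\<ominus>\<^sub>CA to_completion A (x k)||\<^sub>CA < 1 / real (Suc k)"
   by blast
  note [simp] = x(1) to_completion_in
  have lim1: "(\<lambda>k. 1 / real (Suc k))\<longlonglongrightarrow>0" by (rule LIMSEQ_Suc[OF lim_1_over_n])
  have c: "x\<in>cauchy_seqs A"
  proof (rule cauchyI[OF x(1)])
   fix \<epsilon> :: real assume e: "\<epsilon> > 0"
   then have e3: "\<epsilon> / 3 > 0" by simp
   obtain N where N: "\<And>m n. m\<ge>N ==> n\<ge>N ==> ||X m\<ominus>\<^sub>CA X n||\<^sub>CA < \<epsilon> / 3" using Cau[OF e3] by blast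
   obtain N' where N': "\<And>k. k\<ge>N' ==> norm (1 / real (Suc k) - 0) < \<epsilon> / 3" using LIMSEQ_D[OF lim1 e3] by blast
   have "||x m\<ominus>x n|| < \<epsilon>" if mn: "m\<ge>max N N'" "n\<ge>max N N'" for m n
   proof -
    have "||x m\<ominus>x n|| = ||to_completion A (x m)\<ominus>\<^sub>CA to_completion A (x n)||\<^sub>CA"
     using to_completion_norm[of "x m\<ominus>x n"]
     by (simp add: star_hom_diff[OF star_algebra_axioms star_algebra_completion to_completion_hom])
    also have "\<dots>\<le>||to_completion A (x m)\<ominus>\<^sub>CA X m||\<^sub>CA + ||X m\<ominus>\<^sub>CA X n||\<^sub>CA + ||X n\<ominus>\<^sub>CA to_completion A (x n)||\<^sub>CA"
     using C.norm_dist_triangle[of "to_completion A (x m)" "X m" "to_completion A (x n)"]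
      C.norm_dist_triangle[of "X m" "X n" "to_completion A (x n)"] by simp
    finally show ?thesis
     using x(2)[of m] x(2)[of n] N[of m n] N'[of m] N'[of n] mn C.norm_diff_commute[of "to_completion A (x m)" "X m"] by simp
   qed
   then show "\<exists>N. \<forall>m\<ge>N. \<forall>n\<ge>N. ||x m\<ominus>x n|| < \<epsilon>" by blast
  qed
  have "tends CA X (cls x)"
  proof (rule C.tendsI)
   show "||X k\<ominus>\<^sub>CA cls x||\<^sub>CA\<le>1 / real (Suc k) + ||to_completion A (x k)\<ominus>\<^sub>CA cls x||\<^sub>CA" for k
    using C.norm_dist_triangle[of "X k" "to_completion A (x k)" "cls x"] x(2)[of k] cls_in[OF c] by simp
   show "(\<lambda>k. 1 / real (Suc k) + ||to_completion A (x k)\<ominus>\<^sub>CA cls x||\<^sub>CA)\<longlonglongrightarrow>0"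
    using lim1 cls_tends[OF c] unfolding tends_def by (intro tendsto_add_zero) auto
  qed (use cls_in[OF c] in auto)
  then show "\<exists>Y. tends CA X Y" by blast
 qed
qed

end

text \<open>An isometry maps Cauchy sequences to convergent ones and also reflects the Cauchy
  property. The second fact makes the image of the completion all of the closure.\<close>

lemma completion_extend:
 assumes P: "pre_cstar P" and E: "cstar_algebra E" and f: "star_hom P E f"
  and iso: "\<And>x. x\<in>|P| ==> ||f x||\<^sub>E = ||x||\<^sub>P"
 obtains F where "star_hom (completion P) E F" "\<And>x. x\<in>|P| ==> F (to_completion P x) = f x"
  "\<And>X. X\<in>carrier (completion P) ==> ||F X||\<^sub>E = ||X||\<^bsub>completion P\<^esub>"
  "F ` carrier (completion P) = norm_topology E closure_of (f ` |P| )"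
proof -
 interpret P: pre_cstar P by fact
 interpret E: cstar_algebra E by fact
 interpret C: cstar_algebra "completion P" by (rule P.cstar_completion)
 note fd = star_hom_diff[OF P.star_algebra_axioms E.star_algebra_axioms f]
 note fin = star_hom_in[OF f]
 have dist: "||f x\<ominus>\<^sub>E f y||\<^sub>E = ||x\<ominus>\<^sub>P y||\<^sub>P" if "x\<in>|P|" "y\<in>|P|" for x y
  using iso[of "x\<ominus>\<^sub>P y"] that by (simp add: fd)
 have ex: "\<exists>e. tends E (\<lambda>n. f (s n)) e" if s: "s\<in>cauchy_seqs P" for s
 proof (rule E.Cauchy_tends[of "\<lambda>n. f (s n)"])
  fix \<epsilon> :: real assume "\<epsilon> > 0"
  then show "\<exists>N. \<forall>m\<ge>N. \<forall>n\<ge>N. ||f (s m)\<ominus>\<^sub>E f (s n)||\<^sub>E < \<epsilon>"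
   using P.cauchyD[OF s] by (metis dist P.cauchy_in[OF s])
 qed (use P.cauchy_in[OF s] fin in auto)
 \<comment> \<open>Any representing sequence may be chosen here; the next claim shows that every
   other representative has the same limit.\<close>
 define F where "F X = (SOME e. \<exists>s. s\<in>cauchy_seqs P\<and>X = P.cls s\<and>tends E (\<lambda>n. f (s n)) e)" for X
 have F: "tends E (\<lambda>n. f (s n)) (F (P.cls s))" if s: "s\<in>cauchy_seqs P" for s
 proof -
  have "\<exists>t. t\<in>cauchy_seqs P\<and>P.cls s = P.cls t\<and>tends E (\<lambda>n. f (t n)) (F (P.cls s))"
   unfolding F_def by (rule someI_ex) (use ex[OF s] s in blast)
  then obtain t where t: "t\<in>cauchy_seqs P" "P.cls s = P.cls t" "tends E (\<lambda>n. f (t n)) (F (P.cls s))" by blast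
  note [simp] = P.cauchy_in[OF s] P.cauchy_in[OF t(1)] fin
  note [simp] = E.tends_in(2)[OF t(3)]
  show ?thesis
  proof (rule E.tendsI)
   show "||f (s n)\<ominus>\<^sub>E F (P.cls s)||\<^sub>E\<le>||s n\<ominus>\<^sub>P t n||\<^sub>P + ||f (t n)\<ominus>\<^sub>E F (P.cls s)||\<^sub>E" for n
    using E.norm_dist_triangle[of "f (s n)" "f (t n)" "F (P.cls s)"] by (simp add: dist)
   show "(\<lambda>n. ||s n\<ominus>\<^sub>P t n||\<^sub>P + ||f (t n)\<ominus>\<^sub>E F (P.cls s)||\<^sub>E)\<longlonglongrightarrow>0"
    using t(2,3) P.cls_eq_iff[OF s t(1)] unfolding tends_def by (intro tendsto_add_zero) auto
  qed auto
 qed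
 have Feq: "F (P.cls s) = e" if "s\<in>cauchy_seqs P" "tends E (\<lambda>n. f (s n)) e" for s e
  using E.tends_unique[OF F[OF that(1)] that(2)] .
 show ?thesis
 proof
  show "star_hom (completion P) E F"
   unfolding star_hom_def
  proof (intro conjI allI ballI funcsetI; elim P.cls_cases)
   fix X s c assume s: "s\<in>cauchy_seqs P" and X: "X = P.cls s"
   note [simp] = P.cauchy_in[OF s]
   show "F X\<in>|E|" unfolding X using E.tends_in(2)[OF F[OF s]] .
   show "F (c\<odot>\<^bsub>completion P\<^esub> X) = c\<odot>\<^sub>E F X"
    unfolding X P.cls_smult[OF s] using E.tends_smult[OF F[OF s], of c]
    by (intro Feq P.cauchy_smult s) (simp add: star_hom_simps[OF f])
   show "F (X\<star>\<^bsub>completion P\<^esub>) = (F X)\<star>\<^sub>E"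
    unfolding X P.cls_adj[OF s] using E.tends_adj[OF F[OF s]]
    by (intro Feq P.cauchy_adj s) (simp add: star_hom_simps[OF f])
   fix Y t assume t: "t\<in>cauchy_seqs P" and Y: "Y = P.cls t"
   note [simp] = P.cauchy_in[OF t]
   show "F (X\<oplus>\<^bsub>completion P\<^esub> Y) = F X\<oplus>\<^sub>E F Y"
    unfolding X Y P.cls_add[OF s t] using E.tends_add[OF F[OF s] F[OF t]]
    by (intro Feq P.cauchy_add s t) (simp add: star_hom_simps[OF f])
   show "F (X\<cdot>\<^bsub>completion P\<^esub> Y) = F X\<cdot>\<^sub>E F Y"
    unfolding X Y P.cls_mult[OF s t] using E.tends_mult[OF F[OF s] F[OF t]]
    by (intro Feq P.cauchy_mult s t) (simp add: star_hom_simps[OF f])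
  qed
  show "F (to_completion P x) = f x" if "x\<in>|P|" for x
   unfolding P.to_completion_cls by (rule Feq) (use that fin in \<open>auto intro: P.cauchy_const E.tends_const\<close>)
  show "||F X||\<^sub>E = ||X||\<^bsub>completion P\<^esub>" if X: "X\<in>carrier (completion P)" for X
  proof -
   obtain s where s: "s\<in>cauchy_seqs P" "X = P.cls s" using P.cls_cases[OF X] by blast
   show ?thesis
    unfolding s(2) by (rule LIMSEQ_unique[OF E.tends_norm[OF F[OF s(1)]]])
     (use P.cls_norm[OF s(1)] iso P.cauchy_in[OF s(1)] in simp)
  qed
  have sub: "f ` |P|\<subseteq>|E|" using fin by blast
  show "F ` carrier (completion P) = norm_topology E closure_of (f ` |P| )"
  proof (intro equalityI subsetI)
   fix e assume "e\<in>F ` carrier (completion P)"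
   then obtain s where s: "s\<in>cauchy_seqs P" "e = F (P.cls s)" using P.cls_cases by blast
   then show "e\<in>norm_topology E closure_of (f ` |P| )"
    unfolding E.closure_iff[OF sub] using F[OF s(1)] P.cauchy_in[OF s(1)]
    by (intro exI[of _ "\<lambda>n. f (s n)"]) simp
  next
   fix e assume "e\<in>norm_topology E closure_of (f ` |P| )"
   then obtain u where u: "\<forall>n. u n\<in>f ` |P|" "tends E u e" unfolding E.closure_iff[OF sub] by blast
   then have "\<forall>n. \<exists>x. x\<in>|P|\<and>u n = f x" by blast
   from choice[OF this] obtain s where s: "\<And>n. s n\<in>|P|" "\<And>n. u n = f (s n)" by blast
   have "s\<in>cauchy_seqs P"
   proof (rule P.cauchyI[OF s(1)])
    fix \<epsilon> :: real assume e: "\<epsilon> > 0"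
    have "(\<lambda>n. ||u n\<ominus>\<^sub>E e||\<^sub>E)\<longlonglongrightarrow>0" using u(2) by (simp add: tends_def)
    from LIMSEQ_D[OF this, of "\<epsilon> / 2"] e obtain N where
     N: "\<And>n. n\<ge>N ==> norm ( ||u n\<ominus>\<^sub>E e||\<^sub>E - 0) < \<epsilon> / 2" by auto
    have "||s m\<ominus>\<^sub>P s n||\<^sub>P < \<epsilon>" if "m\<ge>N" "n\<ge>N" for m n
    proof -
     have [simp]: "u k\<in>|E|" "e\<in>|E|" for k using E.tends_in[OF u(2)] by auto
     have "||s m\<ominus>\<^sub>P s n||\<^sub>P = ||u m\<ominus>\<^sub>E u n||\<^sub>E" using dist s by simp
     also have "\<dots>\<le>||u m\<ominus>\<^sub>E e||\<^sub>E + ||u n\<ominus>\<^sub>E e||\<^sub>E"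
      using E.norm_dist_triangle[of "u m" e "u n"] E.norm_diff_commute[of e "u n"] by simp
     finally show ?thesis using N[OF that(1)] N[OF that(2)] by simp
    qed
    then show "\<exists>N. \<forall>m\<ge>N. \<forall>n\<ge>N. ||s m\<ominus>\<^sub>P s n||\<^sub>P < \<epsilon>" by blast
   qed
   moreover have "F (P.cls s) = e"
    by (rule Feq[OF calculation]) (use u(2) s(2) in \<open>simp flip: s(2)\<close>)
   ultimately show "e\<in>F ` carrier (completion P)" using P.cls_in by blast
  qed
 qed
qed

lemma isometric_inj:
 assumes "cstar_algebra A" "cstar_algebra B" "star_hom A B \<phi>" "\<And>x. x\<in>|A| ==> ||\<phi> x||\<^sub>B = ||x||\<^sub>A"
 shows "inj_on \<phi> ( |A| )"
proof (rule inj_onI)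
 interpret A: cstar_algebra A by fact
 interpret B: cstar_algebra B by fact
 fix x y assume xy: "x\<in>|A|" "y\<in>|A|" "\<phi> x = \<phi> y"
 have "||x\<ominus>\<^sub>A y||\<^sub>A = ||\<phi> x\<ominus>\<^sub>B \<phi> y||\<^sub>B"
  using assms(4)[of "x\<ominus>\<^sub>A y"] xy(1,2) star_hom_diff[OF A.star_algebra_axioms B.star_algebra_axioms assms(3)] by simp
 also have "\<dots> = 0" using xy star_hom_in[OF assms(3) xy(2)] by simp
 finally show "x = y" using xy A.norm_diff_eq_zero by blast
qed

section \<open>Subalgebras and closed spans\<close>

context cstar_algebra
begin

lemma closed_set_subalgebra:
 assumes "cstar_subalgebra A S"
 shows "cstar_algebra (A\<lparr>carrier := S\<rparr>)"
proof -
 let ?S = "A\<lparr>carrier := S\<rparr>"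
 have sub: "submodule S complex_ring A" and cl: "closedin (norm_topology A) S"
  and m: "\<And>x y. x\<in>S ==> y\<in>S ==> x\<cdot>y\<in>S" and ad: "\<And>x. x\<in>S ==> x\<star>\<in>S"
  using assms by (auto simp: cstar_subalgebra_def)
 note [simp] = submodule_in[OF sub] submodule_add[OF sub] submodule_smult[OF sub] submodule_zero[OF sub] m ad
 have SA: "star_algebra ?S"
  by (rule star_algebraI) (simp_all add: expand M.a_assoc M.a_comm M.a_lcomm smult_add_left neg_add)
 interpret S: star_algebra ?S by (rule SA)
 have diff: "x\<ominus>\<^bsub>?S\<^esub> y = x\<ominus>y" if "x\<in>S" "y\<in>S" for x y
  using S.diff_eq[of x y] that by (simp add: diff_eq)
 have pre: "pre_cstar ?S"
  by unfold_locales (simp add: cstar_seminorm_def norm_triangle norm_smult norm_mult norm_cstar)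
 show ?thesis
 proof (rule pre_cstar.cstar_algebraI[OF pre])
  fix s :: "nat=>_" assume s: "\<And>n. s n\<in>|?S|"
   and c: "\<And>\<epsilon>. \<epsilon> > 0 ==> \<exists>N. \<forall>m\<ge>N. \<forall>n\<ge>N. ||s m\<ominus>\<^bsub>?S\<^esub> s n||\<^bsub>?S\<^esub> < \<epsilon>"
  obtain x where x: "tends A s x"
   by (rule Cauchy_tends[of s]) (use s c in \<open>simp_all add: diff\<close>)
  have "x\<in>S" by (rule closedin_tends[OF cl _ x]) (use s in simp)
  then have "tends ?S s x" using x s by (simp add: tends_def diff)
  then show "\<exists>x. tends ?S s x" by blast
 qed simp
qed

abbreviation "lspan\<equiv>\<lambda>S. (\<lambda>V. submodule V complex_ring A) hull S"

lemma span_submodule: assumes "S\<subseteq>|A|" shows "submodule (lspan S) complex_ring A"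
proof (rule submoduleI')
 show "lspan S\<subseteq>|A|" using hull_minimal[of S "|A|" "\<lambda>V. submodule V complex_ring A"] assms carrier_is_submodule by blast
qed (auto simp: hull_def submodule_zero submodule_add submodule_smult)

lemma span_in: "S\<subseteq>|A| ==> x\<in>lspan S ==> x\<in>|A|"
 using submodule_in[OF span_submodule] by blast

lemma closed_span_iff:
 assumes "S\<subseteq>|A|" shows "x\<in>closed_span A S\<longleftrightarrow>(\<exists>s. (\<forall>n. s n\<in>lspan S)\<and>tends A s x)"
 unfolding closed_span_def by (rule closure_iff) (use span_in[OF assms] in blast)

lemma closed_span_subset: assumes "S\<subseteq>|A|" shows "S\<subseteq>closed_span A S"
proof
 fix x assume "x\<in>S"
 then have "x\<in>lspan S" "x\<in>|A|" using hull_inc assms by auto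
 then show "x\<in>closed_span A S"
  unfolding closed_span_iff[OF assms] by (intro exI[of _ "\<lambda>n. x"]) (auto simp: tends_const)
qed

lemma closed_span_in: "S\<subseteq>|A| ==> x\<in>closed_span A S ==> x\<in>|A|"
 unfolding closed_span_iff using tends_in(2) by blast

lemma closed_span_closed:
 assumes S: "S\<subseteq>|A|" shows "closedin (norm_topology A) (closed_span A S)"
 unfolding closed_span_def by (rule closedin_closure_of)

lemma closed_span_submodule:
 assumes S: "S\<subseteq>|A|" shows "submodule (closed_span A S) complex_ring A"
proof (rule submoduleI')
 note iff = closed_span_iff[OF S] and sub = span_submodule[OF S]
 show "closed_span A S\<subseteq>|A|" using closed_span_in[OF S] by blast
 show "\<zero>\<in>closed_span A S"
  unfolding iff by (intro exI[of _ "\<lambda>n. \<zero>"]) (auto simp: tends_const submodule_zero[OF sub])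
 show "x\<oplus>y\<in>closed_span A S" if xy: "x\<in>closed_span A S" "y\<in>closed_span A S" for x y
 proof -
  obtain s t where "\<forall>n. s n\<in>lspan S" "tends A s x" "\<forall>n. t n\<in>lspan S" "tends A t y"
   using xy unfolding iff by blast
  then show ?thesis
   unfolding iff by (intro exI[of _ "\<lambda>n. s n\<oplus>t n"]) (auto intro: tends_add submodule_add[OF sub])
 qed
 show "c\<odot>x\<in>closed_span A S" if x: "x\<in>closed_span A S" for x c
 proof -
  obtain s where "\<forall>n. s n\<in>lspan S" "tends A s x" using x unfolding iff by blast
  then show ?thesis
   unfolding iff by (intro exI[of _ "\<lambda>n. c\<odot>s n"]) (auto intro: tends_smult submodule_smult[OF sub])
 qed
qed

lemma closed_span_minimal:
 assumes "S\<subseteq>T" "submodule T complex_ring A" "closedin (norm_topology A) T" shows "closed_span A S\<subseteq>T"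
proof
 fix x assume x: "x\<in>closed_span A S"
 have S: "S\<subseteq>|A|" using assms submodule_in by blast
 obtain s where s: "\<forall>n. s n\<in>lspan S" "tends A s x" using x unfolding closed_span_iff[OF S] by blast
 have "lspan S\<subseteq>T" by (rule hull_minimal) (use assms in auto)
 then show "x\<in>T" using closedin_tends[OF assms(3) _ s(2)] s(1) by blast
qed

lemma closed_span_induct [consumes 2, case_names base zero add smult lim]:
 assumes "x\<in>closed_span A S" "S\<subseteq>|A|" "\<And>x. x\<in>S ==> P x" "P \<zero>"
  "\<And>x y. x\<in>|A| ==> y\<in>|A| ==> P x ==> P y ==> P (x\<oplus>y)" "\<And>c x. x\<in>|A| ==> P x ==> P (c\<odot>x)"
  "\<And>s x. tends A s x ==> (\<And>n. P (s n)) ==> P x"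
 shows "P x"
proof -
 have "closed_span A S\<subseteq>{x\<in>|A|. P x}"
 proof (rule closed_span_minimal)
  show "submodule {x\<in>|A|. P x} complex_ring A"
   by (rule submoduleI') (use assms in auto)
  show "closedin (norm_topology A) {x\<in>|A|. P x}"
   unfolding closedin_iff using assms(7) tends_in(2) by blast
 qed (use assms in auto)
 then show ?thesis using assms(1) by blast
qed

lemma closed_span_subalgebra:
 assumes S: "S\<subseteq>|A|" and m: "\<And>x y. x\<in>S ==> y\<in>S ==> x\<cdot>y\<in>closed_span A S"
  and ad: "\<And>x. x\<in>S ==> x\<star>\<in>closed_span A S"
 shows "cstar_subalgebra A (closed_span A S)"
 unfolding cstar_subalgebra_def
proof (intro conjI ballI closed_span_submodule[OF S] closed_span_closed[OF S])
 note sub = closed_span_submodule[OF S] and lim = closedin_tends[OF closed_span_closed[OF S]]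
 \<comment> \<open>Multiplication is treated one factor at a time: the right factor is a generator
   here and arbitrary in the next induction.\<close>
 have one: "x\<cdot>y\<in>closed_span A S" if x: "x\<in>closed_span A S" and y: "y\<in>S" for x y
  using x S
 proof (induction rule: closed_span_induct)
  case (lim s x)
  have "tends A (\<lambda>n. s n\<cdot>y) (x\<cdot>y)" using lim(1) y S by (intro tends_mult tends_const) auto
  then show ?case using closedin_tends[OF closed_span_closed[OF S], of "\<lambda>n. s n\<cdot>y"] lim(2) by blast
 qed (use y S m sub in \<open>auto simp: subset_iff distrib_right smult_mult_left intro: submodule_zero submodule_add submodule_smult\<close>)
 show "x\<cdot>y\<in>closed_span A S" if x: "x\<in>closed_span A S" and y: "y\<in>closed_span A S" for x y
  using y S
 proof (induction rule: closed_span_induct)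
  case (lim s y)
  have "tends A (\<lambda>n. x\<cdot>s n) (x\<cdot>y)" using lim(1) x closed_span_in[OF S] by (intro tends_mult tends_const) auto
  then show ?case using closedin_tends[OF closed_span_closed[OF S], of "\<lambda>n. x\<cdot>s n"] lim(2) by blast
 qed (use x S one sub closed_span_in[OF S x] in \<open>auto simp: distrib_left smult_mult_right intro: submodule_zero submodule_add submodule_smult\<close>)
 show "x\<star>\<in>closed_span A S" if x: "x\<in>closed_span A S" for x
  using x S
 proof (induction rule: closed_span_induct)
  case (lim s x)
  have "tends A (\<lambda>n. (s n)\<star>) (x\<star>)" using lim(1) by (rule tends_adj)
  then show ?case using closedin_tends[OF closed_span_closed[OF S], of "\<lambda>n. (s n)\<star>"] lim(2) by blast
 qed (use S ad sub in \<open>auto simp: adj_add adj_smult intro: submodule_zero submodule_add submodule_smult\<close>)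
qed

end

section \<open>Crossed products by the integers\<close>

locale z_action = cstar_algebra A for A :: "('a, 'm) cstar_struct_scheme" (structure) +
 fixes \<alpha> assumes aut: "star_iso A A \<alpha>"
begin

abbreviation "ap\<equiv>aut_power A \<alpha>"
abbreviation "fs\<equiv>fin_support A"
abbreviation "CP\<equiv>crossed_prealgebra A \<alpha>"

lemma aut_hom: "star_hom A A \<alpha>" and aut_bij: "bij_betw \<alpha> ( |A| ) ( |A| )"
 using aut by (auto simp: star_iso_def)

lemma inv_props:
 assumes "x\<in>|A|"
 shows "inv_into ( |A| ) \<alpha> x\<in>|A|" "\<alpha> (inv_into ( |A| ) \<alpha> x) = x" "inv_into ( |A| ) \<alpha> (\<alpha> x) = x"
 using assms aut_bij by (auto simp: bij_betw_def inv_into_into f_inv_into_f)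

lemma inv_hom: "star_hom A A (inv_into ( |A| ) \<alpha>)"
proof -
 let ?\<beta> = "inv_into ( |A| ) \<alpha>"
 have eqI: "?\<beta> x = y" if "y\<in>|A|" "\<alpha> y = x" for x y using inv_props(3)[OF that(1)] that by simp
 show ?thesis
  unfolding star_hom_def
  by (intro conjI allI ballI funcsetI; (rule eqI)?; simp add: star_hom_simps[OF aut_hom] inv_props)
qed

lemma funpow_hom: assumes "star_hom A A \<phi>" shows "star_hom A A (\<phi> ^^ n)"
proof (induction n)
 case 0 then show ?case by (simp add: star_hom_def)
next
 case (Suc n)
 then show ?case using star_hom_comp[OF Suc assms] by (simp add: o_def)
qed

lemma ap_hom: "star_hom A A (ap n)"
 unfolding aut_power_def using funpow_hom aut_hom inv_hom by auto

lemmas ap_simps [simp] = star_hom_simps[OF ap_hom]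

lemma ap_zero_el [simp]: "ap n \<zero> = \<zero>"
 by (rule star_hom_zero[OF star_algebra_axioms star_algebra_axioms ap_hom])

lemma ap_0 [simp]: "ap 0 x = x"
 by (simp add: aut_power_def)

lemma ap_succ: assumes "x\<in>|A|" shows "ap (n + 1) x = \<alpha> (ap n x)"
proof (cases "0\<le>n")
 case True
 then have "nat (n + 1) = Suc (nat n)" by simp
 then show ?thesis using True by (simp add: aut_power_def)
next
 case False
 then have e: "nat (- n) = Suc (nat (- (n + 1)))" by simp
 have *: "ap (n + 1) x = (inv_into ( |A| ) \<alpha> ^^ nat (- (n + 1))) x"
  using False by (auto simp: aut_power_def)
 have "ap n x = inv_into ( |A| ) \<alpha> (ap (n + 1) x)"
  unfolding * using False by (simp add: aut_power_def e)
 then show ?thesis using inv_props(2)[of "ap (n + 1) x"] assms by simp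
qed

lemma ap_pred: assumes "x\<in>|A|" shows "ap (n - 1) x = inv_into ( |A| ) \<alpha> (ap n x)"
 using ap_succ[OF assms, of "n - 1"] inv_props(3)[of "ap (n - 1) x"] assms by simp

lemma ap_ap [simp]: assumes "x\<in>|A|" shows "ap m (ap n x) = ap (m + n) x"
proof (induction m rule: int_induct[where k = 0])
 case base then show ?case by simp
next
 case (step1 i)
 then show ?case using ap_succ[of "ap n x" i] ap_succ[of x "i + n"] assms by (simp add: add_ac)
next
 case (step2 i)
 have e: "i - 1 + n = i + n - 1" by simp
 show ?case unfolding e using step2 ap_pred[of "ap n x" i] ap_pred[of x "i + n"] assms by simp
qed

lemma ap_norm [simp]: assumes "x\<in>|A|" shows "||ap n x|| = ||x||"
proof (rule antisym)
 note c = star_hom_contractive[OF cstar_algebra_axioms cstar_algebra_axioms ap_hom]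
 show "||ap n x||\<le>||x||" by (rule c[OF assms])
 show "||x||\<le>||ap n x||" using c[of "ap n x" "- n"] assms by simp
qed

section \<open>Finitely supported families and twisted convolution\<close>

definition single :: "int=>'a=>int=>'a" where
 "single n b = (\<lambda>i. if i = n then b else \<zero>)"

lemma single_apply: "single n b i = (if i = n then b else \<zero>)"
 by (simp add: single_def)

lemma fs_in [simp]: "f\<in>fs ==> f n\<in>|A|"
 and fs_finite [simp]: "f\<in>fs ==> finite {n. f n\<noteq>\<zero>}"
 by (auto simp: fin_support_def)

lemma fsI: "(\<And>n. f n\<in>|A| ) ==> finite F ==> (\<And>n. n\<notin>F ==> f n = \<zero>) ==> f\<in>fs"
 unfolding fin_support_def by (auto intro: finite_subset[of _ F])

lemma single_in [simp]: "b\<in>|A| ==> single n b\<in>fs"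
 by (rule fsI[of _ "{n}"]) (auto simp: single_def)

lemma fs_zero [simp]: "(\<lambda>n. \<zero>)\<in>fs"
 by (rule fsI[of _ "{}"]) auto

lemma fs_add [simp]: "f\<in>fs ==> g\<in>fs ==> (\<lambda>n. f n\<oplus>g n)\<in>fs"
 by (rule fsI[of _ "{n. f n\<noteq>\<zero>}\<union>{n. g n\<noteq>\<zero>}"]) auto

lemma fs_smult [simp]: "f\<in>fs ==> (\<lambda>n. c\<odot>f n)\<in>fs"
 by (rule fsI[of _ "{n. f n\<noteq>\<zero>}"]) auto

text \<open>Reduces associativity, the adjoint rule and multiplicativity of the regular
  representation to computations with homogeneous families.\<close>

lemma fs_induct [consumes 1, case_names zero single add]:
 assumes f: "f\<in>fs" and 0: "P (\<lambda>n. \<zero>)" and 1: "\<And>n b. b\<in>|A| ==> P (single n b)"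
  and 2: "\<And>f g. f\<in>fs ==> g\<in>fs ==> P f ==> P g ==> P (\<lambda>n. f n\<oplus>g n)"
 shows "P f"
proof -
 have "\<forall>f\<in>fs. {n. f n\<noteq>\<zero>}\<subseteq>F\<longrightarrow>P f" if "finite F" for F
  using that
 proof (induction F rule: finite_induct)
  case empty
  then show ?case using 0 by (auto simp: fun_eq_iff[symmetric])
 next
  case (insert n F)
  show ?case
  proof (intro ballI impI)
   fix f assume f: "f\<in>fs" "{n. f n\<noteq>\<zero>}\<subseteq>insert n F"
   define g where "g = f(n := \<zero>)"
   have g: "g\<in>fs" "{n. g n\<noteq>\<zero>}\<subseteq>F"
    using f insert(2) by (auto intro!: fsI[of _ "{n. f n\<noteq>\<zero>}"] simp: g_def split: if_splits)
   have eq: "f = (\<lambda>i. g i\<oplus>single n (f n) i)" using f by (auto simp: g_def single_def)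
   have "P g" using insert(3) g by blast
   then have "P (\<lambda>i. g i\<oplus>single n (f n) i)"
    by (intro 2 1 single_in g) (use f in simp_all)
   then show "P f" unfolding eq[symmetric] .
  qed
 qed
 from this[OF fs_finite[OF f]] show ?thesis using f by blast
qed

text \<open>Convolution and the regular representation are both of the following form.\<close>

definition bil :: "(int=>int=>'a=>'a=>'a)=>bool" where
 "bil G\<longleftrightarrow>(\<forall>m n. \<forall>a\<in>|A|. \<forall>x\<in>|A|. G m n a x\<in>|A|\<and>
   (\<forall>b\<in>|A|. G m n (a\<oplus>b) x = G m n a x\<oplus>G m n b x)\<and>
   (\<forall>y\<in>|A|. G m n a (x\<oplus>y) = G m n a x\<oplus>G m n a y)\<and>
   (\<forall>c. G m n (c\<odot>a) x = c\<odot>G m n a x)\<and>(\<forall>c. G m n a (c\<odot>x) = c\<odot>G m n a x))"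

definition twist :: "(int=>int=>'a=>'a=>'a)=>(int=>'a)=>(int=>'a)=>int=>'a" where
 "twist G f \<xi> n = (\<Oplus>m\<in>{m. f m\<noteq>\<zero>}. G m n (f m) (\<xi> (n - m)))"

context
 fixes G assumes G: "bil G"
begin

lemma bil_simps [simp]:
 "a\<in>|A| ==> x\<in>|A| ==> G m n a x\<in>|A|"
 "a\<in>|A| ==> b\<in>|A| ==> x\<in>|A| ==> G m n (a\<oplus>b) x = G m n a x\<oplus>G m n b x"
 "a\<in>|A| ==> x\<in>|A| ==> y\<in>|A| ==> G m n a (x\<oplus>y) = G m n a x\<oplus>G m n a y"
 "a\<in>|A| ==> x\<in>|A| ==> G m n (c\<odot>a) x = c\<odot>G m n a x"
 "a\<in>|A| ==> x\<in>|A| ==> G m n a (c\<odot>x) = c\<odot>G m n a x"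
 using G unfolding bil_def by auto

lemma bil_zero [simp]: "x\<in>|A| ==> G m n \<zero> x = \<zero>" "a\<in>|A| ==> G m n a \<zero> = \<zero>"
 using bil_simps(4)[of \<zero> x m n 0] bil_simps(5)[of a \<zero> m n 0] by auto

lemma twist_superset:
 assumes "f\<in>fs" "\<xi>\<in>fs" "finite F" "{m. f m\<noteq>\<zero>}\<subseteq>F"
 shows "twist G f \<xi> n = (\<Oplus>m\<in>F. G m n (f m) (\<xi> (n - m)))"
 unfolding twist_def by (rule M.add.finprod_mono_neutral_cong_left) (use assms in auto)

lemma twist_in_A [simp]: "f\<in>fs ==> \<xi>\<in>fs ==> twist G f \<xi> n\<in>|A|"
 unfolding twist_def by (rule M.finsum_closed) auto

lemma twist_add_left:
 assumes "f\<in>fs" "g\<in>fs" "\<xi>\<in>fs"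
 shows "twist G (\<lambda>n. f n\<oplus>g n) \<xi> = (\<lambda>n. twist G f \<xi> n\<oplus>twist G g \<xi> n)"
proof
 fix n
 let ?F = "{n. f n\<noteq>\<zero>}\<union>{n. g n\<noteq>\<zero>}"
 have F: "finite ?F" using assms by auto
 have "twist G (\<lambda>n. f n\<oplus>g n) \<xi> n = (\<Oplus>m\<in>?F. G m n (f m\<oplus>g m) (\<xi> (n - m)))"
  by (rule twist_superset) (use assms in auto)
 also have "\<dots> = (\<Oplus>m\<in>?F. G m n (f m) (\<xi> (n - m))\<oplus>G m n (g m) (\<xi> (n - m)))"
  by (rule M.finsum_cong') (use assms in auto)
 also have "\<dots> = (\<Oplus>m\<in>?F. G m n (f m) (\<xi> (n - m)))\<oplus>(\<Oplus>m\<in>?F. G m n (g m) (\<xi> (n - m)))"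
  by (rule M.finsum_addf) (use assms in auto)
 also have "\<dots> = twist G f \<xi> n\<oplus>twist G g \<xi> n"
  using twist_superset[OF assms(1,3) F, of n] twist_superset[OF assms(2,3) F, of n] by simp
 finally show "twist G (\<lambda>n. f n\<oplus>g n) \<xi> n = twist G f \<xi> n\<oplus>twist G g \<xi> n" .
qed

lemma twist_add_right:
 assumes "f\<in>fs" "\<xi>\<in>fs" "\<eta>\<in>fs"
 shows "twist G f (\<lambda>n. \<xi> n\<oplus>\<eta> n) = (\<lambda>n. twist G f \<xi> n\<oplus>twist G f \<eta> n)"
proof
 fix n
 have "twist G f (\<lambda>n. \<xi> n\<oplus>\<eta> n) n = (\<Oplus>m\<in>{m. f m\<noteq>\<zero>}. G m n (f m) (\<xi> (n - m))\<oplus>G m n (f m) (\<eta> (n - m)))"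
  unfolding twist_def by (rule M.finsum_cong') (use assms in auto)
 also have "\<dots> = twist G f \<xi> n\<oplus>twist G f \<eta> n"
  unfolding twist_def by (rule M.finsum_addf) (use assms in auto)
 finally show "twist G f (\<lambda>n. \<xi> n\<oplus>\<eta> n) n = twist G f \<xi> n\<oplus>twist G f \<eta> n" .
qed

lemma twist_zero [simp]: "f\<in>fs ==> twist G (\<lambda>n. \<zero>) f = (\<lambda>n. \<zero>)" "f\<in>fs ==> twist G f (\<lambda>n. \<zero>) = (\<lambda>n. \<zero>)"
 by (auto simp: twist_def fun_eq_iff intro!: M.add.finprod_one_eqI)

lemma twist_smult_right:
 assumes "f\<in>fs" "\<xi>\<in>fs" shows "twist G f (\<lambda>n. c\<odot>\<xi> n) = (\<lambda>n. c\<odot>twist G f \<xi> n)"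
proof
 fix n
 have "twist G f (\<lambda>n. c\<odot>\<xi> n) n = (\<Oplus>m\<in>{m. f m\<noteq>\<zero>}. c\<odot>G m n (f m) (\<xi> (n - m)))"
  unfolding twist_def by (rule M.finsum_cong') (use assms in auto)
 also have "\<dots> = c\<odot>twist G f \<xi> n"
  unfolding twist_def by (rule finsum_smult_ldistr[symmetric]) (use assms in auto)
 finally show "twist G f (\<lambda>n. c\<odot>\<xi> n) n = c\<odot>twist G f \<xi> n" .
qed

lemma twist_smult_left:
 assumes "f\<in>fs" "\<xi>\<in>fs" shows "twist G (\<lambda>n. c\<odot>f n) \<xi> = (\<lambda>n. c\<odot>twist G f \<xi> n)"
proof
 fix n
 have "twist G (\<lambda>n. c\<odot>f n) \<xi> n = (\<Oplus>m\<in>{m. f m\<noteq>\<zero>}. G m n (c\<odot>f m) (\<xi> (n - m)))"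
  by (rule twist_superset) (use assms in auto)
 also have "\<dots> = (\<Oplus>m\<in>{m. f m\<noteq>\<zero>}. c\<odot>G m n (f m) (\<xi> (n - m)))"
  by (rule M.finsum_cong') (use assms in auto)
 also have "\<dots> = c\<odot>twist G f \<xi> n"
  unfolding twist_def by (rule finsum_smult_ldistr[symmetric]) (use assms in auto)
 finally show "twist G (\<lambda>n. c\<odot>f n) \<xi> n = c\<odot>twist G f \<xi> n" .
qed

lemma twist_single_left:
 assumes "a\<in>|A|" "\<xi>\<in>fs" shows "twist G (single m a) \<xi> n = G m n a (\<xi> (n - m))"
proof -
 have "twist G (single m a) \<xi> n = (\<Oplus>i\<in>{m}. G i n (single m a i) (\<xi> (n - i)))"
  by (rule twist_superset) (use assms in \<open>auto simp: single_apply\<close>)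
 also have "\<dots> = G m n (single m a m) (\<xi> (n - m))"
  by (subst M.finsum_insert) (use assms in \<open>auto simp: single_apply\<close>)
 finally show ?thesis by (simp add: single_apply)
qed

lemma twist_single:
 assumes "a\<in>|A|" "x\<in>|A|" shows "twist G (single m a) (single k x) = single (m + k) (G m (m + k) a x)"
 by (rule ext) (use assms in \<open>auto simp: twist_single_left single_apply algebra_simps\<close>)

lemma twist_fs [simp]: assumes "f\<in>fs" "\<xi>\<in>fs" shows "twist G f \<xi>\<in>fs"
 using assms(1)
proof (induction rule: fs_induct)
 case (single m a)
 show ?case
 proof (rule fsI)
  show "finite ((\<lambda>k. k + m) ` {k. \<xi> k\<noteq>\<zero>})" using assms(2) by auto
  show "twist G (single m a) \<xi> n = \<zero>" if "n\<notin>(\<lambda>k. k + m) ` {k. \<xi> k\<noteq>\<zero>}" for n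
  proof -
   have "\<xi> (n - m) = \<zero>" using that by (auto simp: image_iff dest: spec[of _ "n - m"])
   then show ?thesis using single assms(2) by (simp add: twist_single_left)
  qed
 qed (use single assms(2) in auto)
next
 case (add f g)
 then show ?case using assms(2) by (simp add: twist_add_left)
qed (use assms(2) in auto)

end

abbreviation "convG\<equiv>\<lambda>m n a x. a\<cdot>ap m x"
abbreviation "repG\<equiv>\<lambda>m n a x. ap (- n) a\<cdot>x"

lemma bil_conv: "bil convG"
 by (auto simp: bil_def expand)

lemma bil_rep: "bil repG"
 by (auto simp: bil_def expand)

abbreviation "conv\<equiv>twist convG"
abbreviation "rr\<equiv>regular_rep A \<alpha>"

lemma rr_twist: "rr = twist repG"
 by (auto simp: fun_eq_iff twist_def regular_rep_def)

definition fadj :: "(int=>'a)=>int=>'a" where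
 "fadj f = (\<lambda>n. ap n ((f (- n))\<star>))"

lemma CP_simps [simp]:
 "|CP| = fs" "f\<oplus>\<^sub>CP g = (\<lambda>n. f n\<oplus>g n)" "f\<cdot>\<^sub>CP g = conv f g" "c\<odot>\<^sub>CP f = (\<lambda>n. c\<odot>f n)"
 "f\<star>\<^sub>CP = fadj f" "\<zero>\<^sub>CP = (\<lambda>n. \<zero>)"
 by (simp_all add: crossed_prealgebra_def twist_def fadj_def fun_eq_iff)

lemma fadj_in [simp]: assumes "f\<in>fs" shows "fadj f\<in>fs"
proof (rule fsI)
 show "finite (uminus ` {n. f n\<noteq>\<zero>})" using assms by simp
 show "fadj f n = \<zero>" if "n\<notin>uminus ` {n. f n\<noteq>\<zero>}" for n
 proof -
  have "f (- n) = \<zero>" using that by (auto simp: image_iff dest: spec[of _ "- n"])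
  then show ?thesis by (simp add: fadj_def)
 qed
qed (use assms in \<open>auto simp: fadj_def\<close>)

lemma fadj_single: "a\<in>|A| ==> fadj (single m a) = single (- m) (ap (- m) (a\<star>))"
 by (auto simp: fadj_def single_def fun_eq_iff)

lemma fadj_add: "f\<in>fs ==> g\<in>fs ==> fadj (\<lambda>n. f n\<oplus>g n) = (\<lambda>n. fadj f n\<oplus>fadj g n)"
 by (auto simp: fadj_def adj_add)

lemma fadj_zero [simp]: "fadj (\<lambda>n. \<zero>) = (\<lambda>n. \<zero>)"
 by (simp add: fadj_def)

lemmas conv_rules = twist_add_left[OF bil_conv] twist_add_right[OF bil_conv] twist_zero[OF bil_conv]
 twist_single[OF bil_conv] twist_fs[OF bil_conv]
lemmas rr_rules = twist_add_left[OF bil_rep] twist_add_right[OF bil_rep] twist_zero[OF bil_rep]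
 twist_single[OF bil_rep] twist_fs[OF bil_rep]

lemma conv_assoc:
 assumes "f\<in>fs" "g\<in>fs" "h\<in>fs" shows "conv (conv f g) h = conv f (conv g h)"
 using assms(1)
proof (induction rule: fs_induct)
 case (single m a) note a = this
 show ?case using assms(2)
 proof (induction rule: fs_induct)
  case (single n b) note b = this
  show ?case using assms(3)
   by (induction rule: fs_induct) (use a b in \<open>simp_all add: conv_rules mult_assoc add.assoc\<close>)
 qed (use a assms(3) in \<open>simp_all add: conv_rules\<close>)
qed (use assms(2,3) in \<open>simp_all add: conv_rules\<close>)

lemma fadj_conv:
 assumes "f\<in>fs" "g\<in>fs" shows "fadj (conv f g) = conv (fadj g) (fadj f)"
 using assms(1)
proof (induction rule: fs_induct)
 case (single m a) note a = this
 show ?case using assms(2)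
  by (induction rule: fs_induct) (use a in \<open>simp_all add: conv_rules fadj_single fadj_add adj_mult add.commute\<close>)
qed (use assms(2) in \<open>simp_all add: conv_rules fadj_add\<close>)

lemma rr_conv:
 assumes "f\<in>fs" "g\<in>fs" "\<xi>\<in>fs" shows "rr (conv f g) \<xi> = rr f (rr g \<xi>)"
 unfolding rr_twist using assms(1)
proof (induction rule: fs_induct)
 case (single m a) note a = this
 show ?case using assms(2)
 proof (induction rule: fs_induct)
  case (single n b) note b = this
  show ?case using assms(3)
   by (induction rule: fs_induct) (use a b in \<open>simp_all add: conv_rules rr_rules mult_assoc add.assoc\<close>)
 qed (use a assms(3) in \<open>simp_all add: conv_rules rr_rules\<close>)
qed (use assms(2,3) in \<open>simp_all add: conv_rules rr_rules\<close>)

lemma fadj_fadj: "f\<in>fs ==> fadj (fadj f) = f"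
 by (auto simp: fadj_def adj_adj)

lemma fadj_smult: "f\<in>fs ==> fadj (\<lambda>n. c\<odot>f n) = (\<lambda>n. cnj c\<odot>fadj f n)"
 by (auto simp: fadj_def adj_smult)

lemma star_algebra_CP: "star_algebra CP"
 by (rule star_algebraI; simp add: conv_rules conv_assoc fadj_conv fadj_add fadj_fadj fadj_smult
   twist_smult_left[OF bil_conv] twist_smult_right[OF bil_conv]
   M.a_assoc M.a_comm M.a_lcomm smult_add_left smult_add_right neg_add)

end

context star_algebra
begin

lemma finsum_adj: "finite F ==> (\<And>i. i\<in>F ==> f i\<in>|A| ) ==> (\<Oplus>i\<in>F. f i)\<star> = (\<Oplus>i\<in>F. (f i)\<star>)"
proof (induction F rule: finite_induct)
 case (insert i F)
 have "(\<Oplus>i\<in>insert i F. f i) = f i\<oplus>(\<Oplus>i\<in>F. f i)" using insert by (intro M.finsum_insert) auto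
 moreover have "(\<Oplus>i\<in>insert i F. (f i)\<star>) = (f i)\<star>\<oplus>(\<Oplus>i\<in>F. (f i)\<star>)" using insert by (intro M.finsum_insert) auto
 ultimately show ?case using insert M.finsum_closed[of f F] by (simp add: adj_add Pi_def)
qed simp

lemma finsum_mult_right: "finite F ==> b\<in>|A| ==> (\<And>i. i\<in>F ==> f i\<in>|A| ) ==> (\<Oplus>i\<in>F. f i)\<cdot>b = (\<Oplus>i\<in>F. f i\<cdot>b)"
proof (induction F rule: finite_induct)
 case (insert i F)
 have "(\<Oplus>i\<in>insert i F. f i) = f i\<oplus>(\<Oplus>i\<in>F. f i)" using insert by (intro M.finsum_insert) auto
 moreover have "(\<Oplus>i\<in>insert i F. f i\<cdot>b) = f i\<cdot>b\<oplus>(\<Oplus>i\<in>F. f i\<cdot>b)" using insert by (intro M.finsum_insert) auto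
 ultimately show ?case using insert M.finsum_closed[of f F] by (simp add: distrib_right Pi_def)
qed simp

end

lemma (in cstar_algebra) Pos_smult:
 assumes "Pos x" "0\<le>r" shows "Pos (of_real r\<odot>x)"
 using unital_cstar.pos_smult[OF unital_multiplier, of "J x" r] assms by (simp add: Pos_def J_simps)

section \<open>The Hilbert module of square summable families and the reduced norm\<close>

context z_action
begin

definition ip :: "(int=>'a)=>(int=>'a)=>'a" where
 "ip \<xi> \<eta> = (\<Oplus>n\<in>{n. \<xi> n\<noteq>\<zero>}. (\<xi> n)\<star>\<cdot>\<eta> n)"

abbreviation "l2\<equiv>l2_norm A"

lemma ip_superset:
 assumes "\<xi>\<in>fs" "\<eta>\<in>fs" "finite F" "{m. \<xi> m\<noteq>\<zero>}\<subseteq>F"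
 shows "ip \<xi> \<eta> = (\<Oplus>m\<in>F. (\<xi> m)\<star>\<cdot>\<eta> m)"
 unfolding ip_def by (rule M.add.finprod_mono_neutral_cong_left) (use assms in auto)

lemma ip_in [simp]: "\<xi>\<in>fs ==> \<eta>\<in>fs ==> ip \<xi> \<eta>\<in>|A|"
 unfolding ip_def by (rule M.finsum_closed) auto

lemma ip_adj: assumes "\<xi>\<in>fs" "\<eta>\<in>fs" shows "(ip \<xi> \<eta>)\<star> = ip \<eta> \<xi>"
proof -
 let ?F = "{n. \<xi> n\<noteq>\<zero>}\<union>{n. \<eta> n\<noteq>\<zero>}"
 have F: "finite ?F" using assms by auto
 have "ip \<xi> \<eta> = (\<Oplus>m\<in>?F. (\<xi> m)\<star>\<cdot>\<eta> m)" by (rule ip_superset) (use assms in auto)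
 then have "(ip \<xi> \<eta>)\<star> = (\<Oplus>m\<in>?F. ((\<xi> m)\<star>\<cdot>\<eta> m)\<star>)" using finsum_adj[OF F, of "\<lambda>m. (\<xi> m)\<star>\<cdot>\<eta> m"] assms by simp
 also have "\<dots> = (\<Oplus>m\<in>?F. (\<eta> m)\<star>\<cdot>\<xi> m)" by (rule M.finsum_cong') (use assms in \<open>auto simp: adj_mult adj_adj\<close>)
 also have "\<dots> = ip \<eta> \<xi>" by (rule ip_superset[symmetric]) (use assms in auto)
 finally show ?thesis .
qed

lemma ip_add_right:
 assumes "\<xi>\<in>fs" "\<eta>\<in>fs" "\<zeta>\<in>fs" shows "ip \<xi> (\<lambda>n. \<eta> n\<oplus>\<zeta> n) = ip \<xi> \<eta>\<oplus>ip \<xi> \<zeta>"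
proof -
 have "ip \<xi> (\<lambda>n. \<eta> n\<oplus>\<zeta> n) = (\<Oplus>n\<in>{n. \<xi> n\<noteq>\<zero>}. (\<xi> n)\<star>\<cdot>\<eta> n\<oplus>(\<xi> n)\<star>\<cdot>\<zeta> n)"
  unfolding ip_def by (rule M.finsum_cong') (use assms in \<open>auto simp: distrib_left\<close>)
 also have "\<dots> = ip \<xi> \<eta>\<oplus>ip \<xi> \<zeta>"
  unfolding ip_def by (rule M.finsum_addf) (use assms in auto)
 finally show ?thesis .
qed

lemma ip_add_left:
 assumes "\<xi>\<in>fs" "\<eta>\<in>fs" "\<zeta>\<in>fs" shows "ip (\<lambda>n. \<eta> n\<oplus>\<zeta> n) \<xi> = ip \<eta> \<xi>\<oplus>ip \<zeta> \<xi>"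
proof -
 have "ip (\<lambda>n. \<eta> n\<oplus>\<zeta> n) \<xi> = (ip \<xi> (\<lambda>n. \<eta> n\<oplus>\<zeta> n))\<star>" by (rule ip_adj[symmetric]) (use assms in auto)
 then show ?thesis using assms by (simp add: ip_add_right adj_add ip_adj)
qed

lemma ip_smult_right:
 assumes "\<xi>\<in>fs" "\<eta>\<in>fs" shows "ip \<xi> (\<lambda>n. c\<odot>\<eta> n) = c\<odot>ip \<xi> \<eta>"
proof -
 have "ip \<xi> (\<lambda>n. c\<odot>\<eta> n) = (\<Oplus>n\<in>{n. \<xi> n\<noteq>\<zero>}. c\<odot>((\<xi> n)\<star>\<cdot>\<eta> n))"
  unfolding ip_def by (rule M.finsum_cong') (use assms in \<open>auto simp: smult_mult_right\<close>)
 also have "\<dots> = c\<odot>ip \<xi> \<eta>"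
  unfolding ip_def by (rule finsum_smult_ldistr[symmetric]) (use assms in auto)
 finally show ?thesis .
qed

lemma ip_smult_left:
 assumes "\<xi>\<in>fs" "\<eta>\<in>fs" shows "ip (\<lambda>n. c\<odot>\<eta> n) \<xi> = cnj c\<odot>ip \<eta> \<xi>"
proof -
 have "ip (\<lambda>n. c\<odot>\<eta> n) \<xi> = (ip \<xi> (\<lambda>n. c\<odot>\<eta> n))\<star>" by (rule ip_adj[symmetric]) (use assms in auto)
 then show ?thesis using assms by (simp add: ip_smult_right adj_smult ip_adj)
qed

lemma fs_mult [simp]: "\<xi>\<in>fs ==> b\<in>|A| ==> (\<lambda>n. \<xi> n\<cdot>b)\<in>fs"
 by (rule fsI[of _ "{n. \<xi> n\<noteq>\<zero>}"]) auto

lemma ip_mult_right: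
 assumes "\<xi>\<in>fs" "\<eta>\<in>fs" "b\<in>|A|" shows "ip \<xi> (\<lambda>n. \<eta> n\<cdot>b) = ip \<xi> \<eta>\<cdot>b"
proof -
 have "ip \<xi> (\<lambda>n. \<eta> n\<cdot>b) = (\<Oplus>n\<in>{n. \<xi> n\<noteq>\<zero>}. ((\<xi> n)\<star>\<cdot>\<eta> n)\<cdot>b)"
  unfolding ip_def by (rule M.finsum_cong') (use assms in \<open>auto simp: mult_assoc\<close>)
 also have "\<dots> = ip \<xi> \<eta>\<cdot>b"
  unfolding ip_def by (rule finsum_mult_right[symmetric]) (use assms in auto)
 finally show ?thesis .
qed

lemma ip_zero [simp]: "\<xi>\<in>fs ==> ip (\<lambda>n. \<zero>) \<xi> = \<zero>" "\<xi>\<in>fs ==> ip \<xi> (\<lambda>n. \<zero>) = \<zero>"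
 by (auto simp: ip_def intro!: M.add.finprod_one_eqI)

lemma ip_single:
 assumes "x\<in>|A|" "\<eta>\<in>fs" shows "ip (single p x) \<eta> = x\<star>\<cdot>\<eta> p"
proof -
 have "ip (single p x) \<eta> = (\<Oplus>n\<in>{p}. (single p x n)\<star>\<cdot>\<eta> n)"
  by (rule ip_superset) (use assms in \<open>auto simp: single_apply\<close>)
 also have "\<dots> = x\<star>\<cdot>\<eta> p" by (subst M.finsum_insert) (use assms in \<open>auto simp: single_apply\<close>)
 finally show ?thesis .
qed

lemma ip_Pos: "\<xi>\<in>fs ==> Pos (ip \<xi> \<xi>)"
 unfolding ip_def by (intro Pos_finsum Pos_cstar) auto

lemma l2_sq: "\<xi>\<in>fs ==> (l2 \<xi>)\<^sup>2 = ||ip \<xi> \<xi>||"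
 by (simp add: l2_norm_def ip_def[symmetric])

lemma l2_nonneg [simp]: "\<xi>\<in>fs ==> 0\<le>l2 \<xi>"
 by (simp add: l2_norm_def ip_def[symmetric])

text \<open>Let b be the inner product of \<xi> and \<eta>, x and p their squares, and \<zeta> =
  t\<eta> - \<xi>b. Then t^2 p - 2t b\<star>b + b\<star>xb, the square of \<zeta>, is positive,
  while b\<star>xb \<le> t b\<star>b. Together t b\<star>b \<le> t^2 p. A strictly positive t above
  the squared norm of \<xi> avoids dividing by a norm that may vanish; \<open>cauchy_schwarz\<close>
  then lets t decrease.\<close>

lemma cauchy_schwarz_aux:
 assumes \<xi>: "\<xi>\<in>fs" and \<eta>: "\<eta>\<in>fs" and t: "(l2 \<xi>)\<^sup>2\<le>t" "0 < t"
 shows "||ip \<xi> \<eta>||\<^sup>2\<le>t * (l2 \<eta>)\<^sup>2"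
proof -
 define b x p where "b = ip \<xi> \<eta>" and "x = ip \<xi> \<xi>" and "p = ip \<eta> \<eta>"
 have [simp]: "b\<in>|A|" "x\<in>|A|" "p\<in>|A|" using \<xi> \<eta> by (auto simp: b_def x_def p_def)
 have [simp]: "x\<star> = x" "p\<star> = p" using \<xi> \<eta> by (auto simp: x_def p_def ip_adj)
 have bs: "ip \<eta> \<xi> = b\<star>" using \<xi> \<eta> by (simp add: b_def ip_adj)
 define c where "c = (-1)\<odot>b"
 have [simp]: "c\<in>|A|" by (simp add: c_def)
 define \<zeta> where "\<zeta> = (\<lambda>n. of_real t\<odot>\<eta> n\<oplus>\<xi> n\<cdot>c)"
 have \<zeta>: "\<zeta>\<in>fs" using \<xi> \<eta> by (simp add: \<zeta>_def)
 have z: "ip \<theta> \<zeta> = of_real t\<odot>ip \<theta> \<eta>\<oplus>ip \<theta> \<xi>\<cdot>c" if "\<theta>\<in>fs" for \<theta>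
  using that \<xi> \<eta> by (simp add: \<zeta>_def ip_add_right ip_smult_right ip_mult_right)
 have "ip \<zeta> \<zeta> = of_real t\<odot>(ip \<eta> \<zeta>)\<star>\<oplus>(ip \<xi> \<zeta>)\<star>\<cdot>c"
  using z[OF \<zeta>] \<xi> \<eta> \<zeta> by (simp add: ip_adj)
 also have "\<dots> = of_real t\<odot>(of_real t\<odot>p\<oplus>b\<star>\<cdot>c)\<star>\<oplus>(of_real t\<odot>b\<oplus>x\<cdot>c)\<star>\<cdot>c"
  using z[OF \<xi>] z[OF \<eta>] bs by (simp add: b_def[symmetric] x_def[symmetric] p_def[symmetric])
 also have "\<dots> = of_real (t * t)\<odot>p\<ominus>of_real (2 * t)\<odot>(b\<star>\<cdot>b)\<oplus>b\<star>\<cdot>x\<cdot>b"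
  unfolding c_def by ((simp add: expand)?; (rule linI, (rule lins | (simp add: algebra_simps; fail))+))
 finally have zz: "ip \<zeta> \<zeta> = of_real (t * t)\<odot>p\<ominus>of_real (2 * t)\<odot>(b\<star>\<cdot>b)\<oplus>b\<star>\<cdot>x\<cdot>b" .
 let ?x = "of_real (inverse t)\<odot>x"
 have "||?x||\<le>1" by (rule norm_scale_le) (use t l2_sq[OF \<xi>] in \<open>auto simp: x_def[symmetric]\<close>)
 moreover have "sa ?x" by (intro sa_smult) (simp add: sa_def del: sa_in sa_adj)
 ultimately obtain y where y: "y\<in>|A|" "b\<star>\<cdot>b\<ominus>b\<star>\<cdot>?x\<cdot>b = y\<star>\<cdot>y"
  using sandwich_square[of ?x b] by auto
 have tt: "of_real t * inverse (of_real t) = (1 :: complex)" using t by simp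
 have ty: "of_real t\<odot>(y\<star>\<cdot>y) = of_real t\<odot>(b\<star>\<cdot>b)\<ominus>b\<star>\<cdot>x\<cdot>b"
  unfolding y(2)[symmetric] using tt by (simp add: expand)
 have "of_real (t * t)\<odot>p = of_real t\<odot>(b\<star>\<cdot>b)\<oplus>(ip \<zeta> \<zeta>\<oplus>of_real t\<odot>(y\<star>\<cdot>y))"
  unfolding zz ty by ((simp add: expand)?; (rule linI, (rule lins | (simp add: algebra_simps; fail))+))
 moreover have "Pos (of_real t\<odot>(b\<star>\<cdot>b))" "Pos (ip \<zeta> \<zeta>\<oplus>of_real t\<odot>(y\<star>\<cdot>y))"
  using t y(1) \<zeta> by (auto intro!: Pos_smult Pos_cstar Pos_add ip_Pos)
 ultimately have "||of_real t\<odot>(b\<star>\<cdot>b)||\<le>||of_real (t * t)\<odot>p||"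
  using Pos_norm_mono by simp
 then have "t * ||b||\<^sup>2\<le>t * (t * ||p||)" using t by (simp add: norm_smult norm_cstar Real_Vector_Spaces.norm_mult mult.assoc)
 then show ?thesis using t l2_sq[OF \<eta>] by (simp add: b_def p_def)
qed

lemma cauchy_schwarz:
 assumes \<xi>: "\<xi>\<in>fs" and \<eta>: "\<eta>\<in>fs" shows "||ip \<xi> \<eta>||\<le>l2 \<xi> * l2 \<eta>"
proof (rule power2_le_imp_le)
 show "0\<le>l2 \<xi> * l2 \<eta>" using assms by simp
 show "||ip \<xi> \<eta>||\<^sup>2\<le>(l2 \<xi> * l2 \<eta>)\<^sup>2"
 proof (rule LIMSEQ_le_const)
  show "(\<lambda>n. ((l2 \<xi>)\<^sup>2 + 1 / real (Suc n)) * (l2 \<eta>)\<^sup>2)\<longlonglongrightarrow>(l2 \<xi> * l2 \<eta>)\<^sup>2"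
   using tendsto_mult_right[OF tendsto_add[OF tendsto_const LIMSEQ_Suc[OF lim_1_over_n]], of "(l2 \<xi>)\<^sup>2" "(l2 \<eta>)\<^sup>2"]
   by (simp add: power_mult_distrib)
  show "\<exists>N. \<forall>n\<ge>N. ||ip \<xi> \<eta>||\<^sup>2\<le>((l2 \<xi>)\<^sup>2 + 1 / real (Suc n)) * (l2 \<eta>)\<^sup>2"
   by (intro exI[of _ 0] allI impI cauchy_schwarz_aux assms) (auto intro: add_nonneg_pos)
 qed
qed

lemma l2_smult: "\<xi>\<in>fs ==> l2 (\<lambda>n. c\<odot>\<xi> n) = cmod c * l2 \<xi>"
proof -
 assume \<xi>: "\<xi>\<in>fs"
 have "(l2 (\<lambda>n. c\<odot>\<xi> n))\<^sup>2 = ||(cnj c * c)\<odot>ip \<xi> \<xi>||"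
  using \<xi> by (simp add: l2_sq ip_smult_left ip_smult_right mult.commute)
 also have "\<dots> = (cmod c * l2 \<xi>)\<^sup>2"
  unfolding power_mult_distrib l2_sq[OF \<xi>] using \<xi>
  by (simp add: norm_smult power2_eq_square Real_Vector_Spaces.norm_mult)
 finally have "(l2 (\<lambda>n. c\<odot>\<xi> n))\<^sup>2 = (cmod c * l2 \<xi>)\<^sup>2" .
 then show ?thesis using \<xi> by (simp add: power2_eq_iff_nonneg)
qed

lemma l2_add:
 assumes \<xi>: "\<xi>\<in>fs" and \<eta>: "\<eta>\<in>fs" shows "l2 (\<lambda>n. \<xi> n\<oplus>\<eta> n)\<le>l2 \<xi> + l2 \<eta>"
proof (rule power2_le_imp_le)
 note [simp] = assms
 have "(l2 (\<lambda>n. \<xi> n\<oplus>\<eta> n))\<^sup>2 = ||(ip \<xi> \<xi>\<oplus>ip \<xi> \<eta>)\<oplus>(ip \<eta> \<xi>\<oplus>ip \<eta> \<eta>)||"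
  by (simp add: l2_sq ip_add_left ip_add_right)
 also have "\<dots>\<le>( ||ip \<xi> \<xi>|| + ||ip \<xi> \<eta>||) + ( ||ip \<eta> \<xi>|| + ||ip \<eta> \<eta>||)"
  using norm_triangle[of "ip \<xi> \<xi>\<oplus>ip \<xi> \<eta>" "ip \<eta> \<xi>\<oplus>ip \<eta> \<eta>"] norm_triangle[of "ip \<xi> \<xi>" "ip \<xi> \<eta>"]
   norm_triangle[of "ip \<eta> \<xi>" "ip \<eta> \<eta>"] by simp
 also have "\<dots>\<le>((l2 \<xi>)\<^sup>2 + l2 \<xi> * l2 \<eta>) + (l2 \<eta> * l2 \<xi> + (l2 \<eta>)\<^sup>2)"
  using cauchy_schwarz[OF \<xi> \<eta>] cauchy_schwarz[OF \<eta> \<xi>] unfolding l2_sq[OF \<xi>] l2_sq[OF \<eta>] by linarith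
 also have "\<dots> = (l2 \<xi> + l2 \<eta>)\<^sup>2" by (simp add: power2_eq_square algebra_simps)
 finally show "(l2 (\<lambda>n. \<xi> n\<oplus>\<eta> n))\<^sup>2\<le>(l2 \<xi> + l2 \<eta>)\<^sup>2" .
qed (use assms in simp)

lemma rr_fs [simp]: "f\<in>fs ==> \<xi>\<in>fs ==> rr f \<xi>\<in>fs"
 unfolding rr_twist by (rule rr_rules)

lemma rr_adj:
 assumes "f\<in>fs" "\<xi>\<in>fs" "\<eta>\<in>fs" shows "ip (rr f \<xi>) \<eta> = ip \<xi> (rr (fadj f) \<eta>)"
 unfolding rr_twist using assms(1)
proof (induction rule: fs_induct)
 case (single m a) note a = this
 show ?case using assms(2)
 proof (induction rule: fs_induct)
  case (single k x)
  define c where "c = ap (- (m + k)) a"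
  have c [simp]: "c\<in>|A|" using a by (simp add: c_def)
  have "ip (twist repG (single m a) (single k x)) \<eta> = ip (single (m + k) (c\<cdot>x)) \<eta>"
   using a single by (simp add: rr_rules c_def)
  also have "\<dots> = (c\<cdot>x)\<star>\<cdot>\<eta> (m + k)" using single assms(3) by (intro ip_single) auto
  also have "\<dots> = x\<star>\<cdot>twist repG (single (- m) (ap (- m) (a\<star>))) \<eta> k"
   using a single assms(3) by (subst twist_single_left[OF bil_rep]) (simp_all add: c_def adj_mult mult_assoc add.commute)
  also have "\<dots> = ip (single k x) (twist repG (single (- m) (ap (- m) (a\<star>))) \<eta>)"
   using a single assms(3) by (intro ip_single[symmetric]) (auto intro: rr_rules)
  finally show ?case using a by (simp add: fadj_single)
 qed (use a assms(3) in \<open>simp_all add: rr_rules ip_add_left fadj_single\<close>)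
qed (use assms(2,3) in \<open>simp_all add: rr_rules ip_add_left ip_add_right fadj_add\<close>)

text \<open>A homogeneous element acts as a shift combined with multiplication, coordinate by
  coordinate, by images of \<open>a\<close> under the automorphism, all of the same norm. The
  operator inequality of \<open>cpos_sandwich\<close> is applied in each coordinate and summed, so
  the estimate does not depend on the size of the support.\<close>

lemma rr_single_bound:
 assumes a: "a\<in>|A|" and \<xi>: "\<xi>\<in>fs" shows "l2 (rr (single m a) \<xi>)\<le>||a|| * l2 \<xi>"
proof -
 note [simp] = a \<xi>
 define d where "d = ap (- m) a"
 have [simp]: "d\<in>|A|" by (simp add: d_def)
 let ?S = "{n. \<xi> n\<noteq>\<zero>}"
 have nap: "||ap (- n) d||\<^sup>2 = ||a||\<^sup>2" for n by (simp add: d_def)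
 have "ip (rr (single m a) \<xi>) (rr (single m a) \<xi>) = ip \<xi> (rr (conv (fadj (single m a)) (single m a)) \<xi>)"
  by (simp add: rr_adj rr_conv)
 also have "conv (fadj (single m a)) (single m a) = single 0 (d\<star>\<cdot>d)"
  by (simp add: fadj_single conv_rules d_def)
 also have "ip \<xi> (rr (single 0 (d\<star>\<cdot>d)) \<xi>) = (\<Oplus>n\<in>?S. (ap (- n) d\<cdot>\<xi> n)\<star>\<cdot>(ap (- n) d\<cdot>\<xi> n))"
  unfolding ip_def rr_twist by (rule M.finsum_cong') (auto simp: twist_single_left[OF bil_rep] expand)
 finally have e: "ip (rr (single m a) \<xi>) (rr (single m a) \<xi>) = (\<Oplus>n\<in>?S. (ap (- n) d\<cdot>\<xi> n)\<star>\<cdot>(ap (- n) d\<cdot>\<xi> n))" .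
 have P: "Pos (ip (rr (single m a) \<xi>) (rr (single m a) \<xi>))" by (rule ip_Pos) simp
 have le: "(l2 (rr (single m a) \<xi>))\<^sup>2\<le>t * (l2 \<xi>)\<^sup>2" if t: "||a||\<^sup>2\<le>t" "0 < t" for t
 proof -
  let ?u = "\<lambda>n. (ap (- n) d\<cdot>\<xi> n)\<star>\<cdot>(ap (- n) d\<cdot>\<xi> n)"
  let ?v = "\<lambda>n. of_real t\<odot>((\<xi> n)\<star>\<cdot>\<xi> n)\<ominus>?u n"
  have "Pos (\<Oplus>n\<in>?S. ?v n)"
   by (intro Pos_finsum Pos_cpos cpos_sandwich) (use t nap in auto)
  moreover have "(\<Oplus>n\<in>?S. ?u n)\<oplus>(\<Oplus>n\<in>?S. ?v n) = of_real t\<odot>ip \<xi> \<xi>"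
  proof -
   have "(\<Oplus>n\<in>?S. ?u n)\<oplus>(\<Oplus>n\<in>?S. ?v n) = (\<Oplus>n\<in>?S. ?u n\<oplus>?v n)"
    by (rule M.finsum_addf[symmetric]) auto
   also have "\<dots> = (\<Oplus>n\<in>?S. of_real t\<odot>((\<xi> n)\<star>\<cdot>\<xi> n))"
   proof (rule M.finsum_cong')
    fix n assume "n\<in>?S"
    define u w where "u = ?u n" and "w = (\<xi> n)\<star>\<cdot>\<xi> n"
    have [simp]: "u\<in>|A|" "w\<in>|A|" by (simp_all add: u_def w_def)
    show "?u n\<oplus>?v n = of_real t\<odot>((\<xi> n)\<star>\<cdot>\<xi> n)" unfolding u_def[symmetric] w_def[symmetric] by ((simp add: expand)?; (rule linI, (rule lins | (simp add: algebra_simps; fail))+))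
   qed auto
   also have "\<dots> = of_real t\<odot>ip \<xi> \<xi>" unfolding ip_def by (rule finsum_smult_ldistr[symmetric]) auto
   finally show ?thesis .
  qed
  ultimately have "||\<Oplus>n\<in>?S. ?u n||\<le>||of_real t\<odot>ip \<xi> \<xi>||"
   using Pos_norm_mono[of "\<Oplus>n\<in>?S. ?u n" "\<Oplus>n\<in>?S. ?v n"] P unfolding e by simp
  then show ?thesis using t by (simp add: l2_sq e norm_smult)
 qed
 have "(l2 (rr (single m a) \<xi>))\<^sup>2\<le>( ||a|| * l2 \<xi>)\<^sup>2"
 proof (rule LIMSEQ_le_const)
  show "(\<lambda>n. ( ||a||\<^sup>2 + 1 / real (Suc n)) * (l2 \<xi>)\<^sup>2)\<longlonglongrightarrow>( ||a|| * l2 \<xi>)\<^sup>2"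
   using tendsto_mult_right[OF tendsto_add[OF tendsto_const LIMSEQ_Suc[OF lim_1_over_n]], of "||a||\<^sup>2" "(l2 \<xi>)\<^sup>2"]
   by (simp add: power_mult_distrib)
  show "\<exists>N. \<forall>n\<ge>N. (l2 (rr (single m a) \<xi>))\<^sup>2\<le>( ||a||\<^sup>2 + 1 / real (Suc n)) * (l2 \<xi>)\<^sup>2"
   by (intro exI[of _ 0] allI impI le) (auto intro: add_nonneg_pos)
 qed
 then show ?thesis by (rule power2_le_imp_le) simp
qed

lemma rr_bounded: assumes "f\<in>fs" shows "\<exists>C\<ge>0. \<forall>\<xi>\<in>fs. l2 (rr f \<xi>)\<le>C * l2 \<xi>"
 using assms
proof (induction rule: fs_induct)
 case zero
 have "l2 (\<lambda>n. \<zero>) = 0" by (simp add: l2_norm_def)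
 then show ?case by (intro exI[of _ 0]) (simp add: rr_twist rr_rules)
next
 case (single m a)
 then show ?case using rr_single_bound by (intro exI[of _ "||a||"]) auto
next
 case (add f g)
 then obtain C D where C: "C\<ge>0" "\<forall>\<xi>\<in>fs. l2 (rr f \<xi>)\<le>C * l2 \<xi>" and D: "D\<ge>0" "\<forall>\<xi>\<in>fs. l2 (rr g \<xi>)\<le>D * l2 \<xi>" by blast
 have "l2 (rr (\<lambda>n. f n\<oplus>g n) \<xi>)\<le>(C + D) * l2 \<xi>" if \<xi>: "\<xi>\<in>fs" for \<xi>
 proof -
  have "rr (\<lambda>n. f n\<oplus>g n) \<xi> = (\<lambda>n. rr f \<xi> n\<oplus>rr g \<xi> n)" using add \<xi> by (simp add: rr_twist rr_rules)
  then have "l2 (rr (\<lambda>n. f n\<oplus>g n) \<xi>)\<le>l2 (rr f \<xi>) + l2 (rr g \<xi>)" using add \<xi> l2_add by simp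
  moreover have "l2 (rr f \<xi>)\<le>C * l2 \<xi>" "l2 (rr g \<xi>)\<le>D * l2 \<xi>" using C D \<xi> by auto
  ultimately show ?thesis by (simp add: ring_distribs)
 qed
 then show ?case using C D by (intro exI[of _ "C + D"]) auto
qed

lemma CP_norm_def: "||f||\<^sub>CP = Sup {l2 (rr f \<xi>) | \<xi>. \<xi>\<in>fs\<and>l2 \<xi>\<le>1}"
 by (simp add: crossed_prealgebra_def)

lemma l2_zero [simp]: "l2 (\<lambda>n. \<zero>) = 0" by (simp add: l2_norm_def)

lemma CP_norm_le: assumes "f\<in>fs" "0\<le>C" "\<And>\<xi>. \<xi>\<in>fs ==> l2 (rr f \<xi>)\<le>C * l2 \<xi>" shows "||f||\<^sub>CP\<le>C"
 unfolding CP_norm_def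
proof (rule cSup_least)
 show "{l2 (rr f \<xi>) | \<xi>. \<xi>\<in>fs\<and>l2 \<xi>\<le>1}\<noteq>{}" by (auto intro: exI[of _ "\<lambda>n. \<zero>"])
 fix r assume "r\<in>{l2 (rr f \<xi>) | \<xi>. \<xi>\<in>fs\<and>l2 \<xi>\<le>1}"
 then obtain \<xi> where \<xi>: "r = l2 (rr f \<xi>)" "\<xi>\<in>fs" "l2 \<xi>\<le>1" by blast
 have "C * l2 \<xi>\<le>C * 1" using \<xi> assms(2) by (intro mult_left_mono) auto
 then show "r\<le>C" using assms(3)[OF \<xi>(2)] \<xi>(1) by simp
qed

lemma rr_le1: assumes "f\<in>fs" "\<xi>\<in>fs" "l2 \<xi>\<le>1" shows "l2 (rr f \<xi>)\<le>||f||\<^sub>CP"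
proof -
 obtain C where C: "C\<ge>0" "\<forall>\<xi>\<in>fs. l2 (rr f \<xi>)\<le>C * l2 \<xi>" using rr_bounded[OF assms(1)] by blast
 have "l2 (rr f \<xi>)\<le>C" if "\<xi>\<in>fs" "l2 \<xi>\<le>1" for \<xi>
 proof -
  have "C * l2 \<xi>\<le>C * 1" using that C by (intro mult_left_mono) auto
  then show ?thesis using C(2) that by fastforce
 qed
 then have "bdd_above {l2 (rr f \<xi>) | \<xi>. \<xi>\<in>fs\<and>l2 \<xi>\<le>1}" by (intro bdd_aboveI) auto
 then show ?thesis unfolding CP_norm_def using assms by (intro cSup_upper) auto
qed

lemma CP_norm_nonneg: "f\<in>fs ==> 0\<le>||f||\<^sub>CP"
 using order_trans[OF l2_nonneg rr_le1[of f "\<lambda>n. \<zero>"]] by simp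

lemma rr_le: assumes f: "f\<in>fs" and \<xi>: "\<xi>\<in>fs" shows "l2 (rr f \<xi>)\<le>||f||\<^sub>CP * l2 \<xi>"
proof (cases "l2 \<xi> = 0")
 case True
 obtain C where C: "C\<ge>0" "\<forall>\<xi>\<in>fs. l2 (rr f \<xi>)\<le>C * l2 \<xi>" using rr_bounded[OF f] by blast
 then show ?thesis using True \<xi> by fastforce
next
 case False
 then have p: "l2 \<xi> > 0" using l2_nonneg[OF \<xi>] by linarith
 define r where "r = inverse (l2 \<xi>)"
 have r: "r > 0" using p by (simp add: r_def)
 have "l2 (rr f (\<lambda>n. of_real r\<odot>\<xi> n))\<le>||f||\<^sub>CP"
  by (rule rr_le1) (use f \<xi> p r in \<open>auto simp: l2_smult r_def norm_inverse\<close>)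
 moreover have "rr f (\<lambda>n. of_real r\<odot>\<xi> n) = (\<lambda>n. of_real r\<odot>rr f \<xi> n)"
  unfolding rr_twist by (rule twist_smult_right[OF bil_rep f \<xi>])
 moreover have "l2 (\<lambda>n. of_real r\<odot>rr f \<xi> n) = r * l2 (rr f \<xi>)" using f \<xi> r by (simp add: l2_smult)
 ultimately have "r * l2 (rr f \<xi>)\<le>||f||\<^sub>CP" by simp
 then show ?thesis using p by (simp add: r_def field_simps)
qed

text \<open>The usual argument for adjointable operators on a Hilbert module: Cauchy-Schwarz
  together with \<open>rr_adj\<close> yields both the isometry of the adjoint and the
  C*-identity.\<close>

theorem pre_cstar_CP: "pre_cstar CP"
proof -
 interpret C: star_algebra CP by (rule star_algebra_CP)
 have mult_le: "||conv f g||\<^sub>CP\<le>||f||\<^sub>CP * ||g||\<^sub>CP" if f: "f\<in>fs" and g: "g\<in>fs" for f g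
 proof (rule CP_norm_le)
  show "l2 (rr (conv f g) \<xi>)\<le>||f||\<^sub>CP * ||g||\<^sub>CP * l2 \<xi>" if "\<xi>\<in>fs" for \<xi>
   using order_trans[OF rr_le[OF f, of "rr g \<xi>"] mult_left_mono[OF rr_le[OF g that] CP_norm_nonneg[OF f]]] f g that
   by (simp add: rr_conv mult.assoc)
 qed (use f g CP_norm_nonneg conv_rules in auto)
 have adj_le: "||fadj f||\<^sub>CP\<le>||f||\<^sub>CP" if f: "f\<in>fs" for f
 proof (rule CP_norm_le)
  fix \<xi> assume \<xi>: "\<xi>\<in>fs"
  let ?y = "rr (fadj f) \<xi>"
  have y: "?y\<in>fs" using f \<xi> by simp
  have "(l2 ?y)\<^sup>2 = ||ip \<xi> (rr f ?y)||" using l2_sq[OF y] rr_adj[of "fadj f" \<xi> ?y] f \<xi> y by (simp add: fadj_fadj)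
  also have "\<dots>\<le>l2 \<xi> * ( ||f||\<^sub>CP * l2 ?y)"
   using order_trans[OF cauchy_schwarz[OF \<xi>, of "rr f ?y"] mult_left_mono[OF rr_le[OF f y]]] f \<xi> y by simp
  finally have *: "l2 ?y * l2 ?y\<le>( ||f||\<^sub>CP * l2 \<xi>) * l2 ?y" by (simp add: power2_eq_square mult_ac)
  show "l2 ?y\<le>||f||\<^sub>CP * l2 \<xi>"
  proof (cases "l2 ?y = 0")
   case True then show ?thesis using CP_norm_nonneg[OF f] \<xi> by simp
  next
   case False
   then have "l2 ?y > 0" using l2_nonneg[OF y] by linarith
   then show ?thesis using * mult_le_cancel_right_pos by blast
  qed
 qed (use f CP_norm_nonneg in auto)
 show ?thesis
 proof
  show "cstar_seminorm CP (cnorm CP)"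
   unfolding cstar_seminorm_def CP_simps
  proof (intro conjI ballI allI)
   fix f g c assume f: "f\<in>fs" and g: "g\<in>fs"
   show "0\<le>||f||\<^sub>CP" by (rule CP_norm_nonneg[OF f])
   show "||conv f g||\<^sub>CP\<le>||f||\<^sub>CP * ||g||\<^sub>CP" by (rule mult_le[OF f g])
   show "||\<lambda>n. f n\<oplus>g n||\<^sub>CP\<le>||f||\<^sub>CP + ||g||\<^sub>CP"
   proof (rule CP_norm_le)
    fix \<xi> assume \<xi>: "\<xi>\<in>fs"
    have "rr (\<lambda>n. f n\<oplus>g n) \<xi> = (\<lambda>n. rr f \<xi> n\<oplus>rr g \<xi> n)" using f g \<xi> by (simp add: rr_twist rr_rules)
    then have "l2 (rr (\<lambda>n. f n\<oplus>g n) \<xi>)\<le>l2 (rr f \<xi>) + l2 (rr g \<xi>)" using f g \<xi> l2_add by simp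
    then show "l2 (rr (\<lambda>n. f n\<oplus>g n) \<xi>)\<le>( ||f||\<^sub>CP + ||g||\<^sub>CP) * l2 \<xi>"
     using rr_le[OF f \<xi>] rr_le[OF g \<xi>] by (simp add: ring_distribs)
   qed (use f g CP_norm_nonneg in auto)
   have sm: "||\<lambda>n. c\<odot>f n||\<^sub>CP\<le>cmod c * ||f||\<^sub>CP" if f: "f\<in>fs" for f c
   proof (rule CP_norm_le)
    fix \<xi> assume \<xi>: "\<xi>\<in>fs"
    have "rr (\<lambda>n. c\<odot>f n) \<xi> = (\<lambda>n. c\<odot>rr f \<xi> n)" unfolding rr_twist by (rule twist_smult_left[OF bil_rep f \<xi>])
    then show "l2 (rr (\<lambda>n. c\<odot>f n) \<xi>)\<le>cmod c * ||f||\<^sub>CP * l2 \<xi>"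
     using mult_left_mono[OF rr_le[OF f \<xi>], of "cmod c"] f \<xi> by (simp add: l2_smult mult.assoc)
   qed (use f CP_norm_nonneg in auto)
   show "||\<lambda>n. c\<odot>f n||\<^sub>CP = cmod c * ||f||\<^sub>CP"
   proof (cases "c = 0")
    case True
    then show ?thesis using sm[OF f, of 0] CP_norm_nonneg[of "\<lambda>n. \<zero>"] f by simp
   next
    case False
    then have "||f||\<^sub>CP\<le>inverse (cmod c) * ||\<lambda>n. c\<odot>f n||\<^sub>CP"
     using sm[of "\<lambda>n. c\<odot>f n" "inverse c"] f by (simp add: norm_inverse)
    then show ?thesis using sm[OF f, of c] False by (simp add: field_simps)
   qed
   show "||conv (fadj f) f||\<^sub>CP = ( ||f||\<^sub>CP)\<^sup>2"
   proof (rule antisym)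
    have "||conv (fadj f) f||\<^sub>CP\<le>||fadj f||\<^sub>CP * ||f||\<^sub>CP" by (rule mult_le) (use f in auto)
    also have "\<dots>\<le>||f||\<^sub>CP * ||f||\<^sub>CP" by (rule mult_right_mono[OF adj_le[OF f] CP_norm_nonneg[OF f]])
    finally show "||conv (fadj f) f||\<^sub>CP\<le>( ||f||\<^sub>CP)\<^sup>2" by (simp add: power2_eq_square)
    let ?N = "||conv (fadj f) f||\<^sub>CP"
    have ff: "conv (fadj f) f\<in>fs" using f conv_rules by auto
    have "||f||\<^sub>CP\<le>sqrt ?N"
    proof (rule CP_norm_le[OF f])
     show "0\<le>sqrt ?N" using CP_norm_nonneg[OF ff] by simp
     fix \<xi> assume \<xi>: "\<xi>\<in>fs"
     have "(l2 (rr f \<xi>))\<^sup>2 = ||ip \<xi> (rr (conv (fadj f) f) \<xi>)||"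
      using f \<xi> by (simp add: l2_sq rr_adj rr_conv)
     also have "\<dots>\<le>l2 \<xi> * (?N * l2 \<xi>)"
      using order_trans[OF cauchy_schwarz[OF \<xi>] mult_left_mono[OF rr_le[OF ff \<xi>]]] ff \<xi> by simp
     finally have "(l2 (rr f \<xi>))\<^sup>2\<le>(sqrt ?N * l2 \<xi>)\<^sup>2"
      using CP_norm_nonneg[OF ff] by (simp add: power_mult_distrib power2_eq_square mult_ac)
     then show "l2 (rr f \<xi>)\<le>sqrt ?N * l2 \<xi>"
      by (rule power2_le_imp_le) (use CP_norm_nonneg[OF ff] \<xi> in simp)
    qed
    then have "( ||f||\<^sub>CP)\<^sup>2\<le>(sqrt ?N)\<^sup>2" using CP_norm_nonneg[OF f] by (rule power_mono)
    then show "( ||f||\<^sub>CP)\<^sup>2\<le>?N" using CP_norm_nonneg[OF ff] by simp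
   qed
  qed
 qed
qed

lemma l2_coeff_le: assumes \<xi>: "\<xi>\<in>fs" shows "||\<xi> n||\<le>l2 \<xi>"
proof (rule power2_le_imp_le)
 let ?S = "{n. \<xi> n\<noteq>\<zero>} - {n}"
 let ?t = "\<lambda>n. (\<xi> n)\<star>\<cdot>\<xi> n"
 have "ip \<xi> \<xi> = (\<Oplus>m\<in>insert n ?S. ?t m)" by (rule ip_superset) (use \<xi> in auto)
 also have "\<dots> = ?t n\<oplus>(\<Oplus>m\<in>?S. ?t m)" by (rule M.finsum_insert) (use \<xi> in auto)
 finally have "ip \<xi> \<xi> = ?t n\<oplus>(\<Oplus>m\<in>?S. ?t m)" .
 moreover have "Pos (?t n)" "Pos (\<Oplus>m\<in>?S. ?t m)" using \<xi> by (auto intro!: Pos_finsum Pos_cstar)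
 ultimately have "||?t n||\<le>||ip \<xi> \<xi>||" using Pos_norm_mono by simp
 then show "||\<xi> n||\<^sup>2\<le>(l2 \<xi>)\<^sup>2" using \<xi> by (simp add: l2_sq norm_cstar)
qed (use \<xi> in simp)

lemma rr_single_zero:
 assumes "f\<in>fs" "x\<in>|A|" shows "rr f (single 0 x) n = ap (- n) (f n)\<cdot>x"
 unfolding rr_twist using assms(1)
proof (induction rule: fs_induct)
 case (single m a)
 then have "twist repG (single m a) (single 0 x) n = single m (ap (- m) a\<cdot>x) n"
  using assms(2) by (simp add: rr_rules)
 also have "single m (ap (- m) a\<cdot>x) n = ap (- n) (single m a n)\<cdot>x"
  using single assms(2) by (simp add: single_apply)
 finally show ?case .
qed (use assms(2) in \<open>simp_all add: rr_rules distrib_right\<close>)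

text \<open>The n-th coefficient is read off from a vector supported at 0: its image has the entry
  cx at n, where c is the transported coefficient. For x = c\<star> this entry has norm the square
  of that of c. These lower bounds are what makes the crossed product norm dominate other
  representations.\<close>

lemma CP_coeff_le: assumes f: "f\<in>fs" shows "||f n||\<le>||f||\<^sub>CP"
proof -
 define c where "c = ap (- n) (f n)"
 have c [simp]: "c\<in>|A|" using f by (simp add: c_def)
 have nc: "||c|| = ||f n||" using f by (simp add: c_def)
 let ?\<xi> = "single 0 (c\<star>)"
 have "(l2 ?\<xi>)\<^sup>2 = ||c||\<^sup>2" by (simp add: l2_sq ip_single single_apply adj_adj norm_cstar')
 then have l: "l2 ?\<xi> = ||c||" by (simp add: power2_eq_iff_nonneg)
 have "||c\<cdot>c\<star>||\<le>||f||\<^sub>CP * l2 ?\<xi>"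
  using l2_coeff_le[of "rr f ?\<xi>" n] rr_le[OF f, of ?\<xi>] rr_single_zero[OF f, of "c\<star>" n] f
  by (simp add: c_def[symmetric])
 then have *: "||c|| * ||c||\<le>||f||\<^sub>CP * ||c||" by (simp add: l norm_cstar' power2_eq_square)
 show ?thesis
 proof (cases "||c|| = 0")
  case True
  then have "||f n|| = 0" unfolding nc .
  then show ?thesis using CP_norm_nonneg[OF f] by linarith
 next
  case False
  then have "||c|| > 0" using norm_nonneg[OF c] by linarith
  then have "||c||\<le>||f||\<^sub>CP" using * mult_le_cancel_right_pos by blast
  then show ?thesis unfolding nc .
 qed
qed

lemma CP_norm_single: assumes a: "a\<in>|A|" shows "||single n a||\<^sub>CP = ||a||"
proof (rule antisym)
 show "||single n a||\<^sub>CP\<le>||a||" by (rule CP_norm_le) (use a rr_single_bound in auto)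
 show "||a||\<le>||single n a||\<^sub>CP" using CP_coeff_le[of "single n a" n] a by (simp add: single_apply)
qed

end

section \<open>Cohen factorization and the strictly continuous extension\<close>

context unital_cstar
begin

text \<open>The geometric series of ratio 1/2; the bound 2 is the sum of its majorant.\<close>

lemma neumann:
 assumes Y: "Y\<in>|A|" "||Y||\<le>1/2"
 obtains F where "F\<in>|A|" "(\<one>\<ominus>Y)\<cdot>F = \<one>" "F\<cdot>(\<one>\<ominus>Y) = \<one>" "||F||\<le>2"
proof -
 note [simp] = Y(1)
 have pn: "||pw Y n||\<le>(1/2) ^ n" for n
 proof (induction n)
  case (Suc n)
  then show ?case using norm_mult[of "pw Y n" Y] mult_mono[OF Suc Y(2)] by simp
 qed (simp add: norm_one_le)
 have comm: "pw Y n\<cdot>Y = Y\<cdot>pw Y n" for n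
  by (induction n) (simp_all add: mult_assoc)
 have right: "(\<one>\<ominus>Y)\<cdot>pw_sum Y n = \<one>\<ominus>pw Y n" for n
 proof (induction n)
  case (Suc n)
  have "(\<one>\<ominus>Y)\<cdot>pw_sum Y (Suc n) = (\<one>\<ominus>Y)\<cdot>pw_sum Y n\<oplus>(pw Y n\<ominus>Y\<cdot>pw Y n)" by ((simp add: expand)?; (rule linI, (rule lins | (simp add: algebra_simps; fail))+))
  also have "\<dots> = \<one>\<ominus>pw Y (Suc n)" unfolding Suc pw.simps comm by ((simp add: expand)?; (rule linI, (rule lins | (simp add: algebra_simps; fail))+))
  finally show ?case .
 qed simp
 have left: "pw_sum Y n\<cdot>(\<one>\<ominus>Y) = \<one>\<ominus>pw Y n" for n
 proof (induction n)
  case (Suc n)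
  have "pw_sum Y (Suc n)\<cdot>(\<one>\<ominus>Y) = pw_sum Y n\<cdot>(\<one>\<ominus>Y)\<oplus>(pw Y n\<ominus>pw Y n\<cdot>Y)" by ((simp add: expand)?; (rule linI, (rule lins | (simp add: algebra_simps; fail))+))
  also have "\<dots> = \<one>\<ominus>pw Y (Suc n)" unfolding Suc pw.simps by ((simp add: expand)?; (rule linI, (rule lins | (simp add: algebra_simps; fail))+))
  finally show ?case .
 qed simp
 have ps: "||pw_sum Y n||\<le>2 - 2 * (1/2) ^ n" for n
 proof (induction n)
  case (Suc n)
  then show ?case using norm_triangle[of "pw_sum Y n" "pw Y n"] pn[of n] by simp
 qed simp
 obtain F where F: "tends A (pw_sum Y) F"
 proof (rule summable_tends[of "pw_sum Y" "\<lambda>n. - 2 * (1/2) ^ n"])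
  show "||pw_sum Y (Suc n)\<ominus>pw_sum Y n||\<le>- 2 * (1/2) ^ Suc n - - 2 * (1/2) ^ n" for n
  proof -
   have "pw_sum Y (Suc n)\<ominus>pw_sum Y n = pw Y n" by ((simp add: expand)?; (rule linI, (rule lins | (simp add: algebra_simps; fail))+))
   then show ?thesis using pn[of n] by simp
  qed
  show "convergent (\<lambda>n. - 2 * (1/2 :: real) ^ n)"
   by (intro convergent_mult convergent_const convergentI[OF LIMSEQ_realpow_zero]) simp_all
 qed auto
 have FA [simp]: "F\<in>|A|" using tends_in(2)[OF F] .
 have p0: "tends A (pw Y) \<zero>"
 proof (rule tendsI[where r = "\<lambda>n. (1/2) ^ n"])
  have "pw Y n\<ominus>\<zero> = pw Y n" for n by ((simp add: expand)?; (rule linI, (rule lins | (simp add: algebra_simps; fail))+))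
  then show "||pw Y n\<ominus>\<zero>||\<le>(1/2) ^ n" for n using pn by simp
 qed (auto intro: LIMSEQ_realpow_zero)
 have l1: "tends A (\<lambda>n. \<one>\<ominus>pw Y n) \<one>" using tends_diff[OF tends_const[OF unit_in] p0] by (simp add: diff_eq)
 have "tends A (\<lambda>n. (\<one>\<ominus>Y)\<cdot>pw_sum Y n) ((\<one>\<ominus>Y)\<cdot>F)" by (intro tends_mult tends_const F) simp
 then have "(\<one>\<ominus>Y)\<cdot>F = \<one>" unfolding right using tends_unique l1 by blast
 moreover have "tends A (\<lambda>n. pw_sum Y n\<cdot>(\<one>\<ominus>Y)) (F\<cdot>(\<one>\<ominus>Y))" by (intro tends_mult tends_const F) simp
 then have "F\<cdot>(\<one>\<ominus>Y) = \<one>" unfolding left using tends_unique l1 by blast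
 moreover have "||F||\<le>2"
 proof (rule tends_norm_le[OF F])
  show "||pw_sum Y n||\<le>2" for n using ps[of n] zero_le_power[of "1/2 :: real" n] by linarith
 qed
 ultimately show ?thesis using that FA by blast
qed

end

locale approx_unital = cstar_algebra A for A :: "('a, 'm) cstar_struct_scheme" (structure) +
 fixes e :: "nat=>'a"
 assumes e_sa: "sa (e n)" and e_norm: "||e n||\<le>1"
  and e_left: "x\<in>|A| ==> tends A (\<lambda>n. e n\<cdot>x) x"
  and e_right: "x\<in>|A| ==> tends A (\<lambda>n. x\<cdot>e n) x"

sublocale approx_unital\<subseteq>U: unital_cstar "multiplier_algebra A"
 by (rule unital_multiplier)

context approx_unital
begin

lemma e_in [simp]: "e n\<in>|A|" and e_adj [simp]: "(e n)\<star> = e n"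
 using e_sa[of n] by auto

lemma lact_tends:
 assumes "m\<in>|MA|" "tends A s x" shows "tends A (\<lambda>n. lact m (s n)) (lact m x)"
proof (rule tendsI)
 note [simp] = tends_in[OF assms(2)] assms(1)
 show "||lact m (s n)\<ominus>lact m x||\<le>||m||\<^sub>MA * ||s n\<ominus>x||" for n
 proof -
  have "lact m (s n)\<ominus>lact m x = lact m (s n\<ominus>x)" by (simp add: diff_eq lact_add lact_smult)
  then show ?thesis using lact_le[of m "s n\<ominus>x"] by simp
 qed
 show "(\<lambda>n. ||m||\<^sub>MA * ||s n\<ominus>x||)\<longlonglongrightarrow>0"
  using assms(2) unfolding tends_def by (auto intro: tendsto_mult_right_zero)
qed (use assms in \<open>auto simp: tends_in\<close>)

text \<open>One step of Cohen's construction: the right inverse \<open>g\<close> of \<open>\<lambda> + a\<close> is replaced by a right inverse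
 of \<open>\<lambda>(1 - \<gamma> + \<gamma>e\<^sub>k) + a\<close> with \<open>\<gamma> = 1/4\<close>, at small cost for the vector \<open>x\<close>.\<close>

lemma cohen_step:
 assumes R: "star_hom MA MA R" "R \<one>\<^sub>MA = \<one>\<^sub>MA"
  and Re: "\<And>x. x\<in>|A| ==> tends A (\<lambda>n. lact (R (J (e n))) x) x"
  and x [simp]: "x\<in>|A|" and a [simp]: "a\<in>|A|" and g [simp]: "g\<in>|MA|"
  and inv: "(of_real r\<odot>\<^sub>MA \<one>\<^sub>MA\<oplus>\<^sub>MA J a)\<cdot>\<^sub>MA g = \<one>\<^sub>MA" and \<eta>: "\<eta> > 0"
 obtains k g' where "g'\<in>|MA|"
  "(of_real (3/4 * r)\<odot>\<^sub>MA \<one>\<^sub>MA\<oplus>\<^sub>MA J (a\<oplus>of_real (r/4)\<odot>e k))\<cdot>\<^sub>MA g' = \<one>\<^sub>MA"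
  "||lact (R g') x\<ominus>lact (R g) x||\<le>\<eta>"
proof -
 let ?one = "\<one>\<^sub>MA"
 note Rs [simp] = star_hom_simps[OF R(1)] and Rd = star_hom_diff[OF U.star_algebra_axioms U.star_algebra_axioms R(1)]
 have Rc: "||R m||\<^sub>MA\<le>||m||\<^sub>MA" if "m\<in>|MA|" for m
  by (rule star_hom_contractive[OF cstar_multiplier cstar_multiplier R(1) that])
 let ?G = "||g||\<^sub>MA"
 have G: "?G\<ge>0" by simp
 \<comment> \<open>One limit encodes both demands on k. With u and v the defects of e_k as a unit
   for a and, through R, for x, the product of u and the norm of g must be at most 1 so that the
   perturbation below is invertible, and the change of the vector must be at most \<eta>.\<close>
 have "(\<lambda>k. ||e k\<cdot>a\<ominus>a|| * (?G + ?G * ?G * ||x|| / \<eta>) + ?G * ||lact (R (J (e k))) x\<ominus>x|| / \<eta>)\<longlonglongrightarrow>0 * (?G + ?G * ?G * ||x|| / \<eta>) + ?G * 0 / \<eta>"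
  using e_left[OF a] Re[OF x] \<eta> unfolding tends_def by (intro tendsto_intros) auto
 from LIMSEQ_D[OF this, of 1] obtain k where
  k0: "norm ( ||e k\<cdot>a\<ominus>a|| * (?G + ?G * ?G * ||x|| / \<eta>) + ?G * ||lact (R (J (e k))) x\<ominus>x|| / \<eta> - (0 * (?G + ?G * ?G * ||x|| / \<eta>) + ?G * 0 / \<eta>)) < 1"
  by auto
 define u where "u = ||e k\<cdot>a\<ominus>a||"
 define v where "v = ||lact (R (J (e k))) x\<ominus>x||"
 have uv: "u\<ge>0" "v\<ge>0" by (simp_all add: u_def v_def)
 have k: "u * (?G + ?G * ?G * ||x|| / \<eta>) + ?G * v / \<eta> < 1"
  using k0 abs_ge_self by (simp add: u_def[symmetric] v_def[symmetric])
 have k1: "u * ?G\<le>1"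
 proof -
  have "0\<le>u * (?G * ?G * ||x|| / \<eta>)" "0\<le>?G * v / \<eta>" using uv \<eta> by simp_all
  then show ?thesis using k by (simp add: ring_distribs)
 qed
 have k2: "u * ?G * ?G * ||x|| + ?G * v\<le>\<eta>"
 proof -
  have "0\<le>u * ?G" using uv by simp
  then have "u * (?G * ?G * ||x|| / \<eta>) + ?G * v / \<eta>\<le>1" using k by (simp add: ring_distribs)
  then have "(u * ?G * ?G * ||x|| + ?G * v) / \<eta>\<le>1" by (simp add: add_divide_distrib mult.assoc)
  then show ?thesis using \<eta> by (simp add: pos_divide_le_eq)
 qed
 define E where "E = J (e k)"
 define a' where "a' = J a"
 have [simp]: "E\<in>|MA|" "a'\<in>|MA|" by (simp_all add: E_def a'_def)
 \<comment> \<open>Thus 1 - Y = 1 - \<gamma> + \<gamma> e_k with \<gamma> = 1/4. Since 1 - e_k has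
   norm at most 2, Y has norm at most 1/2, which is what \<open>neumann\<close> asks for.\<close>
 define Y where "Y = of_real (1/4)\<odot>\<^sub>MA (?one\<ominus>\<^sub>MA E)"
 have Y [simp]: "Y\<in>|MA|" by (simp add: Y_def)
 have nE: "||E||\<^sub>MA\<le>1" using e_norm by (simp add: E_def J_norm)
 have "||?one\<ominus>\<^sub>MA E||\<^sub>MA\<le>2"
  using U.norm_diff_triangle[of ?one E] U.norm_one_le nE by simp
 then have nY: "||Y||\<^sub>MA\<le>1/2" unfolding Y_def by (simp add: U.norm_smult)
 obtain F where F [simp]: "F\<in>|MA|" and F1: "(?one\<ominus>\<^sub>MA Y)\<cdot>\<^sub>MA F = ?one"
  and F2: "F\<cdot>\<^sub>MA (?one\<ominus>\<^sub>MA Y) = ?one" and nF: "||F||\<^sub>MA\<le>2"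
  using U.neumann[OF Y nY] by blast
 have FY: "F\<ominus>\<^sub>MA ?one = F\<cdot>\<^sub>MA Y"
 proof -
  have "F\<ominus>\<^sub>MA F\<cdot>\<^sub>MA (?one\<ominus>\<^sub>MA Y) = F\<cdot>\<^sub>MA Y" by ((simp add: U.expand)?; (rule U.linI, (rule U.lins | (simp add: algebra_simps; fail))+))
  then show ?thesis unfolding F2 .
 qed
 define \<delta> where "\<delta> = F\<cdot>\<^sub>MA a'\<ominus>\<^sub>MA a'"
 have \<delta> [simp]: "\<delta>\<in>|MA|" by (simp add: \<delta>_def)
 have "\<delta> = (F\<ominus>\<^sub>MA ?one)\<cdot>\<^sub>MA a'" unfolding \<delta>_def by ((simp add: U.expand)?; (rule U.linI, (rule U.lins | (simp add: algebra_simps; fail))+))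
 then have "\<delta> = F\<cdot>\<^sub>MA (Y\<cdot>\<^sub>MA a')" unfolding FY by (simp add: U.mult_assoc)
 moreover have "Y\<cdot>\<^sub>MA a' = of_real (-1/4)\<odot>\<^sub>MA J (e k\<cdot>a\<ominus>a)"
  unfolding Y_def E_def a'_def by (simp add: J_diff J_simps U.expand)
   (rule U.linI, (rule U.lins | (simp add: algebra_simps; fail))+)
 then have "||Y\<cdot>\<^sub>MA a'||\<^sub>MA = u / 4" by (simp add: U.norm_smult J_norm u_def)
 ultimately have n\<delta>: "||\<delta>||\<^sub>MA\<le>u / 2"
  using order_trans[OF U.norm_mult[of F "Y\<cdot>\<^sub>MA a'"] mult_right_mono[OF nF]] by simp
 define y where "y = \<delta>\<cdot>\<^sub>MA g"
 have y [simp]: "y\<in>|MA|" by (simp add: y_def)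
 have ny: "||y||\<^sub>MA\<le>u / 2 * ?G"
  unfolding y_def using order_trans[OF U.norm_mult[of \<delta> g] mult_right_mono[OF n\<delta> G]] by simp
 have ny2: "||\<ominus>\<^sub>MA y||\<^sub>MA\<le>1/2" using ny k1 by simp
 obtain N where N [simp]: "N\<in>|MA|" and N1: "(?one\<ominus>\<^sub>MA\<ominus>\<^sub>MA y)\<cdot>\<^sub>MA N = ?one"
  and N2: "N\<cdot>\<^sub>MA (?one\<ominus>\<^sub>MA\<ominus>\<^sub>MA y) = ?one" and nN: "||N||\<^sub>MA\<le>2"
  using U.neumann[OF _ ny2] by auto
 have Ny: "N\<ominus>\<^sub>MA ?one =\<ominus>\<^sub>MA (N\<cdot>\<^sub>MA y)"
 proof -
  have "N\<ominus>\<^sub>MA N\<cdot>\<^sub>MA (?one\<ominus>\<^sub>MA\<ominus>\<^sub>MA y) =\<ominus>\<^sub>MA (N\<cdot>\<^sub>MA y)"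
   by (simp add: U.uminus_eq) ((simp add: U.expand)?; (rule U.linI, (rule U.lins | (simp add: algebra_simps; fail))+))
  then show ?thesis unfolding N2 .
 qed
 have oy: "?one\<oplus>\<^sub>MA y = ?one\<ominus>\<^sub>MA\<ominus>\<^sub>MA y" by ((simp add: U.expand)?; (rule U.linI, (rule U.lins | (simp add: algebra_simps; fail))+))
 show ?thesis
 proof (rule that[of "g\<cdot>\<^sub>MA (N\<cdot>\<^sub>MA F)" k])
  show "g\<cdot>\<^sub>MA (N\<cdot>\<^sub>MA F)\<in>|MA|" by simp
  \<comment> \<open>Pulling out 1 - Y, whose inverse is F, leaves r + Fa. This differs from the old
    r + a only by \<open>\<delta>\<close>, which is small because e_k nearly fixes a.\<close>
  have b: "of_real (3/4 * r)\<odot>\<^sub>MA ?one\<oplus>\<^sub>MA J (a\<oplus>of_real (r/4)\<odot>e k)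
    = (?one\<ominus>\<^sub>MA Y)\<cdot>\<^sub>MA (of_real r\<odot>\<^sub>MA ?one\<oplus>\<^sub>MA F\<cdot>\<^sub>MA a')"
  proof -
   have "(?one\<ominus>\<^sub>MA Y)\<cdot>\<^sub>MA (of_real r\<odot>\<^sub>MA ?one\<oplus>\<^sub>MA F\<cdot>\<^sub>MA a')
     = of_real r\<odot>\<^sub>MA (?one\<ominus>\<^sub>MA Y)\<oplus>\<^sub>MA ((?one\<ominus>\<^sub>MA Y)\<cdot>\<^sub>MA F)\<cdot>\<^sub>MA a'" by ((simp add: U.expand)?; (rule U.linI, (rule U.lins | (simp add: algebra_simps; fail))+))
   also have "\<dots> = of_real r\<odot>\<^sub>MA (?one\<ominus>\<^sub>MA Y)\<oplus>\<^sub>MA a'" unfolding F1 by simp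
   also have "\<dots> = of_real (3/4 * r)\<odot>\<^sub>MA ?one\<oplus>\<^sub>MA (a'\<oplus>\<^sub>MA of_real (r/4)\<odot>\<^sub>MA E)" unfolding Y_def by ((simp add: U.expand)?; (rule U.linI, (rule U.lins | (simp add: algebra_simps; fail))+))
   finally show ?thesis by (simp add: E_def a'_def J_simps)
  qed
  have c: "(of_real r\<odot>\<^sub>MA ?one\<oplus>\<^sub>MA F\<cdot>\<^sub>MA a')\<cdot>\<^sub>MA g = ?one\<oplus>\<^sub>MA y"
  proof -
   have "(of_real r\<odot>\<^sub>MA ?one\<oplus>\<^sub>MA F\<cdot>\<^sub>MA a')\<cdot>\<^sub>MA g = (of_real r\<odot>\<^sub>MA ?one\<oplus>\<^sub>MA a')\<cdot>\<^sub>MA g\<oplus>\<^sub>MA y"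
    unfolding y_def \<delta>_def by ((simp add: U.expand)?; (rule U.linI, (rule U.lins | (simp add: algebra_simps; fail))+))
   then show ?thesis using inv unfolding a'_def by simp
  qed
  have "((?one\<ominus>\<^sub>MA Y)\<cdot>\<^sub>MA (of_real r\<odot>\<^sub>MA ?one\<oplus>\<^sub>MA F\<cdot>\<^sub>MA a'))\<cdot>\<^sub>MA (g\<cdot>\<^sub>MA (N\<cdot>\<^sub>MA F))
   = (?one\<ominus>\<^sub>MA Y)\<cdot>\<^sub>MA ((((of_real r\<odot>\<^sub>MA ?one\<oplus>\<^sub>MA F\<cdot>\<^sub>MA a')\<cdot>\<^sub>MA g)\<cdot>\<^sub>MA N)\<cdot>\<^sub>MA F)"
   by (simp add: U.mult_assoc)
  also have "\<dots> = ?one" unfolding c oy N1 using F1 by simp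
  finally show "(of_real (3/4 * r)\<odot>\<^sub>MA ?one\<oplus>\<^sub>MA J (a\<oplus>of_real (r/4)\<odot>e k))\<cdot>\<^sub>MA (g\<cdot>\<^sub>MA (N\<cdot>\<^sub>MA F)) = ?one"
   unfolding b .
  \<comment> \<open>Each term of the difference ends in Y or in y: R(Y)x is small because e_k nearly
    fixes x through R, and y is small in norm.\<close>
  have d: "g\<cdot>\<^sub>MA (N\<cdot>\<^sub>MA F)\<ominus>\<^sub>MA g = (g\<cdot>\<^sub>MA (N\<cdot>\<^sub>MA F))\<cdot>\<^sub>MA Y\<ominus>\<^sub>MA (g\<cdot>\<^sub>MA N)\<cdot>\<^sub>MA y"
  proof -
   have "g\<cdot>\<^sub>MA (N\<cdot>\<^sub>MA F)\<ominus>\<^sub>MA g = g\<cdot>\<^sub>MA (N\<cdot>\<^sub>MA (F\<ominus>\<^sub>MA ?one))\<oplus>\<^sub>MA g\<cdot>\<^sub>MA (N\<ominus>\<^sub>MA ?one)" by ((simp add: U.expand)?; (rule U.linI, (rule U.lins | (simp add: algebra_simps; fail))+))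
   also have "\<dots> = (g\<cdot>\<^sub>MA (N\<cdot>\<^sub>MA F))\<cdot>\<^sub>MA Y\<ominus>\<^sub>MA (g\<cdot>\<^sub>MA N)\<cdot>\<^sub>MA y"
    unfolding FY Ny by (simp add: U.uminus_eq) ((simp add: U.expand)?; (rule U.linI, (rule U.lins | (simp add: algebra_simps; fail))+))
   finally show ?thesis .
  qed
  have nNF: "||g\<cdot>\<^sub>MA (N\<cdot>\<^sub>MA F)||\<^sub>MA\<le>?G * 4"
  proof -
   have "||N\<cdot>\<^sub>MA F||\<^sub>MA\<le>2 * 2" using order_trans[OF U.norm_mult[of N F] mult_mono[OF nN nF]] by simp
   then show ?thesis using order_trans[OF U.norm_mult[of g "N\<cdot>\<^sub>MA F"] mult_left_mono[OF _ G]] by simp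
  qed
  have nNg: "||g\<cdot>\<^sub>MA N||\<^sub>MA\<le>?G * 2"
   using order_trans[OF U.norm_mult[of g N] mult_left_mono[OF nN G]] by simp
  have RY: "lact (R Y) x = of_real (-1/4)\<odot>(lact (R (J (e k))) x\<ominus>x)"
   unfolding Y_def E_def using R(2) by (simp add: Rd lact_diff smult_diff) ((simp add: expand)?; (rule linI, (rule lins | (simp add: algebra_simps; fail))+))
  have "||lact (R (g\<cdot>\<^sub>MA (N\<cdot>\<^sub>MA F))) (lact (R Y) x)||\<le>(?G * 4) * (v / 4)"
  proof -
   have e: "||lact (R Y) x|| = v / 4" unfolding RY v_def by (simp add: norm_smult)
   have "||lact (R (g\<cdot>\<^sub>MA (N\<cdot>\<^sub>MA F))) (lact (R Y) x)||\<le>(?G * 4) * ||lact (R Y) x||"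
    using order_trans[OF lact_le[of "R (g\<cdot>\<^sub>MA (N\<cdot>\<^sub>MA F))" "lact (R Y) x"] mult_right_mono[OF order_trans[OF Rc nNF]]] by simp
   then show ?thesis by (simp only: e)
  qed
  moreover have "||lact (R (g\<cdot>\<^sub>MA N\<cdot>\<^sub>MA y)) x||\<le>((?G * 2) * (u / 2 * ?G)) * ||x||"
  proof -
   have "||g\<cdot>\<^sub>MA N\<cdot>\<^sub>MA y||\<^sub>MA\<le>(?G * 2) * (u / 2 * ?G)"
    using order_trans[OF U.norm_mult[of "g\<cdot>\<^sub>MA N" y] mult_mono[OF nNg ny]] by simp
   then show ?thesis
    using order_trans[OF lact_le[of "R (g\<cdot>\<^sub>MA N\<cdot>\<^sub>MA y)" x] mult_right_mono[OF order_trans[OF Rc]]] by simp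
  qed
  moreover have "lact (R (g\<cdot>\<^sub>MA (N\<cdot>\<^sub>MA F))) x\<ominus>lact (R g) x
    = lact (R (g\<cdot>\<^sub>MA (N\<cdot>\<^sub>MA F))) (lact (R Y) x)\<ominus>lact (R (g\<cdot>\<^sub>MA N\<cdot>\<^sub>MA y)) x"
  proof -
   define h where "h = g\<cdot>\<^sub>MA (N\<cdot>\<^sub>MA F)"
   define w where "w = g\<cdot>\<^sub>MA N\<cdot>\<^sub>MA y"
   have [simp]: "h\<in>|MA|" "w\<in>|MA|" by (simp_all add: h_def w_def)
   have "lact (R (h\<ominus>\<^sub>MA g)) x = lact (R (h\<cdot>\<^sub>MA Y\<ominus>\<^sub>MA w)) x" using d by (simp add: h_def w_def)
   then have "lact (R h) x\<ominus>lact (R g) x = lact (R h) (lact (R Y) x)\<ominus>lact (R w) x"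
    by (simp add: Rd lact_diff)
   then show ?thesis by (simp only: h_def w_def)
  qed
  ultimately show "||lact (R (g\<cdot>\<^sub>MA (N\<cdot>\<^sub>MA F))) x\<ominus>lact (R g) x||\<le>\<eta>"
   using norm_diff_triangle[of "lact (R (g\<cdot>\<^sub>MA (N\<cdot>\<^sub>MA F))) (lact (R Y) x)" "lact (R (g\<cdot>\<^sub>MA N\<cdot>\<^sub>MA y)) x"] k2
   by (simp add: mult_ac)
 qed
qed

text \<open>R is kept general for two uses: the identity gives x = bc, the extension of \<rho> gives
  x = \<rho>(b)c. The pairs (a, g) satisfy (s + a)g = 1 with s = (3/4)^n. Applying R and putting c =
  R(g)x gives sc + R(a)c = x; here a and c converge geometrically and s tends to 0.\<close>

theorem cohen_factorization:
 assumes R: "star_hom MA MA R" "R \<one>\<^sub>MA = \<one>\<^sub>MA"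
  and Re: "\<And>x. x\<in>|A| ==> tends A (\<lambda>n. lact (R (J (e n))) x) x"
  and x [simp]: "x\<in>|A|"
 obtains b c where "b\<in>|A|" "c\<in>|A|" "x = lact (R (J b)) c"
proof -
 let ?one = "\<one>\<^sub>MA"
 note Rs [simp] = star_hom_simps[OF R(1)]
 define P where "P n s\<longleftrightarrow>fst s\<in>|A|\<and>snd s\<in>|MA|\<and>
   (of_real ((3/4) ^ n)\<odot>\<^sub>MA ?one\<oplus>\<^sub>MA J (fst s))\<cdot>\<^sub>MA snd s = ?one" for n :: nat and s
 define Q where "Q n s s'\<longleftrightarrow>||fst s'\<ominus>fst s||\<le>(3/4) ^ n / 4\<and>||lact (R (snd s')) x\<ominus>lact (R (snd s)) x||\<le>(1/2) ^ n / 2" for n :: nat and s s'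
 have "\<exists>f. \<forall>n. P n (f n)\<and>Q n (f n) (f (Suc n))"
 proof (rule dependent_nat_choice)
  show "\<exists>s. P 0 s"
   by (rule exI[of _ "(\<zero>, ?one)"]) (simp add: P_def J_zero)
  fix s n assume "P n s"
  then have s: "fst s\<in>|A|" "snd s\<in>|MA|"
   "(of_real ((3/4) ^ n)\<odot>\<^sub>MA ?one\<oplus>\<^sub>MA J (fst s))\<cdot>\<^sub>MA snd s = ?one" by (auto simp: P_def)
  have "(1/2 :: real) ^ n / 2 > 0" by simp
  from cohen_step[OF R Re x s this] obtain k g' where kg: "g'\<in>|MA|"
   "(of_real (3/4 * (3/4) ^ n)\<odot>\<^sub>MA ?one\<oplus>\<^sub>MA J (fst s\<oplus>of_real ((3/4) ^ n / 4)\<odot>e k))\<cdot>\<^sub>MA g' = ?one"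
   "||lact (R g') x\<ominus>lact (R (snd s)) x||\<le>(1/2) ^ n / 2" by blast
  define q :: real where "q = (3/4) ^ n / 4"
  have q: "q\<ge>0" by (simp add: q_def)
  have "(fst s\<oplus>of_real q\<odot>e k)\<ominus>fst s = of_real q\<odot>e k" supply s(1) [simp] by ((simp add: expand)?; (rule linI, (rule lins | (simp add: algebra_simps; fail))+))
  moreover have "||of_real q\<odot>e k||\<le>q" using e_norm[of k] q mult_left_mono[OF e_norm[of k] q] by (simp add: norm_smult)
  ultimately have "||(fst s\<oplus>of_real q\<odot>e k)\<ominus>fst s||\<le>q" by simp
  then have "Q n s (fst s\<oplus>of_real q\<odot>e k, g')" unfolding Q_def q_def using kg(3) by simp
  moreover have "P (Suc n) (fst s\<oplus>of_real q\<odot>e k, g')" unfolding P_def q_def using kg(1,2) s by simp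
  ultimately show "\<exists>s'. P (Suc n) s'\<and>Q n s s'" by blast
 qed
 then obtain f where f: "\<And>n. P n (f n)" "\<And>n. Q n (f n) (f (Suc n))" by blast
 define a g c where "a n = fst (f n)" and "g n = snd (f n)" and "c n = lact (R (g n)) x" for n
 have ag [simp]: "a n\<in>|A|" "g n\<in>|MA|" "c n\<in>|A|"
  and inv: "(of_real ((3/4) ^ n)\<odot>\<^sub>MA ?one\<oplus>\<^sub>MA J (a n))\<cdot>\<^sub>MA g n = ?one" for n
  using f(1)[of n] by (auto simp: P_def a_def g_def c_def)
 have step: "||a (Suc n)\<ominus>a n||\<le>(3/4) ^ n / 4" "||c (Suc n)\<ominus>c n||\<le>(1/2) ^ n / 2" for n
  using f(2)[of n] by (auto simp: Q_def a_def g_def c_def)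
 have conv: "convergent (\<lambda>n. - (q ^ n))" if "0\<le>q" "q < 1" for q :: real
  using that by (intro convergent_minus_iff[THEN iffD1]) (auto intro: convergentI LIMSEQ_realpow_zero)
 obtain b where b: "tends A a b"
  by (rule summable_tends[of a "\<lambda>n. - ((3/4) ^ n)"]) (use step(1) conv[of "3/4"] in \<open>auto simp: field_simps\<close>)
 obtain d where d: "tends A c d"
  by (rule summable_tends[of c "\<lambda>n. - ((1/2) ^ n)"]) (use step(2) conv[of "1/2"] in \<open>auto simp: field_simps\<close>)
 have bd [simp]: "b\<in>|A|" "d\<in>|A|" using tends_in(2) b d by auto
 have eq: "of_real ((3/4) ^ n)\<odot>c n\<oplus>lact (R (J (a n))) (c n) = x" for n
 proof -
  have "lact (R ((of_real ((3/4) ^ n)\<odot>\<^sub>MA ?one\<oplus>\<^sub>MA J (a n))\<cdot>\<^sub>MA g n)) x = x" unfolding inv using R(2) by simp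
  then show ?thesis using R(2) by (simp add: c_def)
 qed
 have t1: "tends A (\<lambda>n. lact (R (J (a n))) (c n)) (lact (R (J b)) d)"
 proof (rule tendsI)
  show "||lact (R (J (a n))) (c n)\<ominus>lact (R (J b)) d||\<le>||a n\<ominus>b|| * ||c n|| + ||b|| * ||c n\<ominus>d||" for n
  proof -
   have Rc: "||R (J z)||\<^sub>MA\<le>||z||" if "z\<in>|A|" for z
    using star_hom_contractive[OF cstar_multiplier cstar_multiplier R(1), of "J z"] that by (simp add: J_norm)
   have "lact (R (J (a n))) (c n)\<ominus>lact (R (J b)) d = lact (R (J (a n\<ominus>b))) (c n)\<oplus>lact (R (J b)) (c n\<ominus>d)"
   proof -
    have "lact (R (J (a n\<ominus>b))) (c n) = lact (R (J (a n))) (c n)\<ominus>lact (R (J b)) (c n)"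
     by (simp add: J_diff star_hom_diff[OF U.star_algebra_axioms U.star_algebra_axioms R(1)] lact_diff)
    moreover have "lact (R (J b)) (c n\<ominus>d) = lact (R (J b)) (c n)\<ominus>lact (R (J b)) d"
     by (simp add: diff_eq lact_add lact_smult)
    ultimately show ?thesis by simp ((simp add: expand)?; (rule linI, (rule lins | (simp add: algebra_simps; fail))+))
   qed
   moreover have "||lact (R (J (a n\<ominus>b))) (c n)||\<le>||a n\<ominus>b|| * ||c n||"
    using order_trans[OF lact_le[of "R (J (a n\<ominus>b))" "c n"] mult_right_mono[OF Rc]] by simp
   moreover have "||lact (R (J b)) (c n\<ominus>d)||\<le>||b|| * ||c n\<ominus>d||"
    using order_trans[OF lact_le[of "R (J b)" "c n\<ominus>d"] mult_right_mono[OF Rc]] by simp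
   ultimately show ?thesis using norm_triangle[of "lact (R (J (a n\<ominus>b))) (c n)" "lact (R (J b)) (c n\<ominus>d)"] by simp
  qed
  have "(\<lambda>n. ||a n\<ominus>b|| * ||c n|| + ||b|| * ||c n\<ominus>d||)\<longlonglongrightarrow>0 * ||d|| + ||b|| * 0"
   by (intro tendsto_intros tends_norm[OF d]) (use b d in \<open>auto simp: tends_def\<close>)
  then show "(\<lambda>n. ||a n\<ominus>b|| * ||c n|| + ||b|| * ||c n\<ominus>d||)\<longlonglongrightarrow>0" by simp
 qed auto
 have t2: "tends A (\<lambda>n. of_real ((3/4) ^ n)\<odot>c n) \<zero>"
 proof (rule tendsI)
  show "||of_real ((3/4) ^ n)\<odot>c n\<ominus>\<zero>||\<le>(3/4) ^ n * ||c n||" for n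
  proof -
   have "of_real ((3/4) ^ n)\<odot>c n\<ominus>\<zero> = of_real ((3/4) ^ n)\<odot>c n" by ((simp add: expand)?; (rule linI, (rule lins | (simp add: algebra_simps; fail))+))
   then show ?thesis by (simp add: norm_smult norm_power del: of_real_power of_real_divide)
  qed
  have "(\<lambda>n. (3/4) ^ n * ||c n||)\<longlonglongrightarrow>0 * ||d||"
   by (intro tendsto_mult tends_norm[OF d] LIMSEQ_realpow_zero) auto
  then show "(\<lambda>n. (3/4) ^ n * ||c n||)\<longlonglongrightarrow>0" by simp
 qed auto
 from tends_add[OF t2 t1] have "tends A (\<lambda>n. x) (\<zero>\<oplus>lact (R (J b)) d)" by (simp only: eq)
 then have "x = lact (R (J b)) d" using tends_unique[OF tends_const[OF x]] by simp
 then show ?thesis using that[of b d] by simp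
qed

lemma factor:
 assumes "x\<in>|A|" obtains b c where "b\<in>|A|" "c\<in>|A|" "x = b\<cdot>c"
proof -
 have "star_hom MA MA (\<lambda>m. m)" by (simp add: star_hom_def)
 then obtain b c where "b\<in>|A|" "c\<in>|A|" "x = lact (J b) c"
  by (rule cohen_factorization[OF _ _ _ assms]) (use e_left in auto)
 then show ?thesis using that by simp
qed

end

section \<open>The extension of the endomorphism to multipliers\<close>

locale endo = approx_unital A e for A :: "'a cstar_struct" (structure) and e +
 fixes \<rho> :: "'a=>'a multiplier"
 assumes hom: "star_hom A (multiplier_algebra A) \<rho>" and inj: "inj_on \<rho> ( |A| )" and nondeg: "nondegenerate A \<rho>"
begin

lemmas rho_simps [simp] = star_hom_simps[OF hom]
lemmas rho_diff = star_hom_diff[OF star_algebra_axioms U.star_algebra_axioms hom]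

lemma rho_le: "a\<in>|A| ==> ||\<rho> a||\<^sub>MA\<le>||a||"
 by (rule star_hom_contractive[OF cstar_algebra_axioms cstar_multiplier hom])

abbreviation "gens\<equiv>{lact (\<rho> a) x | a x. a\<in>|A|\<and>x\<in>|A| }"

lemma gens_sub: "gens\<subseteq>|A|" by auto

lemma dense_induct [consumes 1, case_names base zero add smult lim]:
 assumes "x\<in>|A|" "\<And>b c. b\<in>|A| ==> c\<in>|A| ==> P (lact (\<rho> b) c)" "P \<zero>"
  "\<And>x y. x\<in>|A| ==> y\<in>|A| ==> P x ==> P y ==> P (x\<oplus>y)" "\<And>c x. x\<in>|A| ==> P x ==> P (c\<odot>x)"
  "\<And>s x. tends A s x ==> (\<And>n. P (s n)) ==> P x"
 shows "P x"
proof -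
 have "x\<in>closed_span A gens" using nondeg assms(1) by (simp add: nondegenerate_def)
 from this gens_sub show ?thesis
  by (rule closed_span_induct) (use assms(2-) in blast)+
qed

lemma eq_dense:
 assumes "m\<in>|MA|" "n\<in>|MA|"
  "\<And>b c. b\<in>|A| ==> c\<in>|A| ==> lact m (lact (\<rho> b) c) = lact n (lact (\<rho> b) c)"
 shows "m = n"
proof (rule multiplier_eqI[OF assms(1,2)])
 fix x assume "x\<in>|A|"
 then show "lact m x = lact n x"
 proof (induction rule: dense_induct)
  case zero
  then show ?case using lact_smult[OF assms(1), of \<zero> 0] lact_smult[OF assms(2), of \<zero> 0] assms(1,2) by simp
 next
  case (lim s x)
  then show ?case using lact_tends[OF assms(1) lim(1)] lact_tends[OF assms(2) lim(1)] tends_unique by simp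
 qed (use assms in \<open>auto simp: lact_add lact_smult\<close>)
qed

lemma rho_e_bound:
 assumes "m\<in>|MA|" "x\<in>|A|" shows "||lact (\<rho> (lact m (e n))) x||\<le>||m||\<^sub>MA * ||x||"
proof -
 have "||lact m (e n)||\<le>||m||\<^sub>MA * 1"
  using order_trans[OF lact_le[OF assms(1), of "e n"] mult_left_mono[OF e_norm[of n]]] assms by simp
 then have "||\<rho> (lact m (e n))||\<^sub>MA\<le>||m||\<^sub>MA" using rho_le[of "lact m (e n)"] assms by simp
 then show ?thesis using order_trans[OF lact_le[of "\<rho> (lact m (e n))" x] mult_right_mono] assms by simp
qed

lemma rho_e_base:
 assumes m: "m\<in>|MA|" and b: "b\<in>|A|" and c: "c\<in>|A|"
 shows "tends A (\<lambda>n. lact (\<rho> (lact m (e n))) (lact (\<rho> b) c)) (lact (\<rho> (lact m b)) c)"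
proof (rule tendsI)
 note [simp] = assms
 show "||lact (\<rho> (lact m (e n))) (lact (\<rho> b) c)\<ominus>lact (\<rho> (lact m b)) c||\<le>||m||\<^sub>MA * ||e n\<cdot>b\<ominus>b|| * ||c||" for n
 proof -
  have "lact m (e n)\<cdot>b\<ominus>lact m b = lact m (e n\<cdot>b\<ominus>b)"
   by (simp add: lact_mult[symmetric] diff_eq lact_add lact_smult)
  then have "lact (\<rho> (lact m (e n))) (lact (\<rho> b) c)\<ominus>lact (\<rho> (lact m b)) c = lact (\<rho> (lact m (e n\<cdot>b\<ominus>b))) c"
   using rho_diff[of "lact m (e n)\<cdot>b" "lact m b"] by (simp add: lact_diff)
  moreover have "||\<rho> (lact m (e n\<cdot>b\<ominus>b))||\<^sub>MA\<le>||m||\<^sub>MA * ||e n\<cdot>b\<ominus>b||"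
   using order_trans[OF rho_le lact_le[OF m]] by simp
  ultimately show ?thesis
   using order_trans[OF lact_le[of "\<rho> (lact m (e n\<cdot>b\<ominus>b))" c] mult_right_mono] by simp
 qed
 have "(\<lambda>n. ||m||\<^sub>MA * ||e n\<cdot>b\<ominus>b|| * ||c||)\<longlonglongrightarrow>||m||\<^sub>MA * 0 * ||c||"
  using e_left[OF b] by (intro tendsto_intros) (simp add: tends_def)
 then show "(\<lambda>n. ||m||\<^sub>MA * ||e n\<cdot>b\<ominus>b|| * ||c||)\<longlonglongrightarrow>0" by simp
qed (use assms in auto)

text \<open>On a vector \<rho>(b)c the limit is \<rho>(mb)c. The operators \<rho>(m e_n) are bounded
  by the norm of m uniformly in n, so convergence spreads to the closed span of such vectors, which
  is everything by nondegeneracy.\<close>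

lemma ext_exists:
 assumes m: "m\<in>|MA|" and x: "x\<in>|A|" shows "\<exists>y. tends A (\<lambda>n. lact (\<rho> (lact m (e n))) x) y"
 using x
proof (induction rule: dense_induct)
 case (base b c)
 then show ?case using rho_e_base[OF m] by blast
next
 case zero
 have "lact (\<rho> (lact m (e n))) \<zero> = \<zero>" for n using lact_smult[of "\<rho> (lact m (e n))" \<zero> 0] m by simp
 then show ?case using tends_const[of \<zero>] by auto
next
 case (add x y)
 then obtain u v where "tends A (\<lambda>n. lact (\<rho> (lact m (e n))) x) u" "tends A (\<lambda>n. lact (\<rho> (lact m (e n))) y) v" by blast
 from tends_add[OF this] show ?case using add m by (auto simp: lact_add)
next
 case (smult c x)
 then obtain u where "tends A (\<lambda>n. lact (\<rho> (lact m (e n))) x) u" by blast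
 from tends_smult[OF this, of c] show ?case using smult m by (auto simp: lact_smult)
next
 case (lim s x)
 note [simp] = tends_in[OF lim(1)] m
 let ?T = "\<lambda>n. lact (\<rho> (lact m (e n)))"
 have diff: "||?T n y\<ominus>?T n z||\<le>||m||\<^sub>MA * ||y\<ominus>z||" if "y\<in>|A|" "z\<in>|A|" for n y z
 proof -
  have "?T n y\<ominus>?T n z = ?T n (y\<ominus>z)" using that by (simp add: diff_eq lact_add lact_smult)
  then show ?thesis using rho_e_bound[OF m, of "y\<ominus>z" n] that by simp
 qed
 show ?case
 proof (rule Cauchy_tends[of "\<lambda>n. ?T n x"])
  fix \<epsilon> :: real assume e: "\<epsilon> > 0"
  have "(\<lambda>k. ||m||\<^sub>MA * ||s k\<ominus>x||)\<longlonglongrightarrow>0"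
   using lim(1) unfolding tends_def by (auto intro: tendsto_mult_right_zero)
  from LIMSEQ_D[OF this, of "\<epsilon> / 4"] e obtain k where "norm ( ||m||\<^sub>MA * ||s k\<ominus>x|| - 0) < \<epsilon> / 4" by auto
  then have k: "||m||\<^sub>MA * ||s k\<ominus>x|| < \<epsilon> / 4" using abs_ge_self[of "||m||\<^sub>MA * ||s k\<ominus>x||"] by simp
  obtain y where y: "tends A (\<lambda>n. ?T n (s k)) y" using lim(2) by blast
  have "(\<lambda>n. ||?T n (s k)\<ominus>y||)\<longlonglongrightarrow>0" using y by (simp add: tends_def)
  from LIMSEQ_D[OF this, of "\<epsilon> / 4"] e obtain N where "\<And>n. n\<ge>N ==> norm ( ||?T n (s k)\<ominus>y|| - 0) < \<epsilon> / 4" by auto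
  then have N: "||?T n (s k)\<ominus>y|| < \<epsilon> / 4" if "n\<ge>N" for n
   using that abs_ge_self[of "||?T n (s k)\<ominus>y||"] by fastforce
  have yA [simp]: "y\<in>|A|" using tends_in(2)[OF y] .
  have near: "||?T n x\<ominus>y|| < \<epsilon> / 2" if "n\<ge>N" for n
   using norm_dist_triangle[of "?T n x" "?T n (s k)" y] N[OF that] diff[of x "s k" n] k norm_diff_commute[of x "s k"] by simp
  have "||?T i x\<ominus>?T j x|| < \<epsilon>" if "i\<ge>N" "j\<ge>N" for i j
   using norm_dist_triangle[of "?T i x" y "?T j x"] near[OF that(1)] near[OF that(2)] norm_diff_commute[of y "?T j x"] by simp
  then show "\<exists>N. \<forall>i\<ge>N. \<forall>j\<ge>N. ||?T i x\<ominus>?T j x|| < \<epsilon>" by blast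
 qed auto
qed

text \<open>Prescribing \<rho>(mb)c on \<rho>(b)c and extending to sums would raise the question of
  independence of the representation. A limit along the approximate unit is defined on each vector
  directly.\<close>

definition lbar :: "'a multiplier=>'a=>'a" where
 "lbar m x = (THE y. tends A (\<lambda>n. lact (\<rho> (lact m (e n))) x) y)"

lemma lbar_tends:
 assumes "m\<in>|MA|" "x\<in>|A|" shows "tends A (\<lambda>n. lact (\<rho> (lact m (e n))) x) (lbar m x)"
proof -
 obtain y where y: "tends A (\<lambda>n. lact (\<rho> (lact m (e n))) x) y" using ext_exists[OF assms] by blast
 then show ?thesis unfolding lbar_def by (rule theI2) (use y tends_unique in blast)+
qed

lemma lbar_in [simp]: "m\<in>|MA| ==> x\<in>|A| ==> lbar m x\<in>|A|"
 using lbar_tends tends_in(2) by blast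

lemma lbar_base: "m\<in>|MA| ==> b\<in>|A| ==> c\<in>|A| ==> lbar m (lact (\<rho> b) c) = lact (\<rho> (lact m b)) c"
 using tends_unique[OF lbar_tends rho_e_base] by simp

lemma lbar_le: "m\<in>|MA| ==> x\<in>|A| ==> ||lbar m x||\<le>||m||\<^sub>MA * ||x||"
 by (rule tends_norm_le[OF lbar_tends]) (auto intro: rho_e_bound)

lemma lbar_add: "m\<in>|MA| ==> x\<in>|A| ==> y\<in>|A| ==> lbar m (x\<oplus>y) = lbar m x\<oplus>lbar m y"
 by (rule tends_unique[OF lbar_tends]) (use tends_add[OF lbar_tends lbar_tends] in \<open>auto simp: lact_add\<close>)

lemma lbar_smult: "m\<in>|MA| ==> x\<in>|A| ==> lbar m (c\<odot>x) = c\<odot>lbar m x"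
 by (rule tends_unique[OF lbar_tends]) (use tends_smult[OF lbar_tends] in \<open>auto simp: lact_smult\<close>)

lemma lbar_cont: assumes "m\<in>|MA|" "tends A s x" shows "tends A (\<lambda>n. lbar m (s n)) (lbar m x)"
proof (rule tendsI)
 note [simp] = tends_in[OF assms(2)] assms(1)
 show "||lbar m (s n)\<ominus>lbar m x||\<le>||m||\<^sub>MA * ||s n\<ominus>x||" for n
 proof -
  have "lbar m (s n)\<ominus>lbar m x = lbar m (s n\<ominus>x)" by (simp add: diff_eq lbar_add lbar_smult)
  then show ?thesis using lbar_le[of m "s n\<ominus>x"] by simp
 qed
 show "(\<lambda>n. ||m||\<^sub>MA * ||s n\<ominus>x||)\<longlonglongrightarrow>0"
  using assms(2) unfolding tends_def by (auto intro: tendsto_mult_right_zero)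
qed (use assms in \<open>auto simp: tends_in\<close>)

lemma lbar_zero: "m\<in>|MA| ==> lbar m \<zero> = \<zero>"
 using lbar_smult[of m \<zero> 0] by simp

lemma lact_adj:
 assumes "m\<in>|MA|" "x\<in>|A|" "y\<in>|A|" shows "(lact m x)\<star>\<cdot>y = x\<star>\<cdot>lact (m\<star>\<^sub>MA) y"
 using arg_cong[OF ract_lact[OF assms(1), of "y\<star>" x], of "cadj A"] assms by (simp add: adj_mult adj_adj)

text \<open>On generators this is \<rho> applied to b\<star>(mb') = (m\<star>b)\<star>b'; two nested
  density inductions do the rest. It supplies the right action that completes \<open>lbar m\<close>
  to a double centralizer.\<close>

lemma lbar_adj:
 assumes m: "m\<in>|MA|" and x: "x\<in>|A|" and y: "y\<in>|A|"
 shows "(lbar (m\<star>\<^sub>MA) x)\<star>\<cdot>y = x\<star>\<cdot>lbar m y"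
 using x
proof (induction rule: dense_induct)
 case (base b c) note bc = this
 show ?case using y
 proof (induction rule: dense_induct)
  case (base b' c')
  note [simp] = m bc base
  have "b\<star>\<cdot>lact m b' = (lact (m\<star>\<^sub>MA) b)\<star>\<cdot>b'"
   using lact_adj[of "m\<star>\<^sub>MA" b b'] by (simp add: U.adj_adj)
  from arg_cong[OF this, of \<rho>]
  have e: "(\<rho> b)\<star>\<^sub>MA\<cdot>\<^sub>MA \<rho> (lact m b') = (\<rho> (lact (m\<star>\<^sub>MA) b))\<star>\<^sub>MA\<cdot>\<^sub>MA \<rho> b'" by simp
  have "(lbar (m\<star>\<^sub>MA) (lact (\<rho> b) c))\<star>\<cdot>lact (\<rho> b') c' = c\<star>\<cdot>lact ((\<rho> (lact (m\<star>\<^sub>MA) b))\<star>\<^sub>MA\<cdot>\<^sub>MA \<rho> b') c'"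
   by (simp add: lbar_base lact_adj del: mult_ops(7))
  also have "\<dots> = (lact (\<rho> b) c)\<star>\<cdot>lbar m (lact (\<rho> b') c')"
   unfolding e[symmetric] by (simp add: lbar_base lact_adj del: mult_ops(7))
  finally show ?case .
 next
  case (lim s y)
  have "tends A (\<lambda>n. (lbar (m\<star>\<^sub>MA) (lact (\<rho> b) c))\<star>\<cdot>s n) ((lbar (m\<star>\<^sub>MA) (lact (\<rho> b) c))\<star>\<cdot>y)"
   using m bc lim(1) by (intro tends_mult tends_const) auto
  moreover have "tends A (\<lambda>n. (lact (\<rho> b) c)\<star>\<cdot>lbar m (s n)) ((lact (\<rho> b) c)\<star>\<cdot>lbar m y)"
   using m bc lim(1) by (intro tends_mult tends_const lbar_cont) auto
  ultimately show ?case unfolding lim(2) by (rule tends_unique)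
 qed (use m bc in \<open>simp_all add: lbar_add lbar_smult lbar_zero distrib_left smult_mult_right\<close>)
next
 case (lim s x)
 have "tends A (\<lambda>n. (lbar (m\<star>\<^sub>MA) (s n))\<star>\<cdot>y) ((lbar (m\<star>\<^sub>MA) x)\<star>\<cdot>y)"
  using m y lim(1) by (intro tends_mult tends_const tends_adj lbar_cont) auto
 moreover have "tends A (\<lambda>n. (s n)\<star>\<cdot>lbar m y) (x\<star>\<cdot>lbar m y)"
  using m y lim(1) by (intro tends_mult tends_const tends_adj) auto
 ultimately show ?case unfolding lim(2) by (rule tends_unique)
qed (use m y in \<open>simp_all add: lbar_add lbar_smult lbar_zero distrib_right smult_mult_left adj_add adj_smult\<close>)

definition rbar :: "'a multiplier=>'a multiplier" where
 "rbar m = (\<lambda>x\<in>|A|. lbar m x, \<lambda>x\<in>|A|. (lbar (m\<star>\<^sub>MA) (x\<star>))\<star>)"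

lemma rbar_in [simp]: assumes m: "m\<in>|MA|" shows "rbar m\<in>|MA|"
 unfolding rbar_def
proof (rule multiplierI)
 show "(lbar (m\<star>\<^sub>MA) (x\<star>))\<star>\<cdot>y = x\<cdot>lbar m y" if "x\<in>|A|" "y\<in>|A|" for x y
  using lbar_adj[OF m, of "x\<star>" y] that by (simp add: adj_adj)
 show "||lbar m x||\<le>||m||\<^sub>MA * ||x||" if "x\<in>|A|" for x by (rule lbar_le[OF m that])
qed (use m in auto)

lemma lact_rbar: "x\<in>|A| ==> lact (rbar m) x = lbar m x"
 by (simp add: rbar_def)

lemma rbar_base [simp]: "m\<in>|MA| ==> b\<in>|A| ==> c\<in>|A| ==> lact (rbar m) (lact (\<rho> b) c) = lact (\<rho> (lact m b)) c"
 by (simp add: lact_rbar lbar_base)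

lemma rbar_hom: "star_hom MA MA rbar"
 unfolding star_hom_def
proof (intro conjI allI ballI funcsetI)
 fix m n c assume m [simp]: "m\<in>|MA|" and n [simp]: "n\<in>|MA|"
 show "rbar m\<in>|MA|" by simp
 show "rbar (m\<oplus>\<^sub>MA n) = rbar m\<oplus>\<^sub>MA rbar n" by (rule eq_dense) auto
 show "rbar (c\<odot>\<^sub>MA m) = c\<odot>\<^sub>MA rbar m" by (rule eq_dense) auto
 show "rbar (m\<cdot>\<^sub>MA n) = rbar m\<cdot>\<^sub>MA rbar n" by (rule eq_dense) auto
 show "rbar (m\<star>\<^sub>MA) = (rbar m)\<star>\<^sub>MA"
 proof (rule multiplier_eqI)
  fix x assume x: "x\<in>|A|"
  have "lact ((rbar m)\<star>\<^sub>MA) x = (ract (rbar m) (x\<star>))\<star>" using x by simp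
  also have "\<dots> = lbar (m\<star>\<^sub>MA) x" using x by (simp add: rbar_def adj_adj)
  finally show "lact (rbar (m\<star>\<^sub>MA)) x = lact ((rbar m)\<star>\<^sub>MA) x" using x by (simp add: lact_rbar)
 qed (simp_all only: rbar_in U.adj_closed m)
qed

lemmas rbar_simps [simp] = star_hom_simps[OF rbar_hom]
lemmas rbar_diff = star_hom_diff[OF U.star_algebra_axioms U.star_algebra_axioms rbar_hom]

lemma rbar_one [simp]: "rbar \<one>\<^sub>MA = \<one>\<^sub>MA"
 by (rule eq_dense) auto

lemma rbar_J [simp]: "a\<in>|A| ==> rbar (J a) = \<rho> a"
 by (rule eq_dense) auto

lemma rbar_e: assumes "x\<in>|A|" shows "tends A (\<lambda>n. lact (\<rho> (e n)) x) x"
 using lbar_tends[of "\<one>\<^sub>MA" x] lact_rbar[of x "\<one>\<^sub>MA"] assms by simp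

lemma rho_factor:
 assumes "x\<in>|A|" obtains b c where "b\<in>|A|" "c\<in>|A|" "x = lact (\<rho> b) c"
 by (rule cohen_factorization[OF rbar_hom rbar_one _ assms]) (use rbar_e in auto)

lemma rbar_unique:
 assumes \<phi>: "star_hom MA MA \<phi>" "\<And>a. a\<in>|A| ==> \<phi> (J a) = \<rho> a" and m: "m\<in>|MA|"
 shows "\<phi> m = rbar m"
proof (rule eq_dense)
 note [simp] = star_hom_simps[OF \<phi>(1)] m
 show "\<phi> m\<in>|MA|" "rbar m\<in>|MA|" by simp_all
 fix b c assume [simp]: "b\<in>|A|" "c\<in>|A|"
 have "lact (\<phi> m) (lact (\<rho> b) c) = lact (\<phi> (m\<cdot>\<^sub>MA J b)) c" using \<phi>(2)[of b] by simp
 also have "\<dots> = lact (\<rho> (lact m b)) c" using mult_J[of m b] \<phi>(2)[of "lact m b"] by simp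
 finally show "lact (\<phi> m) (lact (\<rho> b) c) = lact (rbar m) (lact (\<rho> b) c)" by simp
qed

lemma strict_topspace: "topspace (strict_topology A) = |MA|"
proof -
 have m: "m\<in>{m'\<in>|MA|. ||lact m' \<zero>\<ominus>lact m \<zero>|| < 1}" if "m\<in>|MA|" for m using that by simp
 show ?thesis
  unfolding strict_topology_def topology_generated_by_topspace
 proof (rule equalityI[OF Union_least subsetI])
  fix V assume "V\<in>{{m\<in>|MA|. ||lact m a\<ominus>lact m0 a|| < \<epsilon>} | m0 a \<epsilon>.
     m0\<in>|MA|\<and>a\<in>|A|\<and>\<epsilon> > 0}\<union>
   {{m\<in>|MA|. ||ract m a\<ominus>ract m0 a|| < \<epsilon>} | m0 a \<epsilon>. m0\<in>|MA|\<and>a\<in>|A|\<and>\<epsilon> > 0}"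
  then show "V\<subseteq>|MA|" by (elim UnE CollectE exE conjE) simp_all
 next
  fix m assume c: "m\<in>|MA|"
  show "m\<in>\<Union> ({{m\<in>|MA|. ||lact m a\<ominus>lact m0 a|| < \<epsilon>} | m0 a \<epsilon>.
     m0\<in>|MA|\<and>a\<in>|A|\<and>\<epsilon> > 0}\<union>
   {{m\<in>|MA|. ||ract m a\<ominus>ract m0 a|| < \<epsilon>} | m0 a \<epsilon>. m0\<in>|MA|\<and>a\<in>|A|\<and>\<epsilon> > 0})"
   by (rule UnionI[OF UnI1 m[OF c]], rule CollectI, intro exI conjI, rule refl) (simp_all only: c zero_closed zero_less_one)
 qed
qed

lemma strict_open_left: "m0\<in>|MA| ==> a\<in>|A| ==> r > 0 ==>
  openin (strict_topology A) {m\<in>|MA|. ||lact m a\<ominus>lact m0 a|| < r}"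
 unfolding strict_topology_def by (rule topology_generated_by_Basis) blast

lemma strict_open_right: "m0\<in>|MA| ==> a\<in>|A| ==> r > 0 ==>
  openin (strict_topology A) {m\<in>|MA|. ||ract m a\<ominus>ract m0 a|| < r}"
 unfolding strict_topology_def by (rule topology_generated_by_Basis) blast

text \<open>Factor a = \<rho>(b)c: the difference of R(m) and R(m1) on a is then bounded by that of
  m and m1 on b, times the norm of c. The exact factorization gives strict continuity on all of
  M(A), not only on bounded sets.\<close>

lemma rbar_open_left:
 assumes m0: "m0\<in>|MA|" and a: "a\<in>|A|"
 shows "openin (strict_topology A) {m\<in>|MA|. ||lact (rbar m) a\<ominus>lact m0 a|| < r}" (is "openin _ ?S")
proof (subst openin_subopen, intro ballI)
 fix m1 assume "m1\<in>?S"
 then have m1 [simp]: "m1\<in>|MA|" and r1: "||lact (rbar m1) a\<ominus>lact m0 a|| < r" by auto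
 obtain b c where bc [simp]: "b\<in>|A|" "c\<in>|A|" and ab: "a = lact (\<rho> b) c" using rho_factor[OF a] by blast
 define t where "t = (r - ||lact (rbar m1) a\<ominus>lact m0 a||) / ( ||c|| + 1)"
 have t: "t > 0" using r1 by (simp add: t_def add_nonneg_pos)
 let ?T = "{m\<in>|MA|. ||lact m b\<ominus>lact m1 b|| < t}"
 have "?T\<subseteq>?S"
 proof
  fix m assume "m\<in>?T"
  then have m [simp]: "m\<in>|MA|" and mt: "||lact m b\<ominus>lact m1 b|| < t" by auto
  have "lact (rbar m) a\<ominus>lact (rbar m1) a = lact (\<rho> (lact m b\<ominus>lact m1 b)) c"
   by (simp add: ab rho_diff lact_diff)
  then have "||lact (rbar m) a\<ominus>lact (rbar m1) a||\<le>||lact m b\<ominus>lact m1 b|| * ||c||"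
   using order_trans[OF lact_le[of "\<rho> (lact m b\<ominus>lact m1 b)" c] mult_right_mono[OF rho_le]] by simp
  also have "\<dots>\<le>t * ||c||" using mt by (intro mult_right_mono) auto
  also have "\<dots> < t * ( ||c|| + 1)" using t by simp
  also have "\<dots> = r - ||lact (rbar m1) a\<ominus>lact m0 a||" by (simp add: t_def add_nonneg_pos less_imp_neq[THEN not_sym])
  finally show "m\<in>?S"
   using norm_dist_triangle[of "lact (rbar m) a" "lact (rbar m1) a" "lact m0 a"] m0 a by simp
 qed
 moreover have "m1\<in>?T" using t by simp
 ultimately show "\<exists>T. openin (strict_topology A) T\<and>m1\<in>T\<and>T\<subseteq>?S"
  using strict_open_left[OF m1 bc(1) t] by blast
qed

text \<open>Factorization produces left actions of \<rho>(b), so a\<star> is factored and the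
  estimate is transported by the adjoint.\<close>

lemma rbar_open_right:
 assumes m0: "m0\<in>|MA|" and a: "a\<in>|A|"
 shows "openin (strict_topology A) {m\<in>|MA|. ||ract (rbar m) a\<ominus>ract m0 a|| < r}" (is "openin _ ?S")
proof (subst openin_subopen, intro ballI)
 fix m1 assume "m1\<in>?S"
 then have m1 [simp]: "m1\<in>|MA|" and r1: "||ract (rbar m1) a\<ominus>ract m0 a|| < r" by auto
 obtain b c where bc [simp]: "b\<in>|A|" "c\<in>|A|" and ab: "a\<star> = lact (\<rho> b) c" using rho_factor[of "a\<star>"] a by auto
 define t where "t = (r - ||ract (rbar m1) a\<ominus>ract m0 a||) / ( ||c|| + 1)"
 have t: "t > 0" using r1 by (simp add: t_def add_nonneg_pos)
 let ?T = "{m\<in>|MA|. ||ract m (b\<star>)\<ominus>ract m1 (b\<star>)|| < t}"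
 have ra: "ract (rbar m) a = (lact (\<rho> ((ract m (b\<star>))\<star>)) c)\<star>" if m: "m\<in>|MA|" for m
 proof -
  have "ract (rbar m) a = (lact ((rbar m)\<star>\<^sub>MA) (a\<star>))\<star>" using a m by (simp add: adj_adj)
  also have "\<dots> = (lact (rbar (m\<star>\<^sub>MA)) (lact (\<rho> b) c))\<star>" unfolding ab using m by (simp only: rbar_simps(5))
  also have "\<dots> = (lact (\<rho> (lact (m\<star>\<^sub>MA) b)) c)\<star>" using m by (simp only: rbar_base U.adj_closed bc)
  finally show ?thesis by (simp only: mult_ops(7) bc)
 qed
 have "?T\<subseteq>?S"
 proof
  fix m assume "m\<in>?T"
  then have m [simp]: "m\<in>|MA|" and mt: "||ract m (b\<star>)\<ominus>ract m1 (b\<star>)|| < t" by auto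
  let ?d = "(ract m (b\<star>))\<star>\<ominus>(ract m1 (b\<star>))\<star>"
  have nd: "||?d|| = ||ract m (b\<star>)\<ominus>ract m1 (b\<star>)||" by (simp flip: adj_diff)
  have "ract (rbar m) a\<ominus>ract (rbar m1) a = (lact (\<rho> ?d) c)\<star>"
   unfolding ra[OF m] ra[OF m1] by (simp add: rho_diff lact_diff adj_diff del: rho_simps(5))
  then have "||ract (rbar m) a\<ominus>ract (rbar m1) a||\<le>||?d|| * ||c||"
   using order_trans[OF lact_le[of "\<rho> ?d" c] mult_right_mono[OF rho_le]] by (simp del: rho_simps(5))
  also have "\<dots>\<le>t * ||c||" unfolding nd using mt by (intro mult_right_mono) auto
  also have "\<dots> < t * ( ||c|| + 1)" using t by simp
  also have "\<dots> = r - ||ract (rbar m1) a\<ominus>ract m0 a||" by (simp add: t_def add_nonneg_pos less_imp_neq[THEN not_sym])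
  finally show "m\<in>?S"
   using norm_dist_triangle[of "ract (rbar m) a" "ract (rbar m1) a" "ract m0 a"] m0 a by simp
 qed
 moreover have "m1\<in>?T" using t by simp
 ultimately show "\<exists>T. openin (strict_topology A) T\<and>m1\<in>T\<and>T\<subseteq>?S"
  using strict_open_right[OF m1 _ t, of "b\<star>"] by auto
qed

lemma rbar_continuous: "continuous_map (strict_topology A) (strict_topology A) (restrict rbar ( |MA| ))"
proof -
 let ?f = "restrict rbar ( |MA| )"
 have pre: "?f -` {m\<in>|MA|. P m} \<inter> |MA| = {m\<in>|MA|. P (rbar m)}" for P by auto
 show ?thesis
  apply (subst (2) strict_topology_def)
  unfolding continuous_on_generated_topo_iff
 proof (intro conjI allI impI)
  show "?f ` topspace (strict_topology A)\<subseteq>\<Union> ({{m\<in>|MA|. ||lact m a\<ominus>lact m0 a|| < \<epsilon>} | m0 a \<epsilon>.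
     m0\<in>|MA|\<and>a\<in>|A|\<and>\<epsilon> > 0}\<union>
   {{m\<in>|MA|. ||ract m a\<ominus>ract m0 a|| < \<epsilon>} | m0 a \<epsilon>. m0\<in>|MA|\<and>a\<in>|A|\<and>\<epsilon> > 0})"
   using strict_topspace unfolding strict_topology_def topology_generated_by_topspace by auto
 next
  fix V assume "V\<in>{{m\<in>|MA|. ||lact m a\<ominus>lact m0 a|| < \<epsilon>} | m0 a \<epsilon>.
     m0\<in>|MA|\<and>a\<in>|A|\<and>\<epsilon> > 0}\<union>
   {{m\<in>|MA|. ||ract m a\<ominus>ract m0 a|| < \<epsilon>} | m0 a \<epsilon>. m0\<in>|MA|\<and>a\<in>|A|\<and>\<epsilon> > 0}"
  then show "openin (strict_topology A) (?f -` V \<inter> topspace (strict_topology A))"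
   unfolding strict_topspace by (elim UnE CollectE exE conjE; simp only: pre rbar_open_left rbar_open_right)
 qed
qed

lemma strict_extension_eq: "strict_extension A \<rho> = restrict rbar ( |MA| )"
 unfolding strict_extension_def
proof (rule the_equality)
 have "star_hom MA MA (restrict rbar ( |MA| ))"
  using rbar_hom U.mult_closed U.adj_closed unfolding star_hom_def by (auto simp del: rbar_simps)
 then show "restrict rbar ( |MA| )\<in>extensional ( |MA| )\<and>star_hom MA MA (restrict rbar ( |MA| ))\<and>
   continuous_map (strict_topology A) (strict_topology A) (restrict rbar ( |MA| ))\<and>
   (\<forall>a\<in>|A|. restrict rbar ( |MA| ) (J a) = \<rho> a)"
  using rbar_continuous by simp
 show "\<phi> = restrict rbar ( |MA| )" if "\<phi>\<in>extensional ( |MA| )\<and>star_hom MA MA \<phi>\<and>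
   continuous_map (strict_topology A) (strict_topology A) \<phi>\<and>(\<forall>a\<in>|A|. \<phi> (J a) = \<rho> a)" for \<phi>
  by (rule extensionalityI[of _ "|MA|"]) (use that rbar_unique[of \<phi>] in auto)
qed

section \<open>Isometry of the extension, and truncation modulo the ideal\<close>

lemma I_ideal: "closed_ideal MA (J ` |A| )" by (rule J_ideal)

lemma J_neg_norm_le:
 assumes "sa h" "0 < t" "U.pos (J h)" "U.pos (of_real t\<odot>\<^sub>MA \<one>\<^sub>MA\<ominus>\<^sub>MA J h)" shows "||h||\<le>t"
 using U.norm_le_of_pos[OF assms(3,4,2)] assms(1) by (simp add: J_norm)

lemma npart_rbar:
 assumes "U.sa k" "||k||\<^sub>MA\<le>K" "0 < K"
 shows "rbar (U.npart K k) = U.npart K (rbar k)"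
proof -
 have [simp]: "k\<in>|MA|" using assms by simp
 note a = U.absv_arg[OF assms]
 have "rbar (sqrt_defect MA (\<one>\<^sub>MA\<ominus>\<^sub>MA of_real (inverse (K * K))\<odot>\<^sub>MA (k\<cdot>\<^sub>MA k)))
   = sqrt_defect MA (rbar (\<one>\<^sub>MA\<ominus>\<^sub>MA of_real (inverse (K * K))\<odot>\<^sub>MA (k\<cdot>\<^sub>MA k)))"
  by (rule sqrt_defect_hom[OF cstar_multiplier cstar_multiplier rbar_hom star_hom_contractive[OF cstar_multiplier cstar_multiplier rbar_hom] a(1,2)])
 then show ?thesis
  unfolding U.npart_def U.absv_def using U.sqrt_defect_in[OF a(1,2)] by (simp add: rbar_diff)
qed

text \<open>Let h = z\<star>z and let t bound the norm of \<rho>(h). Modulo A, t - h equals the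
  positive scalar t, so its negative part lies in A. The extension sends this part to the negative
  part of t - \<rho>(h), which is 0, and injectivity on A makes it vanish. Hence h \<le> t.\<close>

lemma rho_norm: assumes z: "z\<in>|A|" shows "||\<rho> z||\<^sub>MA = ||z||"
proof (rule antisym[OF rho_le[OF z]])
 define h where "h = z\<star>\<cdot>z"
 have h [simp]: "h\<in>|A|" "sa h" using z sa_cstar by (auto simp: h_def)
 have ph: "U.pos (J h)" using U.cstar_pos[of "J z"] z by (simp add: h_def J_simps)
 have bound: "||h||\<le>t" if t: "||\<rho> h||\<^sub>MA\<le>t" "0 < t" for t
 proof -
  let ?t = "of_real t\<odot>\<^sub>MA \<one>\<^sub>MA"
  define k where "k = ?t\<ominus>\<^sub>MA J h"
  \<comment> \<open>One scale has to serve both k and the scalar t, because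
    \<open>npart_cong\<close> compares negative parts formed with the same \<open>K\<close>.\<close>
  define K where "K = ||k||\<^sub>MA + t"
  have st: "U.sa ?t" by (intro U.sa_smult U.sa_one)
  have sk: "U.sa k" unfolding k_def by (intro U.sa_diff st U.pos_sa[OF ph])
  have K: "||k||\<^sub>MA\<le>K" "0 < K" using t sk by (auto simp: K_def add_nonneg_pos)
  have pt: "U.pos ?t" using t U.pos_smult[OF U.pos_square[OF U.sa_one], of t] by simp
  have nt: "||?t||\<^sub>MA\<le>K"
  proof -
   have "||?t||\<^sub>MA\<le>t * 1" using t(2) mult_left_mono[OF U.norm_one_le, of t] by (simp add: U.norm_smult)
   moreover have "0\<le>||k||\<^sub>MA" using sk by simp
   ultimately show ?thesis by (simp add: K_def)
  qed
  have "U.npart K ?t = \<zero>\<^sub>MA" by (rule U.npart_pos[OF pt nt K(2)])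
  moreover have "U.npart K k\<ominus>\<^sub>MA U.npart K ?t\<in>J ` |A|"
  proof (rule U.npart_cong[OF I_ideal sk K(1) st nt K(2)])
   have "k\<ominus>\<^sub>MA ?t = J ((-1)\<odot>h)" unfolding k_def by (simp add: J_simps) ((simp add: U.expand)?; (rule U.linI, (rule U.lins | (simp add: algebra_simps; fail))+))
   then show "k\<ominus>\<^sub>MA ?t\<in>J ` |A|" by simp
  qed
  moreover have "U.sa (U.npart K k)" by (rule U.npart_sa[OF sk K])
  ultimately have "U.npart K k\<in>J ` |A|" by (simp add: U.diff_eq)
  then obtain a where a: "a\<in>|A|" "U.npart K k = J a" by auto
  have rk: "rbar k = ?t\<ominus>\<^sub>MA \<rho> h" by (simp add: k_def rbar_diff)
  have "(\<rho> h)\<star>\<^sub>MA = \<rho> h" using star_hom_adj[OF hom h(1)] h(2) by simp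
  then have sr: "U.sa (\<rho> h)" by (simp add: U.sa_def del: U.sa_in U.sa_adj)
  have prk: "U.pos (rbar k)" unfolding rk by (rule U.pos_of_norm_le[OF sr t])
  have "||rbar k||\<^sub>MA\<le>K" using order_trans[OF star_hom_contractive[OF cstar_multiplier cstar_multiplier rbar_hom] K(1)] sk by simp
  from U.npart_pos[OF prk this K(2)] have "rbar (U.npart K k) = \<zero>\<^sub>MA" using npart_rbar[OF sk K] by simp
  then have "\<rho> a = \<rho> \<zero>" using a star_hom_zero[OF star_algebra_axioms U.star_algebra_axioms hom] by simp
  then have "a = \<zero>" using inj a(1) by (auto dest: inj_onD)
  then have "U.npart K k = \<zero>\<^sub>MA" using a(2) J_zero by simp
  then have "U.pos k" by (rule U.npart_zero_pos[OF sk K])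
  then show ?thesis using J_neg_norm_le[OF h(2) t(2) ph] by (simp add: k_def)
 qed
 have "||h||\<le>||\<rho> h||\<^sub>MA"
 proof (rule field_le_epsilon)
  fix \<epsilon> :: real assume "0 < \<epsilon>"
  then show "||h||\<le>||\<rho> h||\<^sub>MA + \<epsilon>" by (intro bound) (auto simp: add_nonneg_pos)
 qed
 then have "||z||\<^sup>2\<le>( ||\<rho> z||\<^sub>MA)\<^sup>2" using z by (simp add: h_def norm_cstar U.norm_cstar)
 then show "||z||\<le>||\<rho> z||\<^sub>MA" by (rule power2_le_imp_le) (use z in simp)
qed

text \<open>mx lies in A, so its norm is that of \<rho>(mx) = R(m)\<rho>(x): isometry on A passes to
  multipliers.\<close>

lemma rbar_norm [simp]: assumes m: "m\<in>|MA|" shows "||rbar m||\<^sub>MA = ||m||\<^sub>MA"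
proof (rule antisym)
 show "||rbar m||\<^sub>MA\<le>||m||\<^sub>MA" by (rule star_hom_contractive[OF cstar_multiplier cstar_multiplier rbar_hom m])
 show "||m||\<^sub>MA\<le>||rbar m||\<^sub>MA"
 proof (rule mnorm_le[OF m])
  fix x assume x: "x\<in>|A|"
  have "||lact m x|| = ||rbar (m\<cdot>\<^sub>MA J x)||\<^sub>MA" using m x by (simp only: mult_J rbar_J lact_in rho_norm)
  also have "\<dots>\<le>||rbar m||\<^sub>MA * ||x||" using U.norm_mult[of "rbar m" "\<rho> x"] m x by (simp add: rho_norm)
  finally show "||lact m x||\<le>||rbar m||\<^sub>MA * ||x||" .
 qed (use m in simp)
qed

text \<open>R(y e_n) = c\<rho>(e_n) converges to c = R(y). Since R is isometric, y e_n converges to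
  y in norm, and A is closed in M(A). This is what places the part cut off by \<open>clamp\<close>
  in A and not merely its image.\<close>

lemma rbar_preimage:
 assumes y: "y\<in>|MA|" and c: "c\<in>|A|" "rbar y = J c"
 obtains a where "a\<in>|A|" "y = J a" "\<rho> a = J c"
proof -
 let ?s = "\<lambda>n. lact y (e n)"
 note [simp] = y c
 have "tends A (\<lambda>n. (lact (\<rho> (e n)) (c\<star>))\<star>) ((c\<star>)\<star>)" by (intro tends_adj rbar_e) simp
 moreover have "(lact (\<rho> (e n)) (c\<star>))\<star> = ract (\<rho> (e n)) c" for n
 proof -
  have sym: "(\<rho> (e n))\<star>\<^sub>MA = \<rho> (e n)" using star_hom_adj[OF hom e_in[of n]] by (simp only: e_adj)
  show ?thesis using mult_ops(8)[OF c(1), of "\<rho> (e n)"] unfolding sym by simp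
 qed
 ultimately have t: "tends A (\<lambda>n. ract (\<rho> (e n)) c) c" by (simp add: adj_adj)
 have "tends MA (\<lambda>n. J (?s n)) y"
 proof (rule U.tendsI)
  show "||J (?s n)\<ominus>\<^sub>MA y||\<^sub>MA\<le>||ract (\<rho> (e n)) c\<ominus>c||" for n
  proof -
   have "J (?s n) = y\<cdot>\<^sub>MA J (e n)" by (simp add: mult_J)
   then have "rbar (J (?s n)\<ominus>\<^sub>MA y) = J (ract (\<rho> (e n)) c)\<ominus>\<^sub>MA J c"
    by (simp add: rbar_diff J_mult del: rbar_J) (simp add: J_mult)
   then have "||J (?s n)\<ominus>\<^sub>MA y||\<^sub>MA = ||J (ract (\<rho> (e n)) c\<ominus>c)||\<^sub>MA"
    using rbar_norm[of "J (?s n)\<ominus>\<^sub>MA y"] by (simp add: J_diff)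
   then show ?thesis by (simp add: J_norm)
  qed
  show "(\<lambda>n. ||ract (\<rho> (e n)) c\<ominus>c||)\<longlonglongrightarrow>0" using t by (simp add: tends_def)
 qed auto
 then obtain a where a: "a\<in>|A|" "y = J a" by (rule J_tends[rotated]) simp_all
 then show ?thesis using that[of a] c(2) by simp
qed

text \<open>The clamp \<open>y \<mapsto> min y t\<close> changes \<open>y\<close> only by an element of \<open>A\<close>, because \<open>t - \<rho>(y)\<equiv>t - T\<ge>0\<close> modulo \<open>A\<close>.\<close>

lemma clamp:
 assumes w: "w\<in>|MA|" and T: "T\<in>|MA|" and y: "y = w\<star>\<^sub>MA\<cdot>\<^sub>MA w"
  and S: "S = T\<star>\<^sub>MA\<cdot>\<^sub>MA T" and a: "a\<in>|A|" "S = J a\<oplus>\<^sub>MA rbar y" and t: "0 < t" "||S||\<^sub>MA\<le>t"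
 obtains j c where "j\<in>|A|" "c\<in>|A|" "\<rho> j = J c" "||y\<ominus>\<^sub>MA J j||\<^sub>MA\<le>2 * t"
proof -
 let ?t = "of_real t\<odot>\<^sub>MA \<one>\<^sub>MA"
 have py: "U.pos y" unfolding y by (rule U.cstar_pos[OF w])
 have pS: "U.pos S" unfolding S by (rule U.cstar_pos[OF T])
 note [simp] = a(1) U.pos_sa[OF py] U.pos_sa[OF pS]
 define k k' where "k = ?t\<ominus>\<^sub>MA y" and "k' = ?t\<ominus>\<^sub>MA S"
 have st: "U.sa ?t" by (intro U.sa_smult U.sa_one)
 have sk: "U.sa k" "U.sa k'" unfolding k_def k'_def by (auto intro: U.sa_diff st)
 note [simp] = sk
 define K where "K = ||k||\<^sub>MA + ||k'||\<^sub>MA + 1"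
 have K: "||k||\<^sub>MA\<le>K" "||k'||\<^sub>MA\<le>K" "0 < K" by (auto simp: K_def add_nonneg_pos)
 have srk: "U.sa (rbar k)" using star_hom_adj[OF rbar_hom, of k] by (simp add: U.sa_def del: U.sa_in U.sa_adj rbar_simps(5))
   (simp add: sk)
 have rkK: "||rbar k||\<^sub>MA\<le>K" using K(1) by simp
 have pk': "U.pos k'" unfolding k'_def by (rule U.pos_of_norm_le[OF U.pos_sa[OF pS] t(2,1)])
 have n0: "U.npart K k' = \<zero>\<^sub>MA" by (rule U.npart_pos[OF pk' K(2,3)])
 \<comment> \<open>Modulo A, R(k) equals k' = t - S, which is positive. So the negative part of
   R(k), which is R of the negative part of k, lies in A.\<close>
 have "U.npart K (rbar k)\<ominus>\<^sub>MA U.npart K k'\<in>J ` |A|"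
 proof (rule U.npart_cong[OF I_ideal srk rkK sk(2) K(2,3)])
  have "rbar k\<ominus>\<^sub>MA k' = J a" unfolding k_def k'_def a(2) by (simp add: rbar_diff) ((simp add: U.expand)?; (rule U.linI, (rule U.lins | (simp add: algebra_simps; fail))+))
  then show "rbar k\<ominus>\<^sub>MA k'\<in>J ` |A|" by simp
 qed
 moreover have sn: "U.sa (U.npart K k)" by (rule U.npart_sa[OF sk(1) K(1,3)])
 moreover have "U.sa (U.npart K (rbar k))" by (rule U.npart_sa[OF srk rkK K(3)])
 ultimately have "rbar (U.npart K k)\<in>J ` |A|"
  unfolding npart_rbar[OF sk(1) K(1,3)] n0 by (simp add: U.diff_eq)
 then obtain c0 where "c0\<in>|A|" "rbar (U.npart K k) = J c0" by auto
 then obtain j0 where j0: "j0\<in>|A|" "U.npart K k = J j0" "\<rho> j0 = J c0" and c0: "c0\<in>|A|"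
  using rbar_preimage[of "U.npart K k" c0] sn by auto
 define p where "p = U.absv K k\<oplus>\<^sub>MA k"
 have sr: "U.sa (U.absv K k)" using U.absv_props(1)[OF sk(1) K(1,3)] U.pos_sa by blast
 note [simp] = sr
 have np: "||p||\<^sub>MA\<le>2 * t"
  unfolding p_def using U.clamp_bound[OF py t(1) _ K(3)] K(1) by (simp add: k_def)
 \<comment> \<open>This is min(y, t) = t minus the positive part of k; \<open>p\<close> and
   \<open>U.npart K k\<close> are twice the positive and negative parts. The bound 2t comes from the
   triangle inequality applied to the right-hand side.\<close>
 have "y\<ominus>\<^sub>MA of_real (1/2)\<odot>\<^sub>MA U.npart K k = ?t\<ominus>\<^sub>MA of_real (1/2)\<odot>\<^sub>MA p"
 proof -
  define r where "r = U.absv K k"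
  have [simp]: "r\<in>|MA|" by (simp add: r_def)
  have yk: "y = ?t\<ominus>\<^sub>MA k" unfolding k_def by ((simp add: U.expand)?; (rule U.linI, (rule U.lins | (simp add: algebra_simps; fail))+))
  show ?thesis unfolding p_def U.npart_def r_def[symmetric] by (subst yk) ((simp add: U.expand)?; (rule U.linI, (rule U.lins | (simp add: algebra_simps; fail))+))
 qed
 then have "||y\<ominus>\<^sub>MA of_real (1/2)\<odot>\<^sub>MA U.npart K k||\<^sub>MA\<le>||?t||\<^sub>MA + ||of_real (1/2)\<odot>\<^sub>MA p||\<^sub>MA"
  using U.norm_diff_triangle[of ?t "of_real (1/2)\<odot>\<^sub>MA p"] by (simp add: p_def)
 also have "\<dots>\<le>t * 1 + 1/2 * (2 * t)"
  using np mult_left_mono[OF U.norm_one_le, of t] t by (intro add_mono) (simp_all add: U.norm_smult p_def)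
 finally have "||y\<ominus>\<^sub>MA J (of_real (1/2)\<odot>j0)||\<^sub>MA\<le>2 * t" using j0 by (simp add: J_simps)
 then show ?thesis using that[of "of_real (1/2)\<odot>j0" "of_real (1/2)\<odot>c0"] j0 c0 by (simp add: J_simps)
qed

end

section \<open>The inductive limit of an isometric endomorphism\<close>

lemma star_hom_tends:
 assumes A: "cstar_algebra A" and B: "cstar_algebra B" and h: "star_hom A B \<phi>" and t: "tends A s x"
 shows "tends B (\<lambda>n. \<phi> (s n)) (\<phi> x)"
proof -
 interpret A: cstar_algebra A by fact
 interpret B: cstar_algebra B by fact
 note [simp] = A.tends_in[OF t] star_hom_in[OF h]
 show ?thesis
 proof (rule B.tendsI)
  show "||\<phi> (s n)\<ominus>\<^sub>B \<phi> x||\<^sub>B\<le>||s n\<ominus>\<^sub>A x||\<^sub>A" for n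
   using star_hom_contractive[OF A B h, of "s n\<ominus>\<^sub>A x"]
   by (simp add: star_hom_diff[OF A.star_algebra_axioms B.star_algebra_axioms h])
 qed (use t in \<open>auto simp: tends_def\<close>)
qed

locale tower = cstar_algebra M for M :: "'a cstar_struct" (structure) +
 fixes \<phi> assumes \<phi>_hom: "star_hom M M \<phi>" and \<phi>_norm: "x\<in>|M| ==> ||\<phi> x|| = ||x||"
begin

abbreviation "AL\<equiv>algebraic_limit (\<lambda>_. M) (\<lambda>_. \<phi>)"
abbreviation "FA\<equiv>inductive_limit (\<lambda>_. M) (\<lambda>_. \<phi>)"
abbreviation "io\<equiv>limit_map (\<lambda>_. M) (\<lambda>_. \<phi>)"

definition al :: "(int=>'a) set" where
 "al = {f. (\<forall>k. f k\<in>|M| )\<and>(\<exists>N. \<forall>k\<ge>N. f (k + 1) = \<phi> (f k))}"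

lemmas \<phi>_simps [simp] = star_hom_simps[OF \<phi>_hom]
lemma \<phi>_zero [simp]: "\<phi> \<zero> = \<zero>" by (rule star_hom_zero[OF star_algebra_axioms star_algebra_axioms \<phi>_hom])

lemma AL_simps [simp]: "|AL| = al" "f\<oplus>\<^sub>AL g = (\<lambda>k. f k\<oplus>g k)" "f\<cdot>\<^sub>AL g = (\<lambda>k. f k\<cdot>g k)"
 "c\<odot>\<^sub>AL f = (\<lambda>k. c\<odot>f k)" "f\<star>\<^sub>AL = (\<lambda>k. (f k)\<star>)" "\<zero>\<^sub>AL = (\<lambda>k. \<zero>)"
 by (simp_all add: algebraic_limit_def al_def)

lemma al_in [simp]: "f\<in>al ==> f k\<in>|M|"
 by (simp add: al_def)

lemma alE: assumes "f\<in>al" obtains N where "\<And>k. k\<ge>N ==> f (k + 1) = \<phi> (f k)"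
 using assms unfolding al_def by blast

lemma alI: "(\<And>k. f k\<in>|M| ) ==> (\<And>k. k\<ge>N ==> f (k + 1) = \<phi> (f k)) ==> f\<in>al"
 unfolding al_def by blast

lemma al_zero [simp]: "(\<lambda>k. \<zero>)\<in>al"
 by (rule alI) auto

lemma al_smult [simp]: assumes "f\<in>al" shows "(\<lambda>k. c\<odot>f k)\<in>al"
proof -
 obtain N where "\<And>k. k\<ge>N ==> f (k + 1) = \<phi> (f k)" using alE[OF assms] by blast
 then show ?thesis by (intro alI[of _ N]) (use assms in auto)
qed

lemma al_adj [simp]: assumes "f\<in>al" shows "(\<lambda>k. (f k)\<star>)\<in>al"
proof -
 obtain N where "\<And>k. k\<ge>N ==> f (k + 1) = \<phi> (f k)" using alE[OF assms] by blast
 then show ?thesis by (intro alI[of _ N]) (use assms in auto)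
qed

lemma al_add [simp]: assumes "f\<in>al" "g\<in>al" shows "(\<lambda>k. f k\<oplus>g k)\<in>al" "(\<lambda>k. f k\<cdot>g k)\<in>al"
proof -
 obtain N where N: "\<And>k. k\<ge>N ==> f (k + 1) = \<phi> (f k)" using alE[OF assms(1)] by blast
 obtain N' where N': "\<And>k. k\<ge>N' ==> g (k + 1) = \<phi> (g k)" using alE[OF assms(2)] by blast
 show "(\<lambda>k. f k\<oplus>g k)\<in>al" by (rule alI[of _ "max N N'"]) (use assms N N' in auto)
 show "(\<lambda>k. f k\<cdot>g k)\<in>al" by (rule alI[of _ "max N N'"]) (use assms N N' in auto)
qed

lemma star_algebra_AL: "star_algebra AL"
 by (rule star_algebraI; simp add: expand adj_adj adj_add adj_smult adj_mult mult_assoc smult_mult_right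
   M.a_assoc M.a_comm M.a_lcomm smult_add_left smult_add_right neg_add)

lemma al_diff: "f\<in>al ==> g\<in>al ==> f\<ominus>\<^sub>AL g = (\<lambda>k. f k\<ominus>g k)"
 by (simp add: star_algebra.diff_eq[OF star_algebra_AL] diff_eq)

text \<open>The connecting map is isometric, so the norms are constant from N on and the limit
  defining the seminorm exists.\<close>

lemma AL_norm:
 assumes f: "f\<in>al" and N: "\<And>k. k\<ge>N ==> f (k + 1) = \<phi> (f k)" shows "||f||\<^sub>AL = ||f N||"
proof -
 have c: "||f k|| = ||f N||" if "k\<ge>N" for k
  using that
 proof (induction rule: int_ge_induct)
  case (step i)
  then show ?case using N[of i] f by (simp add: \<phi>_norm)
 qed simp
 have "((\<lambda>k. ||f k||)\<longlongrightarrow>||f N||) at_top"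
  by (rule tendsto_eventually, rule eventually_mono[OF eventually_ge_at_top[of N]]) (rule c)
 then have "Lim at_top (\<lambda>k. ||f k||) = ||f N||" by (rule tendsto_Lim[rotated]) simp
 then show ?thesis unfolding algebraic_limit_def by simp
qed

lemma AL_norm_ev: assumes f: "f\<in>al" obtains N where "\<And>k. k\<ge>N ==> ||f||\<^sub>AL = ||f k||"
proof -
 obtain N where N: "\<And>k. k\<ge>N ==> f (k + 1) = \<phi> (f k)" using alE[OF f] by blast
 show ?thesis by (rule that[of N], rule AL_norm[OF f]) (use N in auto)
qed

lemma pre_cstar_AL: "pre_cstar AL"
proof -
 interpret L: star_algebra AL by (rule star_algebra_AL)
 show ?thesis
 proof
  show "cstar_seminorm AL (cnorm AL)"
   unfolding cstar_seminorm_def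
  proof (intro conjI ballI allI; simp only: AL_simps)
   fix f c assume f: "f\<in>al"
   obtain N where N: "\<And>k. k\<ge>N ==> ||f||\<^sub>AL = ||f k||" using AL_norm_ev[OF f] by blast
   show "0\<le>||f||\<^sub>AL" using N[of N] f by simp
   obtain N' where N': "\<And>k. k\<ge>N' ==> ||\<lambda>k. c\<odot>f k||\<^sub>AL = ||c\<odot>f k||" using AL_norm_ev[OF al_smult[OF f]] by blast
   show "||\<lambda>k. c\<odot>f k||\<^sub>AL = cmod c * ||f||\<^sub>AL"
    using N[of "max N N'"] N'[of "max N N'"] f by (simp add: norm_smult)
   obtain N' where N': "\<And>k. k\<ge>N' ==> ||\<lambda>k. (f k)\<star>\<cdot>f k||\<^sub>AL = ||(f k)\<star>\<cdot>f k||"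
    using AL_norm_ev[OF al_add(2)[OF al_adj[OF f] f]] by blast
   show "||\<lambda>k. (f k)\<star>\<cdot>f k||\<^sub>AL = ( ||f||\<^sub>AL)\<^sup>2"
    using N[of "max N N'"] N'[of "max N N'"] f by (simp add: norm_cstar)
   fix g assume g: "g\<in>al"
   obtain K where K: "\<And>k. k\<ge>K ==> ||g||\<^sub>AL = ||g k||" using AL_norm_ev[OF g] by blast
   obtain N' where N': "\<And>k. k\<ge>N' ==> ||\<lambda>k. f k\<oplus>g k||\<^sub>AL = ||f k\<oplus>g k||" using AL_norm_ev[OF al_add(1)[OF f g]] by blast
   show "||\<lambda>k. f k\<oplus>g k||\<^sub>AL\<le>||f||\<^sub>AL + ||g||\<^sub>AL"
    using N[of "max K (max N N')"] N'[of "max K (max N N')"] K[of "max K (max N N')"] f g by (simp add: norm_triangle)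
   obtain N' where N': "\<And>k. k\<ge>N' ==> ||\<lambda>k. f k\<cdot>g k||\<^sub>AL = ||f k\<cdot>g k||" using AL_norm_ev[OF al_add(2)[OF f g]] by blast
   show "||\<lambda>k. f k\<cdot>g k||\<^sub>AL\<le>||f||\<^sub>AL * ||g||\<^sub>AL"
    using N[of "max K (max N N')"] N'[of "max K (max N N')"] K[of "max K (max N N')"] f g by (simp add: norm_mult)
  qed
 qed
qed

sublocale L: pre_cstar AL by (rule pre_cstar_AL)

lemma FA_completion: "FA = completion AL" by (simp add: inductive_limit_def)

lemma cstar_FA: "cstar_algebra FA"
 unfolding FA_completion by (rule L.cstar_completion)

lemma FA_tends: assumes "X\<in>|FA|" obtains s where "\<And>n. s n\<in>al" "tends FA (\<lambda>n. to_completion AL (s n)) X"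
proof -
 obtain s where s: "s\<in>cauchy_seqs AL" "X = L.cls s" using L.cls_cases assms unfolding FA_completion by blast
 show ?thesis using that[of s] L.cls_tends[OF s(1)] L.cauchy_in[OF s(1)] s(2) by (simp add: FA_completion)
qed

definition elt :: "int=>'a=>int=>'a" where
 "elt n x k = (if k < n then \<zero> else (\<phi> ^^ nat (k - n)) x)"

lemma transition_const: "transition (\<lambda>_. \<phi>) n j x = (\<phi> ^^ j) x"
 by (induction j) auto

lemma io_elt: "io n x = to_completion AL (elt n x)"
 unfolding limit_map_def transition_const elt_def[abs_def] by (rule refl)

lemma pow_in [simp]: "x\<in>|M| ==> (\<phi> ^^ j) x\<in>|M|"
 by (induction j) auto

lemma elt_succ: "k\<ge>n ==> elt n x (k + 1) = \<phi> (elt n x k)"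
proof -
 assume "k\<ge>n"
 then have "nat (k + 1 - n) = Suc (nat (k - n))" by simp
 then show ?thesis using \<open>k\<ge>n\<close> by (simp add: elt_def)
qed

lemma elt_al [simp]: "x\<in>|M| ==> elt n x\<in>al"
 by (rule alI[of _ n]) (auto simp: elt_succ, auto simp: elt_def)

lemma pow_hom: "star_hom M M (\<phi> ^^ j)"
proof (induction j)
 case (Suc j)
 then show ?case using star_hom_comp[OF Suc \<phi>_hom] by (simp add: comp_def)
qed (simp add: star_hom_def)

lemma elt_hom: "star_hom M AL (elt n)"
 unfolding star_hom_def using star_hom_simps[OF pow_hom] by (auto simp: elt_def fun_eq_iff simp flip: funcset_mem)

lemma elt_norm: "x\<in>|M| ==> ||elt n x||\<^sub>AL = ||x||"
 using AL_norm[of "elt n x" n] elt_succ by (simp add: elt_def[of n x n])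

lemma io_hom: "star_hom M FA (io n)"
 using star_hom_comp[OF elt_hom L.to_completion_hom] unfolding FA_completion
 by (simp add: io_elt[abs_def] comp_def)

lemma io_norm: "x\<in>|M| ==> ||io n x||\<^sub>FA = ||x||"
 by (simp add: io_elt FA_completion L.to_completion_norm elt_norm)

text \<open>Families that agree from some index on have distance 0, so the values below N are
  irrelevant. Every element of the algebraic limit therefore comes from a single level.\<close>

lemma to_completion_io:
 assumes f: "f\<in>al" and N: "\<And>k. k\<ge>N ==> f (k + 1) = \<phi> (f k)" shows "to_completion AL f = io N (f N)"
proof -
 have c: "f k = elt N (f N) k" if "k\<ge>N" for k
  using that
 proof (induction rule: int_ge_induct)
  case (step i)
  then show ?case using N[of i] by (simp add: elt_succ)
 qed (simp add: elt_def)
 have "||\<lambda>k. f k\<ominus>elt N (f N) k||\<^sub>AL = ||f N\<ominus>elt N (f N) N||"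
 proof (rule AL_norm)
  show "(\<lambda>k. f k\<ominus>elt N (f N) k)\<in>al" using L.M.minus_closed[of f "elt N (f N)"] f by (simp add: al_diff)
  fix k assume k: "N\<le>k"
  then show "f (k + 1)\<ominus>elt N (f N) (k + 1) = \<phi> (f k\<ominus>elt N (f N) k)"
   using c[OF k, symmetric] c[of "k + 1", symmetric] f by (simp)
 qed
 also have "\<dots> = 0" using c[of N] f by (simp add: elt_def)
 finally show ?thesis
  unfolding io_elt by (subst L.to_completion_eq_iff) (use f in \<open>auto simp: al_diff\<close>)
qed

lemma io_succ: assumes x: "x\<in>|M|" shows "io (n + 1) (\<phi> x) = io n x"
proof -
 have "io n x = io (n + 1) (elt n x (n + 1))"
  unfolding io_elt[of n] by (rule to_completion_io) (use x elt_succ in auto)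
 then show ?thesis using elt_succ[of n n x] by (simp add: elt_def[of n x n])
qed

abbreviation "sh\<equiv>\<lambda>f k. f (k - (1::int))"

lemma sh_al [simp]: assumes "f\<in>al" shows "sh f\<in>al"
proof -
 obtain N where N: "\<And>k. k\<ge>N ==> f (k + 1) = \<phi> (f k)" using alE[OF assms] by blast
 show ?thesis by (rule alI[of _ "N + 1"]) (use assms N[of "k - 1" for k] in auto)
qed

lemma sh_norm: assumes f: "f\<in>al" shows "||sh f||\<^sub>AL = ||f||\<^sub>AL"
proof -
 obtain N where N: "\<And>k. k\<ge>N ==> f (k + 1) = \<phi> (f k)" using alE[OF f] by blast
 have "||sh f||\<^sub>AL = ||sh f (N + 1)||"
  by (rule AL_norm) (use f N[of "k - 1" for k] in auto)
 then show ?thesis using AL_norm[OF f N] by simp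
qed

lemma sh_surj: assumes "f\<in>al" obtains g where "g\<in>al" "f = sh g"
proof
 obtain N where N: "\<And>k. k\<ge>N ==> f (k + 1) = \<phi> (f k)" using alE[OF assms] by blast
 have "f (k + 1 + 1) = \<phi> (f (k + 1))" if "k\<ge>N" for k by (rule N) (use that in simp)
 then show "(\<lambda>k. f (k + 1))\<in>al" by (intro alI[of _ N]) (use assms in simp)
 show "f = sh (\<lambda>k. f (k + 1))" by simp
qed

lemma FA_hom_eq:
 assumes B: "cstar_algebra B" and s: "star_hom FA B s" and t: "star_hom FA B t"
  and eq: "\<And>n x. x\<in>|M| ==> s (io n x) = t (io n x)" and X: "X\<in>|FA|"
 shows "s X = t X"
proof -
 obtain f where f: "\<And>n. f n\<in>al" "tends FA (\<lambda>n. to_completion AL (f n)) X" using FA_tends[OF X] by blast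
 have "s (to_completion AL (f n)) = t (to_completion AL (f n))" for n
 proof -
  obtain N where "\<And>k. k\<ge>N ==> f n (k + 1) = \<phi> (f n k)" using alE[OF f(1)] by blast
  from to_completion_io[OF f(1) this] show ?thesis using eq[of "f n N" N] f(1) by simp
 qed
 then show ?thesis
  using star_hom_tends[OF cstar_FA B s f(2)] star_hom_tends[OF cstar_FA B t f(2)]
   cstar_algebra.tends_unique[OF B] by simp
qed

text \<open>Shifting families is isometric and surjective already before completion, so its
  extension is an isometry onto the closure of a dense set. Uniqueness holds because the levels have
  dense union. This is what gives meaning to the definite description in
  \<open>limit_shift\<close>.\<close>

lemma shift_ex1: "\<exists>!\<sigma>. \<sigma>\<in>extensional ( |FA| )\<and>star_iso FA FA \<sigma>\<and>(\<forall>n. \<forall>x\<in>|M|. \<sigma> (io n x) = io (n + 1) x)"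
proof (rule ex_ex1I)
 interpret F: cstar_algebra FA by (rule cstar_FA)
 have h: "star_hom AL FA (\<lambda>f. to_completion AL (sh f))"
  using star_hom_simps[OF L.to_completion_hom] unfolding FA_completion star_hom_def by auto
 have n: "||to_completion AL (sh f)||\<^sub>FA = ||f||\<^sub>AL" if "f\<in>|AL|" for f
  using that by (simp add: FA_completion L.to_completion_norm sh_norm)
 obtain F where F: "star_hom FA FA F" "\<And>f. f\<in>|AL| ==> F (to_completion AL f) = to_completion AL (sh f)"
  "\<And>X. X\<in>|FA| ==> ||F X||\<^sub>FA = ||X||\<^sub>FA"
  "F ` |FA| = norm_topology FA closure_of ((\<lambda>f. to_completion AL (sh f)) ` |AL| )"
  using completion_extend[OF L.pre_cstar_axioms cstar_FA h n] unfolding FA_completion by blast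
 have im: "(\<lambda>f. to_completion AL (sh f)) ` |AL|\<subseteq>|FA|" using star_hom_in[OF h] by auto
 have "F ` |FA| = |FA|"
 proof
  show "F ` |FA|\<subseteq>|FA|" using star_hom_in[OF F(1)] by auto
  show "|FA|\<subseteq>F ` |FA|"
  proof
   fix X assume "X\<in>|FA|"
   then obtain f where f: "\<And>n. f n\<in>al" "tends FA (\<lambda>n. to_completion AL (f n)) X" using FA_tends by blast
   have "to_completion AL (f n)\<in>(\<lambda>f. to_completion AL (sh f)) ` |AL|" for n
   proof -
    obtain g where g: "g\<in>al" "f n = sh g" using sh_surj[OF f(1)[of n]] by blast
    show ?thesis unfolding g(2) by (rule image_eqI[where x = g]) (use g(1) in simp_all)
   qed
   then show "X\<in>F ` |FA|" unfolding F(4) F.closure_iff[OF im]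
    by (intro exI[of _ "\<lambda>n. to_completion AL (f n)"] conjI allI f(2))
  qed
 qed
 then have F': "bij_betw F ( |FA| ) ( |FA| )"
  using isometric_inj[OF cstar_FA cstar_FA F(1) F(3)] by (simp add: bij_betw_def)
 have "sh (elt n x) = elt (n + 1) x" for n x by (auto simp: elt_def fun_eq_iff algebra_simps)
 then have Fi: "F (io n x) = io (n + 1) x" if "x\<in>|M|" for n x
  using F(2)[of "elt n x"] that by (simp add: io_elt)
 let ?F = "restrict F ( |FA| )"
 have "star_hom FA FA ?F"
  using F(1) F.mult_closed F.adj_closed unfolding star_hom_def by auto
 moreover have "bij_betw ?F ( |FA| ) ( |FA| )" using F' by (simp cong: bij_betw_cong)
 ultimately show "\<exists>\<sigma>. \<sigma>\<in>extensional ( |FA| )\<and>star_iso FA FA \<sigma>\<and>(\<forall>n. \<forall>x\<in>|M|. \<sigma> (io n x) = io (n + 1) x)"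
  using Fi star_hom_in[OF io_hom] by (intro exI[of _ ?F]) (simp add: star_iso_def)
next
 fix s t
 assume s: "s\<in>extensional ( |FA| )\<and>star_iso FA FA s\<and>(\<forall>n. \<forall>x\<in>|M|. s (io n x) = io (n + 1) x)"
  and t: "t\<in>extensional ( |FA| )\<and>star_iso FA FA t\<and>(\<forall>n. \<forall>x\<in>|M|. t (io n x) = io (n + 1) x)"
 show "s = t"
 proof (rule extensionalityI[of _ "|FA|"])
  fix X assume "X\<in>|FA|"
  then show "s X = t X"
   by (rule FA_hom_eq[OF cstar_FA, rotated -1]) (use s t in \<open>auto simp: star_iso_def\<close>)
 qed (use s t in auto)
qed

end

section \<open>The algebra spanned by the levels and its automorphism\<close>

context endo
begin

abbreviation "FA\<equiv>frakA A \<rho>"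
abbreviation "FB\<equiv>frakB A \<rho>"
abbreviation "\<sigma>\<equiv>limit_shift A \<rho>"

lemma ext_apply [simp]: "m\<in>|MA| ==> strict_extension A \<rho> m = rbar m"
 by (simp add: strict_extension_eq)

lemma ext_hom: "star_hom MA MA (strict_extension A \<rho>)"
 unfolding star_hom_def by simp

lemma tower: "tower MA (strict_extension A \<rho>)"
 by (intro tower.intro cstar_multiplier tower_axioms.intro ext_hom) simp

lemma io_iota: "limit_map (\<lambda>_. MA) (\<lambda>_. strict_extension A \<rho>) = iota A \<rho>"
 by (simp add: iota_def fun_eq_iff)

lemmas cstar_FA = tower.cstar_FA[OF tower, folded frakA_def]
lemmas iota_hom = tower.io_hom[OF tower, folded frakA_def, unfolded io_iota]
lemmas iota_norm = tower.io_norm[OF tower, folded frakA_def, unfolded io_iota]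
lemmas iota_simps [simp] = star_hom_simps[OF iota_hom]

sublocale F: cstar_algebra FA by (rule cstar_FA)

lemma iota_succ: "m\<in>|MA| ==> iota A \<rho> (n + 1) (rbar m) = iota A \<rho> n m"
 using tower.io_succ[OF tower, of m n] by (simp add: io_iota)

lemma rpow_in [simp]: "m\<in>|MA| ==> (rbar ^^ j) m\<in>|MA|"
 by (induction j) auto

lemma iota_add: "m\<in>|MA| ==> iota A \<rho> (n + int j) ((rbar ^^ j) m) = iota A \<rho> n m"
proof (induction j)
 case (Suc j)
 then show ?case using iota_succ[of "(rbar ^^ j) m" "n + int j"] by (simp add: algebra_simps)
qed simp

lemma shift: "star_iso FA FA \<sigma>" "m\<in>|MA| ==> \<sigma> (iota A \<rho> n m) = iota A \<rho> (n + 1) m"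
 using theI'[OF tower.shift_ex1[OF tower, folded frakA_def, unfolded io_iota]]
 unfolding limit_shift_def by blast+

definition bl :: "int=>'a=>'a dilated" where "bl n a = iota A \<rho> n (J a)"

lemma bl_hom: "star_hom A FA (bl n)"
 using star_hom_comp[OF J_hom iota_hom] by (simp add: bl_def[abs_def] comp_def)

lemma bl_iota: "m\<in>|MA| ==> a\<in>|A| ==> iota A \<rho> n m\<cdot>\<^sub>FA bl n a = bl n (lact m a)"
 by (simp add: bl_def mult_J flip: iota_simps(4))

lemma iota_bl: "m\<in>|MA| ==> a\<in>|A| ==> bl n a\<cdot>\<^sub>FA iota A \<rho> n m = bl n (ract m a)"
 by (simp add: bl_def J_mult flip: iota_simps(4))

lemma iota_lift: assumes "m\<in>|MA|" "n\<le>k" obtains m' where "m'\<in>|MA|" "iota A \<rho> n m = iota A \<rho> k m'"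
 using iota_add[OF assms(1), of n "nat (k - n)"] assms by (intro that[of "(rbar ^^ nat (k - n)) m"]) auto

lemma bl_iota_ge: assumes "m\<in>|MA|" "a\<in>|A|" "k\<le>n"
 obtains c where "c\<in>|A|" "iota A \<rho> k m\<cdot>\<^sub>FA bl n a = bl n c"
proof -
 obtain m' where m': "m'\<in>|MA|" "iota A \<rho> k m = iota A \<rho> n m'" by (rule iota_lift[OF assms(1,3)])
 show ?thesis by (rule that[of "lact m' a"]) (use m' assms in \<open>simp_all add: bl_iota\<close>)
qed

lemma iota_bl_ge: assumes "m\<in>|MA|" "a\<in>|A|" "k\<le>n"
 obtains c where "c\<in>|A|" "bl n a\<cdot>\<^sub>FA iota A \<rho> k m = bl n c"
proof -
 obtain m' where m': "m'\<in>|MA|" "iota A \<rho> k m = iota A \<rho> n m'" by (rule iota_lift[OF assms(1,3)])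
 show ?thesis by (rule that[of "ract m' a"]) (use m' assms in \<open>simp_all add: iota_bl\<close>)
qed

text \<open>The lower level lies among the multipliers of the higher one, by iota_n = iota_(n+j)
  R^j, and A is an ideal in M(A). Hence the linear span of the levels is closed under
  products.\<close>

lemma bl_mult: assumes "a\<in>|A|" "b\<in>|A|"
 obtains c where "c\<in>|A|" "bl m a\<cdot>\<^sub>FA bl n b = bl (max m n) c"
proof (cases "m\<le>n")
 case True
 then obtain c where "c\<in>|A|" "iota A \<rho> m (J a)\<cdot>\<^sub>FA bl n b = bl n c"
  using bl_iota_ge[of "J a" b m n] assms J_in by auto
 then show ?thesis using that[of c] True by (simp add: bl_def max_absorb2)
next
 case False
 then obtain c where "c\<in>|A|" "bl m a\<cdot>\<^sub>FA iota A \<rho> n (J b) = bl m c"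
  using iota_bl_ge[of "J b" a n m] assms J_in by auto
 then show ?thesis using that[of c] False by (simp add: bl_def max_absorb1)
qed

abbreviation "Bgen\<equiv>\<Union>n. B_level A \<rho> n"

lemma Bgen_iff: "x\<in>Bgen\<longleftrightarrow>(\<exists>n. \<exists>a\<in>|A|. x = bl n a)"
 unfolding B_level_def bl_def by (simp add: image_image image_iff)

lemma Bgen_sub: "Bgen\<subseteq>|FA|"
proof
 fix x assume "x\<in>Bgen"
 then show "x\<in>|FA|" unfolding Bgen_iff using star_hom_in[OF bl_hom] by blast
qed

lemma FB_subalgebra: "cstar_subalgebra FA ( |FB| )"
proof -
 note cs = F.closed_span_subset[OF Bgen_sub]
 have "cstar_subalgebra FA (closed_span FA Bgen)"
 proof (rule F.closed_span_subalgebra[OF Bgen_sub]; rule subsetD[OF cs])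
  fix x y assume "x\<in>Bgen" "y\<in>Bgen"
  then obtain a m b n where ab: "a\<in>|A|" "b\<in>|A|" "x = bl m a" "y = bl n b" unfolding Bgen_iff by blast
  obtain c where "c\<in>|A|" "bl m a\<cdot>\<^sub>FA bl n b = bl (max m n) c" by (rule bl_mult[OF ab(1,2)])
  then show "x\<cdot>\<^sub>FA y\<in>Bgen" unfolding Bgen_iff ab by blast
 next
  fix x assume "x\<in>Bgen"
  then obtain a m where ab: "a\<in>|A|" "x = bl m a" unfolding Bgen_iff by blast
  have "x\<star>\<^sub>FA = bl m (a\<star>)" using ab star_hom_adj[OF bl_hom] by simp
  then show "x\<star>\<^sub>FA\<in>Bgen" unfolding Bgen_iff using ab(1) adj_closed by blast
 qed
 then show ?thesis by (simp add: frakB_def)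
qed

lemma FB_ops [simp]: "x\<oplus>\<^sub>FB y = x\<oplus>\<^sub>FA y" "x\<cdot>\<^sub>FB y = x\<cdot>\<^sub>FA y" "c\<odot>\<^sub>FB x = c\<odot>\<^sub>FA x"
 "x\<star>\<^sub>FB = x\<star>\<^sub>FA" "\<zero>\<^sub>FB = \<zero>\<^sub>FA" "||x||\<^sub>FB = ||x||\<^sub>FA"
 by (simp_all add: frakB_def)

lemma FB_FA: "FB = FA\<lparr>carrier := |FB|\<rparr>"
 by (simp add: frakB_def)

lemma cstar_FB: "cstar_algebra FB"
 using F.closed_set_subalgebra[OF FB_subalgebra] FB_FA by simp

lemma FB_sub: "submodule ( |FB| ) complex_ring FA" and FB_closed: "closedin (norm_topology FA) ( |FB| )"
 using FB_subalgebra by (auto simp: cstar_subalgebra_def)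

lemma FB_in [simp]: "x\<in>|FB| ==> x\<in>|FA|"
 by (rule F.submodule_in[OF FB_sub])

lemma bl_in [simp]: "a\<in>|A| ==> bl n a\<in>|FB|"
 using F.closed_span_subset[OF Bgen_sub] Bgen_iff[of "bl n a"] by (auto simp: frakB_def)

sublocale B: cstar_algebra FB by (rule cstar_FB)

lemma FB_diff: "x\<in>|FB| ==> y\<in>|FB| ==> x\<ominus>\<^sub>FB y = x\<ominus>\<^sub>FA y"
 by (simp add: B.diff_eq F.diff_eq)

lemma FB_tends: "tends FA s x ==> (\<And>n. s n\<in>|FB| ) ==> tends FB s x"
 using F.closedin_tends[OF FB_closed, of s x] by (simp add: tends_def FB_diff)

lemma FB_induct [consumes 1, case_names base zero add smult lim]:
 assumes "x\<in>|FB|" and base: "\<And>n a. a\<in>|A| ==> P (bl n a)" and z: "P \<zero>\<^sub>FA"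
  and a: "\<And>x y. x\<in>|FB| ==> y\<in>|FB| ==> P x ==> P y ==> P (x\<oplus>\<^sub>FA y)"
  and s: "\<And>c x. x\<in>|FB| ==> P x ==> P (c\<odot>\<^sub>FA x)"
  and l: "\<And>s x. tends FB s x ==> (\<And>n. P (s n)) ==> P x"
 shows "P x"
proof -
 have "x\<in>closed_span FA Bgen" using assms(1) by (simp add: frakB_def)
 from this Bgen_sub have "x\<in>|FB|\<and>P x"
 proof (induction rule: F.closed_span_induct)
  case (base x)
  then show ?case unfolding Bgen_iff using assms(2) bl_in by blast
 next
  case zero
  then show ?case using z F.submodule_zero[OF FB_sub] by blast
 next
  case (add x y)
  then show ?case using a F.submodule_add[OF FB_sub] by blast
 next
  case (smult c x)
  then show ?case using s F.submodule_smult[OF FB_sub] by blast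
 next
  case (lim s x)
  then have "tends FB s x" by (intro FB_tends) auto
  then show ?case using l[of s x] lim(2) B.tends_in(2) by blast
 qed
 then show ?thesis by simp
qed

lemma FB_invariant:
 assumes h: "star_hom FA FA \<theta>" and g: "\<And>n a. a\<in>|A| ==> \<theta> (bl n a)\<in>|FB|" and x: "x\<in>|FB|"
 shows "\<theta> x\<in>|FB|"
 using x
proof (induction rule: FB_induct)
 case (lim s x)
 have t: "tends FA s x" using lim(1) B.tends_in[OF lim(1)] by (simp add: tends_def FB_diff)
 show ?case by (rule F.closedin_tends[OF FB_closed lim(2) star_hom_tends[OF cstar_FA cstar_FA h t]])
qed (use g star_hom_simps[OF h] star_hom_zero[OF F.star_algebra_axioms F.star_algebra_axioms h]
   F.submodule_zero[OF FB_sub] F.submodule_add[OF FB_sub] F.submodule_smult[OF FB_sub] in auto)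

lemma shift_bl: "a\<in>|A| ==> \<sigma> (bl n a) = bl (n + 1) a"
 by (simp add: bl_def shift)

text \<open>Both the shift and its inverse move levels to levels, so both leave the closed span
  invariant; the inverse is what gives surjectivity of the restriction.\<close>

lemma z_action_FB: "z_action FB \<sigma>"
proof -
 interpret Z: z_action FA \<sigma> by unfold_locales (rule shift(1))
 let ?t = "inv_into ( |FA| ) \<sigma>"
 have a: "\<sigma> x\<in>|FB|" if "x\<in>|FB|" for x
  by (rule FB_invariant[OF Z.aut_hom _ that]) (simp add: shift_bl)
 have "?t (bl n a) = bl (n - 1) a" if "a\<in>|A|" for n a
  using Z.inv_props(3)[of "bl (n - 1) a"] that by (simp add: shift_bl)
 then have b: "?t x\<in>|FB|" if "x\<in>|FB|" for x
  by (intro FB_invariant[OF Z.inv_hom _ that]) simp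
 have "\<sigma> ` |FB| = |FB|"
 proof (intro equalityI subsetI)
  fix x assume x: "x\<in>|FB|"
  then have "x = \<sigma> (?t x)" using Z.inv_props(2)[of x] by simp
  then show "x\<in>\<sigma> ` |FB|" using b[OF x] by blast
 qed (use a in auto)
 moreover have "inj_on \<sigma> ( |FB| )"
  by (rule inj_on_subset[OF bij_betw_imp_inj_on[OF Z.aut_bij]]) (use FB_in in blast)
 moreover have "star_hom FB FB \<sigma>"
  unfolding star_hom_def using a star_hom_simps[OF Z.aut_hom] by auto
 ultimately show ?thesis
  by (intro z_action.intro cstar_FB z_action_axioms.intro) (simp add: star_iso_def bij_betw_def)
qed

sublocale Z: z_action FB \<sigma> by (rule z_action_FB)

lemma ap_bl [simp]: assumes "a\<in>|A|" shows "Z.ap n (bl k a) = bl (k + n) a"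
proof (induction n rule: int_induct[where k = 0])
 case (step1 i)
 then show ?case using Z.ap_succ[of "bl k a" i] assms by (simp add: shift_bl algebra_simps)
next
 case (step2 i)
 then show ?case using Z.ap_pred[of "bl k a" i] Z.inv_props(3)[of "bl (k + i - 1) a"] assms by (simp add: shift_bl algebra_simps)
qed simp

end

section \<open>Representations of the correspondence\<close>

context cstar_algebra
begin

lemma sandwich_tends:
 assumes E: "\<And>n. E n\<in>|A|" "\<And>n. ||E n||\<le>1" and l: "tends A (\<lambda>n. E n\<cdot>d) d" and r: "tends A (\<lambda>n. d\<cdot>E n) d"
 shows "tends A (\<lambda>n. E n\<cdot>d\<cdot>E n) d"
proof (rule tendsI)
 note [simp] = E(1) tends_in(2)[OF l]
 show "||E n\<cdot>d\<cdot>E n\<ominus>d||\<le>||d\<cdot>E n\<ominus>d|| + ||E n\<cdot>d\<ominus>d||" for n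
 proof -
  have "E n\<cdot>d\<cdot>E n\<ominus>d = E n\<cdot>(d\<cdot>E n\<ominus>d)\<oplus>(E n\<cdot>d\<ominus>d)"
   by (simp add: distrib_left_diff mult_assoc) ((simp add: expand)?; (rule linI, (rule lins | (simp add: algebra_simps; fail))+))
  moreover have "||E n\<cdot>(d\<cdot>E n\<ominus>d)||\<le>1 * ||d\<cdot>E n\<ominus>d||"
   by (rule order_trans[OF norm_mult mult_right_mono[OF E(2)]]) simp_all
  ultimately show ?thesis using norm_triangle[of "E n\<cdot>(d\<cdot>E n\<ominus>d)" "E n\<cdot>d\<ominus>d"] by simp
 qed
 show "(\<lambda>n. ||d\<cdot>E n\<ominus>d|| + ||E n\<cdot>d\<ominus>d||)\<longlonglongrightarrow>0"
  using tendsto_add[of "\<lambda>n. ||d\<cdot>E n\<ominus>d||" 0 sequentially "\<lambda>n. ||E n\<cdot>d\<ominus>d||" 0] l r by (simp add: tends_def)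
qed (use E tends_in[OF l] in auto)

end

text \<open>Only the right Hilbert module structure is represented here, without a left action. The
  creation map and all its iterates \<open>Sk k\<close> are instances over the same \<pi>, so the
  homomorphism on compact operators is built once for all levels.\<close>

locale rep_module = approx_unital A e + D: cstar_algebra D
 for A :: "'a cstar_struct" (structure) and e and D :: "'d cstar_struct" +
 fixes \<pi> :: "'a=>'d" and T :: "'a=>'d"
 assumes pi_hom: "star_hom A D \<pi>" and T_in [simp]: "x\<in>|A| ==> T x\<in>|D|"
  and T_add: "x\<in>|A| ==> y\<in>|A| ==> T (x\<oplus>y) = T x\<oplus>\<^sub>D T y"
  and T_smult: "x\<in>|A| ==> T (c\<odot>x) = c\<odot>\<^sub>D T x"
  and T_T: "x\<in>|A| ==> y\<in>|A| ==> (T x)\<star>\<^sub>D\<cdot>\<^sub>D T y = \<pi> (x\<star>\<cdot>y)"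
begin

lemmas pi_simps [simp] = star_hom_simps[OF pi_hom]

lemma T_T2: "x\<in>|A| ==> y\<in>|A| ==> d\<in>|D| ==> (T x)\<star>\<^sub>D\<cdot>\<^sub>D (T y\<cdot>\<^sub>D d) = (\<pi> x)\<star>\<^sub>D\<cdot>\<^sub>D (\<pi> y\<cdot>\<^sub>D d)"
 using T_T[of x y] by (simp flip: D.mult_assoc)

text \<open>Right linearity follows from the inner product: the two candidates have the same four
  mutual products, so their difference has square 0.\<close>

lemma T_pi: assumes "x\<in>|A|" "b\<in>|A|" shows "T x\<cdot>\<^sub>D \<pi> b = T (x\<cdot>b)"
proof -
 note [simp] = assms
 define p q where "p = T x\<cdot>\<^sub>D \<pi> b" and "q = T (x\<cdot>b)"
 define w where "w = \<pi> ((x\<cdot>b)\<star>\<cdot>(x\<cdot>b))"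
 have [simp]: "p\<in>|D|" "q\<in>|D|" "w\<in>|D|" by (simp_all add: p_def q_def w_def)
 have e: "p\<star>\<^sub>D\<cdot>\<^sub>D p = w" "p\<star>\<^sub>D\<cdot>\<^sub>D q = w" "q\<star>\<^sub>D\<cdot>\<^sub>D p = w" "q\<star>\<^sub>D\<cdot>\<^sub>D q = w"
  using T_T[of x x] T_T[of x "x\<cdot>b"] T_T[of "x\<cdot>b" x] T_T[of "x\<cdot>b" "x\<cdot>b"]
  by (simp_all add: p_def q_def w_def D.adj_mult adj_mult D.mult_assoc T_T2)
 have "(p\<ominus>\<^sub>D q)\<star>\<^sub>D\<cdot>\<^sub>D (p\<ominus>\<^sub>D q) = \<zero>\<^sub>D"
  by (simp add: D.adj_diff D.distrib_left_diff D.distrib_right_diff e)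
 then have "p\<ominus>\<^sub>D q = \<zero>\<^sub>D" by (rule D.adj_eq_mult_zero[rotated]) simp
 then show ?thesis using D.diff_eq_zeroD[of p q] by (simp add: p_def q_def)
qed

lemma T_pi2: "x\<in>|A| ==> b\<in>|A| ==> d\<in>|D| ==> T x\<cdot>\<^sub>D (\<pi> b\<cdot>\<^sub>D d) = T (x\<cdot>b)\<cdot>\<^sub>D d"
 by (simp add: T_pi flip: D.mult_assoc)

lemma pi_Tadj: assumes "x\<in>|A|" "b\<in>|A|" shows "\<pi> b\<cdot>\<^sub>D (T x)\<star>\<^sub>D = (T (x\<cdot>b\<star>))\<star>\<^sub>D"
 using assms by (simp add: D.adj_mult D.adj_adj flip: T_pi)

lemma T_le: assumes "x\<in>|A|" shows "||T x||\<^sub>D\<le>||x||"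
proof (rule power2_le_imp_le)
 have "( ||T x||\<^sub>D)\<^sup>2 = ||\<pi> (x\<star>\<cdot>x)||\<^sub>D" using assms D.norm_cstar[of "T x"] by (simp only: T_T T_in)
 also have "\<dots>\<le>||x\<star>\<cdot>x||" using assms by (intro star_hom_contractive[OF cstar_algebra_axioms D.cstar_algebra_axioms pi_hom]) simp
 finally show "( ||T x||\<^sub>D)\<^sup>2\<le>||x||\<^sup>2" using assms by (simp add: norm_cstar)
qed (use assms in simp)

lemma T_diff: "x\<in>|A| ==> y\<in>|A| ==> T (x\<ominus>y) = T x\<ominus>\<^sub>D T y"
 by (simp add: diff_eq D.diff_eq T_add T_smult)

lemma T_tends: assumes "tends A s x" shows "tends D (\<lambda>n. T (s n)) (T x)"
proof (rule D.tendsI)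
 note [simp] = tends_in[OF assms]
 show "||T (s n)\<ominus>\<^sub>D T x||\<^sub>D\<le>||s n\<ominus>x||" for n using T_le[of "s n\<ominus>x"] by (simp add: T_diff)
qed (use assms tends_in[OF assms] in \<open>auto simp: tends_def\<close>)

lemma TT_tends:
 assumes "x\<in>|A|" "y\<in>|A|"
 shows "tends D (\<lambda>n. T (x\<cdot>y\<star>)\<cdot>\<^sub>D (T (e n))\<star>\<^sub>D) (T x\<cdot>\<^sub>D (T y)\<star>\<^sub>D)"
proof -
 have "T (x\<cdot>y\<star>)\<cdot>\<^sub>D (T (e n))\<star>\<^sub>D = T x\<cdot>\<^sub>D (T (e n\<cdot>y))\<star>\<^sub>D" for n
  using assms pi_Tadj[of "e n" "y\<star>"] by (simp add: D.mult_assoc adj_adj del: pi_simps(5) flip: T_pi)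
 moreover have "tends D (\<lambda>n. T x\<cdot>\<^sub>D (T (e n\<cdot>y))\<star>\<^sub>D) (T x\<cdot>\<^sub>D (T y)\<star>\<^sub>D)"
  using assms by (intro D.tends_mult D.tends_const D.tends_adj T_tends e_left) auto
 ultimately show ?thesis by simp
qed

text \<open>The homomorphism on the compact operators of the module, which sends xy\<star> to
  T(x)T(y)\<star>. As a limit along the approximate unit it needs no choice of a representation of
  c; since every c is a single product xy\<star>, the value is then computed by
  \<open>psi_base\<close>.\<close>

definition psi :: "'a=>'d" where
 "psi c = (THE d. tends D (\<lambda>n. T c\<cdot>\<^sub>D (T (e n))\<star>\<^sub>D) d)"

lemma psi_base: "x\<in>|A| ==> y\<in>|A| ==> psi (x\<cdot>y\<star>) = T x\<cdot>\<^sub>D (T y)\<star>\<^sub>D"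
 unfolding psi_def by (rule the_equality, erule (1) TT_tends) (rule D.tends_unique[OF _ TT_tends])

lemma factor_adj: assumes "c\<in>|A|" obtains x y where "x\<in>|A|" "y\<in>|A|" "c = x\<cdot>y\<star>"
proof -
 obtain b d where "b\<in>|A|" "d\<in>|A|" "c = b\<cdot>d" by (rule factor[OF assms])
 then show ?thesis using that[of b "d\<star>"] by (simp add: adj_adj)
qed

lemma psi_tends: assumes "c\<in>|A|" shows "tends D (\<lambda>n. T c\<cdot>\<^sub>D (T (e n))\<star>\<^sub>D) (psi c)"
proof -
 obtain x y where xy: "x\<in>|A|" "y\<in>|A|" "c = x\<cdot>y\<star>" by (rule factor_adj[OF assms])
 show ?thesis using TT_tends[OF xy(1,2)] psi_base[OF xy(1,2)] xy(3) by simp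
qed

lemma psi_in [simp]: "c\<in>|A| ==> psi c\<in>|D|"
 using psi_tends D.tends_in(2) by blast

lemma psi_T: assumes "c\<in>|A|" "z\<in>|A|" shows "psi c\<cdot>\<^sub>D T z = T (c\<cdot>z)"
proof -
 obtain x y where xy: "x\<in>|A|" "y\<in>|A|" "c = x\<cdot>y\<star>" by (rule factor_adj[OF assms(1)])
 then show ?thesis using assms(2) T_pi[of x "y\<star>\<cdot>z"] by (simp add: psi_base D.mult_assoc T_T mult_assoc)
qed

lemma psi_hom: "star_hom A D psi"
 unfolding star_hom_def
proof (intro conjI allI ballI funcsetI)
 fix a b k assume a: "a\<in>|A|" and b: "b\<in>|A|"
 show "psi a\<in>|D|" using a by simp
 show "psi (a\<oplus>b) = psi a\<oplus>\<^sub>D psi b"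
  by (rule D.tends_unique[OF psi_tends]) (use a b D.tends_add[OF psi_tends[OF a] psi_tends[OF b]] in \<open>auto simp: T_add D.distrib_right\<close>)
 show "psi (k\<odot>a) = k\<odot>\<^sub>D psi a"
  by (rule D.tends_unique[OF psi_tends]) (use a D.tends_smult[OF psi_tends[OF a]] in \<open>auto simp: T_smult D.smult_mult_left\<close>)
 obtain x y where xy: "x\<in>|A|" "y\<in>|A|" "a = x\<cdot>y\<star>" by (rule factor_adj[OF a])
 obtain u v where uv: "u\<in>|A|" "v\<in>|A|" "b = u\<cdot>v\<star>" by (rule factor_adj[OF b])
 have "a\<star> = y\<cdot>x\<star>" using xy by (simp add: adj_mult adj_adj)
 then show "psi (a\<star>) = (psi a)\<star>\<^sub>D" using xy by (simp add: psi_base D.adj_mult D.adj_adj)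
 have "psi (a\<cdot>b) = psi ((a\<cdot>u)\<cdot>v\<star>)" using a uv by (simp add: mult_assoc)
 also have "\<dots> = psi a\<cdot>\<^sub>D T u\<cdot>\<^sub>D (T v)\<star>\<^sub>D" using a uv by (simp add: psi_base psi_T)
 also have "\<dots> = psi a\<cdot>\<^sub>D psi b" using a uv by (simp add: psi_base D.mult_assoc)
 finally show "psi (a\<cdot>b) = psi a\<cdot>\<^sub>D psi b" .
qed

lemmas psi_simps [simp] = star_hom_simps[OF psi_hom]
lemmas psi_le = star_hom_contractive[OF cstar_algebra_axioms D.cstar_algebra_axioms psi_hom]
lemmas psi_cont = star_hom_tends[OF cstar_algebra_axioms D.cstar_algebra_axioms psi_hom]

lemma psi_unique:
 assumes "\<And>x y. x\<in>|A| ==> y\<in>|A| ==> \<psi> (x\<cdot>y\<star>) = T x\<cdot>\<^sub>D (T y)\<star>\<^sub>D" "c\<in>|A|"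
 shows "\<psi> c = psi c"
proof -
 obtain x y where xy: "x\<in>|A|" "y\<in>|A|" "c = x\<cdot>y\<star>" by (rule factor_adj[OF assms(2)])
 then show ?thesis using assms(1) psi_base by simp
qed

end

section \<open>Iterated creation maps of a covariant representation\<close>

locale cov = endo A e \<rho> + D: cstar_algebra D
 for A :: "'a cstar_struct" (structure) and e \<rho> and D :: "'d cstar_struct" +
 fixes \<pi> :: "'a=>'d" and S :: "'a=>'d"
 assumes cov: "covariant_rep A \<rho> D \<pi> S"
begin

sublocale S: rep_module A e D \<pi> S
 by unfold_locales (use cov in \<open>auto simp: covariant_rep_def\<close>)

text \<open>The covariance relation speaks of \<pi>(a)S(b)\<pi>(c); factoring x = bc absorbs the
  right-hand factor.\<close>

lemma pi_S: assumes "a\<in>|A|" "x\<in>|A|" shows "\<pi> a\<cdot>\<^sub>D S x = S (lact (\<rho> a) x)"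
proof -
 obtain b c where bc: "b\<in>|A|" "c\<in>|A|" "x = b\<cdot>c" by (rule factor[OF assms(2)])
 have "\<pi> a\<cdot>\<^sub>D S b\<cdot>\<^sub>D \<pi> c = S (lact (\<rho> a) (b\<cdot>c))"
  using cov assms bc unfolding covariant_rep_def by blast
 then show ?thesis using assms bc by (simp add: D.mult_assoc S.T_pi)
qed

lemma S_psi: assumes "a\<in>|A|" "c\<in>|A|" "\<rho> a = J c" shows "S.psi c = \<pi> a"
proof -
 obtain \<psi> where \<psi>: "\<And>x y. x\<in>|A| ==> y\<in>|A| ==> \<psi> (x\<cdot>y\<star>) = S x\<cdot>\<^sub>D (S y)\<star>\<^sub>D"
  "\<And>a c. a\<in>|A| ==> c\<in>|A| ==> \<rho> a = J c ==> \<pi> a = \<psi> c"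
  using cov unfolding covariant_rep_def by blast
 show ?thesis using S.psi_unique[of \<psi> c] \<psi> assms by simp
qed

text \<open>The representation of the k-th tensor power of the correspondence, which is again A as a
  right module, with left action through R^k. The tensor product of b and c corresponds to
  \<rho>(b)c, and the limit makes the assignment independent of how a vector is factored.\<close>

primrec Sk :: "nat=>'a=>'d" where
 "Sk 0 = \<pi>"
| "Sk (Suc k) = (\<lambda>x. THE d. tends D (\<lambda>n. Sk k (e n)\<cdot>\<^sub>D S x) d)"

lemma Sk_step:
 assumes K: "rep_module A e D \<pi> (Sk k)" and b: "b\<in>|A|" and c: "c\<in>|A|"
 shows "tends D (\<lambda>n. Sk k (e n)\<cdot>\<^sub>D S (lact (\<rho> b) c)) (Sk k b\<cdot>\<^sub>D S c)"
  "Sk (Suc k) (lact (\<rho> b) c) = Sk k b\<cdot>\<^sub>D S c"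
proof -
 interpret K: rep_module A e D \<pi> "Sk k" by fact
 have "Sk k (e n)\<cdot>\<^sub>D S (lact (\<rho> b) c) = Sk k (e n\<cdot>b)\<cdot>\<^sub>D S c" for n
  using b c by (simp add: K.T_pi2 flip: pi_S)
 moreover have "tends D (\<lambda>n. Sk k (e n\<cdot>b)\<cdot>\<^sub>D S c) (Sk k b\<cdot>\<^sub>D S c)"
  using b c by (intro D.tends_mult D.tends_const K.T_tends e_left) auto
 ultimately show t: "tends D (\<lambda>n. Sk k (e n)\<cdot>\<^sub>D S (lact (\<rho> b) c)) (Sk k b\<cdot>\<^sub>D S c)" by simp
 show "Sk (Suc k) (lact (\<rho> b) c) = Sk k b\<cdot>\<^sub>D S c"
  unfolding Sk.simps by (rule the_equality, rule t) (rule D.tends_unique[OF _ t])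
qed

lemma Sk_module: "rep_module A e D \<pi> (Sk k)"
proof (induction k)
 case 0
 show ?case by unfold_locales (auto simp: S.pi_hom)
next
 case (Suc k)
 interpret K: rep_module A e D \<pi> "Sk k" by fact
 note st = Sk_step[OF Suc]
 have t: "tends D (\<lambda>n. Sk k (e n)\<cdot>\<^sub>D S x) (Sk (Suc k) x)" if x: "x\<in>|A|" for x
 proof -
  obtain b c where bc: "b\<in>|A|" "c\<in>|A|" "x = lact (\<rho> b) c" by (rule rho_factor[OF x])
  show ?thesis unfolding bc(3) st(2)[OF bc(1,2)] by (rule st(1)[OF bc(1,2)])
 qed
 show ?case
 proof unfold_locales
  show "star_hom A D \<pi>" by (rule S.pi_hom)
 next
  fix x y c assume x [simp]: "x\<in>|A|" and y [simp]: "y\<in>|A|"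
  show "Sk (Suc k) x\<in>|D|" using t[OF x] D.tends_in(2) by blast
  show "Sk (Suc k) (x\<oplus>y) = Sk (Suc k) x\<oplus>\<^sub>D Sk (Suc k) y"
   by (rule D.tends_unique[OF t]) (use D.tends_add[OF t[OF x] t[OF y]] in \<open>simp_all add: S.T_add D.distrib_left del: Sk.simps\<close>)
  show "Sk (Suc k) (c\<odot>x) = c\<odot>\<^sub>D Sk (Suc k) x"
   by (rule D.tends_unique[OF t]) (use D.tends_smult[OF t[OF x], of c] in \<open>simp_all add: S.T_smult D.smult_mult_right del: Sk.simps\<close>)
  obtain b c where bc: "b\<in>|A|" "c\<in>|A|" "x = lact (\<rho> b) c" by (rule rho_factor[OF x])
  obtain b' c' where bc': "b'\<in>|A|" "c'\<in>|A|" "y = lact (\<rho> b') c'" by (rule rho_factor[OF y])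
  note [simp] = bc(1,2) bc'(1,2)
  have "(Sk (Suc k) x)\<star>\<^sub>D\<cdot>\<^sub>D Sk (Suc k) y = (S c)\<star>\<^sub>D\<cdot>\<^sub>D ((\<pi> (b\<star>\<cdot>b'))\<cdot>\<^sub>D S c')"
   unfolding bc(3) bc'(3) st(2)[OF bc(1,2)] st(2)[OF bc'(1,2)]
   by (simp add: D.adj_mult D.mult_assoc K.T_T2)
  also have "\<dots> = \<pi> (c\<star>\<cdot>lact (\<rho> (b\<star>\<cdot>b')) c')" by (simp add: pi_S S.T_T del: S.pi_simps(2-5) rho_simps(2-5))
  also have "c\<star>\<cdot>lact (\<rho> (b\<star>\<cdot>b')) c' = x\<star>\<cdot>y"
   unfolding bc(3) bc'(3) by (simp add: lact_adj del: mult_ops(7))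
  finally show "(Sk (Suc k) x)\<star>\<^sub>D\<cdot>\<^sub>D Sk (Suc k) y = \<pi> (x\<star>\<cdot>y)" .
 qed
qed

sublocale K: rep_module A e D \<pi> "Sk k" for k by (rule Sk_module)

lemma Sk_base: "b\<in>|A| ==> c\<in>|A| ==> Sk (Suc k) (lact (\<rho> b) c) = Sk k b\<cdot>\<^sub>D S c"
 by (rule Sk_step(2)[OF Sk_module])

declare Sk.simps(2) [simp del]

lemma Sk_1: "x\<in>|A| ==> Sk (Suc 0) x = S x"
 by (erule rho_factor) (simp add: Sk_base pi_S)

text \<open>With x = \<rho>(b)c the rightmost creation map splits off, and R of the multiplier
  acting on \<rho>(b)c is \<rho> of its action on b followed by c. Induction then moves letters past
  k creation maps.\<close>

lemma Sk_move:
 assumes "a\<in>|A|" "x\<in>|A|"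
 shows "\<pi> a\<cdot>\<^sub>D Sk k x = Sk k (lact ((rbar ^^ k) (J a)) x)"
  and "S a\<cdot>\<^sub>D Sk k x = Sk (Suc k) (lact ((rbar ^^ k) (J a)) x)"
  and "(S a)\<star>\<^sub>D\<cdot>\<^sub>D Sk (Suc k) x = Sk k (lact ((rbar ^^ k) (J (a\<star>))) x)"
proof -
 note [simp] = assms(1)
 show "\<pi> a\<cdot>\<^sub>D Sk k x = Sk k (lact ((rbar ^^ k) (J a)) x)" using assms(2)
 proof (induction k arbitrary: x)
  case (Suc k)
  obtain b c where bc: "b\<in>|A|" "c\<in>|A|" "x = lact (\<rho> b) c" by (rule rho_factor[OF Suc.prems])
  then show ?case using Suc.IH[of b] by (simp add: Sk_base flip: D.mult_assoc)
 qed simp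
 show "S a\<cdot>\<^sub>D Sk k x = Sk (Suc k) (lact ((rbar ^^ k) (J a)) x)" using assms(2)
 proof (induction k arbitrary: x)
  case (Suc k)
  obtain b c where bc: "b\<in>|A|" "c\<in>|A|" "x = lact (\<rho> b) c" by (rule rho_factor[OF Suc.prems])
  then show ?case using Suc.IH[of b] by (simp add: Sk_base flip: D.mult_assoc)
 qed (simp add: S.T_pi Sk_1)
 show "(S a)\<star>\<^sub>D\<cdot>\<^sub>D Sk (Suc k) x = Sk k (lact ((rbar ^^ k) (J (a\<star>))) x)" using assms(2)
 proof (induction k arbitrary: x)
  case 0
  then show ?case using S.T_T[of a x] by (simp add: Sk_1)
 next
  case (Suc k)
  obtain b c where bc: "b\<in>|A|" "c\<in>|A|" "x = lact (\<rho> b) c" by (rule rho_factor[OF Suc.prems])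
  then show ?case using Suc.IH[of b] by (simp add: Sk_base flip: D.mult_assoc)
 qed
qed

lemma psi_0: "c\<in>|A| ==> K.psi 0 c = \<pi> c"
 by (rule K.psi_unique[symmetric]) simp_all

text \<open>For c = uv\<star>, covariance says \<pi>(a) = S(u)S(v)\<star>. Between S^k(e_n) and its
  adjoint, the left side becomes psi_k of e_n a e_n and the right side psi_(k+1) of
  (\<rho>(e_n)u)(\<rho>(e_n)v)\<star>. Both arguments converge.\<close>

lemma psi_covariance:
 assumes a: "a\<in>|A|" and c: "c\<in>|A|" and eq: "\<rho> a = J c"
 shows "K.psi k a = K.psi (Suc k) c"
proof -
 obtain u v where uv: "u\<in>|A|" "v\<in>|A|" "c = u\<cdot>v\<star>" by (rule S.factor_adj[OF c])
 note [simp] = a uv(1,2)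
 have e: "S u\<cdot>\<^sub>D (S v)\<star>\<^sub>D = \<pi> a" using S_psi[OF a c eq] unfolding uv(3) S.psi_base[OF uv(1,2)] .
 have s: "K.psi k ((e n\<cdot>a)\<cdot>(e n)\<star>) = K.psi (Suc k) (lact (\<rho> (e n)) u\<cdot>(lact (\<rho> (e n)) v)\<star>)" for n
 proof -
  have "K.psi (Suc k) (lact (\<rho> (e n)) u\<cdot>(lact (\<rho> (e n)) v)\<star>)
    = (Sk k (e n)\<cdot>\<^sub>D S u)\<cdot>\<^sub>D (Sk k (e n)\<cdot>\<^sub>D S v)\<star>\<^sub>D"
   by (simp only: K.psi_base Sk_base e_in uv(1,2) rho_simps(1) lact_in)
  also have "\<dots> = Sk k (e n)\<cdot>\<^sub>D (S u\<cdot>\<^sub>D (S v)\<star>\<^sub>D)\<cdot>\<^sub>D (Sk k (e n))\<star>\<^sub>D"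
   by (simp add: D.adj_mult D.mult_assoc)
  also have "\<dots> = Sk k (e n\<cdot>a)\<cdot>\<^sub>D (Sk k (e n))\<star>\<^sub>D" unfolding e by (simp add: K.T_pi)
  also have "\<dots> = K.psi k ((e n\<cdot>a)\<cdot>(e n)\<star>)" by (rule K.psi_base[symmetric]) simp_all
  finally show ?thesis by simp
 qed
 have "tends A (\<lambda>n. e n\<cdot>a\<cdot>e n) a" by (rule sandwich_tends) (simp_all add: e_norm e_left e_right)
 then have "tends D (\<lambda>n. K.psi k ((e n\<cdot>a)\<cdot>(e n)\<star>)) (K.psi k a)" by (simp only: e_adj K.psi_cont)
 moreover have "tends D (\<lambda>n. K.psi (Suc k) (lact (\<rho> (e n)) u\<cdot>(lact (\<rho> (e n)) v)\<star>)) (K.psi (Suc k) (u\<cdot>v\<star>))"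
  by (intro K.psi_cont tends_mult tends_adj rbar_e uv)
 ultimately show ?thesis unfolding s uv(3) by (rule D.tends_unique)
qed

text \<open>A relation, because the expression of T by levels is not unique: the levels may
  intersect. That T determines d is a consequence of \<open>Rel_contractive\<close>, applied to
  differences.\<close>

primrec Rel :: "nat=>'a multiplier=>'d=>bool" where
 "Rel 0 = (\<lambda>T d. \<exists>a\<in>|A|. T = J a\<and>d = \<pi> a)"
| "Rel (Suc m) = (\<lambda>T d. \<exists>a\<in>|A|. \<exists>y d'. Rel m y d'\<and>T = J a\<oplus>\<^sub>MA rbar y\<and>d = K.psi (Suc m) a\<oplus>\<^sub>D d')"

lemma RelI: "a\<in>|A| ==> Rel m y d ==> Rel (Suc m) (J a\<oplus>\<^sub>MA rbar y) (K.psi (Suc m) a\<oplus>\<^sub>D d)"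
 unfolding Rel.simps by blast

lemma Rel_in: "Rel m T d ==> T\<in>|MA|\<and>d\<in>|D|"
 by (induction m arbitrary: T d) auto

text \<open>On the range of S^m, d acts as T does on A. This identifies products with the top level
  and thereby makes the relation multiplicative.\<close>

lemma Rel_act: "Rel m T d ==> x\<in>|A| ==> d\<cdot>\<^sub>D Sk m x = Sk m (lact T x)"
proof (induction m arbitrary: T d x)
 case (Suc m)
 then obtain a y d' where a: "a\<in>|A|" "Rel m y d'" "T = J a\<oplus>\<^sub>MA rbar y" "d = K.psi (Suc m) a\<oplus>\<^sub>D d'" by auto
 note [simp] = a(1) Rel_in[OF a(2), THEN conjunct1] Rel_in[OF a(2), THEN conjunct2] Suc.prems(2)
 obtain b c where bc: "b\<in>|A|" "c\<in>|A|" "x = lact (\<rho> b) c" by (rule rho_factor[OF Suc.prems(2)])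
 have "d'\<cdot>\<^sub>D Sk (Suc m) x = Sk (Suc m) (lact (rbar y) x)"
  using Suc.IH[OF a(2) bc(1)] bc by (simp add: Sk_base flip: D.mult_assoc)
 then show ?case by (simp add: a(3,4) D.distrib_right K.psi_T K.T_add)
qed auto

lemma Rel_J: "a\<in>|A| ==> Rel m (J a) (K.psi m a)"
 and Rel_zero: "Rel m \<zero>\<^sub>MA \<zero>\<^sub>D"
proof -
 have pz: "K.psi m \<zero> = \<zero>\<^sub>D" for m
  by (rule star_hom_zero[OF star_algebra_axioms D.star_algebra_axioms K.psi_hom])
 have rz: "rbar \<zero>\<^sub>MA = \<zero>\<^sub>MA" by (rule star_hom_zero[OF U.star_algebra_axioms U.star_algebra_axioms rbar_hom])
 show z: "Rel m \<zero>\<^sub>MA \<zero>\<^sub>D" for m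
 proof (induction m)
  case 0
  show ?case using pz[of 0] psi_0[of \<zero>] J_zero by (auto intro!: bexI[of _ \<zero>])
 next
  case (Suc m)
  then show ?case using RelI[OF zero_closed Suc] by (simp add: pz rz J_zero del: Rel.simps)
 qed
 show "Rel m (J a) (K.psi m a)" if "a\<in>|A|"
 proof (cases m)
  case 0
  then show ?thesis using that psi_0 by auto
 next
  case (Suc k)
  then show ?thesis using RelI[OF that z[of k]] that by (simp add: rz del: Rel.simps)
 qed
qed

lemma Rel_add: "Rel m T d ==> Rel m T' d' ==> Rel m (T\<oplus>\<^sub>MA T') (d\<oplus>\<^sub>D d')"
proof (induction m arbitrary: T d T' d')
 case 0
 then obtain a b where "a\<in>|A|" "b\<in>|A|" "T = J a" "d = \<pi> a" "T' = J b" "d' = \<pi> b" by auto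
 then show ?case by (auto intro!: bexI[of _ "a\<oplus>b"] simp: J_simps)
next
 case (Suc m)
 obtain a y c where a: "a\<in>|A|" "Rel m y c" "T = J a\<oplus>\<^sub>MA rbar y" "d = K.psi (Suc m) a\<oplus>\<^sub>D c" using Suc.prems(1) by auto
 obtain a' y' c' where a': "a'\<in>|A|" "Rel m y' c'" "T' = J a'\<oplus>\<^sub>MA rbar y'" "d' = K.psi (Suc m) a'\<oplus>\<^sub>D c'" using Suc.prems(2) by auto
 note [simp] = a(1) a'(1) Rel_in[OF a(2), THEN conjunct1] Rel_in[OF a(2), THEN conjunct2] Rel_in[OF a'(2), THEN conjunct1] Rel_in[OF a'(2), THEN conjunct2]
 have "T\<oplus>\<^sub>MA T' = J (a\<oplus>a')\<oplus>\<^sub>MA rbar (y\<oplus>\<^sub>MA y')" by (simp add: a(3) a'(3) J_simps U.M.a_ac)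
 moreover have "d\<oplus>\<^sub>D d' = K.psi (Suc m) (a\<oplus>a')\<oplus>\<^sub>D (c\<oplus>\<^sub>D c')" by (simp add: a(4) a'(4) D.M.a_ac)
 ultimately show ?case using Suc.IH[OF a(2) a'(2)] M.add.m_closed[OF a(1) a'(1)] unfolding Rel.simps by blast
qed

lemma Rel_smult: "Rel m T d ==> Rel m (k\<odot>\<^sub>MA T) (k\<odot>\<^sub>D d)"
proof (induction m arbitrary: T d)
 case 0
 then obtain a where "a\<in>|A|" "T = J a" "d = \<pi> a" by auto
 then show ?case by (auto intro!: bexI[of _ "k\<odot>a"] simp: J_simps)
next
 case (Suc m)
 then obtain a y c where a: "a\<in>|A|" "Rel m y c" "T = J a\<oplus>\<^sub>MA rbar y" "d = K.psi (Suc m) a\<oplus>\<^sub>D c" by auto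
 note [simp] = a(1) Rel_in[OF a(2), THEN conjunct1] Rel_in[OF a(2), THEN conjunct2]
 have "k\<odot>\<^sub>MA T = J (k\<odot>a)\<oplus>\<^sub>MA rbar (k\<odot>\<^sub>MA y)" by (simp add: a(3) J_simps U.smult_add_right)
 moreover have "k\<odot>\<^sub>D d = K.psi (Suc m) (k\<odot>a)\<oplus>\<^sub>D (k\<odot>\<^sub>D c)" by (simp add: a(4) D.smult_add_right)
 ultimately show ?case using Suc.IH[OF a(2)] smult_in[OF a(1), of k] unfolding Rel.simps by blast
qed

lemma Rel_adj: "Rel m T d ==> Rel m (T\<star>\<^sub>MA) (d\<star>\<^sub>D)"
proof (induction m arbitrary: T d)
 case 0
 then obtain a where "a\<in>|A|" "T = J a" "d = \<pi> a" by auto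
 then show ?case by (auto intro!: bexI[of _ "a\<star>"] simp: J_simps)
next
 case (Suc m)
 then obtain a y c where a: "a\<in>|A|" "Rel m y c" "T = J a\<oplus>\<^sub>MA rbar y" "d = K.psi (Suc m) a\<oplus>\<^sub>D c" by auto
 note [simp] = a(1) Rel_in[OF a(2), THEN conjunct1] Rel_in[OF a(2), THEN conjunct2]
 have "T\<star>\<^sub>MA = J (a\<star>)\<oplus>\<^sub>MA rbar (y\<star>\<^sub>MA)" by (simp add: a(3) J_simps U.adj_add)
 moreover have "d\<star>\<^sub>D = K.psi (Suc m) (a\<star>)\<oplus>\<^sub>D c\<star>\<^sub>D" by (simp add: a(4) D.adj_add)
 ultimately show ?case using Suc.IH[OF a(2)] adj_closed[OF a(1)] unfolding Rel.simps by blast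
qed

lemma Rel_lift: assumes "Rel m T d" shows "Rel (Suc m) (rbar T) d"
proof -
 have [simp]: "T\<in>|MA|" "d\<in>|D|" using Rel_in[OF assms] by auto
 have "K.psi (Suc m) \<zero> = \<zero>\<^sub>D"
  by (rule star_hom_zero[OF star_algebra_axioms D.star_algebra_axioms K.psi_hom])
 then show ?thesis using RelI[OF zero_closed assms] by (simp add: J_zero del: Rel.simps)
qed

lemma Rel_lift_psi:
 assumes R: "Rel m T d" and c: "c\<in>|A|"
 shows "d\<cdot>\<^sub>D K.psi m c = K.psi m (lact T c)" "K.psi m c\<cdot>\<^sub>D d = K.psi m (ract T c)"
proof -
 have *: "d\<cdot>\<^sub>D K.psi m c = K.psi m (lact T c)" if R: "Rel m T d" and c: "c\<in>|A|" for T d c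
 proof -
  obtain x y where xy: "x\<in>|A|" "y\<in>|A|" "c = x\<cdot>y\<star>" by (rule S.factor_adj[OF c])
  note [simp] = Rel_in[OF R, THEN conjunct1] Rel_in[OF R, THEN conjunct2] xy(1,2)
  have "d\<cdot>\<^sub>D K.psi m c = (d\<cdot>\<^sub>D Sk m x)\<cdot>\<^sub>D (Sk m y)\<star>\<^sub>D" unfolding xy(3) K.psi_base[OF xy(1,2)] by (simp add: D.mult_assoc)
  also have "\<dots> = K.psi m (lact T x\<cdot>y\<star>)" using Rel_act[OF R xy(1)] by (simp only: K.psi_base lact_in xy(1,2) Rel_in[OF R])
  finally show ?thesis by (simp add: xy(3) lact_mult)
 qed
 note [simp] = Rel_in[OF R, THEN conjunct1] Rel_in[OF R, THEN conjunct2] c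
 show "d\<cdot>\<^sub>D K.psi m c = K.psi m (lact T c)" by (rule *[OF R c])
 have "(d\<star>\<^sub>D\<cdot>\<^sub>D K.psi m (c\<star>))\<star>\<^sub>D = (K.psi m (lact (T\<star>\<^sub>MA) (c\<star>)))\<star>\<^sub>D"
  by (simp only: *[OF Rel_adj[OF R] adj_closed[OF c]])
 then show "K.psi m c\<cdot>\<^sub>D d = K.psi m (ract T c)" by (simp add: D.adj_mult D.adj_adj adj_adj)
qed

lemma psi_step:
 assumes R: "Rel m y d" and a: "a\<in>|A|"
 shows "d\<cdot>\<^sub>D K.psi (Suc m) a = K.psi (Suc m) (lact (rbar y) a)" "K.psi (Suc m) a\<cdot>\<^sub>D d = K.psi (Suc m) (ract (rbar y) a)"
 using Rel_lift_psi[OF Rel_lift[OF R] a] by simp_all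

lemma J_expand:
 "a\<in>|A| ==> b\<in>|A| ==> m\<in>|MA| ==> n\<in>|MA| ==>
  J (a\<cdot>b\<oplus>ract n a\<oplus>lact m b) = J a\<cdot>\<^sub>MA J b\<oplus>\<^sub>MA J a\<cdot>\<^sub>MA n\<oplus>\<^sub>MA m\<cdot>\<^sub>MA J b"
 by (simp add: star_hom_add[OF J_hom] mult_J J_mult)

text \<open>Products involving the top component stay in the top level, since A is an ideal; only
  the product of the two lower parts is left to the induction hypothesis.\<close>

lemma Rel_mult: "Rel m T d ==> Rel m T' d' ==> Rel m (T\<cdot>\<^sub>MA T') (d\<cdot>\<^sub>D d')"
proof (induction m arbitrary: T d T' d')
 case 0
 then obtain a b where "a\<in>|A|" "b\<in>|A|" "T = J a" "d = \<pi> a" "T' = J b" "d' = \<pi> b" by auto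
 then show ?case by (auto intro!: bexI[of _ "a\<cdot>b"] simp: J_simps)
next
 case (Suc m)
 obtain a y c where a: "a\<in>|A|" "Rel m y c" "T = J a\<oplus>\<^sub>MA rbar y" "d = K.psi (Suc m) a\<oplus>\<^sub>D c" using Suc.prems(1) by auto
 obtain a' y' c' where a': "a'\<in>|A|" "Rel m y' c'" "T' = J a'\<oplus>\<^sub>MA rbar y'" "d' = K.psi (Suc m) a'\<oplus>\<^sub>D c'" using Suc.prems(2) by auto
 note [simp] = a(1) a'(1) Rel_in[OF a(2), THEN conjunct1] Rel_in[OF a(2), THEN conjunct2] Rel_in[OF a'(2), THEN conjunct1] Rel_in[OF a'(2), THEN conjunct2]
 let ?a = "a\<cdot>a'\<oplus>ract (rbar y') a\<oplus>lact (rbar y) a'"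
 have "T\<cdot>\<^sub>MA T' = J ?a\<oplus>\<^sub>MA rbar (y\<cdot>\<^sub>MA y')"
  unfolding a(3) a'(3) by (subst J_expand) (simp_all add: U.distrib_left U.distrib_right U.M.a_ac)
 moreover have "d\<cdot>\<^sub>D d' = K.psi (Suc m) ?a\<oplus>\<^sub>D (c\<cdot>\<^sub>D c')"
  unfolding a(4) a'(4) by (simp add: D.distrib_left D.distrib_right psi_step[OF a(2)] psi_step[OF a'(2)] D.M.a_ac)
 moreover have "?a\<in>|A|" by simp
 ultimately show ?case using Suc.IH[OF a(2) a'(2)] unfolding Rel.simps by blast
qed

lemma Rel_diff: assumes "Rel m T d" "Rel m T' d'" shows "Rel m (T\<ominus>\<^sub>MA T') (d\<ominus>\<^sub>D d')"
 using Rel_add[OF assms(1) Rel_smult[OF assms(2), of "-1"]] Rel_in[OF assms(1)] Rel_in[OF assms(2)]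
 by (simp add: U.diff_eq D.diff_eq)

text \<open>A bound with a constant can be improved to a contraction by applying it to high powers.\<close>

lemma Rel_power_trick:
 assumes C: "\<And>T d. Rel m T d ==> ( ||d||\<^sub>D)\<^sup>2\<le>C * ( ||T||\<^sub>MA)\<^sup>2" and R: "Rel m T d"
 shows "||d||\<^sub>D\<le>||T||\<^sub>MA"
proof -
 have [simp]: "T\<in>|MA|" "d\<in>|D|" using Rel_in[OF R] by auto
 define q where "q = rec_nat (T\<star>\<^sub>MA\<cdot>\<^sub>MA T) (\<lambda>n y. y\<cdot>\<^sub>MA y)"
 define r where "r = rec_nat (d\<star>\<^sub>D\<cdot>\<^sub>D d) (\<lambda>n y. y\<cdot>\<^sub>D y)"
 have n: "||q n||\<^sub>MA = ||T||\<^sub>MA ^ (2 ^ Suc n)" "||r n||\<^sub>D = ||d||\<^sub>D ^ (2 ^ Suc n)" for n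
  using U.power_trick_aux[of T n] D.power_trick_aux[of d n] by (auto simp: q_def r_def)
 have Rq: "Rel m (q n) (r n)" for n
  by (induction n) (auto simp: q_def r_def intro: Rel_mult Rel_adj R)
 have "( ||d||\<^sub>D ^ 4) ^ (2 ^ n)\<le>(C + 0 * 2 ^ n) * ( ||T||\<^sub>MA ^ 4) ^ (2 ^ n)" for n
 proof -
  have e: "(x ^ (2 ^ Suc n))\<^sup>2 = (x ^ 4) ^ (2 ^ n)" for x :: real by (simp flip: power_mult)
  show ?thesis using C[OF Rq[of n]] unfolding n e by simp
 qed
 then have "||d||\<^sub>D ^ 4\<le>||T||\<^sub>MA ^ 4" by (rule power_le_poly[where C = C and D = 0, rotated 2]) simp_all
 then show ?thesis by (simp add: power_mono_iff)
qed

text \<open>Suppose the squared norm of T is at most t. Truncating w\<star>w below the top level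
  leaves a remainder of norm at most 2t, to which the induction hypothesis applies. The part cut off
  moves up into the top level, where psi is contractive and the total is at most 3t. This gives the
  constant 5 = 3 + 2, which \<open>Rel_power_trick\<close> removes.\<close>

lemma Rel_contractive: "Rel m T d ==> ||d||\<^sub>D\<le>||T||\<^sub>MA"
proof (induction m arbitrary: T d)
 case 0
 then show ?case using star_hom_contractive[OF cstar_algebra_axioms D.cstar_algebra_axioms S.pi_hom] by (auto simp: J_norm)
next
 case (Suc m)
 show ?case
 proof (rule Rel_power_trick[OF _ Suc.prems])
  fix T d assume "Rel (Suc m) T d"
  then obtain b w f where w: "b\<in>|A|" "Rel m w f" "T = J b\<oplus>\<^sub>MA rbar w" "d = K.psi (Suc m) b\<oplus>\<^sub>D f" by auto
  note [simp] = w(1) Rel_in[OF w(2), THEN conjunct1] Rel_in[OF w(2), THEN conjunct2]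
  have [simp]: "T\<in>|MA|" "d\<in>|D|" by (simp_all add: w(3,4))
  let ?w = "w\<star>\<^sub>MA\<cdot>\<^sub>MA w" and ?f = "f\<star>\<^sub>D\<cdot>\<^sub>D f"
  let ?S = "T\<star>\<^sub>MA\<cdot>\<^sub>MA T"
  define a where "a = b\<star>\<cdot>b\<oplus>ract (rbar w) (b\<star>)\<oplus>lact (rbar (w\<star>\<^sub>MA)) b"
  have [simp]: "a\<in>|A|" unfolding a_def by (intro M.add.m_closed mult_closed ract_in lact_in rbar_in U.adj_closed) simp_all
  have Sa: "?S = J a\<oplus>\<^sub>MA rbar ?w"
  proof -
   have "J a = J (b\<star>)\<cdot>\<^sub>MA J b\<oplus>\<^sub>MA J (b\<star>)\<cdot>\<^sub>MA rbar w\<oplus>\<^sub>MA rbar (w\<star>\<^sub>MA)\<cdot>\<^sub>MA J b"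
    unfolding a_def by (rule J_expand) simp_all
   then show ?thesis unfolding w(3) by (simp add: U.adj_add U.distrib_left U.distrib_right J_simps U.M.a_ac)
  qed
  have da: "d\<star>\<^sub>D\<cdot>\<^sub>D d = K.psi (Suc m) a\<oplus>\<^sub>D ?f"
  proof -
   have "K.psi (Suc m) a = K.psi (Suc m) (b\<star>)\<cdot>\<^sub>D K.psi (Suc m) b\<oplus>\<^sub>D K.psi (Suc m) (b\<star>)\<cdot>\<^sub>D f\<oplus>\<^sub>D f\<star>\<^sub>D\<cdot>\<^sub>D K.psi (Suc m) b"
    unfolding a_def psi_step(1)[OF Rel_adj[OF w(2)] w(1)] psi_step(2)[OF w(2) adj_closed[OF w(1)]]
    by (simp del: rbar_simps(5) mult_ops(7) K.psi_simps(5))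
   then show ?thesis unfolding w(4) by (simp add: D.adj_add D.distrib_left D.distrib_right D.M.a_ac)
  qed
  have "( ||d||\<^sub>D)\<^sup>2\<le>5 * t" if t: "0 < t" "( ||T||\<^sub>MA)\<^sup>2\<le>t" for t
  proof -
   have nS: "||?S||\<^sub>MA\<le>t" using t by (simp add: U.norm_cstar)
   \<comment> \<open>j is what truncation removes at level m, and c is the same element seen from
     level m + 1; that both lie in A allows the transfer.\<close>
   obtain j c where jc: "j\<in>|A|" "c\<in>|A|" "\<rho> j = J c" "||?w\<ominus>\<^sub>MA J j||\<^sub>MA\<le>2 * t"
    by (rule clamp[of w T ?w ?S a t]) (use Sa t nS in simp_all)
   note [simp] = jc(1,2)
   have R: "Rel m (?w\<ominus>\<^sub>MA J j) (?f\<ominus>\<^sub>D K.psi m j)"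
    by (intro Rel_diff Rel_mult Rel_adj w Rel_J jc)
   have f: "||?f\<ominus>\<^sub>D K.psi m j||\<^sub>D\<le>2 * t" using order_trans[OF Suc.IH[OF R] jc(4)] .
   define z where "z = rbar ?w"
   have [simp]: "z\<in>|MA|" by (simp add: z_def)
   \<comment> \<open>The enlarged top component is S minus the image of the truncated lower part, so
     its norm is at most t + 2t.\<close>
   have "J (a\<oplus>c) = ?S\<ominus>\<^sub>MA rbar (?w\<ominus>\<^sub>MA J j)"
    unfolding Sa by (simp add: rbar_diff jc(3) J_simps flip: rbar_simps(4) rbar_simps(5)) (simp add: z_def[symmetric] flip: rbar_simps(4) rbar_simps(5), ((simp add: U.expand)?; (rule U.linI, (rule U.lins | (simp add: algebra_simps; fail))+)))
   then have "||a\<oplus>c|| = ||?S\<ominus>\<^sub>MA rbar (?w\<ominus>\<^sub>MA J j)||\<^sub>MA" using J_norm[of "a\<oplus>c"] by simp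
   also have "\<dots>\<le>||?S||\<^sub>MA + ||rbar (?w\<ominus>\<^sub>MA J j)||\<^sub>MA" by (rule U.norm_diff_triangle) simp_all
   also have "\<dots>\<le>t + 2 * t" using nS jc(4) by (subst rbar_norm) simp_all
   finally have ac: "||K.psi (Suc m) (a\<oplus>c)||\<^sub>D\<le>3 * t" using K.psi_le[of "a\<oplus>c" "Suc m"] by simp
   define p where "p = K.psi m j"
   have pc: "K.psi (Suc m) c = p" unfolding p_def by (rule psi_covariance[symmetric]) (use jc in simp_all)
   have [simp]: "p\<in>|D|" by (simp add: p_def)
   have "d\<star>\<^sub>D\<cdot>\<^sub>D d = K.psi (Suc m) (a\<oplus>c)\<oplus>\<^sub>D (?f\<ominus>\<^sub>D K.psi m j)"
   proof -
    have "u\<oplus>\<^sub>D v = (u\<oplus>\<^sub>D p)\<oplus>\<^sub>D (v\<ominus>\<^sub>D p)" if "u\<in>|D|" "v\<in>|D|" for u v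
     supply that [simp] by (rule D.linI, (rule D.lins | (simp add: algebra_simps; fail))+)
    from this[of "K.psi (Suc m) a" ?f] show ?thesis unfolding da p_def[symmetric] by (simp add: pc)
   qed
   then have "||d\<star>\<^sub>D\<cdot>\<^sub>D d||\<^sub>D\<le>3 * t + 2 * t"
    using D.norm_triangle[of "K.psi (Suc m) (a\<oplus>c)" "?f\<ominus>\<^sub>D K.psi m j"] ac f by simp
   then show ?thesis by (simp add: D.norm_cstar)
  qed
  then have b: "( ||d||\<^sub>D)\<^sup>2\<le>5 * t" if "0 < t" "( ||T||\<^sub>MA)\<^sup>2\<le>t" for t using that by blast
  \<comment> \<open>t has to be strictly positive, so the bound is taken at the squared norm of T
    plus \<epsilon>, and \<epsilon> is removed afterwards.\<close>
  have "( ||d||\<^sub>D)\<^sup>2 / 5\<le>( ||T||\<^sub>MA)\<^sup>2 + \<epsilon>" if "\<epsilon> > 0" for \<epsilon>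
   using b[of "( ||T||\<^sub>MA)\<^sup>2 + \<epsilon>"] add_nonneg_pos[OF zero_le_power2[of "||T||\<^sub>MA"] that] that by simp
  then have "( ||d||\<^sub>D)\<^sup>2 / 5\<le>( ||T||\<^sub>MA)\<^sup>2" by (rule field_le_epsilon)
  then show "( ||d||\<^sub>D)\<^sup>2\<le>5 * ( ||T||\<^sub>MA)\<^sup>2" by simp
 qed
qed

end

section \<open>The free *-algebra\<close>

abbreviation flip_word :: "'g star_word=>'g star_word" where
 "flip_word w\<equiv>rev (map (map_prod id Not) w)"

definition words :: "'g set=>'g star_word set" where
 "words G = {w. w\<noteq>[]\<and>fst ` set w\<subseteq>G}"

definition free_carrier :: "'g set=>('g star_word=>complex) set" where
 "free_carrier G = {f. finite {w. f w\<noteq>0}\<and>(\<forall>w. f w\<noteq>0\<longrightarrow>w\<in>words G)}"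

definition free_mult :: "('g star_word=>complex)=>('g star_word=>complex)=>'g star_word=>complex" where
 "free_mult f g w = (\<Sum>k\<le>length w. f (take k w) * g (drop k w))"

definition free_adj :: "('g star_word=>complex)=>'g star_word=>complex" where
 "free_adj f w = cnj (f (flip_word w))"

definition ind :: "'g star_word=>'g star_word=>complex" where
 "ind w v = (if v = w then 1 else 0)"

lemma free_simps [simp]:
 "carrier (free_star_algebra G p) = free_carrier G"
 "f\<oplus>\<^bsub>free_star_algebra G p\<^esub> g = (\<lambda>w. f w + g w)" "f\<cdot>\<^bsub>free_star_algebra G p\<^esub> g = free_mult f g"
 "c\<odot>\<^bsub>free_star_algebra G p\<^esub> f = (\<lambda>w. c * f w)" "f\<star>\<^bsub>free_star_algebra G p\<^esub> = free_adj f"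
 "\<zero>\<^bsub>free_star_algebra G p\<^esub> = (\<lambda>w. 0)" "||f||\<^bsub>free_star_algebra G p\<^esub> = p f"
 by (simp_all add: free_star_algebra_def free_carrier_def words_def free_mult_def free_adj_def fun_eq_iff)

lemma flip_flip [simp]: "flip_word (flip_word w) = w"
 by (simp add: rev_map) (rule map_idI, auto)

lemma words_append [simp]: "u\<in>words G ==> v\<in>words G ==> u @ v\<in>words G"
 by (auto simp: words_def)

lemma words_flip [simp]: "w\<in>words G ==> flip_word w\<in>words G"
 by (auto simp: words_def)

lemma free_zero [simp]: "(\<lambda>w. 0)\<in>free_carrier G"
 by (simp add: free_carrier_def)

lemma free_ind [simp]: "w\<in>words G ==> ind w\<in>free_carrier G"
 by (auto simp: free_carrier_def ind_def)

lemma free_carrierI: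
 assumes "finite F" "F\<subseteq>words G" "\<And>w. w\<notin>F ==> f w = 0" shows "f\<in>free_carrier G"
proof -
 have "{w. f w\<noteq>0}\<subseteq>F" using assms(3) by auto
 then show ?thesis using assms(2) finite_subset[OF _ assms(1)] by (auto simp: free_carrier_def)
qed

lemma free_words: "f\<in>free_carrier G ==> {w. f w\<noteq>0}\<subseteq>words G" and free_finite: "f\<in>free_carrier G ==> finite {w. f w\<noteq>0}"
 by (auto simp: free_carrier_def)

lemma free_add [simp]: "f\<in>free_carrier G ==> g\<in>free_carrier G ==> (\<lambda>w. f w + g w)\<in>free_carrier G"
 by (rule free_carrierI[OF finite_UnI[OF free_finite[of f] free_finite[of g]] Un_least[OF free_words[of f] free_words[of g]]]) auto

lemma free_smult [simp]: "f\<in>free_carrier G ==> (\<lambda>w. c * f w)\<in>free_carrier G"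
 by (rule free_carrierI[OF free_finite free_words]) auto

text \<open>The case \<open>ind\<close> only concerns words that occur in \<open>f\<close>, so
  assumptions on the support of \<open>f\<close>, such as a fixed degree, can be used there.\<close>

lemma free_induct [consumes 1, case_names zero ind smult add]:
 assumes f: "f\<in>free_carrier G" and 0: "P (\<lambda>w. 0)" and 1: "\<And>w. w\<in>words G ==> f w\<noteq>0 ==> P (ind w)"
  and 2: "\<And>c g. g\<in>free_carrier G ==> P g ==> P (\<lambda>w. c * g w)"
  and 3: "\<And>g h. g\<in>free_carrier G ==> h\<in>free_carrier G ==> P g ==> P h ==> P (\<lambda>w. g w + h w)"
 shows "P f"
proof -
 let ?g = "\<lambda>F v. \<Sum>w\<in>F. f w * ind w v"
 have w: "w\<in>words G" if "f w\<noteq>0" for w using f that by (simp add: free_carrier_def)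
 have "P (?g F)\<and>?g F\<in>free_carrier G" if "finite F" "F\<subseteq>{w. f w\<noteq>0}" for F
  using that
 proof (induction F rule: finite_induct)
  case (insert x F)
  then have x: "f x\<noteq>0" and IH: "P (?g F)" "?g F\<in>free_carrier G" by auto
  have "?g (insert x F) = (\<lambda>v. f x * ind x v + ?g F v)" using insert by simp
  then show ?case using 3[OF free_smult[OF free_ind[OF w[OF x]]] IH(2) 2[OF free_ind[OF w[OF x]] 1[OF w[OF x] x]] IH(1)]
    free_add[OF free_smult[OF free_ind[OF w[OF x]]] IH(2)] by simp
 qed (use 0 in simp)
 then have "P (?g {w. f w\<noteq>0})" if "finite {w. f w\<noteq>0}" using that by blast
 moreover have fin: "finite {w. f w\<noteq>0}" using f by (simp add: free_carrier_def)
 moreover have "?g {w. f w\<noteq>0} = f"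
 proof
  fix v
  have "?g {w. f w\<noteq>0} v = (\<Sum>w\<in>{w. f w\<noteq>0}. if w = v then f w else 0)" by (intro sum.cong) (auto simp: ind_def)
  then show "?g {w. f w\<noteq>0} v = f v" using fin by simp
 qed
 ultimately show ?thesis by simp
qed

lemma free_mult_lin:
 "free_mult (\<lambda>w. f w + g w) h = (\<lambda>w. free_mult f h w + free_mult g h w)"
 "free_mult h (\<lambda>w. f w + g w) = (\<lambda>w. free_mult h f w + free_mult h g w)"
 "free_mult (\<lambda>w. c * f w) h = (\<lambda>w. c * free_mult f h w)"
 "free_mult h (\<lambda>w. c * f w) = (\<lambda>w. c * free_mult h f w)"
 "free_mult (\<lambda>w. 0) h = (\<lambda>w. 0)" "free_mult h (\<lambda>w. 0) = (\<lambda>w. 0)"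
 by (simp_all add: free_mult_def fun_eq_iff sum.distrib sum_distrib_left algebra_simps)

lemma free_mult_ind: "free_mult (ind u) (ind v) = ind (u @ v)"
proof
 fix w
 have "free_mult (ind u) (ind v) w = (\<Sum>k\<le>length w. if k = length u then of_bool (w = u @ v) else 0)"
  unfolding free_mult_def
 proof (intro sum.cong refl)
  fix k assume k: "k\<in>{..length w}"
  have iff: "take k w = u\<and>drop k w = v\<longleftrightarrow>k = length u\<and>w = u @ v"
  proof
   assume h: "take k w = u\<and>drop k w = v"
   then have "w = u @ v" using append_take_drop_id[of k w] by simp
   moreover have "k = length u" using h k by auto
   ultimately show "k = length u\<and>w = u @ v" by simp
  qed simp
  have "ind u (take k w) * ind v (drop k w) = of_bool (take k w = u\<and>drop k w = v)" by (simp add: ind_def)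
  then show "ind u (take k w) * ind v (drop k w) = (if k = length u then of_bool (w = u @ v) else 0)"
   unfolding iff by simp
 qed
 also have "\<dots> = ind (u @ v) w" by (auto simp: ind_def)
 finally show "free_mult (ind u) (ind v) w = ind (u @ v) w" .
qed

lemma free_adj_lin:
 "free_adj (\<lambda>w. f w + g w) = (\<lambda>w. free_adj f w + free_adj g w)"
 "free_adj (\<lambda>w. c * f w) = (\<lambda>w. cnj c * free_adj f w)" "free_adj (\<lambda>w. 0) = (\<lambda>w. 0)"
 by (simp_all add: free_adj_def fun_eq_iff)

lemma free_adj_ind: "free_adj (ind w) = ind (flip_word w)"
proof
 fix v
 have "flip_word v = w\<longleftrightarrow>v = flip_word w" by (metis flip_flip)
 then show "free_adj (ind w) v = ind (flip_word w) v" by (simp add: free_adj_def ind_def)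
qed

lemma free_adj_in [simp]: "f\<in>free_carrier G ==> free_adj f\<in>free_carrier G"
 by (induction rule: free_induct) (simp_all add: free_adj_lin free_adj_ind)

lemma free_mult_in [simp]: assumes "f\<in>free_carrier G" "g\<in>free_carrier G" shows "free_mult f g\<in>free_carrier G"
 using assms(1)
proof (induction rule: free_induct)
 case (ind u) note u = this
 show ?case using assms(2) by (induction rule: free_induct) (use u in \<open>simp_all add: free_mult_lin free_mult_ind\<close>)
qed (simp_all add: free_mult_lin)

lemma free_mult_assoc:
 assumes "f\<in>free_carrier G" "g\<in>free_carrier G" "h\<in>free_carrier G"
 shows "free_mult (free_mult f g) h = free_mult f (free_mult g h)"
 using assms(1)
proof (induction rule: free_induct)
 case (ind u) note u = this
 show ?case using assms(2)
 proof (induction rule: free_induct)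
  case (ind v) note v = this
  show ?case using assms(3) by (induction rule: free_induct) (simp_all add: free_mult_lin free_mult_ind)
 qed (simp_all add: free_mult_lin)
qed (simp_all add: free_mult_lin)

lemma free_adj_mult:
 assumes "f\<in>free_carrier G" "g\<in>free_carrier G" shows "free_adj (free_mult f g) = free_mult (free_adj g) (free_adj f)"
 using assms(1)
proof (induction rule: free_induct)
 case (ind u) note u = this
 show ?case using assms(2) by (induction rule: free_induct) (simp_all add: free_mult_lin free_mult_ind free_adj_lin free_adj_ind)
qed (simp_all add: free_mult_lin free_adj_lin)

lemma free_adj_adj: "free_adj (free_adj f) = f"
 by (simp add: free_adj_def fun_eq_iff del: rev_map)

lemma star_algebra_free: "star_algebra (free_star_algebra G p)"
 by (rule star_algebraI; simp add: free_mult_lin free_mult_assoc free_adj_lin free_adj_adj free_adj_mult algebra_simps)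

lemma free_gen_ind: "free_gen g = ind [(g, False)]"
 by (simp add: free_gen_def ind_def fun_eq_iff)

section \<open>Evaluation of words\<close>

locale free_eval = E: star_algebra E for E :: "('e, 'm) cstar_struct_scheme" (structure) +
 fixes G :: "'g set" and \<gamma> :: "'g=>'e"
 assumes gamma_in [simp]: "g\<in>G ==> \<gamma> g\<in>|E|"
begin

definition letter :: "'g\<times>bool=>'e" where
 "letter l = (if snd l then (\<gamma> (fst l))\<star> else \<gamma> (fst l))"

text \<open>There is no unit to assign to the empty word. Its value 0 is a default outside
  \<open>words G\<close>, and one-letter words are treated separately so that it never enters a
  product.\<close>

primrec wv :: "'g star_word=>'e" where
 "wv [] = \<zero>"
| "wv (l # ls) = (if ls = [] then letter l else letter l\<cdot>wv ls)"

definition ev :: "('g star_word=>complex)=>'e" where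
 "ev f = (\<Oplus>w\<in>{w. f w\<noteq>0}. f w\<odot>wv w)"

lemma words_Cons: "l # ls\<in>words G\<longleftrightarrow>fst l\<in>G\<and>(ls = []\<or>ls\<in>words G)"
 by (auto simp: words_def)

lemma letter_in [simp]: "fst l\<in>G ==> letter l\<in>|E|"
 by (simp add: letter_def)

lemma wv_in [simp]: "w\<in>words G ==> wv w\<in>|E|"
 by (induction w) (auto simp: words_Cons)

lemma wv_append: "u\<in>words G ==> v\<in>words G ==> wv (u @ v) = wv u\<cdot>wv v"
proof (induction u)
 case (Cons l ls)
 then show ?case by (cases "ls = []") (auto simp: words_Cons E.mult_assoc words_def[of G] dest: Cons.IH)
qed (simp add: words_def)

lemma wv_flip: "w\<in>words G ==> wv (flip_word w) = (wv w)\<star>"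
proof (induction w)
 case (Cons l ls)
 have l: "letter (map_prod id Not l) = (letter l)\<star>"
  using Cons.prems by (cases l) (auto simp: letter_def words_Cons E.adj_adj)
 show ?case
 proof (cases "ls = []")
  case False
  then have ls: "ls\<in>words G" "fst l\<in>G" using Cons.prems by (auto simp: words_Cons)
  have "[map_prod id Not l]\<in>words G" using ls(2) by (cases l) (simp add: words_def)
  then have "wv (flip_word (l # ls)) = wv (flip_word ls)\<cdot>wv [map_prod id Not l]"
   using wv_append[OF words_flip[OF ls(1)]] by simp
  also have "\<dots> = (wv ls)\<star>\<cdot>(letter l)\<star>" by (simp only: Cons.IH[OF ls(1)] wv.simps(2) l simp_thms if_True)
  also have "\<dots> = (wv (l # ls))\<star>" using False ls by (simp add: E.adj_mult)
  finally show ?thesis .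
 next
  case True
  then show ?thesis by (simp only: list.map rev.simps append_Nil wv.simps simp_thms if_True l)
 qed
qed (simp add: words_def)

lemma ev_superset:
 assumes "f\<in>free_carrier G" "finite F" "{w. f w\<noteq>0}\<subseteq>F" "F\<subseteq>words G"
 shows "ev f = (\<Oplus>w\<in>F. f w\<odot>wv w)"
 unfolding ev_def by (rule E.M.add.finprod_mono_neutral_cong_left) (use assms in auto)

lemma ev_in [simp]: "f\<in>free_carrier G ==> ev f\<in>|E|"
 unfolding ev_def by (rule E.M.finsum_closed) (use free_words[of f G] in auto)

lemma ev_zero [simp]: "ev (\<lambda>w. 0) = \<zero>"
 by (simp add: ev_def)

lemma ev_add:
 assumes f: "f\<in>free_carrier G" and g: "g\<in>free_carrier G" shows "ev (\<lambda>w. f w + g w) = ev f\<oplus>ev g"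
proof -
 let ?F = "{w. f w\<noteq>0}\<union>{w. g w\<noteq>0}"
 have F: "finite ?F" "?F\<subseteq>words G" using f g by (auto simp: free_carrier_def)
 note in_carrier = subsetD[OF F(2), THEN wv_in]
 have "ev f\<oplus>ev g = (\<Oplus>w\<in>?F. f w\<odot>wv w)\<oplus>(\<Oplus>w\<in>?F. g w\<odot>wv w)"
  using ev_superset[OF f F(1) _ F(2)] ev_superset[OF g F(1) _ F(2)] by auto
 also have "\<dots> = (\<Oplus>w\<in>?F. f w\<odot>wv w\<oplus>g w\<odot>wv w)"
  by (rule E.M.finsum_addf[symmetric]) (use in_carrier in auto)
 also have "\<dots> = (\<Oplus>w\<in>?F. (f w + g w)\<odot>wv w)"
  by (rule E.M.finsum_cong') (use in_carrier E.smult_add_left in auto)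
 also have "\<dots> = ev (\<lambda>w. f w + g w)"
  by (rule ev_superset[symmetric]) (use f g F in auto)
 finally show ?thesis by simp
qed

lemma ev_smult: assumes f: "f\<in>free_carrier G" shows "ev (\<lambda>w. c * f w) = c\<odot>ev f"
proof -
 have F: "finite {w. f w\<noteq>0}" "{w. f w\<noteq>0}\<subseteq>words G" using f by (auto simp: free_carrier_def)
 note in_carrier = subsetD[OF F(2), THEN wv_in]
 have "ev (\<lambda>w. c * f w) = (\<Oplus>w\<in>{w. f w\<noteq>0}. (c * f w)\<odot>wv w)"
  by (rule ev_superset) (use f F in auto)
 also have "\<dots> = (\<Oplus>w\<in>{w. f w\<noteq>0}. c\<odot>(f w\<odot>wv w))"
  by (rule E.M.finsum_cong') (use in_carrier in auto)
 also have "\<dots> = c\<odot>ev f"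
  unfolding ev_def by (rule E.finsum_smult_ldistr[symmetric]) (use F in_carrier in auto)
 finally show ?thesis .
qed

lemma ev_ind: "w\<in>words G ==> ev (ind w) = wv w"
 by (subst ev_superset[of _ "{w}"]) (auto simp: ind_def)

lemma ev_hom: "star_hom (free_star_algebra G p) E ev"
 unfolding star_hom_def
proof (intro conjI allI ballI funcsetI; simp only: free_simps ev_in ev_add ev_smult)
 fix f g assume f: "f\<in>free_carrier G" and g: "g\<in>free_carrier G"
 show "ev (free_mult f g) = ev f\<cdot>ev g" using f
 proof (induction rule: free_induct)
  case (ind u) note u = this
  show ?case using g
   by (induction rule: free_induct)
    (use u in \<open>simp_all add: free_mult_lin free_mult_ind ev_ind wv_append ev_add ev_smult E.distrib_left E.smult_mult_right\<close>)
 qed (use g in \<open>simp_all add: free_mult_lin ev_add ev_smult E.distrib_right E.smult_mult_left\<close>)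
next
 fix f assume "f\<in>free_carrier G"
 then show "ev (free_adj f) = (ev f)\<star>"
  by (induction rule: free_induct)
   (simp_all add: free_adj_lin free_adj_ind ev_ind wv_flip ev_add ev_smult E.adj_add E.adj_smult)
qed

lemmas ev_mult = star_hom_mult[OF ev_hom, unfolded free_simps]
lemmas ev_adj = star_hom_adj[OF ev_hom, unfolded free_simps]

lemma ev_gen: "g\<in>G ==> ev (free_gen g) = \<gamma> g"
 unfolding free_gen_ind by (subst ev_ind) (auto simp: words_def letter_def)

lemma hom_eq_ev:
 assumes h: "star_hom (free_star_algebra G p) E h" and gen: "\<And>g. g\<in>G ==> h (free_gen g) = \<gamma> g" and f: "f\<in>free_carrier G"
 shows "h f = ev f"
proof -
 note hs = star_hom_simps[OF h, unfolded free_simps]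
 have letter: "h (ind [l]) = letter l" if "fst l\<in>G" for l
 proof (cases "snd l")
  case True
  then have "ind [l] = free_adj (free_gen (fst l))" unfolding free_gen_ind free_adj_ind by (cases l) simp
  moreover have "free_gen (fst l)\<in>free_carrier G" unfolding free_gen_ind using that by (simp add: words_def)
  ultimately show ?thesis using True gen[OF that] hs(5) by (simp add: letter_def)
 next
  case False
  then have "ind [l] = free_gen (fst l)" unfolding free_gen_ind by (cases l) simp
  then show ?thesis using False gen[OF that] by (simp add: letter_def)
 qed
 have w: "h (ind w) = wv w" if "w\<in>words G" for w
  using that
 proof (induction w)
  case (Cons l ls)
  show ?case
  proof (cases "ls = []")
   case True
   then show ?thesis using letter Cons.prems by (simp add: words_Cons)
  next
   case False
   then have ls: "ls\<in>words G" "fst l\<in>G" using Cons.prems by (auto simp: words_Cons)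
   then have l: "[l]\<in>words G" by (simp add: words_def)
   have "h (ind (l # ls)) = h (ind [l])\<cdot>h (ind ls)"
    using hs(4)[OF free_ind[OF l] free_ind[OF ls(1)]] by (simp add: free_mult_ind)
   then show ?thesis using False letter[OF ls(2)] Cons.IH[OF ls(1)] by simp
  qed
 qed (simp add: words_def)
 have "h (\<lambda>w. 0) = \<zero>" using star_hom_zero[OF star_algebra_free E.star_algebra_axioms h] by simp
 with f show ?thesis
  by (induction rule: free_induct) (simp_all add: w ev_ind hs ev_add ev_smult)
qed

end

definition graded_part :: "('g star_word=>int)=>int=>('g star_word=>complex)=>'g star_word=>complex" where
 "graded_part deg d f w = (if deg w = d then f w else 0)"

lemma graded_part_in [simp]: "f\<in>free_carrier G ==> graded_part deg d f\<in>free_carrier G"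
 by (rule free_carrierI[OF free_finite[of f G] free_words[of f G]]) (auto simp: graded_part_def)

lemma (in free_eval) norm_graded_sum:
 assumes pre: "pre_cstar E" and I: "finite I"
 shows "f\<in>free_carrier G ==> (\<And>w. f w\<noteq>0 ==> deg w\<in>I) ==> ||ev f||\<le>(\<Sum>d\<in>I. ||ev (graded_part deg d f)||)"
 using I
proof (induction I arbitrary: f rule: finite_induct)
 case empty
 then have "f = (\<lambda>w. 0)" by auto
 then show ?case using pre_cstar.norm_zero[OF pre] by simp
next
 case (insert d I)
 define g where "g w = (if deg w = d then 0 else f w)" for w
 have g: "g\<in>free_carrier G"
  by (rule free_carrierI[OF free_finite free_words, OF insert.prems(1) insert.prems(1)]) (auto simp: g_def)
 have "f = (\<lambda>w. graded_part deg d f w + g w)" by (auto simp: graded_part_def g_def)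
 then have "ev f = ev (graded_part deg d f)\<oplus>ev g" using ev_add[OF graded_part_in g] insert.prems(1) by metis
 then have "||ev f||\<le>||ev (graded_part deg d f)|| + ||ev g||"
  using pre_cstar.norm_triangle[OF pre, of "ev (graded_part deg d f)" "ev g"] g insert.prems(1) by simp
 also have "||ev g||\<le>(\<Sum>d\<in>I. ||ev (graded_part deg d g)||)"
  by (rule insert.IH[OF g]) (use insert.prems(2) in \<open>auto simp: g_def split: if_splits\<close>)
 also have "\<dots> = (\<Sum>d\<in>I. ||ev (graded_part deg d f)||)"
 proof (intro sum.cong refl)
  fix d' assume "d'\<in>I"
  then have "graded_part deg d' g = graded_part deg d' f" using insert.hyps by (auto simp: graded_part_def g_def)
  then show "||ev (graded_part deg d' g)|| = ||ev (graded_part deg d' f)||" by simp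
 qed
 finally show ?case using insert.hyps by simp
qed

lemma free_mult_support:
 assumes "free_mult f g w\<noteq>0" obtains u v where "w = u @ v" "f u\<noteq>0" "g v\<noteq>0"
proof -
 obtain k where "f (take k w) * g (drop k w)\<noteq>0"
  using assms unfolding free_mult_def by (meson sum.not_neutral_contains_not_neutral)
 then show ?thesis using that[of "take k w" "drop k w"] by simp
qed

section \<open>Words in the generators\<close>

context endo
begin

abbreviation "cp_gens\<equiv>Coeff ` |A|\<union>Creation ` |A|"

text \<open>The creation element is x at level 1 in degree 1. Taking the adjoint lowers the level by
  one, so the product of an adjoint creation element with another one lands at level 0, where A is
  placed.\<close>

definition gamC :: "'a cp_generator=>int=>'a dilated" where
 "gamC g = (case g of Coeff a=>Z.single 0 (bl 0 a) | Creation x=>Z.single 1 (bl 1 x))"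

lemma gamC_simps [simp]: "gamC (Coeff a) = Z.single 0 (bl 0 a)" "gamC (Creation x) = Z.single 1 (bl 1 x)"
 by (simp_all add: gamC_def)

sublocale C: pre_cstar Z.CP by (rule Z.pre_cstar_CP)

sublocale FC: free_eval Z.CP cp_gens gamC
 by unfold_locales auto

definition deg :: "'a cp_generator star_word=>int" where
 "deg w = (\<Sum>l\<leftarrow>w. case fst l of Coeff _=>0 | Creation _=>if snd l then - 1 else 1)"

lemma deg_append: "deg (u @ v) = deg u + deg v"
 by (simp add: deg_def)

lemma deg_flip: "deg (flip_word w) = - deg w"
proof (induction w)
 case (Cons l w)
 have "deg [map_prod id Not l] = - deg [l]" by (cases l) (auto simp: deg_def split: cp_generator.split)
 moreover have "deg (l # w) = deg [l] + deg w" by (simp add: deg_def)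
 ultimately show ?case using deg_append[of "flip_word w" "[map_prod id Not l]"] by (simp only: Cons.IH list.map rev.simps)
qed (simp add: deg_def)

lemma deg_bound: "\<bar>deg w\<bar>\<le>int (length w)"
proof (induction w)
 case (Cons l w)
 have "\<bar>deg [l]\<bar>\<le>1" by (cases l) (auto simp: deg_def split: cp_generator.split)
 moreover have "deg (l # w) = deg [l] + deg w" by (simp add: deg_def)
 ultimately show ?case using Cons.IH by simp
qed (simp add: deg_def)

text \<open>The value of S^k(x)S^l(y)\<star> for c = xy\<star>: level k in degree k - l.\<close>

definition mono :: "nat=>nat=>'a=>int=>'a dilated" where
 "mono k l c = Z.single (int k - int l) (bl (int k) c)"

lemma bl_bl: assumes "z\<in>|A|" "c\<in>|A|"
 shows "bl m z\<cdot>\<^sub>FA bl (m + int k) c = bl (m + int k) (lact ((rbar ^^ k) (J z)) c)"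
 unfolding bl_def[of m z] iota_add[OF J_in[OF assms(1)], of m k, symmetric]
 by (rule bl_iota) (use assms in simp_all)

lemma conv_single: "a\<in>|FB| ==> b\<in>|FB| ==>
  Z.single m a\<cdot>\<^sub>Z.CP Z.single k b = Z.single (m + k) (a\<cdot>\<^sub>FA Z.ap m b)"
 by (simp only: Z.CP_simps Z.twist_single[OF Z.bil_conv] FB_ops(2)[symmetric])

lemma bl_adj: "a\<in>|A| ==> (bl n a)\<star>\<^sub>FA = bl n (a\<star>)"
 by (rule star_hom_adj[OF bl_hom, symmetric])

lemma gamC_adj: "a\<in>|A| ==> (gamC (Coeff a))\<star>\<^sub>Z.CP = gamC (Coeff (a\<star>))"
 "a\<in>|A| ==> (gamC (Creation a))\<star>\<^sub>Z.CP = Z.single (-1) (bl 0 (a\<star>))"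
 by (simp_all add: Z.fadj_single bl_adj)

text \<open>These are the counterparts of \<open>Sk_move\<close> in the crossed product.
  Annihilation at k = 0 is special: it meets level -1, which lies in the multipliers of level 0 by
  iota_(-1)(c) = iota_0(\<rho>(c)), and it raises l since k cannot drop.\<close>

lemma mono_moves:
 assumes [simp]: "a\<in>|A|" "c\<in>|A|"
 shows "gamC (Coeff a)\<cdot>\<^sub>Z.CP mono k l c = mono k l (lact ((rbar ^^ k) (J a)) c)"
  and "gamC (Creation a)\<cdot>\<^sub>Z.CP mono k l c = mono (Suc k) l (lact ((rbar ^^ k) (J a)) c)"
  and "(gamC (Creation a))\<star>\<^sub>Z.CP\<cdot>\<^sub>Z.CP mono (Suc k) l c = mono k l (lact ((rbar ^^ k) (J (a\<star>))) c)"
  and "(gamC (Creation a))\<star>\<^sub>Z.CP\<cdot>\<^sub>Z.CP mono 0 l c = mono 0 (Suc l) (ract (\<rho> c) (a\<star>))"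
proof -
 show "gamC (Coeff a)\<cdot>\<^sub>Z.CP mono k l c = mono k l (lact ((rbar ^^ k) (J a)) c)"
  unfolding mono_def gamC_simps by (subst conv_single) (use bl_bl[of a c 0 k] in simp_all)
 show "gamC (Creation a)\<cdot>\<^sub>Z.CP mono k l c = mono (Suc k) l (lact ((rbar ^^ k) (J a)) c)"
  unfolding mono_def gamC_simps by (subst conv_single) (use bl_bl[of a c 1 k] in \<open>simp_all add: algebra_simps\<close>)
 show "(gamC (Creation a))\<star>\<^sub>Z.CP\<cdot>\<^sub>Z.CP mono (Suc k) l c = mono k l (lact ((rbar ^^ k) (J (a\<star>))) c)"
  unfolding mono_def gamC_adj(2)[OF assms(1)] by (subst conv_single) (use bl_bl[of "a\<star>" c 0 k] in simp_all)
 have "bl (-1) c = iota A \<rho> 0 (\<rho> c)" using iota_succ[of "J c" "-1"] by (simp add: bl_def)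
 then have "bl 0 (a\<star>)\<cdot>\<^sub>FA bl (-1) c = bl 0 (ract (\<rho> c) (a\<star>))" by (simp add: iota_bl)
 then show "(gamC (Creation a))\<star>\<^sub>Z.CP\<cdot>\<^sub>Z.CP mono 0 l c = mono 0 (Suc l) (ract (\<rho> c) (a\<star>))"
  unfolding mono_def gamC_adj(2)[OF assms(1)] by (subst conv_single) simp_all
qed

end

context cov
begin

definition gamD :: "'a cp_generator=>'d" where
 "gamD g = (case g of Coeff a=>\<pi> a | Creation x=>S x)"

lemma gamD_simps [simp]: "gamD (Coeff a) = \<pi> a" "gamD (Creation x) = S x"
 by (simp_all add: gamD_def)

sublocale FD: free_eval D cp_gens gamD
 by unfold_locales auto

text \<open>Both values carry the same data k, l, x, y. Proving the normal form simultaneously in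
  the crossed product and in D is what makes the two evaluations comparable word by word.\<close>

definition NF :: "int=>(int=>'a dilated)=>'d=>bool" where
 "NF d c t\<longleftrightarrow>(\<exists>k l x y. x\<in>|A|\<and>y\<in>|A|\<and>int k - int l = d\<and>
   c = mono k l (x\<cdot>y\<star>)\<and>t = Sk k x\<cdot>\<^sub>D (Sk l y)\<star>\<^sub>D)"

lemma NFI: "x\<in>|A| ==> y\<in>|A| ==> int k - int l = d ==> c = mono k l (x\<cdot>y\<star>) ==>
  t = Sk k x\<cdot>\<^sub>D (Sk l y)\<star>\<^sub>D ==> NF d c t"
 unfolding NF_def by blast

lemma NF_base:
 assumes a: "a\<in>|A|"
 shows "NF 0 (gamC (Coeff a)) (\<pi> a)" "NF 1 (gamC (Creation a)) (S a)" "NF (-1) ((gamC (Creation a))\<star>\<^sub>Z.CP) ((S a)\<star>\<^sub>D)"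
proof -
 obtain x y where xy: "x\<in>|A|" "y\<in>|A|" "a = x\<cdot>y\<star>" by (rule S.factor_adj[OF a])
 note [simp] = xy(1,2)
 have Sa: "S a = S x\<cdot>\<^sub>D \<pi> (y\<star>)" unfolding xy(3) by (rule S.T_pi[symmetric]) simp_all
 show "NF 0 (gamC (Coeff a)) (\<pi> a)"
  by (rule NFI[of x y 0 0]) (simp_all add: xy(3) mono_def)
 show "NF 1 (gamC (Creation a)) (S a)"
  by (rule NFI[of x y 1 0]) (simp_all add: Sa Sk_1 mono_def flip: xy(3))
 have "a\<star> = y\<cdot>x\<star>" by (simp add: xy(3) adj_mult adj_adj)
 moreover have "(S a)\<star>\<^sub>D = \<pi> y\<cdot>\<^sub>D (S x)\<star>\<^sub>D" unfolding Sa by (simp add: D.adj_mult D.adj_adj)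
 ultimately show "NF (-1) ((gamC (Creation a))\<star>\<^sub>Z.CP) ((S a)\<star>\<^sub>D)"
  unfolding gamC_adj(2)[OF a] by (intro NFI[of y x 0 1]) (simp_all add: Sk_1 mono_def)
qed

lemma NF_step:
 assumes a: "a\<in>|A|" and nf: "NF d c t"
 shows "NF d (gamC (Coeff a)\<cdot>\<^sub>Z.CP c) (\<pi> a\<cdot>\<^sub>D t)" "NF (1 + d) (gamC (Creation a)\<cdot>\<^sub>Z.CP c) (S a\<cdot>\<^sub>D t)"
  "NF (- 1 + d) ((gamC (Creation a))\<star>\<^sub>Z.CP\<cdot>\<^sub>Z.CP c) ((S a)\<star>\<^sub>D\<cdot>\<^sub>D t)"
proof -
 obtain k l x y where xy: "x\<in>|A|" "y\<in>|A|" "int k - int l = d" "c = mono k l (x\<cdot>y\<star>)"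
  "t = Sk k x\<cdot>\<^sub>D (Sk l y)\<star>\<^sub>D" using nf unfolding NF_def by blast
 note [simp] = a xy(1,2)
 have xyA [simp]: "x\<cdot>y\<star>\<in>|A|" by simp
 have R [simp]: "lact ((rbar ^^ j) (J b)) x\<in>|A|" if "b\<in>|A|" for j b using that by simp
 have lm: "lact ((rbar ^^ j) (J b)) (x\<cdot>y\<star>) = lact ((rbar ^^ j) (J b)) x\<cdot>y\<star>" if "b\<in>|A|" for j b
  using that by (simp add: lact_mult)
 show "NF d (gamC (Coeff a)\<cdot>\<^sub>Z.CP c) (\<pi> a\<cdot>\<^sub>D t)"
  unfolding xy(4,5) mono_moves(1)[OF a xyA] lm[OF a]
  by (rule NFI[OF R[OF a] xy(2,3)]) (simp_all add: Sk_move(1) flip: D.mult_assoc)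
 show "NF (1 + d) (gamC (Creation a)\<cdot>\<^sub>Z.CP c) (S a\<cdot>\<^sub>D t)"
  unfolding xy(4,5) mono_moves(2)[OF a xyA] lm[OF a]
  by (rule NFI[OF R[OF a] xy(2)]) (use xy(3) in \<open>simp_all add: Sk_move(2) flip: D.mult_assoc\<close>)
 show "NF (- 1 + d) ((gamC (Creation a))\<star>\<^sub>Z.CP\<cdot>\<^sub>Z.CP c) ((S a)\<star>\<^sub>D\<cdot>\<^sub>D t)"
 proof (cases k)
  case (Suc j)
  show ?thesis
   unfolding xy(4,5) Suc mono_moves(3)[OF a xyA] lm[OF adj_closed[OF a]]
   by (rule NFI[OF R[OF adj_closed[OF a]] xy(2)]) (use xy(3) Suc in \<open>simp_all add: Sk_move(3) flip: D.mult_assoc\<close>)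
 next
  case 0
  \<comment> \<open>Nothing is left to annihilate on the left, so the letter joins the right-hand
    factor: S^l(yx\<star>)S(a) = S^(l+1)(\<rho>(yx\<star>)a). The new vector is factored again,
    because the normal form needs a product wv\<star>.\<close>
  let ?b = "y\<cdot>x\<star>"
  obtain w v where wv: "w\<in>|A|" "v\<in>|A|" "lact (\<rho> ?b) a = w\<cdot>v\<star>"
   by (rule S.factor_adj[of "lact (\<rho> ?b) a"]) (simp_all del: rho_simps(2-5))
  note [simp] = wv(1,2)
  have "?b = (x\<cdot>y\<star>)\<star>" by (simp add: adj_mult adj_adj)
  then have "\<rho> ?b = (\<rho> (x\<cdot>y\<star>))\<star>\<^sub>MA" using star_hom_adj[OF hom xyA] by simp
  then have "lact (\<rho> ?b) a = (ract (\<rho> (x\<cdot>y\<star>)) (a\<star>))\<star>" using a by (simp only: mult_ops(7))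
  then have "(lact (\<rho> ?b) a)\<star> = ract (\<rho> (x\<cdot>y\<star>)) (a\<star>)" by (simp add: adj_adj del: rho_simps(2-5))
  then have c: "ract (\<rho> (x\<cdot>y\<star>)) (a\<star>) = v\<cdot>w\<star>" unfolding wv(3) by (simp add: adj_mult adj_adj del: rho_simps(2-5))
  have "(Sk l y\<cdot>\<^sub>D \<pi> (x\<star>))\<cdot>\<^sub>D S a = Sk (Suc l) w\<cdot>\<^sub>D \<pi> (v\<star>)"
   using Sk_base[of ?b a l] K.T_pi[of w "v\<star>" "Suc l"] K.T_pi[of y "x\<star>" l]
   by (simp add: wv(3) del: rho_simps(2-5) K.pi_simps(5) S.pi_simps(5))
  then have "((Sk l y\<cdot>\<^sub>D \<pi> (x\<star>))\<cdot>\<^sub>D S a)\<star>\<^sub>D = (Sk (Suc l) w\<cdot>\<^sub>D \<pi> (v\<star>))\<star>\<^sub>D" by simp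
  then have "(S a)\<star>\<^sub>D\<cdot>\<^sub>D (\<pi> x\<cdot>\<^sub>D (Sk l y)\<star>\<^sub>D) = \<pi> v\<cdot>\<^sub>D (Sk (Suc l) w)\<star>\<^sub>D"
   by (simp add: D.adj_mult D.adj_adj D.mult_assoc)
  then show ?thesis
   unfolding xy(4,5) 0 mono_moves(4)[OF a xyA] c
   by (intro NFI[of v w 0 "Suc l"]) (use xy(3) 0 in simp_all)
 qed
qed

lemma NF_word: "w\<in>words cp_gens ==> NF (deg w) (FC.wv w) (FD.wv w)"
proof (induction w)
 case (Cons l ls)
 have deg: "deg (l # ls) = deg [l] + deg ls" using deg_append[of "[l]" ls] by simp
 obtain g b where l: "l = (g, b)" by (cases l)
 have g: "g\<in>cp_gens" using Cons.prems l by (auto simp: words_def)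
 show ?case
 proof (cases "ls = []")
  case True
  from g show ?thesis
  proof
   assume "g\<in>Coeff ` |A|"
   then obtain a where a: "a\<in>|A|" "g = Coeff a" by blast
   show ?thesis
    using NF_base(1)[OF a(1)] NF_base(1)[OF adj_closed[OF a(1)]] True a
    by (cases b) (simp_all add: l FC.letter_def FD.letter_def deg_def gamC_adj(1) del: gamC_simps Z.CP_simps)
  next
   assume "g\<in>Creation ` |A|"
   then obtain a where a: "a\<in>|A|" "g = Creation a" by blast
   show ?thesis
    using NF_base(2,3)[OF a(1)] True a
    by (cases b) (simp_all add: l FC.letter_def FD.letter_def deg_def del: gamC_simps Z.CP_simps)
  qed
 next
  case False
  then have ls: "ls\<in>words cp_gens" using Cons.prems by (auto simp: words_def)
  note IH = Cons.IH[OF ls]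
  from g show ?thesis
  proof
   assume "g\<in>Coeff ` |A|"
   then obtain a where a: "a\<in>|A|" "g = Coeff a" by blast
   show ?thesis
    using NF_step(1)[OF a(1) IH] NF_step(1)[OF adj_closed[OF a(1)] IH] False a unfolding deg
    by (cases b) (simp_all add: l FC.letter_def FD.letter_def deg_def[of "[_]"] gamC_adj(1) del: gamC_simps Z.CP_simps)
  next
   assume "g\<in>Creation ` |A|"
   then obtain a where a: "a\<in>|A|" "g = Creation a" by blast
   show ?thesis
    using NF_step(2,3)[OF a(1) IH] False a unfolding deg
    by (cases b) (simp_all add: l FC.letter_def FD.letter_def deg_def[of "[_]"] del: gamC_simps Z.CP_simps)
  qed
 qed
qed (simp add: words_def)

section \<open>Comparison of norms, degree by degree\<close>

lemma iota_zero: "iota A \<rho> n \<zero>\<^sub>MA = \<zero>\<^sub>FA"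
 by (rule star_hom_zero[OF U.star_algebra_axioms F.star_algebra_axioms iota_hom])

lemma Rel_lift_to:
 assumes "Rel m T d" "m\<le>n" obtains T' where "Rel n T' d" "iota A \<rho> (int n) T' = iota A \<rho> (int m) T"
proof -
 have "\<exists>T'. Rel n T' d\<and>iota A \<rho> (int n) T' = iota A \<rho> (int m) T" using assms(2)
 proof (induction n rule: dec_induct)
  case (step n)
  then obtain T' where T': "Rel n T' d" "iota A \<rho> (int n) T' = iota A \<rho> (int m) T" by blast
  have "iota A \<rho> (int (Suc n)) (rbar T') = iota A \<rho> (int n) T'"
   using iota_succ[of T' "int n"] Rel_in[OF T'(1)] by (simp add: add.commute)
  then show ?case using Rel_lift[OF T'(1)] T'(2) by metis
 qed (use assms(1) in blast)
 then show ?thesis using that by blast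
qed

text \<open>A word of degree 0 has k = l and contributes psi_k(c) in D and c at level k in the
  crossed product, which is a pair in \<open>Rel k\<close>. Different levels are lifted to their
  maximum before they are added.\<close>

lemma ev_degree_zero:
 assumes f: "f\<in>free_carrier cp_gens" and d: "\<And>w. f w\<noteq>0 ==> deg w = 0"
 obtains m T where "Rel m T (FD.ev f)" "FC.ev f 0 = iota A \<rho> (int m) T"
proof -
 have "\<exists>m T. Rel m T (FD.ev f)\<and>FC.ev f 0 = iota A \<rho> (int m) T" using f
 proof (induction rule: free_induct)
  case zero
  show ?case using Rel_zero[of 0] iota_zero[of 0] by (intro exI[of _ 0] exI[of _ "\<zero>\<^sub>MA"]) (simp del: Rel.simps)
 next
  case (ind w)
  from NF_word[OF ind(1)] d[OF ind(2)]
  obtain k x y where xy: "x\<in>|A|" "y\<in>|A|" "FC.wv w = mono k k (x\<cdot>y\<star>)" "FD.wv w = Sk k x\<cdot>\<^sub>D (Sk k y)\<star>\<^sub>D"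
   unfolding NF_def by auto
  have "FD.wv w = K.psi k (x\<cdot>y\<star>)" unfolding xy(4) by (rule K.psi_base[symmetric, OF xy(1,2)])
  moreover have "FC.wv w 0 = iota A \<rho> (int k) (J (x\<cdot>y\<star>))" unfolding xy(3) mono_def bl_def by (simp add: Z.single_apply)
  moreover have "x\<cdot>y\<star>\<in>|A|" using xy by simp
  ultimately show ?case unfolding FC.ev_ind[OF ind(1)] FD.ev_ind[OF ind(1)] using Rel_J[of "x\<cdot>y\<star>" k] by metis
 next
  case (smult c g)
  then obtain m T where mT: "Rel m T (FD.ev g)" "FC.ev g 0 = iota A \<rho> (int m) T" by blast
  have "FC.ev (\<lambda>w. c * g w) 0 = iota A \<rho> (int m) (c\<odot>\<^sub>MA T)"
   using FC.ev_smult[OF smult(1), of c] mT(2) Rel_in[OF mT(1)] by simp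
  then show ?case using Rel_smult[OF mT(1), of c] FD.ev_smult[OF smult(1), of c] by metis
 next
  case (add g h)
  then obtain m T n T' where mT: "Rel m T (FD.ev g)" "FC.ev g 0 = iota A \<rho> (int m) T"
   "Rel n T' (FD.ev h)" "FC.ev h 0 = iota A \<rho> (int n) T'" by blast
  obtain U where U: "Rel (max m n) U (FD.ev g)" "iota A \<rho> (int (max m n)) U = FC.ev g 0"
   using Rel_lift_to[OF mT(1), of "max m n"] mT(2) by auto
  obtain V where V: "Rel (max m n) V (FD.ev h)" "iota A \<rho> (int (max m n)) V = FC.ev h 0"
   using Rel_lift_to[OF mT(3), of "max m n"] mT(4) by auto
  have "FC.ev (\<lambda>w. g w + h w) 0 = iota A \<rho> (int (max m n)) (U\<oplus>\<^sub>MA V)"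
   using FC.ev_add[OF add(1,2)] U(2) V(2) Rel_in[OF U(1)] Rel_in[OF V(1)] by simp
  then show ?case using Rel_add[OF U(1) V(1)] FD.ev_add[OF add(1,2)] by metis
 qed
 then show ?thesis using that by blast
qed

lemma FC_fs: "f\<in>free_carrier cp_gens ==> FC.ev f\<in>Z.fs"
 using FC.ev_in by simp

lemma estimate_zero:
 assumes f: "f\<in>free_carrier cp_gens" and d: "\<And>w. f w\<noteq>0 ==> deg w = 0"
 shows "||FD.ev f||\<^sub>D\<le>||FC.ev f||\<^sub>Z.CP"
proof -
 obtain m T where mT: "Rel m T (FD.ev f)" "FC.ev f 0 = iota A \<rho> (int m) T" using ev_degree_zero[OF f d] by blast
 have "||FD.ev f||\<^sub>D\<le>||FC.ev f 0||\<^sub>FB" using Rel_contractive[OF mT(1)] mT(2) Rel_in[OF mT(1)] by (simp add: iota_norm)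
 also have "\<dots>\<le>||FC.ev f||\<^sub>Z.CP" by (rule Z.CP_coeff_le[OF FC_fs[OF f]])
 finally show ?thesis .
qed

text \<open>f\<star>f has degree 0, and the C*-identity recovers f on both sides.\<close>

lemma estimate_homogeneous:
 assumes f: "f\<in>free_carrier cp_gens" and d: "\<And>w. f w\<noteq>0 ==> deg w = d"
 shows "||FD.ev f||\<^sub>D\<le>||FC.ev f||\<^sub>Z.CP"
proof (rule power2_le_imp_le)
 let ?g = "free_mult (free_adj f) f"
 have "deg w = 0" if g: "?g w\<noteq>0" for w
 proof -
  obtain u v where uv: "w = u @ v" "free_adj f u\<noteq>0" "f v\<noteq>0" using free_mult_support[OF g] by blast
  then have "deg (flip_word u) = d" by (intro d) (simp add: free_adj_def)
  then show ?thesis using d[OF uv(3)] deg_flip[of u] by (simp add: uv(1) deg_append)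
 qed
 then have "||FD.ev ?g||\<^sub>D\<le>||FC.ev ?g||\<^sub>Z.CP" using f by (intro estimate_zero) simp_all
 also have "FD.ev ?g = (FD.ev f)\<star>\<^sub>D\<cdot>\<^sub>D FD.ev f" using f by (simp add: FD.ev_mult FD.ev_adj)
 also have "FC.ev ?g = (FC.ev f)\<star>\<^sub>Z.CP\<cdot>\<^sub>Z.CP FC.ev f" using f by (simp only: FC.ev_mult FC.ev_adj free_adj_in)
 finally show "( ||FD.ev f||\<^sub>D)\<^sup>2\<le>( ||FC.ev f||\<^sub>Z.CP)\<^sup>2"
  using C.norm_cstar[OF FC.ev_in[OF f]] D.norm_cstar[OF FD.ev_in[OF f]] by simp
 show "0\<le>||FC.ev f||\<^sub>Z.CP" by (rule C.norm_nonneg[OF FC.ev_in[OF f]])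
qed

lemma graded_lin: "graded_part deg d (\<lambda>w. c * g w) = (\<lambda>w. c * graded_part deg d g w)"
 "graded_part deg d (\<lambda>w. g w + h w) = (\<lambda>w. graded_part deg d g w + graded_part deg d h w)"
 "graded_part deg d (\<lambda>w. 0) = (\<lambda>w. 0)"
 "graded_part deg d (ind w) = (if deg w = d then ind w else (\<lambda>w. 0))"
 by (auto simp: graded_part_def ind_def fun_eq_iff)

lemma ev_graded: assumes "f\<in>free_carrier cp_gens" shows "FC.ev (graded_part deg d f) = Z.single d (FC.ev f d)"
 using assms
proof (induction rule: free_induct)
 case zero
 then show ?case by (auto simp: graded_lin Z.single_def fun_eq_iff)
next
 case (ind w)
 obtain k l x y where xy: "int k - int l = deg w" "FC.wv w = mono k l (x\<cdot>y\<star>)"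
  using NF_word[OF ind(1)] unfolding NF_def by blast
 then have "FC.wv w = Z.single (deg w) (bl k (x\<cdot>y\<star>))" by (simp add: mono_def)
 then show ?case unfolding graded_lin using ind(1) by (auto simp: FC.ev_ind Z.single_def fun_eq_iff)
next
 case (smult c g)
 then show ?case unfolding graded_lin FC.ev_smult[OF graded_part_in[OF smult(1)]] FC.ev_smult[OF smult(1)]
  by (auto simp: Z.single_def fun_eq_iff)
next
 case (add g h)
 then show ?case unfolding graded_lin FC.ev_add[OF graded_part_in[OF add(1)] graded_part_in[OF add(2)]] FC.ev_add[OF add(1,2)]
  by (auto simp: Z.single_def fun_eq_iff)
qed

text \<open>A word of length at most N has one of 2N + 1 degrees. Each homogeneous part becomes a
  single coefficient in the crossed product, and its norm is bounded by that of the whole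
  element.\<close>

lemma estimate_length:
 assumes f: "f\<in>free_carrier cp_gens" and N: "\<And>w. f w\<noteq>0 ==> length w\<le>N"
 shows "||FD.ev f||\<^sub>D\<le>(1 + 2 * real N) * ||FC.ev f||\<^sub>Z.CP"
proof -
 let ?I = "{- int N..int N}"
 have "||FD.ev f||\<^sub>D\<le>(\<Sum>d\<in>?I. ||FD.ev (graded_part deg d f)||\<^sub>D)"
 proof (rule FD.norm_graded_sum[OF D.pre_cstar_axioms _ f])
  fix w assume "f w\<noteq>0"
  then show "deg w\<in>?I" using N[of w] deg_bound[of w] by auto
 qed simp
 also have "\<dots>\<le>(\<Sum>d\<in>?I. ||FC.ev f||\<^sub>Z.CP)"
 proof (rule sum_mono)
  fix d
  have "||FD.ev (graded_part deg d f)||\<^sub>D\<le>||FC.ev (graded_part deg d f)||\<^sub>Z.CP"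
   by (rule estimate_homogeneous[OF graded_part_in[OF f]]) (simp add: graded_part_def split: if_splits)
  also have "\<dots> = ||FC.ev f d||\<^sub>FB" unfolding ev_graded[OF f] by (rule Z.CP_norm_single) (rule Z.fs_in[OF FC_fs[OF f]])
  also have "\<dots>\<le>||FC.ev f||\<^sub>Z.CP" by (rule Z.CP_coeff_le[OF FC_fs[OF f]])
  finally show "||FD.ev (graded_part deg d f)||\<^sub>D\<le>||FC.ev f||\<^sub>Z.CP" .
 qed
 also have "\<dots> = (1 + 2 * real N) * ||FC.ev f||\<^sub>Z.CP" by simp
 finally show ?thesis .
qed

text \<open>The factor \<open>1 + 2 N\<close> grows only linearly in the word length, so it disappears on passing to the powers \<open>(f\<star> f)\<^bsup>2 ^ n\<^esup>\<close>.\<close>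

theorem estimate:
 assumes f: "f\<in>free_carrier cp_gens" shows "||FD.ev f||\<^sub>D\<le>||FC.ev f||\<^sub>Z.CP"
proof -
 define q where "q = rec_nat (free_mult (free_adj f) f) (\<lambda>n y. free_mult y y)"
 define N where "N = Max (insert 0 (length ` {w. f w\<noteq>0}))"
 have N: "length w\<le>N" if "f w\<noteq>0" for w
  unfolding N_def by (rule Max_ge) (use that free_finite[OF f] in auto)
 have q: "q n\<in>free_carrier cp_gens" for n by (induction n) (simp_all add: q_def f)
 have len: "length w\<le>2 * N * 2 ^ n" if "q n w\<noteq>0" for n w
  using that
 proof (induction n arbitrary: w)
  case 0
  then have "free_mult (free_adj f) f w\<noteq>0" by (simp add: q_def)
  then obtain u v where uv: "w = u @ v" "free_adj f u\<noteq>0" "f v\<noteq>0" by (rule free_mult_support)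
  then show ?case using N[of v] N[of "flip_word u"] by (simp add: free_adj_def)
 next
  case (Suc n)
  then have "free_mult (q n) (q n) w\<noteq>0" by (simp add: q_def)
  then obtain u v where uv: "w = u @ v" "q n u\<noteq>0" "q n v\<noteq>0" by (rule free_mult_support)
  then show ?case using Suc.IH[of u] Suc.IH[of v] by simp
 qed
 have FD: "FD.ev (q n) = rec_nat ((FD.ev f)\<star>\<^sub>D\<cdot>\<^sub>D FD.ev f) (\<lambda>n y. y\<cdot>\<^sub>D y) n" for n
 proof (induction n)
  case 0
  show ?case by (simp only: q_def nat.rec FD.ev_mult FD.ev_adj free_adj_in f)
 next
  case (Suc n)
  have "FD.ev (q (Suc n)) = FD.ev (free_mult (q n) (q n))" by (simp add: q_def)
  then show ?case by (simp only: FD.ev_mult q nat.rec Suc)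
 qed
 have FC: "FC.ev (q n) = rec_nat ((FC.ev f)\<star>\<^sub>Z.CP\<cdot>\<^sub>Z.CP FC.ev f) (\<lambda>n y. y\<cdot>\<^sub>Z.CP y) n" for n
 proof (induction n)
  case 0
  show ?case by (simp only: q_def nat.rec FC.ev_mult FC.ev_adj free_adj_in f)
 next
  case (Suc n)
  have "FC.ev (q (Suc n)) = FC.ev (free_mult (q n) (q n))" by (simp add: q_def)
  then show ?case by (simp only: FC.ev_mult q nat.rec Suc)
 qed
 have "(( ||FD.ev f||\<^sub>D)\<^sup>2) ^ (2 ^ n)\<le>(1 + (4 * real N) * 2 ^ n) * (( ||FC.ev f||\<^sub>Z.CP)\<^sup>2) ^ (2 ^ n)" for n
 proof -
  have "||FD.ev (q n)||\<^sub>D\<le>(1 + 2 * real (2 * N * 2 ^ n)) * ||FC.ev (q n)||\<^sub>Z.CP"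
   by (rule estimate_length[OF q]) (rule len)
  moreover have "||FD.ev (q n)||\<^sub>D = (( ||FD.ev f||\<^sub>D)\<^sup>2) ^ (2 ^ n)"
   unfolding FD using D.power_trick_aux[OF FD.ev_in[OF f], of n] by (simp add: power_mult)
  moreover have "||FC.ev (q n)||\<^sub>Z.CP = (( ||FC.ev f||\<^sub>Z.CP)\<^sup>2) ^ (2 ^ n)"
   unfolding FC using C.power_trick_aux[OF FC.ev_in[OF f], of n] by (simp only: power_Suc power_mult)
  ultimately show ?thesis by (simp add: mult.assoc)
 qed
 then have "( ||FD.ev f||\<^sub>D)\<^sup>2\<le>( ||FC.ev f||\<^sub>Z.CP)\<^sup>2"
  by (rule power_le_poly[rotated 2]) simp_all
 then show ?thesis by (rule power2_le_imp_le) (rule C.norm_nonneg[OF FC.ev_in[OF f]])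
qed

end

section \<open>The universal norm\<close>

context endo
begin

abbreviation "XX\<equiv>completion Z.CP"
abbreviation "tc\<equiv>to_completion Z.CP"

sublocale X: cstar_algebra XX by (rule C.cstar_completion)

definition piX :: "'a=>(nat=>int=>'a dilated) set" where "piX a = tc (gamC (Coeff a))"
definition SX :: "'a=>(nat=>int=>'a dilated) set" where "SX x = tc (gamC (Creation x))"

lemma bl_FB_hom: "star_hom A FB (bl n)"
 using bl_hom[of n] bl_in unfolding star_hom_def by simp

lemma single0_hom: "star_hom FB Z.CP (Z.single 0)"
 unfolding star_hom_def
proof (intro conjI allI ballI funcsetI)
 fix x y c assume [simp]: "x\<in>|FB|" "y\<in>|FB|"
 show "Z.single 0 (x\<cdot>\<^sub>FB y) = Z.single 0 x\<cdot>\<^sub>Z.CP Z.single 0 y"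
  by (subst conv_single) simp_all
 show "Z.single 0 (x\<star>\<^sub>FB) = (Z.single 0 x)\<star>\<^sub>Z.CP"
  by (simp add: Z.fadj_single)
 show "Z.single 0 x\<in>|Z.CP|" by simp
qed (auto simp: Z.single_def fun_eq_iff)

lemma single_add: "x\<in>|FB| ==> y\<in>|FB| ==> Z.single n (x\<oplus>\<^sub>FA y) = Z.single n x\<oplus>\<^sub>Z.CP Z.single n y"
 and single_smult: "x\<in>|FB| ==> Z.single n (c\<odot>\<^sub>FA x) = c\<odot>\<^sub>Z.CP Z.single n x"
 by (auto simp: Z.single_def fun_eq_iff)

lemma tc_in [simp]: "f\<in>Z.fs ==> tc f\<in>|XX|"
 by (rule C.to_completion_in) simp

lemma tc_mult: "f\<in>Z.fs ==> g\<in>Z.fs ==> tc f\<cdot>\<^sub>XX tc g = tc (f\<cdot>\<^sub>Z.CP g)"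
 by (rule star_hom_mult[OF C.to_completion_hom, symmetric]) simp_all

lemma tc_adj: "f\<in>Z.fs ==> (tc f)\<star>\<^sub>XX = tc (f\<star>\<^sub>Z.CP)"
 by (rule star_hom_adj[OF C.to_completion_hom, symmetric]) simp

lemma tc_single_mult: "a\<in>|FB| ==> b\<in>|FB| ==>
  tc (Z.single m a)\<cdot>\<^sub>XX tc (Z.single k b) = tc (Z.single (m + k) (a\<cdot>\<^sub>FA Z.ap m b))"
 by (simp only: tc_mult Z.single_in conv_single)

lemma tc_single_adj: "a\<in>|A| ==> (tc (Z.single 1 (bl 1 a)))\<star>\<^sub>XX = tc (Z.single (-1) (bl 0 (a\<star>)))"
 using tc_adj[of "Z.single 1 (bl 1 a)"] gamC_adj(2)[of a] by (simp del: Z.CP_simps)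

text \<open>The homomorphism on compact operators is the copy of A at level 1 in degree 0. The
  remaining relation then reads iota_1(\<rho>(a)) = iota_0(a), which is compatibility of the
  inductive system.\<close>

lemma covariant_rep_X: "covariant_rep A \<rho> XX piX SX"
proof -
 have h: "star_hom A XX (\<lambda>a. tc (Z.single 0 (bl n a)))" for n
  using star_hom_comp[OF star_hom_comp[OF bl_FB_hom single0_hom] C.to_completion_hom] by (simp add: comp_def)
 have pi: "piX = (\<lambda>a. tc (Z.single 0 (bl 0 a)))" by (simp add: piX_def fun_eq_iff)
 have S: "SX = (\<lambda>x. tc (Z.single 1 (bl 1 x)))" by (simp add: SX_def fun_eq_iff)
 have [simp]: "Z.single n (bl m a)\<in>Z.fs" if "a\<in>|A|" for n m a using that by simp
 note bs = star_hom_simps[OF bl_hom]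
 have pp: "bl n a\<cdot>\<^sub>FA bl n b = bl n (a\<cdot>b)" if "a\<in>|A|" "b\<in>|A|" for n a b
  using that by (rule star_hom_mult[OF bl_hom, symmetric])
 show ?thesis
  unfolding covariant_rep_def
 proof (intro conjI ballI allI funcsetI)
  show "star_hom A XX piX" unfolding pi by (rule h)
 next
  fix x c assume x: "x\<in>|A|"
  show "SX x\<in>|XX|" using x by (simp add: S)
  show "SX (c\<odot>x) = c\<odot>\<^sub>XX SX x"
   unfolding S using x single_smult[of "bl 1 x" 1 c] C.to_completion_hom by (simp add: bs star_hom_smult del: Z.CP_simps(4))
 next
  fix x y assume x: "x\<in>|A|" and y: "y\<in>|A|"
  show "SX (x\<oplus>y) = SX x\<oplus>\<^sub>XX SX y"
   unfolding S using x y single_add[of "bl 1 x" "bl 1 y" 1] C.to_completion_hom by (simp add: bs star_hom_add del: Z.CP_simps(2))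
  show "(SX x)\<star>\<^sub>XX\<cdot>\<^sub>XX SX y = piX (x\<star>\<cdot>y)"
   unfolding pi S using x y by (simp add: tc_single_adj tc_single_mult pp)
 next
  fix a x b assume a: "a\<in>|A|" and x: "x\<in>|A|" and b: "b\<in>|A|"
  have m: "bl 0 a\<cdot>\<^sub>FA bl 1 x = bl 1 (lact (\<rho> a) x)" using bl_bl[OF a x, of 0 1] a by simp
  show "piX a\<cdot>\<^sub>XX SX x\<cdot>\<^sub>XX piX b = SX (lact (\<rho> a) (x\<cdot>b))"
   unfolding pi S using a x b by (simp add: tc_single_mult m pp lact_mult)
 next
  show "\<exists>\<psi>. star_hom A XX \<psi>\<and>(\<forall>x\<in>|A|. \<forall>y\<in>|A|. \<psi> (x\<cdot>y\<star>) = SX x\<cdot>\<^sub>XX (SX y)\<star>\<^sub>XX)\<and>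
    (\<forall>a\<in>|A|. \<forall>c\<in>|A|. \<rho> a = J c\<longrightarrow>piX a = \<psi> c)"
  proof (intro exI[of _ "\<lambda>a. tc (Z.single 0 (bl 1 a))"] conjI ballI impI)
   show "star_hom A XX (\<lambda>a. tc (Z.single 0 (bl 1 a)))" by (rule h)
  next
   fix x y assume x: "x\<in>|A|" and y: "y\<in>|A|"
   show "tc (Z.single 0 (bl 1 (x\<cdot>y\<star>))) = SX x\<cdot>\<^sub>XX (SX y)\<star>\<^sub>XX"
    unfolding S using x y by (simp add: tc_single_adj tc_single_mult pp)
  next
   fix a c assume "a\<in>|A|" "c\<in>|A|" "\<rho> a = J c"
   then have "bl 0 a = bl 1 c" using iota_succ[of "J a" 0] by (simp add: bl_def)
   then show "piX a = tc (Z.single 0 (bl 1 c))" unfolding pi by simp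
  qed
 qed
qed

text \<open>Admissibility asks for the relations inside the completion of the free algebra, whereas
  they are known in the crossed product. Equations pull back along an injective homomorphism; the
  existence of \<psi> also does, because c = bd makes \<psi>(c) a product of elements that already
  lie in the image.\<close>

lemma covariant_rep_pullback:
 assumes E: "star_algebra E" and h: "star_hom E B \<theta>" and inj: "inj_on \<theta> ( |E| )"
  and pS: "\<And>a. a\<in>|A| ==> \<pi> a\<in>|E|" "\<And>a. a\<in>|A| ==> S a\<in>|E|"
  and cv: "covariant_rep A \<rho> B (\<lambda>a. \<theta> (\<pi> a)) (\<lambda>x. \<theta> (S x))"
 shows "covariant_rep A \<rho> E \<pi> S"
proof -
 interpret E: star_algebra E by fact
 note hs = star_hom_simps[OF h] and eqI = inj_onD[OF inj]
 obtain \<psi> where psi: "star_hom A B \<psi>" "\<And>x y. x\<in>|A| ==> y\<in>|A| ==> \<psi> (x\<cdot>y\<star>) = \<theta> (S x)\<cdot>\<^sub>B (\<theta> (S y))\<star>\<^sub>B"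
  "\<And>a c. a\<in>|A| ==> c\<in>|A| ==> \<rho> a = J c ==> \<theta> (\<pi> a) = \<psi> c"
  using cv unfolding covariant_rep_def by blast
 note ps = star_hom_simps[OF psi(1)]
 define \<tau> where "\<tau> c = inv_into ( |E| ) \<theta> (\<psi> c)" for c
 have chi: "\<tau> c\<in>|E|\<and>\<theta> (\<tau> c) = \<psi> c" if c: "c\<in>|A|" for c
 proof -
  obtain b d where bd: "b\<in>|A|" "d\<in>|A|" "c = b\<cdot>d" by (rule factor[OF c])
  then have "\<psi> c = \<theta> (S b\<cdot>\<^sub>E (S (d\<star>))\<star>\<^sub>E)" using psi(2)[of b "d\<star>"] by (simp add: adj_adj hs pS)
  then have "\<psi> c\<in>\<theta> ` |E|" using bd pS by simp
  then show ?thesis unfolding \<tau>_def by (simp add: inv_into_into f_inv_into_f)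
 qed
 have p: "star_hom A B (\<lambda>a. \<theta> (\<pi> a))" using cv by (simp add: covariant_rep_def)
 note pis = star_hom_simps[OF p]
 have 1: "star_hom A E \<pi>"
  unfolding star_hom_def by (intro conjI ballI allI funcsetI; (rule eqI)?; simp add: pS hs pis)
 have 2: "star_hom A E \<tau>"
  unfolding star_hom_def by (intro conjI ballI allI funcsetI; (rule eqI)?; simp add: chi hs ps)
 have 3: "\<tau> (x\<cdot>y\<star>) = S x\<cdot>\<^sub>E (S y)\<star>\<^sub>E" if "x\<in>|A|" "y\<in>|A|" for x y
  by (rule eqI) (use that psi(2) in \<open>simp_all add: chi hs pS\<close>)
 have 4: "\<pi> a = \<tau> c" if "a\<in>|A|" "c\<in>|A|" "\<rho> a = J c" for a c
  by (rule eqI) (use that psi(3) in \<open>simp_all add: chi pS\<close>)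
 have 5: "S (x\<oplus>y) = S x\<oplus>\<^sub>E S y" "S (k\<odot>x) = k\<odot>\<^sub>E S x"
  "(S x)\<star>\<^sub>E\<cdot>\<^sub>E S y = \<pi> (x\<star>\<cdot>y)" if "x\<in>|A|" "y\<in>|A|" for x y k
  by (rule eqI; use that cv in \<open>simp add: covariant_rep_def hs pS\<close>)+
 have 6: "\<pi> a\<cdot>\<^sub>E S x\<cdot>\<^sub>E \<pi> b = S (lact (\<rho> a) (x\<cdot>b))" if "a\<in>|A|" "x\<in>|A|" "b\<in>|A|" for a x b
  by (rule eqI) (use that cv in \<open>simp_all add: covariant_rep_def hs pS\<close>)
 show ?thesis unfolding covariant_rep_def
  by (intro conjI ballI allI funcsetI exI[of _ \<tau>] impI 1 2 pS(2)) (simp_all only: 3 4 5 6)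
qed

abbreviation "cp_rel\<equiv>\<lambda>D \<gamma>. covariant_rep A \<rho> D (\<lambda>a. \<gamma> (Coeff a)) (\<lambda>x. \<gamma> (Creation x))"

abbreviation "FP\<equiv>free_star_algebra cp_gens"

lemma gen_in: "a\<in>|A| ==> free_gen (Coeff a)\<in>free_carrier cp_gens" "a\<in>|A| ==> free_gen (Creation a)\<in>free_carrier cp_gens"
 unfolding free_gen_ind by (rule free_ind, simp add: words_def)+

lemma pre_cstar_FP:
 assumes "cstar_seminorm (FP p) p" shows "pre_cstar (FP p)"
proof -
 have "cnorm (FP p) = p" by (simp add: free_star_algebra_def)
 then show ?thesis using assms by (intro pre_cstar.intro star_algebra_free pre_cstar_axioms.intro) simp
qed

text \<open>The separated completion for p is itself a C*-algebra with a covariant representation,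
  so \<open>estimate\<close> applies there, and p is the norm of the canonical image.\<close>

lemma admissible_le:
 assumes p: "admissible cp_gens cp_rel p" and f: "f\<in>free_carrier cp_gens"
 shows "p f\<le>||FC.ev f||\<^sub>Z.CP"
proof -
 let ?q = "to_completion (FP p)" and ?D = "completion (FP p)"
 interpret P: pre_cstar "FP p" using p by (intro pre_cstar_FP) (simp add: admissible_def)
 interpret D: cstar_algebra ?D by (rule P.cstar_completion)
 interpret V: cov A e \<rho> ?D "\<lambda>a. ?q (free_gen (Coeff a))" "\<lambda>x. ?q (free_gen (Creation x))"
  by unfold_locales (use p in \<open>simp add: admissible_def\<close>)
 have "?q f = V.FD.ev f" by (rule V.FD.hom_eq_ev[OF P.to_completion_hom _ f]) auto
 moreover have "||?q f||\<^bsub>?D\<^esub> = p f" using P.to_completion_norm[of f] f by simp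
 ultimately show ?thesis using V.estimate[OF f] by simp
qed

definition embeds :: "(('a cp_generator star_word=>complex)=>real)=>((nat=>'a cp_generator star_word=>complex) set=>(nat=>int=>'a dilated) set)=>bool" where
 "embeds p \<theta>\<longleftrightarrow>star_hom (completion (FP p)) XX \<theta>\<and>(\<forall>f\<in>free_carrier cp_gens. \<theta> (to_completion (FP p) f) = tc (FC.ev f))\<and>
  (\<forall>x\<in>carrier (completion (FP p)). ||\<theta> x||\<^sub>XX = ||x||\<^bsub>completion (FP p)\<^esub>)\<and>
  \<theta> ` carrier (completion (FP p)) = norm_topology XX closure_of ((\<lambda>f. tc (FC.ev f)) ` free_carrier cp_gens)"

context
 fixes p assumes p: "\<And>f. f\<in>free_carrier cp_gens ==> p f = ||FC.ev f||\<^sub>Z.CP"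
begin

text \<open>p is prescribed on the carrier only. So the results of this block apply to the crossed
  product norm itself, which yields \<open>universal_norm\<close>, and then to the supremum over all
  admissible seminorms.\<close>

lemma seminorm_FP: "cstar_seminorm (FP p) p"
 unfolding cstar_seminorm_def
proof (intro conjI ballI allI; simp only: free_simps)
 fix f c assume f: "f\<in>free_carrier cp_gens"
 note fC = FC.ev_in[OF f]
 show "0\<le>p f" unfolding p[OF f] by (rule C.norm_nonneg[OF fC])
 show "p (\<lambda>w. c * f w) = cmod c * p f" unfolding p[OF f] p[OF free_smult[OF f]] FC.ev_smult[OF f] by (rule C.norm_smult[OF fC])
 show "p (free_mult (free_adj f) f) = (p f)\<^sup>2"
  unfolding p[OF f] p[OF free_mult_in[OF free_adj_in[OF f] f]] FC.ev_mult[OF free_adj_in[OF f] f] FC.ev_adj[OF f]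
  by (rule C.norm_cstar[OF fC])
 fix g assume g: "g\<in>free_carrier cp_gens"
 note gC = FC.ev_in[OF g]
 show "p (\<lambda>w. f w + g w)\<le>p f + p g"
  unfolding p[OF f] p[OF g] p[OF free_add[OF f g]] FC.ev_add[OF f g] by (rule C.norm_triangle[OF fC gC])
 show "p (free_mult f g)\<le>p f * p g"
  unfolding p[OF f] p[OF g] p[OF free_mult_in[OF f g]] FC.ev_mult[OF f g] by (rule C.norm_mult[OF fC gC])
qed

lemma FP_extend: "\<exists>\<theta>. embeds p \<theta>"
proof -
 have h: "star_hom (FP p) XX (\<lambda>f. tc (FC.ev f))"
  using star_hom_comp[OF FC.ev_hom C.to_completion_hom, of p] by (simp add: comp_def)
 have n: "||tc (FC.ev f)||\<^sub>XX = ||f||\<^bsub>FP p\<^esub>" if "f\<in>carrier (FP p)" for f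
  using that C.to_completion_norm[OF FC.ev_in[of f]] p[of f] by simp
 show ?thesis
  by (rule completion_extend[OF pre_cstar_FP[OF seminorm_FP] X.cstar_algebra_axioms h n], assumption)
   (rule exI, unfold embeds_def free_simps, intro conjI ballI; assumption)
qed

text \<open>The completion for p embeds isometrically in the crossed product, with the generators
  going to \<open>piX\<close> and \<open>SX\<close>; the relations are pulled back along this
  embedding.\<close>

lemma admissible_FP: "admissible cp_gens cp_rel p"
 unfolding admissible_def
proof (intro conjI seminorm_FP)
 let ?q = "to_completion (FP p)" and ?D = "completion (FP p)"
 interpret P: pre_cstar "FP p" by (rule pre_cstar_FP[OF seminorm_FP])
 interpret D: cstar_algebra ?D by (rule P.cstar_completion)
 obtain \<theta> where "embeds p \<theta>" using FP_extend by blast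
 then have \<theta>: "star_hom ?D XX \<theta>" "\<And>f. f\<in>free_carrier cp_gens ==> \<theta> (?q f) = tc (FC.ev f)"
  "\<And>x. x\<in>|?D| ==> ||\<theta> x||\<^sub>XX = ||x||\<^bsub>?D\<^esub>" unfolding embeds_def by simp_all
 have g: "\<theta> (?q (free_gen (Coeff a))) = piX a" "\<theta> (?q (free_gen (Creation a))) = SX a" if "a\<in>|A|" for a
  using that FC.ev_gen[of "Coeff a"] FC.ev_gen[of "Creation a"] by (simp_all add: \<theta>(2) gen_in piX_def SX_def del: gamC_simps)
 show "covariant_rep A \<rho> ?D (\<lambda>a. ?q (free_gen (Coeff a))) (\<lambda>x. ?q (free_gen (Creation x)))"
 proof (rule covariant_rep_pullback[OF D.star_algebra_axioms \<theta>(1) isometric_inj[OF D.cstar_algebra_axioms X.cstar_algebra_axioms \<theta>(1,3)]])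
  show "covariant_rep A \<rho> XX (\<lambda>a. \<theta> (?q (free_gen (Coeff a)))) (\<lambda>x. \<theta> (?q (free_gen (Creation x))))"
   using covariant_rep_X unfolding covariant_rep_def star_hom_def by (simp add: g Pi_iff cong: conj_cong)
 qed (simp_all add: P.to_completion_in gen_in)
qed

end

lemma universal_norm:
 assumes f: "f\<in>free_carrier cp_gens"
 shows "Sup {p f | p. admissible cp_gens cp_rel p} = ||FC.ev f||\<^sub>Z.CP"
proof (rule cSup_eq_maximum)
 have "admissible cp_gens cp_rel (\<lambda>f. ||FC.ev f||\<^sub>Z.CP)" by (rule admissible_FP) simp
 then show "||FC.ev f||\<^sub>Z.CP\<in>{p f | p. admissible cp_gens cp_rel p}"
  by (intro CollectI exI[of _ "\<lambda>f. ||FC.ev f||\<^sub>Z.CP"] conjI refl)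
 show "x\<le>||FC.ev f||\<^sub>Z.CP" if "x\<in>{p f | p. admissible cp_gens cp_rel p}" for x
  using that admissible_le[OF _ f] by blast
qed

abbreviation "KX\<equiv>norm_topology XX closure_of ((\<lambda>f. tc (FC.ev f)) ` free_carrier cp_gens)"

lemma cuntz_pimsner_embedding:
 obtains \<theta> where "star_hom (cuntz_pimsner A \<rho>) XX \<theta>" "\<theta> ` carrier (cuntz_pimsner A \<rho>) = KX" "inj_on \<theta> (carrier (cuntz_pimsner A \<rho>))"
  "cstar_algebra (cuntz_pimsner A \<rho>)"
proof -
 let ?p = "\<lambda>f. Sup {p f | p. admissible cp_gens cp_rel p}"
 have cp: "cuntz_pimsner A \<rho> = completion (FP ?p)"
  by (simp add: cuntz_pimsner_def universal_cstar_algebra_def)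
 obtain \<theta> where "embeds ?p \<theta>" using FP_extend[OF universal_norm] by blast
 then have \<theta>: "star_hom (completion (FP ?p)) XX \<theta>"
  "\<And>x. x\<in>carrier (completion (FP ?p)) ==> ||\<theta> x||\<^sub>XX = ||x||\<^bsub>completion (FP ?p)\<^esub>"
  "\<theta> ` carrier (completion (FP ?p)) = KX" unfolding embeds_def by simp_all
 interpret P: pre_cstar "FP ?p" by (rule pre_cstar_FP[OF seminorm_FP[OF universal_norm]])
 show ?thesis
  using that[of \<theta>] \<theta>(1,3) isometric_inj[OF P.cstar_completion X.cstar_algebra_axioms \<theta>(1,2)] P.cstar_completion
  unfolding cp by blast
qed

end

section \<open>The hereditary subalgebra\<close>

context cstar_algebra
begin

lemma right_unit_lim:
 assumes E: "\<And>n. E n\<in>|A|" "\<And>n. ||E n||\<le>1" and s: "\<And>k. tends A (\<lambda>n. s k\<cdot>E n) (s k)" and z: "tends A s z"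
 shows "tends A (\<lambda>n. z\<cdot>E n) z"
proof -
 note [simp] = E(1) tends_in[OF z]
 have "\<exists>N. \<forall>n\<ge>N. ||z\<cdot>E n\<ominus>z|| < r" if r: "r > 0" for r
 proof -
  obtain k where k: "||z\<ominus>s k|| < r / 3" using tends_epsE[OF z, of "r / 3"] r by auto
  have "(\<lambda>n. ||s k\<cdot>E n\<ominus>s k||)\<longlonglongrightarrow>0" using s[of k] by (simp add: tends_def)
  from LIMSEQ_D[OF this, of "r / 3"] r obtain N where N: "\<And>n. n\<ge>N ==> norm ( ||s k\<cdot>E n\<ominus>s k|| - 0) < r / 3" by auto
  have "||z\<cdot>E n\<ominus>z|| < r" if n: "n\<ge>N" for n
  proof -
   have "||z\<cdot>E n\<ominus>s k\<cdot>E n||\<le>||z\<ominus>s k|| * ||E n||" by (simp add: norm_mult flip: distrib_right_diff)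
   also have "\<dots>\<le>||z\<ominus>s k|| * 1" using E(2) by (intro mult_left_mono) simp_all
   finally have a: "||z\<cdot>E n\<ominus>s k\<cdot>E n|| < r / 3" using k by simp
   have b: "||s k\<cdot>E n\<ominus>s k|| < r / 3" using N[OF n] by simp
   have c: "||s k\<ominus>z|| < r / 3" using k norm_diff_commute[of z "s k"] by simp
   show ?thesis
    using norm_dist_triangle[of "z\<cdot>E n" "s k\<cdot>E n" z] norm_dist_triangle[of "s k\<cdot>E n" "s k" z] a b c by simp
  qed
  then show ?thesis by blast
 qed
 then show ?thesis unfolding tends_def lim_sequentially by simp
qed

text \<open>With \<open>h = y\<star> y + g\<star> g\<close> one has \<open>(y E - y)\<star> (y E - y) + (g E - g)\<star> (g E - g) = E (h E - h) - (h E - h)\<close>.\<close>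

lemma dominated_unit:
 assumes E: "\<And>n. E n\<in>|A|" "\<And>n. ||E n||\<le>1" "\<And>n. (E n)\<star> = E n"
  and h: "tends A (\<lambda>n. h\<cdot>E n) h" and y: "y\<in>|A|" and g: "g\<in>|A|" and eq: "h = y\<star>\<cdot>y\<oplus>g\<star>\<cdot>g"
 shows "tends A (\<lambda>n. y\<cdot>E n) y"
proof -
 note [simp] = E(1,3) y g
 have [simp]: "h\<in>|A|" by (simp add: eq)
 have b: "||y\<cdot>E n\<ominus>y||\<^sup>2\<le>2 * ||h\<cdot>E n\<ominus>h||" for n
 proof -
  let ?p = "y\<cdot>E n\<ominus>y" and ?q = "g\<cdot>E n\<ominus>g" and ?r = "h\<cdot>E n\<ominus>h"
  have "?p\<star>\<cdot>?p\<oplus>?q\<star>\<cdot>?q = E n\<cdot>?r\<ominus>?r"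
   unfolding eq by (simp add: adj_diff adj_mult expand mult_assoc) ((simp add: expand)?; (rule linI, (rule lins | (simp add: algebra_simps; fail))+))
  then have "||?p\<star>\<cdot>?p||\<le>||E n\<cdot>?r\<ominus>?r||" using Pos_norm_mono[OF Pos_cstar Pos_cstar, of ?p ?q] by simp
  also have "\<dots>\<le>||E n\<cdot>?r|| + ||?r||" by (rule norm_diff_triangle) simp_all
  also have "||E n\<cdot>?r||\<le>1 * ||?r||" by (rule order_trans[OF norm_mult mult_right_mono[OF E(2)]]) simp_all
  finally show ?thesis by (simp add: norm_cstar)
 qed
 show ?thesis
 proof (rule tendsI)
  show "||y\<cdot>E n\<ominus>y||\<le>sqrt (2 * ||h\<cdot>E n\<ominus>h||)" for n by (rule real_le_rsqrt[OF b])
  have "(\<lambda>n. sqrt (2 * ||h\<cdot>E n\<ominus>h||))\<longlonglongrightarrow>sqrt (2 * 0)"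
   using h by (intro tendsto_intros) (simp add: tends_def)
  then show "(\<lambda>n. sqrt (2 * ||h\<cdot>E n\<ominus>h||))\<longlonglongrightarrow>0" by simp
 qed auto
qed

text \<open>(vh)\<star>(vh) lies below a multiple of h\<star>h, which belongs to T. The summand 1 in
  \<open>t\<close> keeps it positive when v = 0.\<close>

lemma hereditary_cstar:
 assumes T: "hereditary A T" and h: "h\<in>T" and v: "v\<in>|A|" shows "(v\<cdot>h)\<star>\<cdot>(v\<cdot>h)\<in>T"
proof -
 have sub: "submodule T complex_ring A" and c: "\<And>x y. x\<in>T ==> y\<in>T ==> x\<cdot>y\<in>T" "\<And>x. x\<in>T ==> x\<star>\<in>T"
  using T by (auto simp: hereditary_def cstar_subalgebra_def)
 note [simp] = v submodule_in[OF sub h]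
 define t where "t = ||v||\<^sup>2 + 1"
 have t: "0 < t" "||v||\<^sup>2\<le>t" by (simp_all add: t_def add_nonneg_pos)
 let ?k = "of_real t\<odot>(h\<star>\<cdot>h)"
 have k: "?k\<in>T" by (intro submodule_smult[OF sub] c h)
 have "?k = (of_real (sqrt t)\<odot>h)\<star>\<cdot>(of_real (sqrt t)\<odot>h)"
  using t by (simp add: adj_smult smult_mult_left smult_mult_right flip: of_real_mult)
 then have "cpos A ?k" unfolding cpos_def by (intro bexI[of _ "of_real (sqrt t)\<odot>h"]) simp_all
 moreover have "cpos A ((v\<cdot>h)\<star>\<cdot>(v\<cdot>h))" unfolding cpos_def by (intro bexI[of _ "v\<cdot>h"]) simp_all
 moreover have "cpos A (?k\<ominus>(v\<cdot>h)\<star>\<cdot>(v\<cdot>h))" by (rule cpos_sandwich) (use t in simp_all)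
 moreover have "(v\<cdot>h)\<star>\<cdot>(v\<cdot>h)\<in>|A|" by simp
 ultimately show ?thesis using T k unfolding hereditary_def by blast
qed

text \<open>Polarization: \<open>4 z\<star> w = \<Sum>k. i\<^sup>k (w + i\<^sup>k z)\<star> (w + i\<^sup>k z)\<close>.\<close>

lemma hereditary_sandwich:
 assumes T: "hereditary A T" and h: "h\<in>T" "h\<star> = h" and z: "z\<in>|A|" and w: "w\<in>|A|"
 shows "h\<cdot>(z\<star>\<cdot>w)\<cdot>h\<in>T"
proof -
 have sub: "submodule T complex_ring A" using T by (auto simp: hereditary_def cstar_subalgebra_def)
 note [simp] = z w submodule_in[OF sub h(1)]
 define p where "p c = ((w\<oplus>c\<odot>z)\<cdot>h)\<star>\<cdot>((w\<oplus>c\<odot>z)\<cdot>h)" for c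
 have p: "p c\<in>T" for c unfolding p_def by (rule hereditary_cstar[OF T h(1)]) simp
 define zz zw wz ww where "zz = h\<cdot>(z\<star>\<cdot>(z\<cdot>h))" and "zw = h\<cdot>(z\<star>\<cdot>(w\<cdot>h))"
  and "wz = h\<cdot>(w\<star>\<cdot>(z\<cdot>h))" and "ww = h\<cdot>(w\<star>\<cdot>(w\<cdot>h))"
 have [simp]: "zz\<in>|A|" "zw\<in>|A|" "wz\<in>|A|" "ww\<in>|A|" by (simp_all add: zz_def zw_def wz_def ww_def)
 have pe: "p c = ww\<oplus>c\<odot>wz\<oplus>cnj c\<odot>zw\<oplus>(c * cnj c)\<odot>zz" for c
 proof -
  have "p c = (ww\<oplus>c\<odot>wz)\<oplus>(cnj c\<odot>zw\<oplus>(cnj c * c)\<odot>zz)"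
   unfolding p_def zz_def zw_def wz_def ww_def
   by (simp add: adj_mult adj_add adj_smult h(2) mult_assoc distrib_left distrib_right smult_mult_left smult_mult_right smult_add_right M.a_ac mult.commute)
  then show ?thesis by (simp add: M.a_assoc mult.commute)
 qed
 have "zw = (1/4)\<odot>(p 1\<oplus>\<i>\<odot>p \<i>\<oplus>(-1)\<odot>p (-1)\<oplus>(-\<i>)\<odot>p (-\<i>))"
  unfolding pe by (rule linI, (rule lins | (simp; fail))+) (simp add: algebra_simps)
 moreover have "\<dots>\<in>T" by (intro submodule_smult[OF sub] submodule_add[OF sub] p)
 moreover have "h\<cdot>(z\<star>\<cdot>w)\<cdot>h = zw" by (simp add: zw_def mult_assoc)
 ultimately show ?thesis by simp
qed

end

context cov
begin

lemma pi_e: "(\<pi> (e n))\<star>\<^sub>D = \<pi> (e n)" "||\<pi> (e n)||\<^sub>D\<le>1"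
 using star_hom_adj[OF S.pi_hom e_in[of n]]
  order_trans[OF star_hom_contractive[OF cstar_algebra_axioms D.cstar_algebra_axioms S.pi_hom] e_norm[of n]] by simp_all

lemma pi_e_Sk: "x\<in>|A| ==> tends D (\<lambda>n. \<pi> (e n)\<cdot>\<^sub>D Sk k x) (Sk k x)"
proof (induction k arbitrary: x)
 case 0
 then show ?case using K.T_tends[OF e_left[OF 0], of 0] by simp
next
 case (Suc k)
 obtain b c where bc: "b\<in>|A|" "c\<in>|A|" "x = lact (\<rho> b) c" by (rule rho_factor[OF Suc.prems])
 have "tends D (\<lambda>n. (\<pi> (e n)\<cdot>\<^sub>D Sk k b)\<cdot>\<^sub>D S c) (Sk k b\<cdot>\<^sub>D S c)"
  using bc by (intro D.tends_mult D.tends_const Suc.IH) auto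
 then show ?case using bc by (simp add: Sk_base D.mult_assoc)
qed

text \<open>A word ends in S^l(y)\<star>, and \<pi>(e_n) is a left approximate unit on the range of
  S^l because it is one for the innermost \<pi>(b).\<close>

lemma ev_right_unit: "f\<in>free_carrier cp_gens ==> tends D (\<lambda>n. FD.ev f\<cdot>\<^sub>D \<pi> (e n)) (FD.ev f)"
proof (induction rule: free_induct)
 case (ind w)
 obtain k l x y where xy: "x\<in>|A|" "y\<in>|A|" "FD.wv w = Sk k x\<cdot>\<^sub>D (Sk l y)\<star>\<^sub>D"
  using NF_word[OF ind(1)] unfolding NF_def by blast
 have "tends D (\<lambda>n. Sk k x\<cdot>\<^sub>D (\<pi> (e n)\<cdot>\<^sub>D Sk l y)\<star>\<^sub>D) (Sk k x\<cdot>\<^sub>D (Sk l y)\<star>\<^sub>D)"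
  using xy by (intro D.tends_mult D.tends_const D.tends_adj pi_e_Sk) auto
 then show ?case using xy by (simp add: FD.ev_ind[OF ind(1)] D.adj_mult D.mult_assoc pi_e del: S.pi_simps(5))
next
 case zero
 show ?case using D.tends_const[of "\<zero>\<^sub>D"] by simp
next
 case (smult c g)
 then show ?case using D.tends_smult[OF smult(2), of c] by (simp add: FD.ev_smult D.smult_mult_left)
next
 case (add g h)
 then show ?case using D.tends_add[OF add(3,4)] by (simp add: FD.ev_add D.distrib_right)
qed

lemma S_sandwich: assumes x: "x\<in>|A|" shows "tends D (\<lambda>n. \<pi> (e n)\<cdot>\<^sub>D S x\<cdot>\<^sub>D \<pi> (e n)) (S x)"
proof (rule D.sandwich_tends)
 show "tends D (\<lambda>n. \<pi> (e n)\<cdot>\<^sub>D S x) (S x)" using pi_e_Sk[OF x, of 1] x by (simp add: Sk_1)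
 show "tends D (\<lambda>n. S x\<cdot>\<^sub>D \<pi> (e n)) (S x)" using S.T_tends[OF e_right[OF x]] x by (simp add: S.T_pi)
qed (simp_all add: pi_e)

text \<open>S(x) = S(b)\<pi>(c) has the form z\<star>w, so its compressions by \<pi>(e_n) lie in T
  by polarization, and they converge to S(x). Thus the generators in degree 1 belong to any
  hereditary subalgebra that contains the copy of A.\<close>

lemma S_in_hereditary:
 assumes T: "hereditary D T" and sub: "\<pi> ` |A|\<subseteq>T" and x: "x\<in>|A|" shows "S x\<in>T"
proof -
 obtain b c where bc: "b\<in>|A|" "c\<in>|A|" "x = b\<cdot>c" by (rule factor[OF x])
 have S: "S x = ((S b)\<star>\<^sub>D)\<star>\<^sub>D\<cdot>\<^sub>D \<pi> c" using bc by (simp add: D.adj_adj S.T_pi)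
 have "closedin (norm_topology D) T" using T by (simp add: hereditary_def cstar_subalgebra_def)
 then show ?thesis
 proof (rule D.closedin_tends[OF _ _ S_sandwich[OF x]])
  show "\<pi> (e n)\<cdot>\<^sub>D S x\<cdot>\<^sub>D \<pi> (e n)\<in>T" for n
   unfolding S by (rule D.hereditary_sandwich[OF T _ pi_e(1)]) (use sub bc in auto)
 qed
qed

lemma ev_in_hereditary:
 assumes T: "hereditary D T" and sub: "\<pi> ` |A|\<subseteq>T" and f: "f\<in>free_carrier cp_gens" shows "FD.ev f\<in>T"
proof -
 have m: "submodule T complex_ring D" and c: "\<And>x y. x\<in>T ==> y\<in>T ==> x\<cdot>\<^sub>D y\<in>T" "\<And>x. x\<in>T ==> x\<star>\<^sub>D\<in>T"
  using T by (auto simp: hereditary_def cstar_subalgebra_def)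
 have g: "gamD g\<in>T" if "g\<in>cp_gens" for g using that sub S_in_hereditary[OF T sub] by auto
 have w: "FD.wv w\<in>T" if "w\<in>words cp_gens" for w
  using that
 proof (induction w)
  case (Cons l ls)
  then have "FD.letter l\<in>T" using g[of "fst l"] c(2) by (simp add: FD.letter_def FD.words_Cons)
  then show ?case using Cons by (cases "ls = []") (auto simp: FD.words_Cons intro: c(1))
 qed (simp add: words_def)
 from f show ?thesis
  by (induction rule: free_induct)
   (simp_all add: FD.ev_ind w FD.ev_add FD.ev_smult D.submodule_zero[OF m] D.submodule_add[OF m] D.submodule_smult[OF m])
qed

end

section \<open>The image of the universal algebra in the crossed product\<close>

context endo
begin

interpretation V: cov A e \<rho> XX piX SX
 by unfold_locales (rule covariant_rep_X)

lemma ev_X: assumes "f\<in>free_carrier cp_gens" shows "V.FD.ev f = tc (FC.ev f)"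
proof (rule V.FD.hom_eq_ev[symmetric, where p = "\<lambda>_. 0" and h = "\<lambda>f. tc (FC.ev f)", OF _ _ assms])
 show "star_hom (FP (\<lambda>_. 0)) XX (\<lambda>f. tc (FC.ev f))"
  using star_hom_comp[OF FC.ev_hom C.to_completion_hom] by (simp add: comp_def)
 show "tc (FC.ev (free_gen g)) = V.gamD g" if "g\<in>cp_gens" for g
  using that FC.ev_gen[OF that] by (auto simp: piX_def SX_def simp del: gamC_simps)
qed

lemma im_sub: "(\<lambda>f. tc (FC.ev f)) ` free_carrier cp_gens\<subseteq>|XX|"
proof
 fix z assume "z\<in>(\<lambda>f. tc (FC.ev f)) ` free_carrier cp_gens"
 then obtain f where "f\<in>free_carrier cp_gens" "z = tc (FC.ev f)" by blast
 then show "z\<in>|XX|" using FC.ev_in[of f] by simp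
qed

lemma KX_iff: "z\<in>KX\<longleftrightarrow>(\<exists>s. (\<forall>n. s n\<in>(\<lambda>f. tc (FC.ev f)) ` free_carrier cp_gens)\<and>tends XX s z)"
 by (rule X.closure_iff[OF im_sub])

lemma KX_base: "f\<in>free_carrier cp_gens ==> tc (FC.ev f)\<in>KX"
 unfolding KX_iff using X.tends_const[of "tc (FC.ev f)"] im_sub by (intro exI[of _ "\<lambda>_. tc (FC.ev f)"]) auto

lemma KX_pi: "a\<in>|A| ==> piX a\<in>KX"
 using KX_base[OF gen_in(1)[of a]] FC.ev_gen[of "Coeff a"] by (simp add: piX_def del: gamC_simps)

lemma KX_closed: "closedin (norm_topology XX) KX"
 by (rule closedin_closure_of)

text \<open>KX is also the image of the Cuntz-Pimsner algebra under the embedding, so stability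
  under the operations is inherited from there, and closedness comes from its description as a
  closure.\<close>

lemma KX_subalgebra: "cstar_subalgebra XX KX"
proof -
 obtain \<theta> where \<theta>: "star_hom (cuntz_pimsner A \<rho>) XX \<theta>" "\<theta> ` carrier (cuntz_pimsner A \<rho>) = KX" "cstar_algebra (cuntz_pimsner A \<rho>)"
  by (rule cuntz_pimsner_embedding)
 interpret O: cstar_algebra "cuntz_pimsner A \<rho>" by (rule \<theta>(3))
 note h = star_hom_simps[OF \<theta>(1)]
 have im: "\<theta> x\<in>KX" if "x\<in>carrier (cuntz_pimsner A \<rho>)" for x unfolding \<theta>(2)[symmetric] using that by simp
 have ob: "\<exists>x\<in>carrier (cuntz_pimsner A \<rho>). z = \<theta> x" if "z\<in>KX" for z using that unfolding \<theta>(2)[symmetric] by blast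
 show ?thesis
  unfolding cstar_subalgebra_def
 proof (intro conjI ballI KX_closed X.submoduleI')
  show "KX\<subseteq>|XX|" unfolding \<theta>(2)[symmetric] using h(1) by blast
  show "\<zero>\<^sub>XX\<in>KX" using im[OF O.zero_closed] star_hom_zero[OF O.star_algebra_axioms X.star_algebra_axioms \<theta>(1)] by simp
 next
  fix x y assume "x\<in>KX" "y\<in>KX"
  then obtain u v where uv: "u\<in>carrier (cuntz_pimsner A \<rho>)" "v\<in>carrier (cuntz_pimsner A \<rho>)" "x = \<theta> u" "y = \<theta> v"
   using ob by meson
  show "x\<oplus>\<^sub>XX y\<in>KX" using im[of "u\<oplus>\<^bsub>cuntz_pimsner A \<rho>\<^esub> v"] uv by (simp add: h)
  show "x\<cdot>\<^sub>XX y\<in>KX" using im[of "u\<cdot>\<^bsub>cuntz_pimsner A \<rho>\<^esub> v"] uv by (simp add: h)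
 next
  fix x c assume "x\<in>KX"
  then obtain u where u: "u\<in>carrier (cuntz_pimsner A \<rho>)" "x = \<theta> u" using ob by meson
  show "c\<odot>\<^sub>XX x\<in>KX" using im[of "c\<odot>\<^bsub>cuntz_pimsner A \<rho>\<^esub> u"] u by (simp add: h)
  show "x\<star>\<^sub>XX\<in>KX" using im[of "u\<star>\<^bsub>cuntz_pimsner A \<rho>\<^esub>"] u by (simp add: h)
 qed
qed

lemma KX_sub: "submodule KX complex_ring XX"
 using KX_subalgebra by (simp add: cstar_subalgebra_def)

lemma single_tends: assumes "tends FB s b" shows "tends XX (\<lambda>i. tc (Z.single n (s i))) (tc (Z.single n b))"
proof (rule X.tendsI)
 note [simp] = B.tends_in[OF assms]
 show "||tc (Z.single n (s i))\<ominus>\<^sub>XX tc (Z.single n b)||\<^sub>XX\<le>||s i\<ominus>\<^sub>FB b||\<^sub>FB" for i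
 proof -
  have "Z.single n (s i)\<ominus>\<^sub>Z.CP Z.single n b = Z.single n (s i\<ominus>\<^sub>FB b)"
   by (simp add: C.diff_eq B.diff_eq) (auto simp: Z.single_def fun_eq_iff)
  then have "tc (Z.single n (s i))\<ominus>\<^sub>XX tc (Z.single n b) = tc (Z.single n (s i\<ominus>\<^sub>FB b))"
   using star_hom_diff[OF C.star_algebra_axioms X.star_algebra_axioms C.to_completion_hom, of "Z.single n (s i)" "Z.single n b"] by simp
  then show ?thesis using C.to_completion_norm[of "Z.single n (s i\<ominus>\<^sub>FB b)"] Z.CP_norm_single[of "s i\<ominus>\<^sub>FB b" n] by simp
 qed
qed (use assms B.tends_in[OF assms] in \<open>auto simp: tends_def\<close>)

lemma X_induct [consumes 1, case_names base zero add smult lim]: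
 assumes z: "z\<in>|XX|" and base: "\<And>n m c. c\<in>|A| ==> P (tc (Z.single n (bl m c)))" and zero: "P \<zero>\<^sub>XX"
  and add: "\<And>x y. x\<in>|XX| ==> y\<in>|XX| ==> P x ==> P y ==> P (x\<oplus>\<^sub>XX y)"
  and smult: "\<And>c x. x\<in>|XX| ==> P x ==> P (c\<odot>\<^sub>XX x)"
  and lim: "\<And>s x. tends XX s x ==> (\<And>n. P (s n)) ==> P x"
 shows "P z"
proof -
 have tz: "tc (\<lambda>n. \<zero>\<^sub>FB) = \<zero>\<^sub>XX"
  using star_hom_zero[OF C.star_algebra_axioms X.star_algebra_axioms C.to_completion_hom] by simp
 have sz: "Z.single n \<zero>\<^sub>FA = (\<lambda>n. \<zero>\<^sub>FB)" for n by (auto simp: Z.single_def fun_eq_iff)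
 have s: "P (tc (Z.single n b))" if "b\<in>|FB|" for n b
  using that
 proof (induction rule: FB_induct)
  case (base n' a)
  then show ?case by (rule assms(2))
 next
  case zero
  show ?case unfolding sz tz by (rule assms(3))
 next
  case (add x y)
  then show ?case using assms(4)[of "tc (Z.single n x)" "tc (Z.single n y)"]
   star_hom_add[OF C.to_completion_hom, of "Z.single n x" "Z.single n y"] by (simp add: single_add del: Z.CP_simps(2))
 next
  case (smult c x)
  then show ?case using assms(5)[of "tc (Z.single n x)" c]
   star_hom_smult[OF C.to_completion_hom, of "Z.single n x" c] by (simp add: single_smult del: Z.CP_simps(4))
 next
  case (lim s x)
  then show ?case using assms(6)[OF single_tends[OF lim(1)]] by blast
 qed
 have f: "P (tc f)" if "f\<in>Z.fs" for f
  using that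
 proof (induction rule: Z.fs_induct)
  case (add f g)
  then show ?case using assms(4)[of "tc f" "tc g"] star_hom_add[OF C.to_completion_hom, of f g] by simp
 qed (use s zero tz in simp_all)
 obtain s where "s\<in>cauchy_seqs Z.CP" "z = C.cls s" using C.cls_cases[OF z] by blast
 then show ?thesis using lim[OF C.cls_tends[of s]] f C.cauchy_in[of s] by simp
qed

text \<open>S^k(x) is a product of generators by repeated factorization x = \<rho>(b)c, and a
  monomial is S^k(x)S^l(y)\<star> once w is written as xy\<star>.\<close>

lemma mono_ev: assumes "w\<in>|A|" obtains f where "f\<in>free_carrier cp_gens" "FC.ev f = mono k l w"
proof -
 have M: "\<exists>f\<in>free_carrier cp_gens. FC.ev f = Z.single (int k) (bl (int k) x)" if "x\<in>|A|" for k x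
  using that
 proof (induction k arbitrary: x)
  case 0
  then show ?case using gen_in(1)[OF 0] FC.ev_gen[of "Coeff x"] by (intro bexI[of _ "free_gen (Coeff x)"]) auto
 next
  case (Suc k)
  obtain b c where bc: "b\<in>|A|" "c\<in>|A|" "x = lact (\<rho> b) c" by (rule rho_factor[OF Suc.prems])
  obtain f where f: "f\<in>free_carrier cp_gens" "FC.ev f = Z.single (int k) (bl (int k) b)" using Suc.IH[OF bc(1)] by blast
  have "bl (int k) b\<cdot>\<^sub>FA bl (1 + int k) c = bl (1 + int k) x" using bl_bl[OF bc(1,2), of "int k" 1] bc by (simp add: add.commute)
  then have "Z.single (int k) (bl (int k) b)\<cdot>\<^sub>Z.CP Z.single 1 (bl 1 c) = Z.single (int k + 1) (bl (1 + int k) x)"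
   using bc by (subst conv_single) simp_all
  moreover have "FC.ev (free_mult f (free_gen (Creation c))) = Z.single (int k) (bl (int k) b)\<cdot>\<^sub>Z.CP Z.single 1 (bl 1 c)"
   unfolding FC.ev_mult[OF f(1) gen_in(2)[OF bc(2)]] f(2) using FC.ev_gen[of "Creation c"] bc(2) by simp
  ultimately show ?case using f(1) gen_in(2)[OF bc(2)]
   by (intro bexI[of _ "free_mult f (free_gen (Creation c))"]) (simp_all add: add.commute del: Z.CP_simps)
 qed
 obtain x y where xy: "x\<in>|A|" "y\<in>|A|" "w = x\<cdot>y\<star>" by (rule V.S.factor_adj[OF assms])
 obtain f where f: "f\<in>free_carrier cp_gens" "FC.ev f = Z.single (int k) (bl (int k) x)" using M[OF xy(1)] by blast
 obtain g where g: "g\<in>free_carrier cp_gens" "FC.ev g = Z.single (int l) (bl (int l) y)" using M[OF xy(2)] by blast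
 have "FC.ev (free_mult f (free_adj g)) = Z.single (int k) (bl (int k) x)\<cdot>\<^sub>Z.CP (Z.single (int l) (bl (int l) y))\<star>\<^sub>Z.CP"
  unfolding FC.ev_mult[OF f(1) free_adj_in[OF g(1)]] FC.ev_adj[OF g(1)] f(2) g(2) ..
 also have "(Z.single (int l) (bl (int l) y))\<star>\<^sub>Z.CP = Z.single (- int l) (bl 0 (y\<star>))"
  using xy(2) by (simp add: Z.fadj_single bl_adj)
 also have "Z.single (int k) (bl (int k) x)\<cdot>\<^sub>Z.CP Z.single (- int l) (bl 0 (y\<star>)) = mono k l w"
  using xy(1,2) by (subst conv_single) (simp_all add: mono_def xy(3) star_hom_mult[OF bl_hom])
 finally show ?thesis using that[of "free_mult f (free_adj g)"] f(1) g(1) by simp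
qed

text \<open>The crossed product contains levels and degrees that no word reaches. Multiplication by
  A on the left raises the level to at least 0, and on the right to at least the degree; these are
  exactly the levels of monomials.\<close>

lemma pi_sandwich_KX:
 assumes a: "a\<in>|A|" and b: "b\<in>|A|" and z: "z\<in>|XX|" shows "piX a\<cdot>\<^sub>XX z\<cdot>\<^sub>XX piX b\<in>KX"
 using z
proof (induction rule: X_induct)
 case (base n m c)
 have p: "piX x = tc (Z.single 0 (bl 0 x))" for x by (simp add: piX_def)
 obtain u where u: "u\<in>|A|" "bl 0 a\<cdot>\<^sub>FA bl m c = bl (max 0 m) u" by (rule bl_mult[OF a base])
 obtain w where w: "w\<in>|A|" "bl (max 0 m) u\<cdot>\<^sub>FA bl n b = bl (max (max 0 m) n) w" by (rule bl_mult[OF u(1) b])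
 \<comment> \<open>The monomial has level k and degree k - l = n; the maxima ensure that k and l are
   both nonnegative.\<close>
 let ?k = "nat (max (max 0 m) n)"
 let ?l = "nat (max (max 0 m) n - n)"
 have "piX a\<cdot>\<^sub>XX tc (Z.single n (bl m c))\<cdot>\<^sub>XX piX b = tc (mono ?k ?l w)"
  unfolding p using a b base u w by (simp add: tc_single_mult mono_def)
 then show ?case using mono_ev[OF w(1), of ?k ?l] KX_base by metis
next
 case zero
 then show ?case using a b X.submodule_zero[OF KX_sub] by simp
next
 case (add x y)
 then show ?case using a b X.submodule_add[OF KX_sub] by (simp add: X.distrib_left X.distrib_right)
next
 case (smult c x)
 then show ?case using a b X.submodule_smult[OF KX_sub] by (simp add: X.smult_mult_left X.smult_mult_right)
next
 case (lim s x)
 have "tends XX (\<lambda>n. piX a\<cdot>\<^sub>XX s n\<cdot>\<^sub>XX piX b) (piX a\<cdot>\<^sub>XX x\<cdot>\<^sub>XX piX b)"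
  using a b lim(1) by (intro X.tends_mult X.tends_const) auto
 then show ?case by (rule X.closedin_tends[OF KX_closed lim(2)])
qed

lemma KX_right_unit: assumes "z\<in>KX" shows "tends XX (\<lambda>n. z\<cdot>\<^sub>XX piX (e n)) z"
proof -
 obtain s where s: "\<And>n. s n\<in>(\<lambda>f. tc (FC.ev f)) ` free_carrier cp_gens" "tends XX s z" using assms unfolding KX_iff by blast
 have "tends XX (\<lambda>n. s k\<cdot>\<^sub>XX piX (e n)) (s k)" for k
 proof -
  obtain f where f: "f\<in>free_carrier cp_gens" "s k = tc (FC.ev f)" using s(1)[of k] by blast
  show ?thesis using V.ev_right_unit[OF f(1)] unfolding ev_X[OF f(1)] f(2) .
 qed
 then show ?thesis by (intro X.right_unit_lim[OF _ V.pi_e(2) _ s(2)]) simp_all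
qed

text \<open>If 0 \<le> a \<le> h with h in KX, an approximate right unit for h is one for y, where a
  = y\<star>y, by \<open>dominated_unit\<close>. Hence a is the limit of its compressions by
  \<open>piX (e n)\<close>, and these lie in KX.\<close>

lemma KX_hereditary: "hereditary XX KX"
 unfolding hereditary_def
proof (intro conjI ballI impI KX_subalgebra)
 fix h a assume h: "h\<in>KX" and a: "a\<in>|XX|" and p: "cpos XX h\<and>cpos XX a\<and>cpos XX (h\<ominus>\<^sub>XX a)"
 have hX: "h\<in>|XX|" by (rule X.submodule_in[OF KX_sub h])
 obtain y g where y: "y\<in>|XX|" "a = y\<star>\<^sub>XX\<cdot>\<^sub>XX y" and g: "g\<in>|XX|" "h\<ominus>\<^sub>XX a = g\<star>\<^sub>XX\<cdot>\<^sub>XX g"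
  using p unfolding cpos_def by blast
 have "h = a\<oplus>\<^sub>XX (h\<ominus>\<^sub>XX a)"
  by (rule X.linI, (rule X.lins | (simp add: algebra_simps a hX; fail))+)
 then have heq: "h = y\<star>\<^sub>XX\<cdot>\<^sub>XX y\<oplus>\<^sub>XX g\<star>\<^sub>XX\<cdot>\<^sub>XX g" using y(2) g(2) by simp
 have t: "tends XX (\<lambda>n. y\<cdot>\<^sub>XX piX (e n)) y"
  by (rule X.dominated_unit[OF _ V.pi_e(2) V.pi_e(1) KX_right_unit[OF h] y(1) g(1) heq]) simp
 from X.tends_mult[OF X.tends_adj[OF t] t]
 have t2: "tends XX (\<lambda>n. piX (e n)\<cdot>\<^sub>XX a\<cdot>\<^sub>XX piX (e n)) a"
  using y by (simp add: X.adj_mult X.mult_assoc V.pi_e(1) del: V.S.pi_simps(5))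
 show "a\<in>KX" by (rule X.closedin_tends[OF KX_closed _ t2]) (rule pi_sandwich_KX[OF e_in e_in a])
qed

abbreviation "A0\<equiv>to_crossed_product FB \<sigma> ` B_level A \<rho> 0"

lemma A0_eq: "A0 = piX ` |A|"
 by (simp add: B_level_def image_image to_crossed_product_def piX_def bl_def Z.single_def)

lemma hull_eq: "hereditary XX hull A0 = KX"
proof
 show "hereditary XX hull A0\<subseteq>KX"
  by (rule hull_minimal) (use KX_pi KX_hereditary in \<open>auto simp: A0_eq\<close>)
 show "KX\<subseteq>hereditary XX hull A0"
  unfolding hull_def
 proof (rule Inter_greatest)
  fix T assume "T\<in>{t. hereditary XX t\<and>A0\<subseteq>t}"
  then have T: "hereditary XX T" "piX ` |A|\<subseteq>T" by (auto simp: A0_eq)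
  have "closedin (norm_topology XX) T" using T(1) by (simp add: hereditary_def cstar_subalgebra_def)
  moreover have "(\<lambda>f. tc (FC.ev f)) ` free_carrier cp_gens\<subseteq>T"
   using V.ev_in_hereditary[OF T] by (auto simp: ev_X)
  ultimately show "KX\<subseteq>T" by (intro closure_of_minimal)
 qed
qed

text \<open>Level m' in degree n is reached from A through the ideal property: with c = xyw, the
  element y at level 0 is placed between x in degree m' and w in degree n - m'. The left factor
  moves the level of everything behind it by m', and the degrees add up to n.\<close>

lemma full: "full_in XX KX"
proof -
 have ideal: "I = |XX|" if I: "closed_ideal XX I" "KX\<subseteq>I" for I
 proof
  have sub: "submodule I complex_ring XX" and cl: "closedin (norm_topology XX) I"
   and m: "\<And>x y. x\<in>I ==> y\<in>|XX| ==> x\<cdot>\<^sub>XX y\<in>I" "\<And>x y. x\<in>I ==> y\<in>|XX| ==> y\<cdot>\<^sub>XX x\<in>I"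
   using I(1) unfolding closed_ideal_def by blast+
  show "I\<subseteq>|XX|" using X.submodule_in[OF sub] by blast
  show "|XX|\<subseteq>I"
  proof
   fix z assume "z\<in>|XX|"
   then show "z\<in>I"
   proof (induction rule: X_induct)
    case (base n m' c)
    obtain x d where xd: "x\<in>|A|" "d\<in>|A|" "c = x\<cdot>d" by (rule factor[OF base])
    obtain y w where yw: "y\<in>|A|" "w\<in>|A|" "d = y\<cdot>w" by (rule factor[OF xd(2)])
    have "tc (Z.single m' (bl m' x))\<cdot>\<^sub>XX piX y\<cdot>\<^sub>XX tc (Z.single (n - m') (bl 0 w))\<in>I"
     by (intro m subsetD[OF I(2)] KX_pi yw) (use xd yw in simp_all)
    moreover have "bl m' x\<cdot>\<^sub>FA bl m' y\<cdot>\<^sub>FA bl m' w = bl m' c"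
     using xd yw by (simp add: star_hom_mult[OF bl_hom] F.mult_assoc)
    ultimately show ?case using xd(1) yw(1,2) by (simp add: piX_def tc_single_mult star_hom_mult[OF bl_hom, symmetric])
   next
    case (lim s x)
    then show ?case using X.closedin_tends[OF cl] by blast
   qed (use X.submodule_zero[OF sub] X.submodule_add[OF sub] X.submodule_smult[OF sub] in auto)
  qed
 qed
 have "submodule ( |XX| ) complex_ring XX" by (rule X.submoduleI') auto
 moreover have "closedin (norm_topology XX) ( |XX| )" unfolding X.closedin_iff using X.tends_in(2) by blast
 ultimately have "closed_ideal XX ( |XX| )" by (simp add: closed_ideal_def)
 moreover have "KX\<subseteq>|XX|" using X.submodule_in[OF KX_sub] by blast
 ultimately have "closed_ideal XX hull KX\<subseteq>|XX|" by (intro hull_minimal)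
 moreover have "|XX|\<subseteq>closed_ideal XX hull KX"
  unfolding hull_def using ideal by (intro Inter_greatest) blast
 ultimately show ?thesis unfolding full_in_def by blast
qed

lemma main: "full_in XX KX\<and>star_isomorphic (cuntz_pimsner A \<rho>) (XX\<lparr>carrier := KX\<rparr>)"
proof
 obtain \<theta> where \<theta>: "star_hom (cuntz_pimsner A \<rho>) XX \<theta>" "\<theta> ` carrier (cuntz_pimsner A \<rho>) = KX"
  "inj_on \<theta> (carrier (cuntz_pimsner A \<rho>))" by (rule cuntz_pimsner_embedding)
 have im: "\<theta> x\<in>KX" if "x\<in>carrier (cuntz_pimsner A \<rho>)" for x unfolding \<theta>(2)[symmetric] using that by simp
 have "star_hom (cuntz_pimsner A \<rho>) (XX\<lparr>carrier := KX\<rparr>) \<theta>"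
  unfolding star_hom_def using star_hom_simps[OF \<theta>(1)] im by simp
 then show "star_isomorphic (cuntz_pimsner A \<rho>) (XX\<lparr>carrier := KX\<rparr>)"
  unfolding star_isomorphic_def star_iso_def bij_betw_def using \<theta>(2,3) by auto
qed (rule full)

end

lemma endo_exists:
 assumes A: "cstar_algebra A" and s: "sigma_unital A"
  and "star_hom A (multiplier_algebra A) \<rho>" "inj_on \<rho> ( |A| )" "nondegenerate A \<rho>"
 shows "\<exists>e. endo A e \<rho>"
proof -
 interpret A: cstar_algebra A by fact
 obtain e where e: "\<And>n. e n\<in>|A|\<and>cpos A (e n)\<and>||e n||\<^sub>A\<le>1"
  "\<And>x. x\<in>|A| ==> (\<lambda>n. ||e n\<cdot>\<^sub>A x\<ominus>\<^sub>A x||\<^sub>A)\<longlonglongrightarrow>0\<and>(\<lambda>n. ||x\<cdot>\<^sub>A e n\<ominus>\<^sub>A x||\<^sub>A)\<longlonglongrightarrow>0"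
  using s unfolding sigma_unital_def by blast
 have "A.sa (e n)" for n
 proof -
  obtain y where "y\<in>|A|" "e n = y\<star>\<^sub>A\<cdot>\<^sub>A y" using e(1)[of n] unfolding cpos_def by blast
  then show ?thesis using A.sa_cstar by simp
 qed
 then have "endo A e \<rho>"
  by unfold_locales (use e assms in \<open>simp_all add: tends_def\<close>)
 then show ?thesis by blast
qed

theorem theorem2p4:
  fixes A :: "'a cstar_struct" and \<rho> :: "'a \<Rightarrow> 'a multiplier"
  assumes "cstar_algebra A" and "sigma_unital A"
    and "star_hom A (multiplier_algebra A) \<rho>" and "inj_on \<rho> (carrier A)" and "nondegenerate A \<rho>"
  defines "X \<equiv> reduced_crossed_product (frakB A \<rho>) (limit_shift A \<rho>)"
    and "A\<^sub>0 \<equiv> to_crossed_product (frakB A \<rho>) (limit_shift A \<rho>) ` B_level A \<rho> 0"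
  defines "H \<equiv> hereditary X hull A\<^sub>0"
  shows "full_in X H \<and> star_isomorphic (cuntz_pimsner A \<rho>) (X\<lparr>carrier := H\<rparr>)"
proof -
  obtain e where "endo A e \<rho>" using endo_exists[OF assms(1-5)] by blast
  then interpret endo A e \<rho> .
  show ?thesis
    unfolding H_def A\<^sub>0_def X_def reduced_crossed_product_def hull_eq by (rule main)
qed

end
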